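(* Consider the iterates and stochastic directions of the BROS algorithm described in the context, and suppose that (A1), (A2), (A3) of the context hold. Define the full-space directions $$D_Y^k:=\nabla_{\boldsymbol Y}g(x^k,\boldsymbol Y^k),\quad D_Z^k:=\mathcal H(x^k,\boldsymbol Y^k)[\boldsymbol Z^k]-\nabla_{\boldsymbol Y}f(x^k,\boldsymbol Y^k),\quad D_x^k:=\nabla_xf(x^k,\boldsymbol Y^k)-\mathcal J(x^k,\boldsymbol Y^k)[\boldsymbol Z^k].$$ Then for every $k$ $$\mathbb E[\widehat{\boldsymbol V}^{k+1}\mid\mathcal F_k]=D_Y^k,\qquad \mathbb E[\widehat{\boldsymbol S}^{k+1}\mid\mathcal F_k]=D_Z^k,\qquad \mathbb E[\widehat W^{k+1}\mid\mathcal F_k]=D_x^k .$$ Moreover, there exists a finite constant $C_m>0$, independent of the number of iterations $K$ (and of $k$), such that $$\mathbb E\bigl[\|\widehat{\boldsymbol V}^{k+1}-D_Y^k\|^2+\|\widehat{\boldsymbol S}^{k+1}-D_Z^k\|^2+\|\widehat W^{k+1}-D_x^k\|^2\,\big|\,\mathcal F_k\bigr]\le C_m\bigl(1+\|\boldsymbol Y^k-\boldsymbol Y^*(x^k)\|^2+\|\boldsymbol Z^k-\boldsymbol Z^*(x^k)\|^2\bigr).$$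
   Context: **Problem.** Fix integers $d_x,L\ge1$ and, for $\ell\in[L]:=\{1,\dots,L\}$, integers $n_\ell\ge1$, $2\le r_\ell\le m_\ell$. Let $\mathcal Y=\prod_{\ell=1}^L\mathbb R^{m_\ell\times n_\ell}$ and $\mathcal B=\prod_{\ell=1}^L\mathbb R^{r_\ell\times n_\ell}$ with the product Frobenius inner product and norm; $\mathbb R^{d_x}\times\mathcal Y$ carries $\|(x,\boldsymbol Y)\|^2=\|x\|^2+\|\boldsymbol Y\|^2$. Let $f,g:\mathbb R^{d_x}\times\mathcal Y\to\mathbb R$. Write $\mathcal H(x,\boldsymbol Y)=\nabla^2_{\boldsymbol Y\boldsymbol Y}g(x,\boldsymbol Y):\mathcal Y\to\mathcal Y$, and $\mathcal J(x,\boldsymbol Y)=\nabla^2_{x\boldsymbol Y}g(x,\boldsymbol Y):\mathcal Y\to\mathbb R^{d_x}$, the adjoint of $u\mapsto\nabla^2_{\boldsymbol Yx}g(x,\boldsymbol Y)[u]$. Let $\boldsymbol Y^*(x)=\arg\min_{\boldsymbol Y}g(x,\boldsymbol Y)$ and $\boldsymbol Z^*(x)=\mathcal H(x,\boldsymbol Y^*(x))^{-1}[\nabla_{\boldsymbol Y}f(x,\boldsymbol Y^*(x))]$. **(A1)** There are positive constants $\mu_g,L_{f,0},L_{f,1},L_{g,1},L_{g,2}$ such that: $\nabla f$ and $\nabla g$ are $L_{f,1}$- and $L_{g,1}$-Lipschitz in $(x,\boldsymbol Y)$; $\nabla^2g$ is $L_{g,2}$-Lipschitz (operator norm) on $\mathbb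 R^{d_x}\times\mathcal Y$; $\|\nabla_{\boldsymbol Y}f(x,\boldsymbol Y^*(x))\|\le L_{f,0}$ for all $x$; for every $x$, $g(x,\cdot)$ is $\mu_g$-strongly convex. **Projectors and projected functions.** At iteration $k$ a tuple $\boldsymbol P^k=(P_1^k,\dots,P_L^k)$, $P_\ell^k\in\mathbb R^{m_\ell\times r_\ell}$, is drawn; $(\boldsymbol P^k\boldsymbol B)_\ell=P_\ell^kB_\ell$, $(\boldsymbol P^{k\top}\boldsymbol U)_\ell=(P_\ell^k)^\top U_\ell$. Put $\tilde f_k(x,\boldsymbol B)=f(x,\boldsymbol Y^k+\boldsymbol P^k\boldsymbol B)$, $\tilde g_k(x,\boldsymbol B)=g(x,\boldsymbol Y^k+\boldsymbol P^k\boldsymbol B)$ for $\boldsymbol B\in\mathcal B$. **Filtrations.** $\mathcal F_k=\sigma(x^0,\dots,x^k,\boldsymbol Y^0,\dots,\boldsymbol Y^k,\boldsymbol Z^0,\dots,\boldsymbol Z^k,h^0,\dots,h^k,\boldsymbol P^0,\dots,\boldsymbol P^{k-1})$, $\mathcal F_k^+=\sigma(\mathcal F_k\cup\{\boldsymbol P^k\})$, $\mathcal F_k^{++}=\sigma(\mathcal F_k^+,\{u_\ell^{k+1},\xi_\ell^{k+1}\}_{\ell=1}^L)$, where $u_\ell^{k+1}\in\{-1,1\}^{n_\ell}$, $\xi_\ell^{k+1}\in\{-1,1\}^{r_\ell}$ are Rademacher probes (independent uniform signs). **(A2)** At each iteration there are random $\tilde U_x^{k+1}\in\mathbb R^{d_x}$,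 $\tilde{\boldsymbol U}_Y^{k+1},\tilde{\boldsymbol V}^{k+1}\in\mathcal B$ and random linear operators $\tilde{\mathcal H}^{k+1}:\mathcal B\to\mathcal B$, $\tilde{\mathcal J}^{k+1}:\mathcal B\to\mathbb R^{d_x}$ whose conditional means given $\mathcal F_k^+$ are $\nabla_x\tilde f_k(x^k,0)$, $\nabla_{\boldsymbol B}\tilde f_k(x^k,0)$, $\nabla_{\boldsymbol B}\tilde g_k(x^k,0)$, and, for every $W\in\mathcal B$, $\nabla^2_{\boldsymbol B\boldsymbol B}\tilde g_k(x^k,0)[W]$ (for $\tilde{\mathcal H}^{k+1}[W]$) and $\nabla^2_{x\boldsymbol B}\tilde g_k(x^k,0)[W]$ (for $\tilde{\mathcal J}^{k+1}[W]$). Their conditional mean-square deviations from these means given $\mathcal F_k^+$ are at most $\tilde\sigma_{f,1}^2,\tilde\sigma_{f,2}^2,\tilde\sigma_{g,1}^2,\tilde\sigma_{g,2}^2\|W\|^2,\tilde\sigma_{g,2}^2\|W\|^2$ respectively, for constants $\tilde\sigma_{\cdot,\cdot}\ge0$. The probes are independent of $\mathcal F_k^+$ and of these five oracle objects; given $\mathcal F_k^+$, the five oracle objects are mutually independent. $\tilde{\mathcal H}^{k+1},\tilde{\mathcal J}^{k+1}$ are sampled once per iteration and may be queried several times; the first- and second-moment relations for them extend to every $\mathcal F_k^{++}$-measurable random direction $W$ with finite conditional second moment (conditioning on $\mathcal F_k^{++}$). **(A3)** Conditionally on $\mathcal F_k$, $P_1^k,\dots,P_L^k$ are independent and $P_\ell^k=\sqrt{m_\ell/r_\ell}\,O^k_{\ell,r_\ell}$,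 where $O^k_{\ell,r_\ell}$ is the first $r_\ell$ columns of a Haar-uniform matrix in $O(m_\ell)$; $r_\ell\ge2$ for all $\ell$. The probes are independent across layers and $u_\ell^{k+1},\xi_\ell^{k+1}$ are independent. **Corrected Hessian action.** Let $E_t(W)\in\mathcal B$ have $W$ in block $t$ and zeros elsewhere, $\tilde Z_t^k=(P_t^k)^\top Z_t^k$, $A_\ell^{(t),k+1}=P_\ell^k(\tilde{\mathcal H}^{k+1}[E_t(\tilde Z_t^k)])_\ell$, $\boldsymbol M^{k+1}=\tilde{\mathcal H}^{k+1}[(\xi_1^{k+1}(u_1^{k+1})^\top,\dots,\xi_L^{k+1}(u_L^{k+1})^\top)]$ with blocks $M_t^{k+1}$, $\widehat C_t^{k+1}=Z_t^k\bigl((M_t^{k+1})^\top\xi_t^{k+1}(u_t^{k+1})^\top\bigr)$, $\widehat B_{\sharp,t}^{k+1}=P_t^k\bigl(\xi_t^{k+1}((M_t^{k+1})^\top\tilde Z_t^ku_t^{k+1})^\top\bigr)$. With $m=m_t,r=r_t$, $$\widehat{\mathcal H_{tt}[Z_t]}^{k+1}=\tfrac{r(m-1)(m+2)}{m(mr+m-2)}A_t^{(t),k+1}-\tfrac{m-r}{mr+m-2}\widehat C_t^{k+1}+\tfrac{r(m-1)(m-r)}{m(r-1)(mr+m-2)}\bigl(A_t^{(t),k+1}-\widehat B_{\sharp,t}^{k+1}\bigr),$$ and $(\widehat{\mathcal H[\boldsymbol Z]}^{k+1})_\ell=\widehat{\mathcal H_{\ell\ell}[Z_\ell]}^{k+1}+\sum_{t\ne\ell}A_\ell^{(t),k+1}$.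 **BROS algorithm.** From deterministic $x^0\in\mathbb R^{d_x}$, $\boldsymbol Y^0,\boldsymbol Z^0\in\mathcal Y$, $h^0=0$, with stepsizes $\alpha_k,\beta_k,\gamma_k,\theta_k$, for $k=0,1,\dots$: $x^{k+1}=x^k-\alpha_kh^k$; $\boldsymbol Y^{k+1}=\boldsymbol Y^k-\beta_k\widehat{\boldsymbol V}^{k+1}$; $\boldsymbol Z^{k+1}=\boldsymbol Z^k-\gamma_k\widehat{\boldsymbol S}^{k+1}$; $h^{k+1}=(1-\theta_k)h^k+\theta_k\widehat W^{k+1}$, where $\widehat{\boldsymbol V}^{k+1}=\boldsymbol P^k\tilde{\boldsymbol V}^{k+1}$, $\widehat{\boldsymbol S}^{k+1}=\widehat{\mathcal H[\boldsymbol Z]}^{k+1}-\boldsymbol P^k\tilde{\boldsymbol U}_Y^{k+1}$, $\widehat W^{k+1}=\tilde U_x^{k+1}-\tilde{\mathcal J}^{k+1}[\boldsymbol P^{k\top}\boldsymbol Z^k]$. *)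

theory Defs
  imports "HOL-Probability.Probability" "Jordan_Normal_Form.Matrix"
begin

section \<open>Layered matrix spaces\<close>

text \<open>
  The layer sizes depend on the layer, so the two product spaces are Euclidean types \<open>'y\<close> and
  \<open>'b\<close> whose standard (orthonormal) basis is indexed by the matrix units: \<open>unitY \<Lambda> l i j\<close> is the
  tuple whose only nonzero entry is a 1 at position \<open>(i,j)\<close> of block \<open>l\<close>.  The inner product and
  norm of the type are then the product Frobenius ones.  The layers are the elements of a
  finite (nonempty) type \<open>'l\<close>; indices inside a block are counted from 0.
\<close>

record ('l, 'y, 'b) layout =
  nrow :: "'l \<Rightarrow> nat"  \<comment> \<open>\<open>m\<^sub>l\<close>\<close>
  ncol :: "'l \<Rightarrow> nat"  \<comment> \<open>\<open>n\<^sub>l\<close>\<close>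
  rnk  :: "'l \<Rightarrow> nat"  \<comment> \<open>\<open>r\<^sub>l\<close>\<close>
  unitY :: "'l \<Rightarrow> nat \<Rightarrow> nat \<Rightarrow> 'y"
  unitB :: "'l \<Rightarrow> nat \<Rightarrow> nat \<Rightarrow> 'b"

definition matrix_units ::
    "('l::finite \<Rightarrow> nat) \<Rightarrow> ('l \<Rightarrow> nat) \<Rightarrow> ('l \<Rightarrow> nat \<Rightarrow> nat \<Rightarrow> 'v::euclidean_space) \<Rightarrow> bool" where
  "matrix_units p q E \<longleftrightarrow>
     bij_betw (\<lambda>(l, i, j). E l i j) (SIGMA l:UNIV. {..<p l} \<times> {..<q l}) Basis"

definition valid_layout :: "('l::finite, 'y::euclidean_space, 'b::euclidean_space) layout \<Rightarrow> bool" where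
  "valid_layout \<Lambda> \<longleftrightarrow>
     (\<forall>l. 1 \<le> ncol \<Lambda> l \<and> 2 \<le> rnk \<Lambda> l \<and> rnk \<Lambda> l \<le> nrow \<Lambda> l) \<and>
     matrix_units (nrow \<Lambda>) (ncol \<Lambda>) (unitY \<Lambda>) \<and>
     matrix_units (rnk \<Lambda>) (ncol \<Lambda>) (unitB \<Lambda>)"

definition block ::
    "('l \<Rightarrow> nat) \<Rightarrow> ('l \<Rightarrow> nat) \<Rightarrow> ('l \<Rightarrow> nat \<Rightarrow> nat \<Rightarrow> 'v::euclidean_space) \<Rightarrow> 'v \<Rightarrow> 'l \<Rightarrow> real Matrix.mat" where
  "block p q E V l = Matrix.mat (p l) (q l) (\<lambda>(i, j). inner V (E l i j))"

definition assemble ::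
    "('l::finite \<Rightarrow> nat) \<Rightarrow> ('l \<Rightarrow> nat) \<Rightarrow> ('l \<Rightarrow> nat \<Rightarrow> nat \<Rightarrow> 'v::euclidean_space) \<Rightarrow> ('l \<Rightarrow> real Matrix.mat) \<Rightarrow> 'v" where
  "assemble p q E N = (\<Sum>l\<in>UNIV. \<Sum>i<p l. \<Sum>j<q l. (N l $$ (i, j)) *\<^sub>R E l i j)"

definition "blockY \<Lambda> = block (nrow \<Lambda>) (ncol \<Lambda>) (unitY \<Lambda>)"
definition "blockB \<Lambda> = block (rnk \<Lambda>) (ncol \<Lambda>) (unitB \<Lambda>)"
definition "tupleY \<Lambda> = assemble (nrow \<Lambda>) (ncol \<Lambda>) (unitY \<Lambda>)"
definition "tupleB \<Lambda> = assemble (rnk \<Lambda>) (ncol \<Lambda>) (unitB \<Lambda>)"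

definition lift ::
    "('l::finite, 'y::euclidean_space, 'b::euclidean_space) layout \<Rightarrow> ('l \<Rightarrow> real Matrix.mat) \<Rightarrow> 'b \<Rightarrow> 'y" where
  "lift \<Lambda> P B = tupleY \<Lambda> (\<lambda>l. P l * blockB \<Lambda> B l)"

definition colift ::
    "('l::finite, 'y::euclidean_space, 'b::euclidean_space) layout \<Rightarrow> ('l \<Rightarrow> real Matrix.mat) \<Rightarrow> 'y \<Rightarrow> 'b" where
  "colift \<Lambda> P U = tupleB \<Lambda> (\<lambda>l. (P l)\<^sup>T * blockY \<Lambda> U l)"

definition single_block ::
    "('l::finite, 'y::euclidean_space, 'b::euclidean_space) layout \<Rightarrow> 'l \<Rightarrow> real Matrix.mat \<Rightarrow> 'b" where
  "single_block \<Lambda> t W = tupleB \<Lambda> (\<lambda>l. if l = t then W else 0\<^sub>m (rnk \<Lambda> l) (ncol \<Lambda> l))"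

definition outer :: "real Matrix.vec \<Rightarrow> real Matrix.vec \<Rightarrow> real Matrix.mat" where
  "outer v w = Matrix.mat (dim_vec v) (dim_vec w) (\<lambda>(i, j). vec_index v i * vec_index w j)"


section \<open>Gradients, Hessian blocks and the bilevel problem\<close>

definition grad :: "('v::real_inner \<Rightarrow> real) \<Rightarrow> 'v \<Rightarrow> 'v" where
  "grad \<phi> p = (THE G. GDERIV \<phi> p :> G)"

definition grad1 :: "('u::real_inner \<times> 'v \<Rightarrow> real) \<Rightarrow> 'u \<Rightarrow> 'v \<Rightarrow> 'u" where
  "grad1 \<phi> x y = grad (\<lambda>x'. \<phi> (x', y)) x"

definition grad2 :: "('u \<times> 'v::real_inner \<Rightarrow> real) \<Rightarrow> 'u \<Rightarrow> 'v \<Rightarrow> 'v" where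
  "grad2 \<phi> x y = grad (\<lambda>y'. \<phi> (x, y')) y"

definition hess22 :: "('u \<times> 'v::real_inner \<Rightarrow> real) \<Rightarrow> 'u \<Rightarrow> 'v \<Rightarrow> 'v \<Rightarrow> 'v" where
  "hess22 \<phi> x y = frechet_derivative (\<lambda>y'. grad2 \<phi> x y') (at y)"

text \<open>
  \<open>hess12\<close> maps the second factor to the first: it is the adjoint of
  \<open>u \<mapsto> \<nabla>\<^sup>2\<^sub>y\<^sub>x \<phi> (x, y)[u]\<close>, the derivative in \<open>x\<close> of the gradient in \<open>y\<close>.
\<close>

definition hess12 :: "('u::real_inner \<times> 'v::real_inner \<Rightarrow> real) \<Rightarrow> 'u \<Rightarrow> 'v \<Rightarrow> 'v \<Rightarrow> 'u" where
  "hess12 \<phi> x y = adjoint (frechet_derivative (\<lambda>x'. grad2 \<phi> x' y) (at x))"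

definition strongly_convex :: "real \<Rightarrow> ('v::real_normed_vector \<Rightarrow> real) \<Rightarrow> bool" where
  "strongly_convex \<mu> \<phi> \<longleftrightarrow>
     (\<forall>y z. \<forall>t\<in>{0..1}. \<phi> ((1 - t) *\<^sub>R y + t *\<^sub>R z)
        \<le> (1 - t) * \<phi> y + t * \<phi> z - \<mu> / 2 * t * (1 - t) * (norm (y - z))\<^sup>2)"

definition Ystar :: "('u \<times> 'v \<Rightarrow> real) \<Rightarrow> 'u \<Rightarrow> 'v" where
  "Ystar g x = arg_min (\<lambda>Y. g (x, Y)) (\<lambda>_. True)"

definition Zstar :: "('u \<times> 'v::real_inner \<Rightarrow> real) \<Rightarrow> ('u \<times> 'v \<Rightarrow> real) \<Rightarrow> 'u \<Rightarrow> 'v" where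
  "Zstar f g x = inv_into UNIV (hess22 g x (Ystar g x)) (grad2 f x (Ystar g x))"

definition assumption_A1 ::
    "('u::euclidean_space \<times> 'v::euclidean_space \<Rightarrow> real) \<Rightarrow> ('u \<times> 'v \<Rightarrow> real) \<Rightarrow>
     real \<Rightarrow> real \<Rightarrow> real \<Rightarrow> real \<Rightarrow> real \<Rightarrow> bool" where
  "assumption_A1 f g \<mu>g Lf0 Lf1 Lg1 Lg2 \<longleftrightarrow>
     0 < \<mu>g \<and> 0 < Lf0 \<and> 0 < Lf1 \<and> 0 < Lg1 \<and> 0 < Lg2 \<and>
     (\<forall>p. f differentiable at p) \<and> Lf1-lipschitz_on UNIV (grad f) \<and>
     (\<forall>p. g differentiable at p) \<and> Lg1-lipschitz_on UNIV (grad g) \<and>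
     (\<forall>p. grad g differentiable at p) \<and>
     (\<forall>p q. onorm (\<lambda>v. frechet_derivative (grad g) (at p) v - frechet_derivative (grad g) (at q) v)
              \<le> Lg2 * norm (p - q)) \<and>
     (\<forall>x. norm (grad2 f x (Ystar g x)) \<le> Lf0) \<and>
     (\<forall>x. strongly_convex \<mu>g (\<lambda>Y. g (x, Y)))"

definition projected ::
    "('l::finite, 'y::euclidean_space, 'b::euclidean_space) layout \<Rightarrow> ('u \<times> 'y \<Rightarrow> real) \<Rightarrow> 'y \<Rightarrow>
     ('l \<Rightarrow> real Matrix.mat) \<Rightarrow> 'u \<times> 'b \<Rightarrow> real" where
  "projected \<Lambda> \<phi> Y P = (\<lambda>(x, B). \<phi> (x, Y + lift \<Lambda> P B))"


section \<open>Conditional expectation and conditional independence\<close>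

text \<open>
  A conditional mean is taken coordinatewise with the library's real conditional expectation; the
  finiteness clause excludes the default values that the latter takes when the conditional
  expectation does not exist.
\<close>

definition cond_mean :: "'a measure \<Rightarrow> 'a measure \<Rightarrow> ('a \<Rightarrow> 'v::euclidean_space) \<Rightarrow> ('a \<Rightarrow> 'v) \<Rightarrow> bool" where
  "cond_mean M F X D \<longleftrightarrow>
     subalgebra M F \<and> X \<in> borel_measurable M \<and>
     (AE \<omega> in M. nn_cond_exp M F (\<lambda>\<omega>. ennreal (norm (X \<omega>))) \<omega> < \<infinity>) \<and>
     (\<forall>e\<in>Basis. AE \<omega> in M. real_cond_exp M F (\<lambda>\<omega>. inner (X \<omega>) e) \<omega> = inner (D \<omega>) e)"

definition cond_msd_le ::
    "'a measure \<Rightarrow> 'a measure \<Rightarrow> ('a \<Rightarrow> 'v::euclidean_space) \<Rightarrow> ('a \<Rightarrow> 'v) \<Rightarrow> ('a \<Rightarrow> real) \<Rightarrow> bool" where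
  "cond_msd_le M F X D b \<longleftrightarrow>
     (AE \<omega> in M. nn_cond_exp M F (\<lambda>\<omega>. ennreal ((norm (X \<omega> - D \<omega>))\<^sup>2)) \<omega> \<le> ennreal (b \<omega>))"

definition events_of :: "'a measure \<Rightarrow> 'c measure \<Rightarrow> ('a \<Rightarrow> 'c) \<Rightarrow> 'a set set" where
  "events_of M N X = {X -` A \<inter> space M | A. A \<in> sets N}"

definition cond_indep_sets :: "'a measure \<Rightarrow> 'a measure \<Rightarrow> ('i \<Rightarrow> 'a set set) \<Rightarrow> 'i set \<Rightarrow> bool" where
  "cond_indep_sets M F G I \<longleftrightarrow>
     (\<forall>i\<in>I. G i \<subseteq> sets M) \<and>
     (\<forall>J\<subseteq>I. J \<noteq> {} \<longrightarrow> finite J \<longrightarrow> (\<forall>A\<in>Pi J G.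
        AE \<omega> in M. real_cond_exp M F (indicat_real (\<Inter>j\<in>J. A j)) \<omega>
                 = (\<Prod>j\<in>J. real_cond_exp M F (indicat_real (A j)) \<omega>)))"


section \<open>Random matrices\<close>

definition mat_borel :: "nat \<Rightarrow> nat \<Rightarrow> real Matrix.mat measure" where
  "mat_borel p q = vimage_algebra (carrier_mat p q)
     (\<lambda>A. \<lambda>ij\<in>{..<p} \<times> {..<q}. A $$ ij) (Pi\<^sub>M ({..<p} \<times> {..<q}) (\<lambda>_. borel))"

definition orthogonal_group :: "nat \<Rightarrow> real Matrix.mat set" where
  "orthogonal_group p = {Q \<in> carrier_mat p p. Q\<^sup>T * Q = 1\<^sub>m p}"

text \<open>
  Haar measure on O(p) is given as a measure on all \<open>p \<times> p\<close> matrices that is concentrated on O(p);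
  left invariance determines it uniquely.
\<close>

definition haar_orthogonal :: "nat \<Rightarrow> real Matrix.mat measure \<Rightarrow> bool" where
  "haar_orthogonal p \<nu> \<longleftrightarrow>
     prob_space \<nu> \<and> sets \<nu> = sets (mat_borel p p) \<and>
     (AE Q in \<nu>. Q \<in> orthogonal_group p) \<and>
     (\<forall>R\<in>orthogonal_group p. distr \<nu> \<nu> (\<lambda>Q. R * Q) = \<nu>)"

definition first_cols :: "nat \<Rightarrow> nat \<Rightarrow> real Matrix.mat \<Rightarrow> real Matrix.mat" where
  "first_cols p q Q = Matrix.mat p q (\<lambda>ij. Q $$ ij)"


section \<open>The algorithm\<close>

text \<open>
  One run on the probability space \<open>pspace R\<close>.  Time indices are the superscripts in the formulas;
  the oracles and the probes are used only at indices \<open>Suc k\<close>.  The stochastic directions below are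
  indexed by the iteration: \<open>Vhat k\<close>, \<open>Shat k\<close> and \<open>What k\<close> are built from the oracles and probes
  with superscript \<open>k + 1\<close>.
\<close>

record (overloaded) ('a, 'x, 'y, 'b, 'l) run =
  pspace :: "'a measure"
  step_x :: "nat \<Rightarrow> real"  \<comment> \<open>\<open>\<alpha>\<close>\<close>
  step_Y :: "nat \<Rightarrow> real"  \<comment> \<open>\<open>\<beta>\<close>\<close>
  step_Z :: "nat \<Rightarrow> real"  \<comment> \<open>\<open>\<gamma>\<close>\<close>
  step_h :: "nat \<Rightarrow> real"  \<comment> \<open>\<open>\<theta>\<close>\<close>
  it_x :: "nat \<Rightarrow> 'a \<Rightarrow> 'x"
  it_Y :: "nat \<Rightarrow> 'a \<Rightarrow> 'y"
  it_Z :: "nat \<Rightarrow> 'a \<Rightarrow> 'y"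
  it_h :: "nat \<Rightarrow> 'a \<Rightarrow> 'x"
  proj :: "nat \<Rightarrow> 'a \<Rightarrow> 'l \<Rightarrow> real Matrix.mat"
  probe_u  :: "nat \<Rightarrow> 'a \<Rightarrow> 'l \<Rightarrow> nat \<Rightarrow> real"
  probe_xi :: "nat \<Rightarrow> 'a \<Rightarrow> 'l \<Rightarrow> nat \<Rightarrow> real"
  or_Ux :: "nat \<Rightarrow> 'a \<Rightarrow> 'x"
  or_UY :: "nat \<Rightarrow> 'a \<Rightarrow> 'b"
  or_V  :: "nat \<Rightarrow> 'a \<Rightarrow> 'b"
  or_H  :: "nat \<Rightarrow> 'a \<Rightarrow> ('b::real_normed_vector) \<Rightarrow>\<^sub>L 'b"
  or_J  :: "nat \<Rightarrow> 'a \<Rightarrow> 'b \<Rightarrow>\<^sub>L ('x::real_normed_vector)"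

context
  fixes \<Lambda> :: "('l::finite, 'y::euclidean_space, 'b::euclidean_space) layout"
    and R :: "('a, 'x::euclidean_space, 'y, 'b, 'l) run"
begin

definition filt :: "nat \<Rightarrow> 'a measure" where
  "filt k = sigma (space (pspace R))
     ((\<Union>i\<le>k. events_of (pspace R) borel (it_x R i)) \<union>
      (\<Union>i\<le>k. events_of (pspace R) borel (it_Y R i)) \<union>
      (\<Union>i\<le>k. events_of (pspace R) borel (it_Z R i)) \<union>
      (\<Union>i\<le>k. events_of (pspace R) borel (it_h R i)) \<union>
      (\<Union>i<k. \<Union>l. events_of (pspace R) (mat_borel (nrow \<Lambda> l) (rnk \<Lambda> l)) (\<lambda>\<omega>. proj R i \<omega> l)))"

definition filtP :: "nat \<Rightarrow> 'a measure" where
  "filtP k = sigma (space (pspace R))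
     (sets (filt k) \<union>
      (\<Union>l. events_of (pspace R) (mat_borel (nrow \<Lambda> l) (rnk \<Lambda> l)) (\<lambda>\<omega>. proj R k \<omega> l)))"

definition probe_events :: "nat \<Rightarrow> 'a set set" where
  "probe_events k =
     (\<Union>l. \<Union>j<ncol \<Lambda> l. events_of (pspace R) borel (\<lambda>\<omega>. probe_u R (Suc k) \<omega> l j)) \<union>
     (\<Union>l. \<Union>i<rnk \<Lambda> l. events_of (pspace R) borel (\<lambda>\<omega>. probe_xi R (Suc k) \<omega> l i))"

definition filtPP :: "nat \<Rightarrow> 'a measure" where
  "filtPP k = sigma (space (pspace R)) (sets (filtP k) \<union> probe_events k)"

definition Ztilde :: "nat \<Rightarrow> 'a \<Rightarrow> 'l \<Rightarrow> real Matrix.mat" where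
  "Ztilde k \<omega> t = (proj R k \<omega> t)\<^sup>T * blockY \<Lambda> (it_Z R k \<omega>) t"

text \<open>\<open>Aterm k \<omega> t l\<close> is \<open>A\<^sub>l\<^sup>(\<^sup>t\<^sup>)\<close>: the direction sits in block \<open>t\<close>, the output is read off in block \<open>l\<close>.\<close>

definition Aterm :: "nat \<Rightarrow> 'a \<Rightarrow> 'l \<Rightarrow> 'l \<Rightarrow> real Matrix.mat" where
  "Aterm k \<omega> t l = proj R k \<omega> l *
     blockB \<Lambda> (blinfun_apply (or_H R (Suc k) \<omega>) (single_block \<Lambda> t (Ztilde k \<omega> t))) l"

definition uvec :: "nat \<Rightarrow> 'a \<Rightarrow> 'l \<Rightarrow> real Matrix.vec" where
  "uvec k \<omega> t = Matrix.vec (ncol \<Lambda> t) (\<lambda>j. probe_u R (Suc k) \<omega> t j)"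

definition xivec :: "nat \<Rightarrow> 'a \<Rightarrow> 'l \<Rightarrow> real Matrix.vec" where
  "xivec k \<omega> t = Matrix.vec (rnk \<Lambda> t) (\<lambda>i. probe_xi R (Suc k) \<omega> t i)"

definition Mterm :: "nat \<Rightarrow> 'a \<Rightarrow> 'l \<Rightarrow> real Matrix.mat" where
  "Mterm k \<omega> t = blockB \<Lambda> (blinfun_apply (or_H R (Suc k) \<omega>)
     (tupleB \<Lambda> (\<lambda>l. outer (xivec k \<omega> l) (uvec k \<omega> l)))) t"

definition Chat :: "nat \<Rightarrow> 'a \<Rightarrow> 'l \<Rightarrow> real Matrix.mat" where
  "Chat k \<omega> t = blockY \<Lambda> (it_Z R k \<omega>) t *
     outer ((Mterm k \<omega> t)\<^sup>T *\<^sub>v xivec k \<omega> t) (uvec k \<omega> t)"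

definition Bsharp :: "nat \<Rightarrow> 'a \<Rightarrow> 'l \<Rightarrow> real Matrix.mat" where
  "Bsharp k \<omega> t = proj R k \<omega> t *
     outer (xivec k \<omega> t) ((Mterm k \<omega> t)\<^sup>T *\<^sub>v (Ztilde k \<omega> t *\<^sub>v uvec k \<omega> t))"

definition Hdiag :: "nat \<Rightarrow> 'a \<Rightarrow> 'l \<Rightarrow> real Matrix.mat" where
  "Hdiag k \<omega> t = (let m = real (nrow \<Lambda> t); r = real (rnk \<Lambda> t) in
       (r * (m - 1) * (m + 2) / (m * (m * r + m - 2))) \<cdot>\<^sub>m Aterm k \<omega> t t
     - ((m - r) / (m * r + m - 2)) \<cdot>\<^sub>m Chat k \<omega> t
     + (r * (m - 1) * (m - r) / (m * (r - 1) * (m * r + m - 2))) \<cdot>\<^sub>m (Aterm k \<omega> t t - Bsharp k \<omega> t))"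

definition HZhat :: "nat \<Rightarrow> 'a \<Rightarrow> 'y" where
  "HZhat k \<omega> = tupleY \<Lambda> (\<lambda>l. Matrix.mat (nrow \<Lambda> l) (ncol \<Lambda> l)
     (\<lambda>ij. Hdiag k \<omega> l $$ ij + (\<Sum>t\<in>UNIV - {l}. Aterm k \<omega> t l $$ ij)))"

definition Vhat :: "nat \<Rightarrow> 'a \<Rightarrow> 'y" where
  "Vhat k \<omega> = lift \<Lambda> (proj R k \<omega>) (or_V R (Suc k) \<omega>)"

definition Shat :: "nat \<Rightarrow> 'a \<Rightarrow> 'y" where
  "Shat k \<omega> = HZhat k \<omega> - lift \<Lambda> (proj R k \<omega>) (or_UY R (Suc k) \<omega>)"

definition What :: "nat \<Rightarrow> 'a \<Rightarrow> 'x" where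
  "What k \<omega> = or_Ux R (Suc k) \<omega>
     - blinfun_apply (or_J R (Suc k) \<omega>) (colift \<Lambda> (proj R k \<omega>) (it_Z R k \<omega>))"

definition bros_recursion :: bool where
  "bros_recursion \<longleftrightarrow>
     (\<exists>x0 Y0 Z0. \<forall>\<omega>\<in>space (pspace R).
        it_x R 0 \<omega> = x0 \<and> it_Y R 0 \<omega> = Y0 \<and> it_Z R 0 \<omega> = Z0 \<and> it_h R 0 \<omega> = 0) \<and>
     (\<forall>k. \<forall>\<omega>\<in>space (pspace R).
        it_x R (Suc k) \<omega> = it_x R k \<omega> - step_x R k *\<^sub>R it_h R k \<omega> \<and>
        it_Y R (Suc k) \<omega> = it_Y R k \<omega> - step_Y R k *\<^sub>R Vhat k \<omega> \<and>
        it_Z R (Suc k) \<omega> = it_Z R k \<omega> - step_Z R k *\<^sub>R Shat k \<omega> \<and>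
        it_h R (Suc k) \<omega> = (1 - step_h R k) *\<^sub>R it_h R k \<omega> + step_h R k *\<^sub>R What k \<omega>)"

definition oracle_events :: "nat \<Rightarrow> 'a set set list" where
  "oracle_events k =
     [events_of (pspace R) borel (or_Ux R (Suc k)),
      events_of (pspace R) borel (or_UY R (Suc k)),
      events_of (pspace R) borel (or_V R (Suc k)),
      events_of (pspace R) borel (or_H R (Suc k)),
      events_of (pspace R) borel (or_J R (Suc k))]"

definition assumption_A2 ::
    "('x \<times> 'y \<Rightarrow> real) \<Rightarrow> ('x \<times> 'y \<Rightarrow> real) \<Rightarrow> real \<Rightarrow> real \<Rightarrow> real \<Rightarrow> real \<Rightarrow> bool" where
  "assumption_A2 f g \<sigma>f1 \<sigma>f2 \<sigma>g1 \<sigma>g2 \<longleftrightarrow> (\<forall>k.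
     let M = pspace R; F = filtP k; FF = filtPP k;
         fk = (\<lambda>\<omega>. projected \<Lambda> f (it_Y R k \<omega>) (proj R k \<omega>));
         gk = (\<lambda>\<omega>. projected \<Lambda> g (it_Y R k \<omega>) (proj R k \<omega>));
         Ux = or_Ux R (Suc k); UY = or_UY R (Suc k); V = or_V R (Suc k);
         H = (\<lambda>\<omega>. blinfun_apply (or_H R (Suc k) \<omega>)); J = (\<lambda>\<omega>. blinfun_apply (or_J R (Suc k) \<omega>));
         mUx = (\<lambda>\<omega>. grad1 (fk \<omega>) (it_x R k \<omega>) 0);
         mUY = (\<lambda>\<omega>. grad2 (fk \<omega>) (it_x R k \<omega>) 0);
         mV = (\<lambda>\<omega>. grad2 (gk \<omega>) (it_x R k \<omega>) 0);
         mH = (\<lambda>\<omega>. hess22 (gk \<omega>) (it_x R k \<omega>) 0);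
         mJ = (\<lambda>\<omega>. hess12 (gk \<omega>) (it_x R k \<omega>) 0)
     in
       Ux \<in> borel_measurable M \<and> UY \<in> borel_measurable M \<and> V \<in> borel_measurable M \<and>
       or_H R (Suc k) \<in> borel_measurable M \<and> or_J R (Suc k) \<in> borel_measurable M \<and>
       cond_mean M F Ux mUx \<and> cond_msd_le M F Ux mUx (\<lambda>_. \<sigma>f1\<^sup>2) \<and>
       cond_mean M F UY mUY \<and> cond_msd_le M F UY mUY (\<lambda>_. \<sigma>f2\<^sup>2) \<and>
       cond_mean M F V mV \<and> cond_msd_le M F V mV (\<lambda>_. \<sigma>g1\<^sup>2) \<and>
       (\<forall>W. cond_mean M F (\<lambda>\<omega>. H \<omega> W) (\<lambda>\<omega>. mH \<omega> W) \<and>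
            cond_msd_le M F (\<lambda>\<omega>. H \<omega> W) (\<lambda>\<omega>. mH \<omega> W) (\<lambda>_. \<sigma>g2\<^sup>2 * (norm W)\<^sup>2) \<and>
            cond_mean M F (\<lambda>\<omega>. J \<omega> W) (\<lambda>\<omega>. mJ \<omega> W) \<and>
            cond_msd_le M F (\<lambda>\<omega>. J \<omega> W) (\<lambda>\<omega>. mJ \<omega> W) (\<lambda>_. \<sigma>g2\<^sup>2 * (norm W)\<^sup>2)) \<and>
       (\<forall>W\<in>borel_measurable FF.
            (AE \<omega> in M. nn_cond_exp M FF (\<lambda>\<omega>. ennreal ((norm (W \<omega>))\<^sup>2)) \<omega> < \<infinity>) \<longrightarrow>
            cond_mean M FF (\<lambda>\<omega>. H \<omega> (W \<omega>)) (\<lambda>\<omega>. mH \<omega> (W \<omega>)) \<and>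
            cond_msd_le M FF (\<lambda>\<omega>. H \<omega> (W \<omega>)) (\<lambda>\<omega>. mH \<omega> (W \<omega>)) (\<lambda>\<omega>. \<sigma>g2\<^sup>2 * (norm (W \<omega>))\<^sup>2) \<and>
            cond_mean M FF (\<lambda>\<omega>. J \<omega> (W \<omega>)) (\<lambda>\<omega>. mJ \<omega> (W \<omega>)) \<and>
            cond_msd_le M FF (\<lambda>\<omega>. J \<omega> (W \<omega>)) (\<lambda>\<omega>. mJ \<omega> (W \<omega>)) (\<lambda>\<omega>. \<sigma>g2\<^sup>2 * (norm (W \<omega>))\<^sup>2)) \<and>
       prob_space.indep_set M (sigma_sets (space M) (probe_events k))
         (sigma_sets (space M) (sets F \<union> \<Union> (set (oracle_events k)))) \<and>
       cond_indep_sets M F (\<lambda>i. oracle_events k ! i) {..<5})"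

definition rademacher_probes :: "nat \<Rightarrow> bool" where
  "rademacher_probes k \<longleftrightarrow>
     (let M = pspace R;
          S = case_sum (\<lambda>(l, j) \<omega>. probe_u R (Suc k) \<omega> l j) (\<lambda>(l, i) \<omega>. probe_xi R (Suc k) \<omega> l i);
          I = (SIGMA l:UNIV. {..<ncol \<Lambda> l}) <+> (SIGMA l:UNIV. {..<rnk \<Lambda> l})
      in prob_space.indep_vars M (\<lambda>_. borel) S I \<and>
         (\<forall>i\<in>I. (\<forall>\<omega>\<in>space M. S i \<omega> \<in> {-1, 1}) \<and>
                 measure M {\<omega> \<in> space M. S i \<omega> = 1} = 1 / 2 \<and>
                 measure M {\<omega> \<in> space M. S i \<omega> = - 1} = 1 / 2))"

definition assumption_A3 :: bool where
  "assumption_A3 \<longleftrightarrow> (\<forall>k.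
     let M = pspace R; N = (\<lambda>l. mat_borel (nrow \<Lambda> l) (rnk \<Lambda> l)) in
       (\<forall>l. (\<lambda>\<omega>. proj R k \<omega> l) \<in> measurable M (N l)) \<and>
       cond_indep_sets M (filt k) (\<lambda>l. events_of M (N l) (\<lambda>\<omega>. proj R k \<omega> l)) UNIV \<and>
       (\<forall>l. \<exists>\<nu>. haar_orthogonal (nrow \<Lambda> l) \<nu> \<and>
          (\<forall>A\<in>sets (N l). AE \<omega> in M.
             real_cond_exp M (filt k) (indicat_real ((\<lambda>\<omega>. proj R k \<omega> l) -` A \<inter> space M)) \<omega>
             = measure (distr \<nu> (N l) (\<lambda>Q. sqrt (real (nrow \<Lambda> l) / real (rnk \<Lambda> l)) \<cdot>\<^sub>m
                                            first_cols (nrow \<Lambda> l) (rnk \<Lambda> l) Q)) A)) \<and>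
       rademacher_probes k)"

definition dirY :: "('x \<times> 'y \<Rightarrow> real) \<Rightarrow> nat \<Rightarrow> 'a \<Rightarrow> 'y" where
  "dirY g k \<omega> = grad2 g (it_x R k \<omega>) (it_Y R k \<omega>)"

definition dirZ :: "('x \<times> 'y \<Rightarrow> real) \<Rightarrow> ('x \<times> 'y \<Rightarrow> real) \<Rightarrow> nat \<Rightarrow> 'a \<Rightarrow> 'y" where
  "dirZ f g k \<omega> = hess22 g (it_x R k \<omega>) (it_Y R k \<omega>) (it_Z R k \<omega>) - grad2 f (it_x R k \<omega>) (it_Y R k \<omega>)"

definition dirx :: "('x \<times> 'y \<Rightarrow> real) \<Rightarrow> ('x \<times> 'y \<Rightarrow> real) \<Rightarrow> nat \<Rightarrow> 'a \<Rightarrow> 'x" where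
  "dirx f g k \<omega> = grad1 f (it_x R k \<omega>) (it_Y R k \<omega>) - hess12 g (it_x R k \<omega>) (it_Y R k \<omega>) (it_Z R k \<omega>)"

end

definition bros_run ::
    "('l::finite, 'y::euclidean_space, 'b::euclidean_space) layout \<Rightarrow>
     ('x::euclidean_space \<times> 'y \<Rightarrow> real) \<Rightarrow> ('x \<times> 'y \<Rightarrow> real) \<Rightarrow> real \<Rightarrow> real \<Rightarrow> real \<Rightarrow> real \<Rightarrow>
     ('a, 'x, 'y, 'b, 'l) run \<Rightarrow> bool" where
  "bros_run \<Lambda> f g \<sigma>f1 \<sigma>f2 \<sigma>g1 \<sigma>g2 R \<longleftrightarrow>
     prob_space (pspace R) \<and> bros_recursion \<Lambda> R \<and>
     assumption_A2 \<Lambda> R f g \<sigma>f1 \<sigma>f2 \<sigma>g1 \<sigma>g2 \<and> assumption_A3 \<Lambda> R"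

end

theory Submission
  imports Defs
begin

text \<open>
  Conditionally on the past and the projectors, the oracles return on average derivatives of the projected
  functions, and by the chain rule these are the full-space derivatives compressed by \<open>P\<close>.  With
  \<open>S = P P\<^sup>T\<close>, the means of \<open>Vhat\<close> and \<open>What\<close> and of the off-diagonal blocks of the Hessian action
  only involve \<open>E S = I\<close> and the independence of the layers.  The diagonal blocks involve
  \<open>E (S\<^sub>i\<^sub>j S\<^sub>k\<^sub>l)\<close>.  Invariance of Haar measure under reflections in hyperplanes, together with the trace and
  the idempotence of a projection, determines this tensor: it is a combination of the three pairings of
  its indices.  Hence the means of \<open>A\<close>, \<open>Bsharp\<close> and \<open>Chat\<close> are combinations of the same three
  contractions of the Hessian block with \<open>Z\<close>, and the coefficients of the correction are the ones for
  which the two unwanted contractions cancel.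

  For the variance bound crude estimates suffice, since \<open>P\<^sup>T P\<close> is almost surely a multiple of the
  identity and the stochastic directions are compared with zero and not with their means.  The bound also
  propagates square integrability along the iteration, which makes the expectations above meaningful.
\<close>

section \<open>Gradients and Hessians\<close>

text \<open>Each claim about a conditional mean is reduced to unconditional integrals: a coordinate
  of the direction is multiplied by a bounded weight \<open>c\<close> that is measurable for
  \<open>filt\<close>, and randomness is averaged out from the inside. The operator oracles go
  first, given \<open>filtPP\<close>; then the probe signs, given \<open>filtP\<close>; last the
  projectors, given \<open>filt\<close>. What is left are sums of past-measurable coefficients times
  moments of \<open>P P\<^sup>T\<close>. Each exchange of sum and integral needs an integrable
  product, while (A2) only controls conditional moments, so the second moments have to be settled
  before the means.

  For a diagonal block the unknowns are the weights of three contractions: the target must get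
  weight 1, the other two weight 0. These are three linear conditions on the three coefficients. The
  difference of \<open>A\<close> and \<open>Bsharp\<close> isolates one contraction with a factor
  \<open>r (r - 1)\<close>, which is why the rank must be at least 2.

  Only three reflections are needed for the moment tensor: one changes a sign, one swaps two
  coordinates, and one has the rational row (3, -4) / 5. The last one supplies the single relation
  that signed permutations cannot give.\<close>

lemma grad_eqI:
  fixes \<phi> :: "'v::real_inner \<Rightarrow> real"
  assumes "GDERIV \<phi> p :> G"
  shows "grad \<phi> p = G"
proof -
  have *: "G' = G" if "GDERIV \<phi> p :> G'" for G'
  proof -
    have "(\<lambda>h. inner h G') = (\<lambda>h. inner h G)"
      using has_derivative_unique assms that unfolding gderiv_def by blast
    then have "inner (G' - G) (G' - G) = 0"
      unfolding inner_diff_right by (simp add: fun_eq_iff)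
    then show ?thesis by simp
  qed
  show ?thesis unfolding grad_def by (rule the_equality[where P = "\<lambda>G. GDERIV \<phi> p :> G", OF assms *])
qed

lemma GDERIV_grad:
  fixes \<phi> :: "'v::euclidean_space \<Rightarrow> real"
  assumes "\<phi> differentiable at p"
  shows "GDERIV \<phi> p :> grad \<phi> p"
proof -
  obtain D where D: "(\<phi> has_derivative D) (at p)" using assms unfolding differentiable_def by blast
  then have "linear D" using has_derivative_linear by blast
  \<comment> \<open>The Riesz representative of a linear functional is the value of its adjoint at
    1.\<close>
  then have "D = (\<lambda>h. inner h (adjoint D 1))" by (auto simp: adjoint_works)
  then have "GDERIV \<phi> p :> adjoint D 1" unfolding gderiv_def using D by simp
  then show ?thesis using grad_eqI by metis
qed

lemma has_derivative_grad:
  fixes \<phi> :: "'v::euclidean_space \<Rightarrow> real"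
  assumes "\<phi> differentiable at p"
  shows "(\<phi> has_derivative (\<lambda>h. inner h (grad \<phi> p))) (at p)"
  using GDERIV_grad[OF assms] by (simp add: gderiv_def)

lemma GDERIV_comp_affine:
  fixes \<phi> :: "'v::euclidean_space \<Rightarrow> real" and T :: "'w::euclidean_space \<Rightarrow> 'v"
  assumes "\<phi> differentiable at (c + T p)" "linear T"
  shows "GDERIV (\<lambda>q. \<phi> (c + T q)) p :> adjoint T (grad \<phi> (c + T p))"
proof -
  have T: "((\<lambda>q. c + T q) has_derivative T) (at p)"
    using assms(2) linear_linear
    by (auto intro!: derivative_eq_intros bounded_linear_imp_has_derivative)
  have "((\<lambda>q. \<phi> (c + T q)) has_derivative (\<lambda>h. inner (T h) (grad \<phi> (c + T p)))) (at p)"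
    using has_derivative_compose[OF T has_derivative_grad[OF assms(1)]] .
  then show ?thesis unfolding gderiv_def by (simp add: adjoint_works[OF assms(2)])
qed

lemma grad2_eq_snd_grad:
  fixes \<phi> :: "'u::euclidean_space \<times> 'v::euclidean_space \<Rightarrow> real"
  assumes "\<phi> differentiable at (x, y)"
  shows "GDERIV (\<lambda>y'. \<phi> (x, y')) y :> snd (grad \<phi> (x, y))" "grad2 \<phi> x y = snd (grad \<phi> (x, y))"
proof -
  have T: "((\<lambda>q. (x, q)) has_derivative (\<lambda>h. (0, h))) (at y)"
    by (auto intro!: derivative_eq_intros)
  have "((\<lambda>q. \<phi> (x, q)) has_derivative (\<lambda>h. inner (0, h) (grad \<phi> (x, y)))) (at y)"
    using has_derivative_compose[OF T has_derivative_grad[OF assms]] .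
  then show 1: "GDERIV (\<lambda>y'. \<phi> (x, y')) y :> snd (grad \<phi> (x, y))"
    unfolding gderiv_def by (simp add: inner_prod_def)
  then show "grad2 \<phi> x y = snd (grad \<phi> (x, y))" unfolding grad2_def by (rule grad_eqI)
qed

lemma grad1_eq_fst_grad:
  fixes \<phi> :: "'u::euclidean_space \<times> 'v::euclidean_space \<Rightarrow> real"
  assumes "\<phi> differentiable at (x, y)"
  shows "grad1 \<phi> x y = fst (grad \<phi> (x, y))"
proof -
  have T: "((\<lambda>q. (q, y)) has_derivative (\<lambda>h. (h, 0))) (at x)"
    by (auto intro!: derivative_eq_intros)
  have "((\<lambda>q. \<phi> (q, y)) has_derivative (\<lambda>h. inner (h, 0) (grad \<phi> (x, y)))) (at x)"
    using has_derivative_compose[OF T has_derivative_grad[OF assms]] .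
  then have "GDERIV (\<lambda>q. \<phi> (q, y)) x :> fst (grad \<phi> (x, y))"
    unfolding gderiv_def by (simp add: inner_prod_def)
  then show ?thesis unfolding grad1_def by (rule grad_eqI)
qed

text \<open>The part of (A1) that \<open>f\<close> and \<open>g\<close> have in common, so that both
  can share the lemmas below.\<close>

locale smooth_function =
  fixes \<phi> :: "'u::euclidean_space \<times> 'v::euclidean_space \<Rightarrow> real" and L :: real
  assumes diff: "\<And>p. \<phi> differentiable at p"
    and lip: "L-lipschitz_on UNIV (grad \<phi>)"
begin

lemma L_nonneg: "0 \<le> L" using lip lipschitz_on_nonneg by blast

lemma grad1_eq: "grad1 \<phi> x y = fst (grad \<phi> (x, y))"
  and grad2_eq: "grad2 \<phi> x y = snd (grad \<phi> (x, y))"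
  using grad1_eq_fst_grad grad2_eq_snd_grad diff by blast+

lemma continuous_on_grad: "continuous_on UNIV (grad \<phi>)"
  using lip lipschitz_on_continuous_on by blast

lemma borel_measurable_grad [measurable]: "grad \<phi> \<in> borel_measurable borel"
  using continuous_on_grad borel_measurable_continuous_onI by blast

lemma norm_grad_diff: "norm (grad \<phi> p - grad \<phi> q) \<le> L * norm (p - q)"
  using lipschitz_onD[OF lip, of p q] by (simp add: dist_norm)

lemma norm_grad_le: "norm (grad \<phi> p) \<le> norm (grad \<phi> 0) + L * norm p"
proof -
  have "norm (grad \<phi> p) \<le> norm (grad \<phi> 0) + norm (grad \<phi> p - grad \<phi> 0)"
    by (metis add.commute diff_add_cancel norm_triangle_ineq)
  then show ?thesis using norm_grad_diff[of p 0] by simp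
qed

lemma norm_grad1_le: "norm (grad1 \<phi> x y) \<le> norm (grad \<phi> 0) + L * (norm x + norm y)"
  and norm_grad2_le: "norm (grad2 \<phi> x y) \<le> norm (grad \<phi> 0) + L * (norm x + norm y)"
proof -
  have "norm (grad \<phi> (x, y)) \<le> norm (grad \<phi> 0) + L * (norm x + norm y)"
    using norm_grad_le[of "(x, y)"] mult_left_mono[OF norm_Pair_le[of x y] L_nonneg] by linarith
  then show "norm (grad1 \<phi> x y) \<le> norm (grad \<phi> 0) + L * (norm x + norm y)"
    "norm (grad2 \<phi> x y) \<le> norm (grad \<phi> 0) + L * (norm x + norm y)"
    unfolding grad1_eq grad2_eq
    using norm_fst_le[of "fst (grad \<phi> (x, y))" "snd (grad \<phi> (x, y))"]
      norm_snd_le[of "snd (grad \<phi> (x, y))" "fst (grad \<phi> (x, y))"] by auto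
qed

lemma norm_grad2_diff: "norm (grad2 \<phi> x y - grad2 \<phi> x z) \<le> L * norm (y - z)"
proof -
  have "norm (grad2 \<phi> x y - grad2 \<phi> x z) = norm (snd (grad \<phi> (x, y) - grad \<phi> (x, z)))"
    by (simp add: grad2_eq)
  also have "\<dots> \<le> norm (grad \<phi> (x, y) - grad \<phi> (x, z))"
    by (metis norm_snd_le prod.collapse)
  also have "\<dots> \<le> L * norm ((x, y) - (x, z))" by (rule norm_grad_diff)
  finally show ?thesis by (simp add: norm_Pair)
qed

lemma measurable_grad1 [measurable (raw)]:
  assumes [measurable]: "X \<in> borel_measurable M" "Y \<in> borel_measurable M"
  shows "(\<lambda>\<omega>. grad1 \<phi> (X \<omega>) (Y \<omega>)) \<in> borel_measurable M"
  unfolding grad1_eq by (intro borel_measurable_continuous_on[OF continuous_on_fst[OF continuous_on_id]]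
    measurable_compose[OF _ borel_measurable_grad]) (simp add: borel_prod[symmetric])

lemma measurable_grad2 [measurable (raw)]:
  assumes [measurable]: "X \<in> borel_measurable M" "Y \<in> borel_measurable M"
  shows "(\<lambda>\<omega>. grad2 \<phi> (X \<omega>) (Y \<omega>)) \<in> borel_measurable M"
  unfolding grad2_eq by (intro borel_measurable_continuous_on[OF continuous_on_snd[OF continuous_on_id]]
    measurable_compose[OF _ borel_measurable_grad]) (simp add: borel_prod[symmetric])

lemma grad1_projected:
  fixes T :: "'b::euclidean_space \<Rightarrow> 'v"
  assumes "linear T"
  shows "grad1 (\<lambda>(x, B). \<phi> (x, Y + T B)) x B = grad1 \<phi> x (Y + T B)"
  unfolding grad1_def by simp

text \<open>Chain rule for an affine substitution. For \<open>T = lift \<Lambda> P\<close> the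
  adjoint is \<open>colift \<Lambda> P\<close>, so the gradient oracles have means of the form
  \<open>P\<^sup>T\<close> applied to a full-space gradient.\<close>

lemma grad2_projected:
  fixes T :: "'b::euclidean_space \<Rightarrow> 'v"
  assumes "linear T"
  shows "grad2 (\<lambda>(x, B). \<phi> (x, Y + T B)) x B = adjoint T (grad2 \<phi> x (Y + T B))"
proof -
  have d: "(\<lambda>y. \<phi> (x, y)) differentiable at (Y + T B)"
    using grad2_eq_snd_grad(1)[OF diff] unfolding gderiv_def differentiable_def by blast
  have "GDERIV (\<lambda>B. \<phi> (x, Y + T B)) B :> adjoint T (grad2 \<phi> x (Y + T B))"
    using GDERIV_comp_affine[OF d assms] by (simp add: grad2_def)
  then have "grad (\<lambda>B. \<phi> (x, Y + T B)) B = adjoint T (grad2 \<phi> x (Y + T B))" by (rule grad_eqI)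
  then show ?thesis by (simp add: grad2_def[of "\<lambda>(x, B). \<phi> (x, Y + T B)"])
qed

end

section \<open>Hessian blocks: bounds, measurability, projection and symmetry\<close>

locale twice_smooth_function = smooth_function \<phi> L
  for \<phi> :: "'u::euclidean_space \<times> 'v::euclidean_space \<Rightarrow> real" and L +
  fixes L2 :: real
  assumes diff2: "\<And>p. grad \<phi> differentiable at p"
    and lip2: "\<And>p q. onorm (\<lambda>v. frechet_derivative (grad \<phi>) (at p) v - frechet_derivative (grad \<phi>) (at q) v)
              \<le> L2 * norm (p - q)"
begin

abbreviation "DD p \<equiv> frechet_derivative (grad \<phi>) (at p)"

lemma DD: "(grad \<phi> has_derivative DD p) (at p)"
  using diff2 frechet_derivative_works by blast

lemma bounded_linear_DD: "bounded_linear (DD p)"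
  using DD has_derivative_bounded_linear by blast

text \<open>Along the line through \<open>p\<close> in direction \<open>v\<close>, the component of
  the gradient in the direction \<open>DD p v\<close> has derivative \<open>norm (DD p v)\<close>
  squared at 0, while its difference quotients are bounded through the Lipschitz constant. One
  factor of the norm is then cancelled.\<close>

lemma norm_DD_le: "norm (DD p v) \<le> L * norm v"
proof -
  have i: "((\<lambda>s. p + s *\<^sub>R v) has_derivative (\<lambda>h. h *\<^sub>R v)) (at 0)" by (auto intro!: derivative_eq_intros)
  have "((\<lambda>s. grad \<phi> (p + s *\<^sub>R v)) has_derivative (\<lambda>h. DD p (h *\<^sub>R v))) (at (0::real))"
    using has_derivative_compose[OF i, of "grad \<phi>" "DD p"] DD[of p] by simp
  from has_derivative_inner_right[OF this, of "DD p v"]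
  have "((\<lambda>s. inner (DD p v) (grad \<phi> (p + s *\<^sub>R v))) has_real_derivative inner (DD p v) (DD p v)) (at 0)"
    by (simp add: has_field_derivative_def linear_scale[OF bounded_linear.linear[OF bounded_linear_DD]] mult_commute_abs)
  then have lim: "((\<lambda>s. (inner (DD p v) (grad \<phi> (p + s *\<^sub>R v)) - inner (DD p v) (grad \<phi> p)) / s)
      \<longlongrightarrow> inner (DD p v) (DD p v)) (at 0)"
    by (simp add: DERIV_def)
  have "inner (DD p v) (DD p v) \<le> norm (DD p v) * (L * norm v)"
  proof (rule tendsto_upperbound[OF lim])
    have "(inner (DD p v) (grad \<phi> (p + s *\<^sub>R v)) - inner (DD p v) (grad \<phi> p)) / s
        \<le> norm (DD p v) * (L * norm v)" if "s \<noteq> 0" for s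
    proof -
      have "\<bar>inner (DD p v) (grad \<phi> (p + s *\<^sub>R v) - grad \<phi> p)\<bar>
          \<le> norm (DD p v) * norm (grad \<phi> (p + s *\<^sub>R v) - grad \<phi> p)" by (rule Cauchy_Schwarz_ineq2)
      also have "\<dots> \<le> norm (DD p v) * (L * (\<bar>s\<bar> * norm v))"
        using norm_grad_diff[of "p + s *\<^sub>R v" p] by (intro mult_left_mono) auto
      finally have "\<bar>inner (DD p v) (grad \<phi> (p + s *\<^sub>R v) - grad \<phi> p)\<bar> / \<bar>s\<bar> \<le> norm (DD p v) * (L * norm v)"
        using that by (simp add: field_simps)
      then show ?thesis unfolding inner_diff_right abs_divide[symmetric] by linarith
    qed
    then show "\<forall>\<^sub>F s in at 0. (inner (DD p v) (grad \<phi> (p + s *\<^sub>R v)) - inner (DD p v) (grad \<phi> p)) / s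
        \<le> norm (DD p v) * (L * norm v)" by (simp add: eventually_at_filter)
  qed simp
  then have "norm (DD p v) * norm (DD p v) \<le> norm (DD p v) * (L * norm v)"
    by (simp add: power2_norm_eq_inner[symmetric] power2_eq_square)
  then show ?thesis using L_nonneg
    by (cases "norm (DD p v) = 0") (auto simp: mult_le_cancel_left zero_less_mult_iff)
qed

lemma norm_DD_diff: "norm (DD p v - DD q v) \<le> L2 * norm (p - q) * norm v"
proof -
  have "norm (DD p v - DD q v) \<le> onorm (\<lambda>v. DD p v - DD q v) * norm v"
    by (rule onorm[OF bounded_linear_sub[OF bounded_linear_DD bounded_linear_DD]])
  also have "\<dots> \<le> L2 * norm (p - q) * norm v" by (intro mult_right_mono lip2) simp
  finally show ?thesis .
qed

lemma continuous_on_DD: "continuous_on UNIV (\<lambda>p. DD p v)"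
proof -
  \<comment> \<open>The locale does not fix the sign of \<open>L2\<close>, but a Lipschitz constant
    has to be nonnegative.\<close>
  have "(\<bar>L2\<bar> * norm v)-lipschitz_on UNIV (\<lambda>p. DD p v)"
  proof (rule lipschitz_onI)
    fix p q :: "'u \<times> 'v"
    have "L2 * norm (p - q) * norm v \<le> \<bar>L2\<bar> * norm (p - q) * norm v"
      by (intro mult_right_mono) auto
    then show "dist (DD p v) (DD q v) \<le> (\<bar>L2\<bar> * norm v) * dist p q"
      using norm_DD_diff[of p v q] by (simp add: dist_norm mult_ac)
  qed simp
  then show ?thesis by (rule lipschitz_on_continuous_on)
qed

lemma has_derivative_grad2:
  "((\<lambda>y'. grad2 \<phi> x y') has_derivative (\<lambda>v. snd (DD (x, y) (0, v)))) (at y)"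
proof -
  have T: "((\<lambda>q. (x, q)) has_derivative (\<lambda>h. (0, h))) (at y)"
    by (auto intro!: derivative_eq_intros)
  show ?thesis unfolding grad2_eq
    by (rule has_derivative_snd[OF has_derivative_compose[OF T DD]])
qed

lemma has_derivative_grad2_fst:
  "((\<lambda>x'. grad2 \<phi> x' y) has_derivative (\<lambda>u. snd (DD (x, y) (u, 0)))) (at x)"
proof -
  have T: "((\<lambda>q. (q, y)) has_derivative (\<lambda>h. (h, 0))) (at x)"
    by (auto intro!: derivative_eq_intros)
  show ?thesis unfolding grad2_eq
    by (rule has_derivative_snd[OF has_derivative_compose[OF T DD]])
qed

lemma hess22_eq: "hess22 \<phi> x y v = snd (DD (x, y) (0, v))"
  unfolding hess22_def using frechet_derivative_at[OF has_derivative_grad2, symmetric] by simp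

lemma hess12_eq: "hess12 \<phi> x y = adjoint (\<lambda>u. snd (DD (x, y) (u, 0)))"
  unfolding hess12_def using frechet_derivative_at[OF has_derivative_grad2_fst, symmetric] by simp

lemma linear_hess22: "linear (hess22 \<phi> x y)"
proof -
  have "hess22 \<phi> x y = (\<lambda>v. snd (DD (x, y) (0, v)))" by (auto simp: hess22_eq)
  then show ?thesis using has_derivative_linear[OF has_derivative_grad2] by metis
qed

lemma linear_DD_fst: "linear (\<lambda>u. snd (DD (x, y) (u, 0)))"
  using has_derivative_linear[OF has_derivative_grad2_fst] .

lemma linear_hess12: "linear (hess12 \<phi> x y)"
  unfolding hess12_eq by (rule adjoint_linear[OF linear_DD_fst])

lemma norm_hess22_le: "norm (hess22 \<phi> x y v) \<le> L * norm v"
proof -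
  have "norm (hess22 \<phi> x y v) \<le> norm (DD (x, y) (0, v))"
    unfolding hess22_eq by (metis norm_snd_le prod.collapse)
  also have "\<dots> \<le> L * norm v" using norm_DD_le[of "(x, y)" "(0, v)"] by (simp add: norm_Pair)
  finally show ?thesis .
qed

text \<open>Duality: a bound for the mixed derivative \<open>?A\<close> passes to its adjoint by
  testing the value \<open>?w\<close> of the adjoint against itself.\<close>

lemma norm_hess12_le: "norm (hess12 \<phi> x y v) \<le> L * norm v"
proof -
  let ?A = "\<lambda>u. snd (DD (x, y) (u, 0))" and ?w = "hess12 \<phi> x y v"
  have A: "norm (?A u) \<le> L * norm u" for u
  proof -
    have "norm (?A u) \<le> norm (DD (x, y) (u, 0))" by (metis norm_snd_le prod.collapse)
    also have "\<dots> \<le> L * norm u" using norm_DD_le[of "(x, y)" "(u, 0)"] by (simp add: norm_Pair)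
    finally show ?thesis .
  qed
  have "norm ?w * norm ?w = inner ?w ?w"
    by (simp add: power2_norm_eq_inner[symmetric] power2_eq_square)
  also have "\<dots> = inner (?A ?w) v" unfolding hess12_eq by (rule adjoint_works[OF linear_DD_fst])
  also have "\<dots> \<le> norm (?A ?w) * norm v" by (rule norm_cauchy_schwarz)
  also have "\<dots> \<le> (L * norm ?w) * norm v" using A by (intro mult_right_mono) auto
  finally have "norm ?w * norm ?w \<le> norm ?w * (L * norm v)" by (simp add: mult_ac)
  then show ?thesis using L_nonneg
    by (cases "norm ?w = 0") (auto simp: mult_le_cancel_left zero_less_mult_iff)
qed

text \<open>Continuity of \<open>DD p v\<close> in \<open>p\<close> is known for fixed
  \<open>v\<close> only. A random direction is therefore expanded in the basis, which turns it into
  measurable coefficients of fixed directions.\<close>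

lemma measurable_hess22 [measurable (raw)]:
  assumes [measurable]: "X \<in> borel_measurable M" "Y \<in> borel_measurable M" "V \<in> borel_measurable M"
  shows "(\<lambda>\<omega>. hess22 \<phi> (X \<omega>) (Y \<omega>) (V \<omega>)) \<in> borel_measurable M"
proof -
  have m: "(\<lambda>\<omega>. DD (X \<omega>, Y \<omega>) v) \<in> borel_measurable M" for v
    by (rule borel_measurable_continuous_on[OF continuous_on_DD]) (simp add: borel_prod[symmetric])
  have "hess22 \<phi> (X \<omega>) (Y \<omega>) (V \<omega>) = (\<Sum>b\<in>Basis. inner (V \<omega>) b *\<^sub>R snd (DD (X \<omega>, Y \<omega>) (0, b)))" for \<omega>
    by (subst euclidean_representation[of "V \<omega>", symmetric])
      (simp add: linear_sum[OF linear_hess22] linear_scale[OF linear_hess22] hess22_eq[symmetric])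
  moreover have "(\<lambda>\<omega>. snd (DD (X \<omega>, Y \<omega>) (0, b))) \<in> borel_measurable M" for b
    by (rule borel_measurable_continuous_on[OF continuous_on_snd[OF continuous_on_id] m])
  ultimately show ?thesis by simp
qed

lemma measurable_hess12 [measurable (raw)]:
  assumes [measurable]: "X \<in> borel_measurable M" "Y \<in> borel_measurable M" "V \<in> borel_measurable M"
  shows "(\<lambda>\<omega>. hess12 \<phi> (X \<omega>) (Y \<omega>) (V \<omega>)) \<in> borel_measurable M"
proof -
  have m: "(\<lambda>\<omega>. DD (X \<omega>, Y \<omega>) v) \<in> borel_measurable M" for v
    by (rule borel_measurable_continuous_on[OF continuous_on_DD]) (simp add: borel_prod[symmetric])
  have i: "inner (hess12 \<phi> (X \<omega>) (Y \<omega>) (V \<omega>)) b = inner (V \<omega>) (snd (DD (X \<omega>, Y \<omega>) (b, 0)))" for \<omega> b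
    unfolding hess12_eq by (rule adjoint_clauses(2)[OF linear_DD_fst])
  have "hess12 \<phi> (X \<omega>) (Y \<omega>) (V \<omega>) = (\<Sum>b\<in>Basis. inner (V \<omega>) (snd (DD (X \<omega>, Y \<omega>) (b, 0))) *\<^sub>R b)" for \<omega>
    by (subst euclidean_representation[symmetric]) (simp add: i)
  moreover have [measurable]: "(\<lambda>\<omega>. snd (DD (X \<omega>, Y \<omega>) (b, 0))) \<in> borel_measurable M" for b
    by (rule borel_measurable_continuous_on[OF continuous_on_snd[OF continuous_on_id] m])
  ultimately show ?thesis by simp
qed

lemma hess22_projected:
  fixes T :: "'c::euclidean_space \<Rightarrow> 'v"
  assumes T: "linear T"
  shows "hess22 (\<lambda>(x, B). \<phi> (x, Y + T B)) x B W = adjoint T (hess22 \<phi> x (Y + T B) (T W))"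
proof -
  have T': "((\<lambda>q. Y + T q) has_derivative T) (at B)"
    using T linear_linear by (auto intro!: derivative_eq_intros bounded_linear_imp_has_derivative)
  have aT: "bounded_linear (adjoint T)" using adjoint_linear[OF T] linear_linear by blast
  have "((\<lambda>B. adjoint T (grad2 \<phi> x (Y + T B))) has_derivative
      (\<lambda>h. adjoint T (snd (DD (x, Y + T B) (0, T h))))) (at B)"
    by (rule bounded_linear.has_derivative[OF aT has_derivative_compose[OF T' has_derivative_grad2]])
  then show ?thesis unfolding hess22_def[of "\<lambda>(x, B). \<phi> (x, Y + T B)"] grad2_projected[OF T] hess22_eq
    using frechet_derivative_at[symmetric] by fastforce
qed

text \<open>Only the second variable is projected, so this block is compressed on one side: the
  adjoint of "\<open>adjoint T\<close> after A" is "the adjoint of A after \<open>T\<close>". This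
  is why no second moment of the projector is needed for the x-direction.\<close>

lemma hess12_projected:
  fixes T :: "'c::euclidean_space \<Rightarrow> 'v"
  assumes T: "linear T"
  shows "hess12 (\<lambda>(x, B). \<phi> (x, Y + T B)) x B W = hess12 \<phi> x (Y + T B) (T W)"
proof -
  let ?A = "\<lambda>u. snd (DD (x, Y + T B) (u, 0))"
  have aT: "bounded_linear (adjoint T)" using adjoint_linear[OF T] linear_linear by blast
  have "((\<lambda>x. adjoint T (grad2 \<phi> x (Y + T B))) has_derivative (\<lambda>u. adjoint T (?A u))) (at x)"
    by (rule bounded_linear.has_derivative[OF aT has_derivative_grad2_fst])
  then have "frechet_derivative (\<lambda>x'. grad2 (\<lambda>(x, B). \<phi> (x, Y + T B)) x' B) (at x) = (\<lambda>u. adjoint T (?A u))"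
    unfolding grad2_projected[OF T] using frechet_derivative_at[symmetric] by blast
  moreover have "adjoint (\<lambda>u. adjoint T (?A u)) = (\<lambda>w. adjoint ?A (T w))"
    by (rule adjoint_unique) (simp add: adjoint_clauses[OF T] adjoint_works[OF linear_DD_fst])
  ultimately show ?thesis by (simp add: hess12_def[of "\<lambda>(x, B). \<phi> (x, Y + T B)"] hess12_eq)
qed

text \<open>The mean value theorem twice: along \<open>v\<close> for the difference in direction
  \<open>u\<close>, then along \<open>u\<close> for the gradient component that results. The left
  side is symmetric in \<open>u\<close> and \<open>v\<close>, the right side is not visibly so, and
  the gap is what yields the symmetry of the Hessian.\<close>

lemma hess22_second_difference:
  assumes "0 < t"
  shows "\<exists>y'. norm (y' - y) \<le> t * (norm u + norm v) \<and>
    \<phi> (x, y + t *\<^sub>R u + t *\<^sub>R v) - \<phi> (x, y + t *\<^sub>R u) - \<phi> (x, y + t *\<^sub>R v) + \<phi> (x, y)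
      = t * t * inner (hess22 \<phi> x y' u) v"
proof -
  define \<psi> where "\<psi> s = \<phi> (x, (y + t *\<^sub>R u) + s *\<^sub>R v) - \<phi> (x, y + s *\<^sub>R v)" for s
  define \<psi>' where "\<psi>' s = inner v (grad2 \<phi> x ((y + t *\<^sub>R u) + s *\<^sub>R v)) - inner v (grad2 \<phi> x (y + s *\<^sub>R v))" for s
  have l: "((\<lambda>s. \<phi> (x, c + s *\<^sub>R v)) has_real_derivative inner v (grad2 \<phi> x (c + s *\<^sub>R v))) (at s)" for c s
  proof -
    have i: "((\<lambda>s. c + s *\<^sub>R v) has_derivative (\<lambda>h. h *\<^sub>R v)) (at s)" by (auto intro!: derivative_eq_intros)
    have o: "((\<lambda>y'. \<phi> (x, y')) has_derivative (\<lambda>h. inner h (grad2 \<phi> x (c + s *\<^sub>R v)))) (at (c + s *\<^sub>R v))"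
      using grad2_eq_snd_grad[OF diff] unfolding gderiv_def by metis
    show ?thesis using has_derivative_compose[OF i o] by (simp add: has_field_derivative_def mult_commute_abs)
  qed
  have "\<exists>s. 0 < s \<and> s < t \<and> \<psi> t - \<psi> 0 = (t - 0) * \<psi>' s"
    by (rule MVT2[OF assms]) (auto simp: \<psi>_def \<psi>'_def intro!: DERIV_diff l)
  then obtain s where s: "0 < s" "s < t" "\<psi> t - \<psi> 0 = t * \<psi>' s" by auto
  define \<zeta> where "\<zeta> q = inner v (grad2 \<phi> x ((y + s *\<^sub>R v) + q *\<^sub>R u))" for q
  have l2: "(\<zeta> has_real_derivative inner v (hess22 \<phi> x ((y + s *\<^sub>R v) + q *\<^sub>R u) u)) (at q)" for q
  proof -
    let ?c = "y + s *\<^sub>R v"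
    have i: "((\<lambda>s. ?c + s *\<^sub>R u) has_derivative (\<lambda>h. h *\<^sub>R u)) (at q)" by (auto intro!: derivative_eq_intros)
    have "((\<lambda>q. grad2 \<phi> x (?c + q *\<^sub>R u)) has_derivative (\<lambda>h. hess22 \<phi> x (?c + q *\<^sub>R u) (h *\<^sub>R u))) (at q)"
      using has_derivative_compose[OF i has_derivative_grad2] by (simp add: hess22_eq)
    from has_derivative_inner_right[OF this, of v] show ?thesis
      unfolding \<zeta>_def has_field_derivative_def
      by (simp add: linear_scale[OF linear_hess22] mult_commute_abs)
  qed
  have "\<exists>q. 0 < q \<and> q < t \<and> \<zeta> t - \<zeta> 0 = (t - 0) * inner v (hess22 \<phi> x ((y + s *\<^sub>R v) + q *\<^sub>R u) u)"
    by (rule MVT2[OF assms]) (rule l2)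
  then obtain q where q: "0 < q" "q < t" "\<zeta> t - \<zeta> 0 = t * inner v (hess22 \<phi> x ((y + s *\<^sub>R v) + q *\<^sub>R u) u)" by auto
  have "\<psi>' s = \<zeta> t - \<zeta> 0" by (simp add: \<psi>'_def \<zeta>_def algebra_simps)
  then have "\<psi> t - \<psi> 0 = t * t * inner (hess22 \<phi> x ((y + s *\<^sub>R v) + q *\<^sub>R u) u) v"
    using s q by (simp add: inner_commute)
  moreover have "norm (((y + s *\<^sub>R v) + q *\<^sub>R u) - y) \<le> t * (norm u + norm v)"
  proof -
    have "norm (s *\<^sub>R v + q *\<^sub>R u) \<le> s * norm v + q * norm u"
      using norm_triangle_ineq[of "s *\<^sub>R v" "q *\<^sub>R u"] s q by simp
    also have "\<dots> \<le> t * norm v + t * norm u" using s q by (intro add_mono mult_right_mono) auto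
    finally show ?thesis by (simp add: algebra_simps)
  qed
  ultimately show ?thesis unfolding \<psi>_def by (intro exI[of _ "(y + s *\<^sub>R v) + q *\<^sub>R u"]) simp
qed

text \<open>Both mixed second derivatives are limits of the same second difference.\<close>

lemma hess22_symmetric: "inner (hess22 \<phi> x y u) v = inner (hess22 \<phi> x y v) u"
proof -
  define c where "c = norm u + norm v"
  have H: "norm (hess22 \<phi> x y' w - hess22 \<phi> x y w) \<le> \<bar>L2\<bar> * norm (y' - y) * norm w" for y' w
  proof -
    have "norm (hess22 \<phi> x y' w - hess22 \<phi> x y w) \<le> norm (DD (x, y') (0, w) - DD (x, y) (0, w))"
      unfolding hess22_eq snd_diff[symmetric] by (metis norm_snd_le prod.collapse)
    also have "\<dots> \<le> L2 * norm (y' - y) * norm w"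
      using norm_DD_diff[of "(x, y')" "(0, w)" "(x, y)"] by (simp add: norm_Pair)
    also have "\<dots> \<le> \<bar>L2\<bar> * norm (y' - y) * norm w" by (intro mult_right_mono) auto
    finally show ?thesis .
  qed
  have step: "\<bar>inner (hess22 \<phi> x y' w) z - inner (hess22 \<phi> x y w) z\<bar> \<le> t * (\<bar>L2\<bar> * c * norm w * norm z)"
    if "norm (y' - y) \<le> t * c" for y' w z t
  proof -
    have "\<bar>inner (hess22 \<phi> x y' w - hess22 \<phi> x y w) z\<bar> \<le> norm (hess22 \<phi> x y' w - hess22 \<phi> x y w) * norm z"
      by (rule Cauchy_Schwarz_ineq2)
    also have "\<dots> \<le> (\<bar>L2\<bar> * norm (y' - y) * norm w) * norm z" by (intro mult_right_mono H) simp
    also have "\<dots> \<le> (\<bar>L2\<bar> * (t * c) * norm w) * norm z" using that by (intro mult_right_mono mult_left_mono) auto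
    finally show ?thesis by (simp add: inner_diff_left mult_ac)
  qed
  define a where "a = inner (hess22 \<phi> x y u) v"
  define b where "b = inner (hess22 \<phi> x y v) u"
  define K where "K = 2 * (\<bar>L2\<bar> * c * norm u * norm v)"
  \<comment> \<open>Both orders of differencing give the same number for every step length
    \<open>t\<close>. Moving the two evaluation points back to \<open>y\<close> costs a multiple of
    \<open>t\<close>, by the Lipschitz bound on the Hessian.\<close>
  have bound: "\<bar>a - b\<bar> \<le> t * K" if t: "0 < t" for t
  proof -
    obtain y1 where y1: "norm (y1 - y) \<le> t * (norm u + norm v)"
      "\<phi> (x, y + t *\<^sub>R u + t *\<^sub>R v) - \<phi> (x, y + t *\<^sub>R u) - \<phi> (x, y + t *\<^sub>R v) + \<phi> (x, y)
      = t * t * inner (hess22 \<phi> x y1 u) v" using hess22_second_difference[OF t] by blast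
    obtain y2 where y2: "norm (y2 - y) \<le> t * (norm v + norm u)"
      "\<phi> (x, y + t *\<^sub>R v + t *\<^sub>R u) - \<phi> (x, y + t *\<^sub>R v) - \<phi> (x, y + t *\<^sub>R u) + \<phi> (x, y)
      = t * t * inner (hess22 \<phi> x y2 v) u" using hess22_second_difference[OF t] by blast
    have "t * t * inner (hess22 \<phi> x y1 u) v = t * t * inner (hess22 \<phi> x y2 v) u"
      unfolding y1(2)[symmetric] y2(2)[symmetric] by (simp add: algebra_simps)
    then have e: "inner (hess22 \<phi> x y1 u) v = inner (hess22 \<phi> x y2 v) u" using t by simp
    have "norm (y2 - y) \<le> t * c" using y2(1) by (simp add: c_def add.commute)
    then show ?thesis using step[of y1 t u v] step[of y2 t v u] y1(1) e
      unfolding a_def b_def K_def c_def by (simp add: algebra_simps)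
  qed
  have "\<bar>a - b\<bar> \<le> 0"
  proof (rule tendsto_lowerbound)
    show "((\<lambda>t. t * K) \<longlongrightarrow> 0) (at_right 0)" by (auto intro!: tendsto_eq_intros)
    show "\<forall>\<^sub>F t in at_right 0. \<bar>a - b\<bar> \<le> t * K"
      using bound by (auto simp: eventually_at_filter)
  qed simp
  then show ?thesis by (simp add: a_def b_def)
qed

end

section \<open>Strong convexity, the minimiser and the linear system at the minimiser\<close>

locale strongly_convex_family = twice_smooth_function \<phi> L L2
  for \<phi> :: "'u::euclidean_space \<times> 'v::euclidean_space \<Rightarrow> real" and L L2 +
  fixes \<mu> :: real
  assumes mu_pos: "0 < \<mu>" and sc: "\<And>x. strongly_convex \<mu> (\<lambda>y. \<phi> (x, y))"
begin

text \<open>Strong convexity on the segment from \<open>y\<close> to \<open>z\<close>, divided by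
  its parameter \<open>t\<close>, which then tends to 0. The factor \<open>1 - t\<close> in the
  quadratic term disappears in the limit.\<close>

lemma first_order:
  "\<phi> (x, y) + inner (grad2 \<phi> x y) (z - y) + \<mu> / 2 * (norm (z - y))\<^sup>2 \<le> \<phi> (x, z)"
proof -
  let ?f = "\<lambda>t. \<phi> (x, y + t *\<^sub>R (z - y))"
  have i: "((\<lambda>t. y + t *\<^sub>R (z - y)) has_derivative (\<lambda>h. h *\<^sub>R (z - y))) (at 0)"
    by (auto intro!: derivative_eq_intros)
  have o: "((\<lambda>y'. \<phi> (x, y')) has_derivative (\<lambda>h. inner h (grad2 \<phi> x (y + 0 *\<^sub>R (z - y))))) (at (y + 0 *\<^sub>R (z - y)))"
    using grad2_eq_snd_grad[OF diff] unfolding gderiv_def by metis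
  have "(?f has_real_derivative inner (grad2 \<phi> x y) (z - y)) (at 0)"
    using has_derivative_compose[OF i o]
    by (simp add: has_field_derivative_def mult_commute_abs inner_commute)
  then have lim: "((\<lambda>t. (\<phi> (x, y + t *\<^sub>R (z - y)) - \<phi> (x, y)) / t) \<longlongrightarrow> inner (grad2 \<phi> x y) (z - y)) (at_right 0)"
    unfolding DERIV_def by (auto intro: filterlim_mono at_le)
  \<comment> \<open>The limit is one-sided because the convexity inequality holds only for
    \<open>t\<close> between 0 and 1.\<close>
  have lim2: "((\<lambda>t. \<phi> (x, z) - \<phi> (x, y) - \<mu> / 2 * (1 - t) * (norm (z - y))\<^sup>2)
      \<longlongrightarrow> \<phi> (x, z) - \<phi> (x, y) - \<mu> / 2 * (1 - 0) * (norm (z - y))\<^sup>2) (at_right 0)"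
    by (intro tendsto_intros)
  have "inner (grad2 \<phi> x y) (z - y) \<le> \<phi> (x, z) - \<phi> (x, y) - \<mu> / 2 * (1 - 0) * (norm (z - y))\<^sup>2"
  proof (rule tendsto_le[OF _ lim2 lim])
    have "(\<phi> (x, y + t *\<^sub>R (z - y)) - \<phi> (x, y)) / t \<le> \<phi> (x, z) - \<phi> (x, y) - \<mu> / 2 * (1 - t) * (norm (z - y))\<^sup>2"
      if "0 < t" "t < 1" for t
    proof -
      have "\<phi> (x, (1 - t) *\<^sub>R y + t *\<^sub>R z) \<le> (1 - t) * \<phi> (x, y) + t * \<phi> (x, z) - \<mu> / 2 * t * (1 - t) * (norm (y - z))\<^sup>2"
        using sc[of x] that unfolding strongly_convex_def by auto
      moreover have "(1 - t) *\<^sub>R y + t *\<^sub>R z = y + t *\<^sub>R (z - y)" by (simp add: algebra_simps)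
      ultimately have "\<phi> (x, y + t *\<^sub>R (z - y)) - \<phi> (x, y)
          \<le> t * (\<phi> (x, z) - \<phi> (x, y) - \<mu> / 2 * (1 - t) * (norm (z - y))\<^sup>2)"
        by (simp add: algebra_simps norm_minus_commute)
      then show ?thesis using that by (simp add: pos_divide_le_eq mult.commute)
    qed
    then show "\<forall>\<^sub>F t in at_right 0. (\<phi> (x, y + t *\<^sub>R (z - y)) - \<phi> (x, y)) / t
        \<le> \<phi> (x, z) - \<phi> (x, y) - \<mu> / 2 * (1 - t) * (norm (z - y))\<^sup>2"
      using eventually_at_right_real[of 0 1] by (auto elim: eventually_mono)
  qed simp
  then show ?thesis by simp
qed

lemma grad2_strongly_monotone:
  "\<mu> * (norm (z - y))\<^sup>2 \<le> inner (grad2 \<phi> x z - grad2 \<phi> x y) (z - y)"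
  using first_order[of x y z] first_order[of x z y]
  by (simp add: norm_minus_commute inner_diff_left inner_diff_right)

text \<open>The infinitesimal form of strong monotonicity: the difference quotients of the gradient
  along \<open>v\<close> are bounded below, hence so is their limit.\<close>

lemma hess22_coercive: "\<mu> * (norm v)\<^sup>2 \<le> inner (hess22 \<phi> x y v) v"
proof -
  have i: "((\<lambda>t. y + t *\<^sub>R v) has_derivative (\<lambda>h. h *\<^sub>R v)) (at 0)"
    by (auto intro!: derivative_eq_intros)
  have "((\<lambda>t. grad2 \<phi> x (y + t *\<^sub>R v)) has_derivative (\<lambda>h. hess22 \<phi> x y (h *\<^sub>R v))) (at 0)"
    using has_derivative_compose[OF i, of "grad2 \<phi> x"] has_derivative_grad2[of x y] by (simp add: hess22_eq)
  from has_derivative_inner_right[OF this, of v]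
  have "((\<lambda>t. inner v (grad2 \<phi> x (y + t *\<^sub>R v))) has_real_derivative inner v (hess22 \<phi> x y v)) (at 0)"
    by (simp add: has_field_derivative_def linear_scale[OF linear_hess22] mult_commute_abs)
  then have lim: "((\<lambda>t. (inner v (grad2 \<phi> x (y + t *\<^sub>R v)) - inner v (grad2 \<phi> x y)) / t)
      \<longlongrightarrow> inner v (hess22 \<phi> x y v)) (at_right 0)"
    unfolding DERIV_def by (auto intro: filterlim_mono at_le)
  have "\<mu> * (norm v)\<^sup>2 \<le> inner v (hess22 \<phi> x y v)"
  proof (rule tendsto_lowerbound[OF lim])
    have "\<mu> * (norm v)\<^sup>2 \<le> (inner v (grad2 \<phi> x (y + t *\<^sub>R v)) - inner v (grad2 \<phi> x y)) / t" if "0 < t" for t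
    proof -
      have "\<mu> * (t\<^sup>2 * (norm v)\<^sup>2) \<le> t * (inner v (grad2 \<phi> x (y + t *\<^sub>R v)) - inner v (grad2 \<phi> x y))"
        using grad2_strongly_monotone[of "y + t *\<^sub>R v" y x] that
        by (simp add: power_mult_distrib inner_diff_left inner_diff_right inner_commute right_diff_distrib)
      then have "t * (t * (\<mu> * (norm v)\<^sup>2)) \<le> t * (inner v (grad2 \<phi> x (y + t *\<^sub>R v)) - inner v (grad2 \<phi> x y))"
        by (simp add: power2_eq_square mult_ac)
      then have "t * (\<mu> * (norm v)\<^sup>2) \<le> inner v (grad2 \<phi> x (y + t *\<^sub>R v)) - inner v (grad2 \<phi> x y)"
        using that by simp
      then show ?thesis using that by (simp add: pos_le_divide_eq mult_ac)
    qed
    then show "\<forall>\<^sub>F t in at_right 0. \<mu> * (norm v)\<^sup>2 \<le> (inner v (grad2 \<phi> x (y + t *\<^sub>R v)) - inner v (grad2 \<phi> x y)) / t"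
      by (simp add: eventually_at_filter)
  qed simp
  then show ?thesis by (simp add: inner_commute)
qed

text \<open>\<open>Ystar\<close> is a choice among minimisers and carries no information until one
  is known to exist. Coercivity confines the search to a compact ball.\<close>

lemma is_arg_min_Ystar: "is_arg_min (\<lambda>y. \<phi> (x, y)) (\<lambda>_. True) (Ystar \<phi> x)"
proof -
  define G where "G = norm (grad2 \<phi> x 0)"
  \<comment> \<open>From this radius on, the quadratic term of \<open>first_order\<close> at 0
    outweighs the linear one, so that the value is at least the one at 0.\<close>
  define \<rho> where "\<rho> = 2 * G / \<mu>"
  have cont: "continuous_on (cball 0 \<rho>) (\<lambda>y. \<phi> (x, y))"
  proof (intro continuous_at_imp_continuous_on ballI)
    fix y show "isCont (\<lambda>y. \<phi> (x, y)) y"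
      using grad2_eq_snd_grad(1)[OF diff, of x y] unfolding gderiv_def
      by (rule has_derivative_continuous)
  qed
  have "0 \<le> \<rho>" using mu_pos by (simp add: \<rho>_def G_def)
  then have "cball 0 \<rho> \<noteq> ({} :: 'v set)" by simp
  from continuous_attains_inf[OF compact_cball this cont]
  obtain y0 where y0: "y0 \<in> cball 0 \<rho>" "\<And>y. y \<in> cball 0 \<rho> \<Longrightarrow> \<phi> (x, y0) \<le> \<phi> (x, y)" by blast
  have "\<phi> (x, y0) \<le> \<phi> (x, y)" for y
  proof (cases "y \<in> cball 0 \<rho>")
    case False
    then have n: "\<rho> \<le> norm y" by simp
    have "\<phi> (x, 0) + inner (grad2 \<phi> x 0) y + \<mu> / 2 * (norm y)\<^sup>2 \<le> \<phi> (x, y)"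
      using first_order[of x 0 y] by simp
    moreover have "- inner (grad2 \<phi> x 0) y \<le> G * norm y"
      using Cauchy_Schwarz_ineq2[of "grad2 \<phi> x 0" y] by (simp add: G_def)
    moreover have "G * norm y \<le> \<mu> / 2 * (norm y)\<^sup>2"
    proof -
      have "G \<le> \<mu> / 2 * norm y" using n mu_pos by (simp add: \<rho>_def field_simps)
      then have "G * norm y \<le> (\<mu> / 2 * norm y) * norm y" by (intro mult_right_mono) auto
      then show ?thesis by (simp add: power2_eq_square)
    qed
    ultimately have "\<phi> (x, 0) \<le> \<phi> (x, y)" by linarith
    moreover have "\<phi> (x, y0) \<le> \<phi> (x, 0)" using y0(2)[of 0] \<open>0 \<le> \<rho>\<close> by simp
    ultimately show ?thesis by simp
  qed (use y0 in auto)
  then have "is_arg_min (\<lambda>y. \<phi> (x, y)) (\<lambda>_. True) y0" by (simp add: is_arg_min_linorder)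
  then show ?thesis unfolding Ystar_def arg_min_def by (rule someI)
qed

lemma grad2_Ystar: "grad2 \<phi> x (Ystar \<phi> x) = 0"
proof -
  let ?y = "Ystar \<phi> x"
  have "((\<lambda>y. \<phi> (x, y)) has_derivative (\<lambda>h. inner h (grad2 \<phi> x ?y))) (at ?y)"
    using grad2_eq_snd_grad[OF diff, of x ?y] unfolding gderiv_def by metis
  moreover have "\<forall>y\<in>UNIV. \<phi> (x, ?y) \<le> \<phi> (x, y)"
    using is_arg_min_Ystar[of x] by (simp add: is_arg_min_linorder)
  ultimately have "(\<lambda>h. inner h (grad2 \<phi> x ?y)) = (\<lambda>h. 0)"
    using differential_zero_maxmin[of ?y UNIV "\<lambda>y. \<phi> (x, y)"] by auto
  then have "inner (grad2 \<phi> x ?y) (grad2 \<phi> x ?y) = 0" by (simp add: fun_eq_iff)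
  then show ?thesis by simp
qed

lemma norm_grad2_le_Ystar: "norm (grad2 \<phi> x y) \<le> L * norm (y - Ystar \<phi> x)"
  using norm_grad2_diff[of x y "Ystar \<phi> x"] by (simp add: grad2_Ystar)

text \<open>\<open>Zstar\<close> is built with \<open>inv_into\<close>, which inverts only on the
  range. Coercivity makes the Hessian injective, hence surjective in finite dimension, and the
  defining equation of \<open>Zstar\<close> can then be tested with \<open>Zstar\<close>
  itself.\<close>

lemma norm_Zstar_le:
  "\<mu> * norm (Zstar f \<phi> x) \<le> norm (grad2 f x (Ystar \<phi> x))"
proof -
  let ?A = "hess22 \<phi> x (Ystar \<phi> x)" and ?b = "grad2 f x (Ystar \<phi> x)" and ?z = "Zstar f \<phi> x"
  have "inj ?A"
  proof (rule linear_injective_0[OF linear_hess22, THEN iffD2], safe)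
    fix v assume "?A v = 0"
    then have "\<mu> * (norm v)\<^sup>2 \<le> 0" using hess22_coercive[of v x "Ystar \<phi> x"] by simp
    then have "(norm v)\<^sup>2 \<le> 0" using mu_pos by (simp add: mult_le_0_iff)
    then show "v = 0" by simp
  qed
  then have "surj ?A" using linear_injective_imp_surjective[OF linear_hess22] by blast
  then have z: "?A ?z = ?b" unfolding Zstar_def by (simp add: surj_f_inv_f)
  have "\<mu> * (norm ?z)\<^sup>2 \<le> inner ?b ?z" using hess22_coercive[of ?z x "Ystar \<phi> x"] z by simp
  also have "\<dots> \<le> norm ?b * norm ?z" by (rule norm_cauchy_schwarz)
  finally have "(\<mu> * norm ?z) * norm ?z \<le> norm ?b * norm ?z" by (simp add: power2_eq_square mult.assoc)
  then show ?thesis by (cases "norm ?z = 0") (auto simp: mult_le_cancel_right)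
qed

end

section \<open>Layered matrix spaces\<close>

text \<open>Stated for abstract block sizes, since the full space and the compressed space are both
  instances.\<close>

locale matrix_unit_basis =
  fixes p q :: "'l::finite \<Rightarrow> nat" and E :: "'l \<Rightarrow> nat \<Rightarrow> nat \<Rightarrow> 'v::euclidean_space"
  assumes units: "matrix_units p q E"
begin

lemma unit_Basis: "i < p l \<Longrightarrow> j < q l \<Longrightarrow> E l i j \<in> Basis"
  using bij_betw_apply[OF units[unfolded matrix_units_def], of "(l, i, j)"] by simp

lemma inner_unit:
  assumes "i < p l" "j < q l" "i' < p l'" "j' < q l'"
  shows "inner (E l i j) (E l' i' j') = of_bool (l = l' \<and> i = i' \<and> j = j')"
proof -
  have "E l i j = E l' i' j' \<longleftrightarrow> (l, i, j) = (l', i', j')"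
    using inj_on_eq_iff[OF bij_betw_imp_inj_on[OF units[unfolded matrix_units_def]], of "(l, i, j)" "(l', i', j')"]
      assms by simp
  then show ?thesis using inner_Basis[OF unit_Basis[OF assms(1,2)] unit_Basis[OF assms(3,4)]] by auto
qed

lemma sum_Basis_units: "(\<Sum>b\<in>Basis. F b) = (\<Sum>l\<in>UNIV. \<Sum>i<p l. \<Sum>j<q l. F (E l i j))"
proof -
  have "(\<Sum>b\<in>Basis. F b) = (\<Sum>(l, i, j)\<in>(SIGMA l:UNIV. {..<p l} \<times> {..<q l}). F (E l i j))"
    using sum.reindex_bij_betw[OF units[unfolded matrix_units_def], of F] by (simp add: case_prod_unfold)
  also have "\<dots> = (\<Sum>l\<in>UNIV. \<Sum>(i, j)\<in>{..<p l} \<times> {..<q l}. F (E l i j))"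
    by (subst sum.Sigma) auto
  finally show ?thesis by (simp add: sum.cartesian_product)
qed

lemma Basis_unitE:
  assumes "b \<in> Basis"
  obtains l i j where "i < p l" "j < q l" "b = E l i j"
proof -
  have "b \<in> (\<lambda>(l, i, j). E l i j) ` (SIGMA l:UNIV. {..<p l} \<times> {..<q l})"
    using assms units[unfolded matrix_units_def] by (simp add: bij_betw_def)
  then show ?thesis using that by auto
qed

lemma representation: "V = (\<Sum>l\<in>UNIV. \<Sum>i<p l. \<Sum>j<q l. inner V (E l i j) *\<^sub>R E l i j)"
  using sum_Basis_units[of "\<lambda>b. inner V b *\<^sub>R b"] by (simp add: euclidean_representation)

lemma inner_units: "inner V W = (\<Sum>l\<in>UNIV. \<Sum>i<p l. \<Sum>j<q l. inner V (E l i j) * inner W (E l i j))"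
  using sum_Basis_units[of "\<lambda>b. inner V b * inner W b"] by (simp add: euclidean_inner[of V W])

lemma norm2_units: "(norm V)\<^sup>2 = (\<Sum>l\<in>UNIV. \<Sum>i<p l. \<Sum>j<q l. (inner V (E l i j))\<^sup>2)"
  unfolding power2_norm_eq_inner by (subst inner_units) (simp add: power2_eq_square)

lemma abs_inner_unit_le: "i < p l \<Longrightarrow> j < q l \<Longrightarrow> \<bar>inner V (E l i j)\<bar> \<le> norm V"
  by (rule Basis_le_norm[OF unit_Basis])

lemma units_eqI:
  assumes "\<And>l i j. i < p l \<Longrightarrow> j < q l \<Longrightarrow> inner V (E l i j) = inner W (E l i j)"
  shows "V = W"
  by (rule euclidean_eqI) (metis Basis_unitE assms)

text \<open>The ranges of the inner indices depend on the layer, so the Kronecker deltas are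
  resolved from the innermost sum outwards; for a wrong layer the summand vanishes whatever its
  range is.\<close>

lemma sum_delta_units:
  fixes G :: "'l \<Rightarrow> nat \<Rightarrow> nat \<Rightarrow> real"
  assumes "i < p l" "j < q l"
  shows "(\<Sum>l'\<in>UNIV. \<Sum>i'<p l'. \<Sum>j'<q l'. G l' i' j' * of_bool (l' = l \<and> i' = i \<and> j' = j)) = G l i j"
proof -
  have s: "(\<Sum>j'<q l'. G l' i' j' * of_bool (l' = l \<and> i' = i \<and> j' = j))
      = (if i' = i then (if l' = l then G l i j else 0) else 0)" for l' i'
  proof (cases "l' = l \<and> i' = i")
    case True
    then have "(\<Sum>j'<q l'. G l' i' j' * of_bool (l' = l \<and> i' = i \<and> j' = j)) = (\<Sum>j'<q l. if j' = j then G l i j else 0)"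
      by (intro sum.cong) auto
    then show ?thesis using True assms by simp
  qed auto
  have "(\<Sum>i'<p l'. if i' = i then (if l' = l then G l i j else 0) else 0) = (if l' = l then G l i j else 0)" for l'
    using assms by (cases "l' = l") auto
  then show ?thesis by (simp add: s)
qed

lemma inner_assemble:
  assumes "i < p l" "j < q l"
  shows "inner (assemble p q E N) (E l i j) = N l $$ (i, j)"
proof -
  have "inner (assemble p q E N) (E l i j)
      = (\<Sum>l'\<in>UNIV. \<Sum>i'<p l'. \<Sum>j'<q l'. N l' $$ (i', j') * inner (E l' i' j') (E l i j))"
    by (simp add: assemble_def inner_sum_left)
  also have "\<dots> = (\<Sum>l'\<in>UNIV. \<Sum>i'<p l'. \<Sum>j'<q l'. N l' $$ (i', j') * of_bool (l' = l \<and> i' = i \<and> j' = j))"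
    using assms by (intro sum.cong refl) (simp add: inner_unit)
  also have "\<dots> = N l $$ (i, j)" by (rule sum_delta_units[OF assms])
  finally show ?thesis .
qed

lemma block_index: "i < p l \<Longrightarrow> j < q l \<Longrightarrow> block p q E V l $$ (i, j) = inner V (E l i j)"
  by (simp add: block_def)

lemma block_carrier: "block p q E V l \<in> carrier_mat (p l) (q l)"
  by (simp add: block_def)

end

section \<open>Lifting and compressing tuples of blocks\<close>

lemma mult_mat_index:
  fixes A B :: "real Matrix.mat"
  assumes "A \<in> carrier_mat m n" "B \<in> carrier_mat n k" "i < m" "j < k"
  shows "(A * B) $$ (i, j) = (\<Sum>a<n. A $$ (i, a) * B $$ (a, j))"
  using assms by (simp add: scalar_prod_def lessThan_atLeast0)

lemma mult_mat_vec_index: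
  fixes A :: "real Matrix.mat"
  assumes "A \<in> carrier_mat m n" "v \<in> carrier_vec n" "i < m"
  shows "vec_index (A *\<^sub>v v) i = (\<Sum>a<n. A $$ (i, a) * vec_index v a)"
  using assms by (simp add: scalar_prod_def lessThan_atLeast0)

locale layered =
  fixes \<Lambda> :: "('l::finite, 'y::euclidean_space, 'b::euclidean_space) layout"
  assumes valid: "valid_layout \<Lambda>"
begin

abbreviation "m \<equiv> nrow \<Lambda>"
abbreviation "n \<equiv> ncol \<Lambda>"
abbreviation "r \<equiv> rnk \<Lambda>"
abbreviation "EY \<equiv> unitY \<Lambda>"
abbreviation "EB \<equiv> unitB \<Lambda>"

sublocale Y: matrix_unit_basis m n EY
  using valid by unfold_locales (simp add: valid_layout_def)

sublocale B: matrix_unit_basis r n EB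
  using valid by unfold_locales (simp add: valid_layout_def)

lemma sizes: "1 \<le> n l" "2 \<le> r l" "r l \<le> m l" "2 \<le> m l" "0 < r l" "0 < m l" "0 < n l"
proof -
  have "1 \<le> n l \<and> 2 \<le> r l \<and> r l \<le> m l" using valid by (simp add: valid_layout_def)
  then show "1 \<le> n l" "2 \<le> r l" "r l \<le> m l" "2 \<le> m l" "0 < r l" "0 < m l" "0 < n l" by linarith+
qed

definition shaped :: "('l \<Rightarrow> real Matrix.mat) \<Rightarrow> bool" where
  "shaped P \<longleftrightarrow> (\<forall>l. P l \<in> carrier_mat (m l) (r l))"

text \<open>The Gram matrix of the rows of \<open>P l\<close>, which is the matrix \<open>S\<close>
  of the overview.\<close>

definition gram :: "('l \<Rightarrow> real Matrix.mat) \<Rightarrow> 'l \<Rightarrow> nat \<Rightarrow> nat \<Rightarrow> real" where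
  "gram P l i j = (\<Sum>a<r l. P l $$ (i, a) * P l $$ (j, a))"

text \<open>\<open>P\<^sup>T P = (m / r) I\<close> in every layer. This deterministic consequence of
  the Haar law is all that the norm estimates need.\<close>

definition frame :: "('l \<Rightarrow> real Matrix.mat) \<Rightarrow> bool" where
  "frame P \<longleftrightarrow> shaped P \<and> (\<forall>l. \<forall>a<r l. \<forall>b<r l.
     (\<Sum>i<m l. P l $$ (i, a) * P l $$ (i, b)) = real (m l) / real (r l) * of_bool (a = b))"

text \<open>One number that is at least 1 and dominates all layer sizes, all ranks and all ratios
  \<open>m / r\<close>. The estimates trade sharpness for a single constant.\<close>

definition \<kappa> :: real where "\<kappa> = real (\<Sum>l\<in>UNIV. m l)"

lemma inner_tupleB: "a < r l \<Longrightarrow> j < n l \<Longrightarrow> inner (tupleB \<Lambda> N) (EB l a j) = N l $$ (a, j)"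
  unfolding tupleB_def by (rule B.inner_assemble)

lemma inner_tupleY: "i < m l \<Longrightarrow> j < n l \<Longrightarrow> inner (tupleY \<Lambda> N) (EY l i j) = N l $$ (i, j)"
  unfolding tupleY_def by (rule Y.inner_assemble)

lemma blockB_index: "a < r l \<Longrightarrow> j < n l \<Longrightarrow> blockB \<Lambda> V l $$ (a, j) = inner V (EB l a j)"
  and blockY_index: "i < m l \<Longrightarrow> j < n l \<Longrightarrow> blockY \<Lambda> U l $$ (i, j) = inner U (EY l i j)"
  and blockB_carrier: "blockB \<Lambda> V l \<in> carrier_mat (r l) (n l)"
  and blockY_carrier: "blockY \<Lambda> U l \<in> carrier_mat (m l) (n l)"
  by (simp_all add: blockB_def blockY_def B.block_index Y.block_index B.block_carrier Y.block_carrier)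

lemma inner_lift:
  assumes "shaped P" "i < m l" "j < n l"
  shows "inner (lift \<Lambda> P V) (EY l i j) = (\<Sum>a<r l. P l $$ (i, a) * inner V (EB l a j))"
proof -
  have "P l \<in> carrier_mat (m l) (r l)" using assms by (simp add: shaped_def)
  then have "(P l * blockB \<Lambda> V l) $$ (i, j) = (\<Sum>a<r l. P l $$ (i, a) * inner V (EB l a j))"
    using assms by (simp add: mult_mat_index[OF _ blockB_carrier] blockB_index)
  then show ?thesis using assms by (simp add: lift_def inner_tupleY)
qed

lemma inner_colift:
  assumes "shaped P" "a < r l" "j < n l"
  shows "inner (colift \<Lambda> P U) (EB l a j) = (\<Sum>i<m l. P l $$ (i, a) * inner U (EY l i j))"
proof -
  have c: "P l \<in> carrier_mat (m l) (r l)" using assms by (simp add: shaped_def)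
  then have "((P l)\<^sup>T * blockY \<Lambda> U l) $$ (a, j) = (\<Sum>i<m l. P l $$ (i, a) * inner U (EY l i j))"
    using assms by (simp add: mult_mat_index[OF _ blockY_carrier] blockY_index)
  then show ?thesis using assms by (simp add: colift_def inner_tupleB)
qed

lemma inner_lift_colift:
  assumes "shaped P"
  shows "inner (lift \<Lambda> P V) U = inner V (colift \<Lambda> P U)"
proof -
  have "inner (lift \<Lambda> P V) U
      = (\<Sum>l\<in>UNIV. \<Sum>i<m l. \<Sum>j<n l. \<Sum>a<r l. P l $$ (i, a) * inner V (EB l a j) * inner U (EY l i j))"
    by (simp add: Y.inner_units[of "lift \<Lambda> P V" U] inner_lift[OF assms] sum_distrib_right)
  also have "\<dots> = (\<Sum>l\<in>UNIV. \<Sum>a<r l. \<Sum>j<n l. \<Sum>i<m l. P l $$ (i, a) * inner V (EB l a j) * inner U (EY l i j))"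
  proof (rule sum.cong[OF refl])
    fix l
    have "(\<Sum>i<m l. \<Sum>j<n l. \<Sum>a<r l. P l $$ (i, a) * inner V (EB l a j) * inner U (EY l i j))
        = (\<Sum>i<m l. \<Sum>a<r l. \<Sum>j<n l. P l $$ (i, a) * inner V (EB l a j) * inner U (EY l i j))"
      by (intro sum.cong refl sum.swap)
    also have "\<dots> = (\<Sum>a<r l. \<Sum>i<m l. \<Sum>j<n l. P l $$ (i, a) * inner V (EB l a j) * inner U (EY l i j))"
      by (rule sum.swap)
    also have "\<dots> = (\<Sum>a<r l. \<Sum>j<n l. \<Sum>i<m l. P l $$ (i, a) * inner V (EB l a j) * inner U (EY l i j))"
      by (intro sum.cong refl sum.swap)
    finally show "(\<Sum>i<m l. \<Sum>j<n l. \<Sum>a<r l. P l $$ (i, a) * inner V (EB l a j) * inner U (EY l i j))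
        = (\<Sum>a<r l. \<Sum>j<n l. \<Sum>i<m l. P l $$ (i, a) * inner V (EB l a j) * inner U (EY l i j))" .
  qed
  also have "\<dots> = inner V (colift \<Lambda> P U)"
    by (simp add: B.inner_units[of V "colift \<Lambda> P U"] inner_colift[OF assms] sum_distrib_left mult_ac)
  finally show ?thesis .
qed

lemma linear_lift:
  assumes "shaped P" shows "linear (lift \<Lambda> P)"
  by (rule linearI; rule Y.units_eqI)
    (simp_all add: inner_lift[OF assms] inner_add_left sum.distrib distrib_left sum_distrib_left mult_ac)

lemma adjoint_lift:
  assumes "shaped P" shows "adjoint (lift \<Lambda> P) = colift \<Lambda> P"
  by (rule adjoint_unique) (simp add: inner_lift_colift[OF assms])

text \<open>Here \<open>S\<close> enters: compressing and lifting back multiplies each block by its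
  own \<open>gram\<close>.\<close>

lemma lift_colift_unit:
  assumes "shaped P" "i < m l" "j < n l"
  shows "(\<Sum>a<r l. P l $$ (i, a) * inner (colift \<Lambda> P U) (EB l a j))
    = (\<Sum>k<m l. gram P l i k * inner U (EY l k j))"
proof -
  have "(\<Sum>a<r l. P l $$ (i, a) * inner (colift \<Lambda> P U) (EB l a j))
      = (\<Sum>a<r l. \<Sum>k<m l. P l $$ (i, a) * P l $$ (k, a) * inner U (EY l k j))"
    using assms by (simp add: inner_colift sum_distrib_left mult.assoc)
  also have "\<dots> = (\<Sum>k<m l. \<Sum>a<r l. P l $$ (i, a) * P l $$ (k, a) * inner U (EY l k j))"
    by (rule sum.swap)
  finally show ?thesis by (simp add: gram_def sum_distrib_right)
qed

lemma kappa_ge: "real (m l) \<le> \<kappa>" "1 \<le> \<kappa>" "0 \<le> \<kappa>" "real (m l) / real (r l) \<le> \<kappa>"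
proof -
  show 1: "real (m l) \<le> \<kappa>" for l unfolding \<kappa>_def of_nat_sum by (rule member_le_sum) auto
  have s: "1 \<le> real (m l)" "1 \<le> real (r l)" using sizes[of l] by linarith+
  then show "1 \<le> \<kappa>" "0 \<le> \<kappa>" using 1[of l] by linarith+
  have "real (m l) / real (r l) \<le> real (m l) / 1" using s by (intro divide_left_mono) auto
  then show "real (m l) / real (r l) \<le> \<kappa>" using 1[of l] by simp
qed

lemma frame_shaped: "frame P \<Longrightarrow> shaped P"
  by (simp add: frame_def)

lemma frame_entry_le:
  assumes "frame P" "i < m l" "a < r l"
  shows "\<bar>P l $$ (i, a)\<bar> \<le> \<kappa>"
proof -
  have "(P l $$ (i, a))\<^sup>2 \<le> (\<Sum>i<m l. P l $$ (i, a) * P l $$ (i, a))"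
    using member_le_sum[of i "{..<m l}" "\<lambda>i. P l $$ (i, a) * P l $$ (i, a)"] assms
    by (simp add: power2_eq_square)
  also have "\<dots> = real (m l) / real (r l)" using assms by (simp add: frame_def)
  also have "\<dots> \<le> \<kappa>" by (rule kappa_ge)
  \<comment> \<open>Enlarging \<kappa> to its square is allowed as \<kappa> is at least 1, and it
    avoids square roots in all later bounds.\<close>
  also have "\<dots> \<le> \<kappa>\<^sup>2" using kappa_ge(2) by (simp add: power2_eq_square)
  finally show ?thesis using kappa_ge(3) by (simp add: abs_le_square_iff[symmetric])
qed

lemma frame_gram_le:
  assumes "frame P" "i < m l" "j < m l"
  shows "\<bar>gram P l i j\<bar> \<le> real (r l) * \<kappa>\<^sup>2"
proof -
  have "\<bar>gram P l i j\<bar> \<le> (\<Sum>a<r l. \<bar>P l $$ (i, a)\<bar> * \<bar>P l $$ (j, a)\<bar>)"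
    unfolding gram_def by (rule order_trans[OF sum_abs]) (simp add: abs_mult)
  also have "\<dots> \<le> (\<Sum>a<r l. \<kappa> * \<kappa>)"
    using assms kappa_ge(3) by (intro sum_mono mult_mono frame_entry_le) auto
  finally show ?thesis by (simp add: power2_eq_square)
qed

text \<open>By \<open>frame\<close>, each column of block \<open>l\<close> is stretched exactly by
  the square root of \<open>m / r\<close>: expanding the square, only the diagonal pairs of columns
  of \<open>P l\<close> survive.\<close>

lemma norm_lift_le:
  assumes "frame P"
  shows "norm (lift \<Lambda> P V) \<le> \<kappa> * norm V"
proof -
  note sh = frame_shaped[OF assms]
  have "(norm (lift \<Lambda> P V))\<^sup>2 = (\<Sum>l\<in>UNIV. \<Sum>j<n l. \<Sum>i<m l. (\<Sum>a<r l. P l $$ (i, a) * inner V (EB l a j))\<^sup>2)"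
    unfolding Y.norm2_units by (intro sum.cong refl trans[OF sum.swap]) (simp add: inner_lift[OF sh])
  also have "\<dots> = (\<Sum>l\<in>UNIV. \<Sum>j<n l. real (m l) / real (r l) * (\<Sum>a<r l. (inner V (EB l a j))\<^sup>2))"
  proof (intro sum.cong refl)
    fix l j
    let ?v = "\<lambda>a. inner V (EB l a j)"
    have "(\<Sum>i<m l. (\<Sum>a<r l. P l $$ (i, a) * ?v a)\<^sup>2)
        = (\<Sum>i<m l. \<Sum>a<r l. \<Sum>b<r l. P l $$ (i, a) * P l $$ (i, b) * (?v a * ?v b))"
      by (simp add: power2_eq_square sum_product mult_ac)
    also have "\<dots> = (\<Sum>a<r l. \<Sum>i<m l. \<Sum>b<r l. P l $$ (i, a) * P l $$ (i, b) * (?v a * ?v b))"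
      by (rule sum.swap)
    also have "\<dots> = (\<Sum>a<r l. \<Sum>b<r l. \<Sum>i<m l. P l $$ (i, a) * P l $$ (i, b) * (?v a * ?v b))"
      by (intro sum.cong refl sum.swap)
    also have "\<dots> = (\<Sum>a<r l. \<Sum>b<r l. (real (m l) / real (r l) * of_bool (a = b)) * (?v a * ?v b))"
      using assms by (intro sum.cong refl) (simp add: sum_distrib_right[symmetric] frame_def)
    also have "\<dots> = (\<Sum>a<r l. real (m l) / real (r l) * (?v a)\<^sup>2)"
      by (intro sum.cong refl) (simp add: of_bool_def if_distrib if_distribR power2_eq_square cong: if_cong)
    finally show "(\<Sum>i<m l. (\<Sum>a<r l. P l $$ (i, a) * ?v a)\<^sup>2) = real (m l) / real (r l) * (\<Sum>a<r l. (?v a)\<^sup>2)"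
      by (simp add: sum_distrib_left)
  qed
  also have "\<dots> \<le> (\<Sum>l\<in>UNIV. \<Sum>j<n l. \<kappa> * (\<Sum>a<r l. (inner V (EB l a j))\<^sup>2))"
    by (intro sum_mono mult_right_mono kappa_ge) (simp add: sum_nonneg)
  also have "\<dots> = \<kappa> * (norm V)\<^sup>2"
    unfolding B.norm2_units sum_distrib_left by (intro sum.cong refl sum.swap)
  also have "\<dots> \<le> (\<kappa> * norm V)\<^sup>2"
    using kappa_ge(2) mult_right_mono[of \<kappa> "\<kappa>\<^sup>2" "(norm V)\<^sup>2"]
    by (simp add: power_mult_distrib) (simp add: power2_eq_square)
  finally show ?thesis using kappa_ge(3) by (simp add: power2_le_iff_abs_le)
qed

text \<open>An adjoint inherits the norm bound of the map.\<close>

lemma norm_colift_le: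
  assumes "frame P"
  shows "norm (colift \<Lambda> P U) \<le> \<kappa> * norm U"
proof -
  let ?c = "colift \<Lambda> P U"
  have "norm ?c * norm ?c = inner ?c ?c" by (simp add: power2_norm_eq_inner[symmetric] power2_eq_square)
  also have "\<dots> = inner (lift \<Lambda> P ?c) U" by (simp add: inner_lift_colift[OF frame_shaped[OF assms]])
  also have "\<dots> \<le> norm (lift \<Lambda> P ?c) * norm U" by (rule norm_cauchy_schwarz)
  also have "\<dots> \<le> (\<kappa> * norm ?c) * norm U" by (intro mult_right_mono norm_lift_le assms) simp
  finally have "norm ?c * norm ?c \<le> norm ?c * (\<kappa> * norm U)" by (simp add: mult_ac)
  then show ?thesis using kappa_ge(3) by (cases "norm ?c = 0") (auto simp: mult_le_cancel_left)
qed

lemma inner_single_block: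
  assumes "a < r l" "j < n l"
  shows "inner (single_block \<Lambda> t W) (EB l a j) = (if l = t then W $$ (a, j) else 0)"
  using assms by (simp add: single_block_def inner_tupleB)

lemma inner_single_block_colift:
  assumes "shaped P" "a < r l" "j < n l"
  shows "inner (single_block \<Lambda> t ((P t)\<^sup>T * blockY \<Lambda> U t)) (EB l a j)
    = (if l = t then inner (colift \<Lambda> P U) (EB l a j) else 0)"
  using assms by (cases "l = t") (simp_all add: inner_single_block colift_def inner_tupleB)

lemma norm_single_block_colift_le:
  assumes "frame P"
  shows "norm (single_block \<Lambda> t ((P t)\<^sup>T * blockY \<Lambda> U t)) \<le> \<kappa> * norm U"
proof -
  have "(norm (single_block \<Lambda> t ((P t)\<^sup>T * blockY \<Lambda> U t)))\<^sup>2 \<le> (norm (colift \<Lambda> P U))\<^sup>2"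
    unfolding B.norm2_units
    by (intro sum_mono) (simp add: inner_single_block_colift[OF frame_shaped[OF assms]])
  then have "norm (single_block \<Lambda> t ((P t)\<^sup>T * blockY \<Lambda> U t)) \<le> norm (colift \<Lambda> P U)"
    by (simp add: power2_le_iff_abs_le)
  then show ?thesis using norm_colift_le[OF assms, of U] by simp
qed

lemma inner_lift_single_block:
  assumes "shaped P" "i < m l" "j < n l"
  shows "inner (lift \<Lambda> P (single_block \<Lambda> t ((P t)\<^sup>T * blockY \<Lambda> U t))) (EY l i j)
    = (if l = t then (\<Sum>k<m t. gram P t i k * inner U (EY t k j)) else 0)"
  using assms lift_colift_unit[of P i l j U]
  by (cases "l = t") (simp_all add: inner_lift inner_single_block_colift)

text \<open>Used with \<open>h\<close> a Hessian of \<open>g\<close>: it separates the projector,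
  which appears only through \<open>gram\<close>, from the matrix entries of \<open>h\<close> and
  the coordinates of \<open>U\<close>, which belong to the past.\<close>

lemma linear_lift_single_block:
  assumes "linear h" "shaped P"
  shows "inner (h (lift \<Lambda> P (single_block \<Lambda> t ((P t)\<^sup>T * blockY \<Lambda> U t)))) e
    = (\<Sum>k<m t. \<Sum>j<n t. \<Sum>k'<m t. gram P t k k' * (inner (h (EY t k j)) e * inner U (EY t k' j)))"
proof -
  let ?w = "single_block \<Lambda> t ((P t)\<^sup>T * blockY \<Lambda> U t)"
  have "lift \<Lambda> P ?w = (\<Sum>l\<in>UNIV. \<Sum>k<m l. \<Sum>j<n l. inner (lift \<Lambda> P ?w) (EY l k j) *\<^sub>R EY l k j)"
    by (rule Y.representation)
  also have "\<dots> = (\<Sum>l\<in>UNIV. if l = t then (\<Sum>k<m t. \<Sum>j<n t. (\<Sum>k'<m t. gram P t k k' * inner U (EY t k' j)) *\<^sub>R EY t k j) else 0)"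
    by (intro sum.cong refl) (auto simp: inner_lift_single_block[OF assms(2)])
  also have "\<dots> = (\<Sum>k<m t. \<Sum>j<n t. (\<Sum>k'<m t. gram P t k k' * inner U (EY t k' j)) *\<^sub>R EY t k j)" by simp
  finally have "h (lift \<Lambda> P ?w) = (\<Sum>k<m t. \<Sum>j<n t. (\<Sum>k'<m t. gram P t k k' * inner U (EY t k' j)) *\<^sub>R h (EY t k j))"
    using assms(1) by (simp add: linear_sum linear_scale)
  then show ?thesis by (simp add: inner_sum_left sum_distrib_left sum_distrib_right mult_ac)
qed

text \<open>The lifted matrix unit is column \<open>a\<close> of the projector, placed in column
  \<open>j\<close> of block \<open>t\<close>.\<close>

lemma lift_unitB:
  assumes "shaped P" "a < r t" "j < n t"
  shows "lift \<Lambda> P (EB t a j) = (\<Sum>i<m t. P t $$ (i, a) *\<^sub>R EY t i j)"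
proof (rule Y.units_eqI)
  fix l i k assume A: "i < m l" "k < n l"
  have "inner (lift \<Lambda> P (EB t a j)) (EY l i k) = (\<Sum>a'<r l. P l $$ (i, a') * of_bool (t = l \<and> a = a' \<and> j = k))"
    using assms A unfolding inner_lift[OF assms(1) A]
    by (intro sum.cong refl) (simp add: B.inner_unit)
  also have "\<dots> = of_bool (t = l \<and> j = k) * (\<Sum>a'<r l. if a' = a then P l $$ (i, a) else 0)"
    by (auto intro!: sum.cong)
  also have "\<dots> = of_bool (t = l \<and> j = k) * P t $$ (i, a)" using assms by auto
  also have "\<dots> = (\<Sum>i'<m t. P t $$ (i', a) * of_bool (t = l \<and> i' = i \<and> j = k))"
    using A by (cases "t = l \<and> j = k") (auto simp: of_bool_def if_distrib cong: if_cong)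
  also have "\<dots> = inner (\<Sum>i<m t. P t $$ (i, a) *\<^sub>R EY t i j) (EY l i k)"
    using assms A by (simp add: inner_sum_left Y.inner_unit)
  finally show "inner (lift \<Lambda> P (EB t a j)) (EY l i k) = inner (\<Sum>i<m t. P t $$ (i, a) *\<^sub>R EY t i j) (EY l i k)" .
qed

end

section \<open>Haar-distributed columns\<close>

lemma space_mat_borel [simp]: "space (mat_borel p q) = carrier_mat p q"
  by (simp add: mat_borel_def)

lemma measurable_mat_entry:
  assumes "i < p" "j < q"
  shows "(\<lambda>A. A $$ (i, j)) \<in> borel_measurable (mat_borel p q)"
proof -
  let ?f = "\<lambda>A :: real Matrix.mat. \<lambda>ij\<in>{..<p} \<times> {..<q}. A $$ ij"
  have "?f \<in> measurable (mat_borel p q) (Pi\<^sub>M ({..<p} \<times> {..<q}) (\<lambda>_. borel))"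
    unfolding mat_borel_def by (rule measurable_vimage_algebra1) (auto simp: space_PiM)
  from measurable_compose[OF this measurable_component_singleton[of "(i, j)"]]
  show ?thesis using assms by simp
qed

lemma measurable_into_mat_borel:
  assumes "\<And>x. x \<in> space M \<Longrightarrow> X x \<in> carrier_mat p q"
    and "\<And>i j. i < p \<Longrightarrow> j < q \<Longrightarrow> (\<lambda>x. X x $$ (i, j)) \<in> borel_measurable M"
  shows "X \<in> measurable M (mat_borel p q)"
  unfolding mat_borel_def
  by (rule measurable_vimage_algebra2) (use assms in \<open>auto intro!: measurable_restrict\<close>)

text \<open>The Householder matrix \<open>I - 2 w w\<^sup>T\<close> for a vector \<open>w\<close>
  supported on the coordinates \<open>s\<close> and \<open>t\<close>; it is a reflection when
  \<open>w\<close> is a unit vector. With two nonzero coordinates at most, its effect on a row is an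
  explicit combination of two rows.\<close>

definition reflection :: "nat \<Rightarrow> nat \<Rightarrow> nat \<Rightarrow> real \<Rightarrow> real \<Rightarrow> real Matrix.mat" where
  "reflection p s t x y = (let w = (\<lambda>i. if i = s then x else if i = t then y else 0) in
     Matrix.mat p p (\<lambda>(i, j). of_bool (i = j) - 2 * w i * w j))"

lemma sum_two:
  fixes c :: "nat \<Rightarrow> real"
  assumes "s \<noteq> t" "s < p" "t < p"
  shows "(\<Sum>k<p. (if k = s then x else if k = t then y else 0) * c k) = x * c s + y * c t"
proof -
  have "(\<Sum>k<p. (if k = s then x else if k = t then y else 0) * c k)
      = (\<Sum>k<p. (if k = s then x * c s else 0) + (if k = t then y * c t else 0))"
    using assms by (intro sum.cong) auto
  then show ?thesis using assms by (simp add: sum.distrib)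
qed

lemma reflection_mult_index:
  assumes Q: "Q \<in> carrier_mat p p" and st: "s \<noteq> t" "s < p" "t < p" and ij: "i < p" "a < p"
  shows "(reflection p s t x y * Q) $$ (i, a)
    = Q $$ (i, a) - 2 * (if i = s then x else if i = t then y else 0) * (x * Q $$ (s, a) + y * Q $$ (t, a))"
proof -
  let ?w = "\<lambda>i. if i = s then x else if i = t then y else 0"
  have "(reflection p s t x y * Q) $$ (i, a) = (\<Sum>k<p. (of_bool (i = k) - 2 * ?w i * ?w k) * Q $$ (k, a))"
    using Q ij unfolding reflection_def Let_def
    by (simp add: scalar_prod_def lessThan_atLeast0 cong: if_cong)
  also have "\<dots> = (\<Sum>k<p. if k = i then Q $$ (i, a) else 0) - 2 * ?w i * (\<Sum>k<p. ?w k * Q $$ (k, a))"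
    unfolding sum_distrib_left sum_subtractf[symmetric] by (intro sum.cong) (auto simp: algebra_simps)
  also have "\<dots> = Q $$ (i, a) - 2 * ?w i * (x * Q $$ (s, a) + y * Q $$ (t, a))"
    using ij by (simp only: sum_two[OF st]) simp
  finally show ?thesis .
qed

lemma reflection_orthogonal:
  assumes st: "s \<noteq> t" "s < p" "t < p" and xy: "x\<^sup>2 + y\<^sup>2 = 1"
  shows "reflection p s t x y \<in> orthogonal_group p"
proof -
  let ?R = "reflection p s t x y" and ?w = "\<lambda>i. if i = s then x else if i = t then y else 0"
  have R: "?R \<in> carrier_mat p p" by (simp add: reflection_def Let_def)
  have sym: "?R\<^sup>T = ?R" by (rule eq_matI) (auto simp: reflection_def Let_def)
  have "?R * ?R = 1\<^sub>m p"
  proof (rule eq_matI)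
    fix i a assume "i < dim_row (1\<^sub>m p :: real Matrix.mat)" "a < dim_col (1\<^sub>m p :: real Matrix.mat)"
    then have ia: "i < p" "a < p" by auto
    have e: "?R $$ (k, a) = of_bool (k = a) - 2 * ?w k * ?w a" if "k < p" for k
      using that ia by (simp add: reflection_def Let_def)
    \<comment> \<open>In view of the symmetry of the matrix, this computation says that
      \<open>w\<close> is mapped to its negative.\<close>
    have "x * ?R $$ (s, a) + y * ?R $$ (t, a) = ?w a - 2 * ?w a * (x\<^sup>2 + y\<^sup>2)"
      using st by (simp add: e power2_eq_square algebra_simps)
    then have "x * ?R $$ (s, a) + y * ?R $$ (t, a) = - ?w a" using xy by simp
    then show "(?R * ?R) $$ (i, a) = 1\<^sub>m p $$ (i, a)"
      using ia by (simp add: reflection_mult_index[OF R st ia] e cong: if_cong)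
  qed (use R in auto)
  then show ?thesis using R sym by (simp add: orthogonal_group_def)
qed

text \<open>The entries of \<open>Q diag(1, \<dots>, 1, 0, \<dots>, 0) Q\<^sup>T\<close>, the orthogonal projection onto the span of the
  first \<open>r\<close> columns.\<close>

definition col_proj :: "nat \<Rightarrow> real Matrix.mat \<Rightarrow> nat \<Rightarrow> nat \<Rightarrow> real" where
  "col_proj r Q i j = (\<Sum>a<r. Q $$ (i, a) * Q $$ (j, a))"

text \<open>The bound \<open>2 \<le> p\<close> supplies the second coordinate that every reflection
  needs.\<close>

locale haar_columns =
  fixes p r :: nat and \<nu> :: "real Matrix.mat measure"
  assumes haar: "haar_orthogonal p \<nu>" and p2: "2 \<le> p" and rp: "r \<le> p"
begin

sublocale prob_space \<nu> using haar by (simp add: haar_orthogonal_def)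

lemma sets_nu [measurable_cong]: "sets \<nu> = sets (mat_borel p p)"
  using haar by (simp add: haar_orthogonal_def)

lemma space_nu [simp]: "space \<nu> = carrier_mat p p"
  using sets_eq_imp_space_eq[OF sets_nu] by simp

lemma measurable_entry [measurable]:
  "i < p \<Longrightarrow> j < p \<Longrightarrow> (\<lambda>Q. Q $$ (i, j)) \<in> borel_measurable \<nu>"
  using measurable_mat_entry measurable_cong_sets[OF sets_nu refl] by blast

lemma measurable_col_proj [measurable]:
  "i < p \<Longrightarrow> j < p \<Longrightarrow> (\<lambda>Q. col_proj r Q i j) \<in> borel_measurable \<nu>"
  unfolding col_proj_def using rp by (intro borel_measurable_sum borel_measurable_times measurable_entry) auto

lemma AE_columns: "AE Q in \<nu>. \<forall>a<p. \<forall>b<p. (\<Sum>i<p. Q $$ (i, a) * Q $$ (i, b)) = of_bool (a = b)"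
proof -
  have "AE Q in \<nu>. Q \<in> orthogonal_group p" using haar by (simp add: haar_orthogonal_def)
  then show ?thesis
  proof eventually_elim
    case (elim Q)
    then have Q: "Q \<in> carrier_mat p p" "Q\<^sup>T * Q = 1\<^sub>m p" by (auto simp: orthogonal_group_def)
    show ?case
    proof (intro allI impI)
      fix a b assume ab: "a < p" "b < p"
      then have "(\<Sum>i<p. Q $$ (i, a) * Q $$ (i, b)) = (Q\<^sup>T * Q) $$ (a, b)"
        using Q(1) by (simp add: scalar_prod_def lessThan_atLeast0)
      also have "\<dots> = of_bool (a = b)" unfolding Q(2) using ab by simp
      finally show "(\<Sum>i<p. Q $$ (i, a) * Q $$ (i, b)) = of_bool (a = b)" .
    qed
  qed
qed

lemma AE_entry_le: "AE Q in \<nu>. \<forall>i<p. \<forall>a<p. \<bar>Q $$ (i, a)\<bar> \<le> 1"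
  using AE_columns
proof eventually_elim
  case (elim Q)
  show ?case
  proof (intro allI impI)
    fix i a assume ia: "i < p" "a < p"
    have "(Q $$ (i, a))\<^sup>2 \<le> (\<Sum>i<p. Q $$ (i, a) * Q $$ (i, a))"
      using member_le_sum[of i "{..<p}" "\<lambda>i. Q $$ (i, a) * Q $$ (i, a)"] ia
      by (simp add: power2_eq_square)
    also have "\<dots> = 1" using elim ia by simp
    finally show "\<bar>Q $$ (i, a)\<bar> \<le> 1" by (simp add: abs_square_le_1)
  qed
qed

lemma AE_col_proj_le: "AE Q in \<nu>. \<forall>i<p. \<forall>j<p. \<bar>col_proj r Q i j\<bar> \<le> real r"
  using AE_entry_le
proof eventually_elim
  case (elim Q)
  show ?case
  proof (intro allI impI)
    fix i j assume ij: "i < p" "j < p"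
    have "\<bar>col_proj r Q i j\<bar> \<le> (\<Sum>a<r. \<bar>Q $$ (i, a)\<bar> * \<bar>Q $$ (j, a)\<bar>)"
      unfolding col_proj_def by (rule order_trans[OF sum_abs]) (simp add: abs_mult)
    also have "\<dots> \<le> (\<Sum>a<r. 1 * 1)" using elim ij rp by (intro sum_mono mult_mono) auto
    finally show "\<bar>col_proj r Q i j\<bar> \<le> real r" by simp
  qed
qed

lemma integrable_col_proj:
  assumes "i < p" "j < p" shows "integrable \<nu> (\<lambda>Q. col_proj r Q i j)"
  by (rule integrable_const_bound[where B = "real r"])
    (use AE_col_proj_le assms in \<open>auto elim!: eventually_mono\<close>)

lemma integrable_col_proj2:
  assumes "i < p" "j < p" "k < p" "l < p"
  shows "integrable \<nu> (\<lambda>Q. col_proj r Q i j * col_proj r Q k l)"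
proof (rule integrable_const_bound[where B = "real r * real r"])
  show "AE Q in \<nu>. norm (col_proj r Q i j * col_proj r Q k l) \<le> real r * real r"
    using AE_col_proj_le
    by eventually_elim (use assms in \<open>auto simp: abs_mult intro!: mult_mono\<close>)
qed (use assms in measurable)

lemma haar_invariant:
  assumes R: "R \<in> orthogonal_group p" and [measurable]: "f \<in> borel_measurable \<nu>"
  shows "(\<integral>Q. f (R * Q) \<partial>\<nu>) = (\<integral>Q. (f Q :: real) \<partial>\<nu>)"
proof -
  have Rc: "R \<in> carrier_mat p p" using R by (simp add: orthogonal_group_def)
  have "(\<lambda>Q. R * Q) \<in> measurable \<nu> (mat_borel p p)"
  proof (rule measurable_into_mat_borel)
    fix i j assume ij: "i < p" "j < p"
    have "(\<lambda>Q. \<Sum>k<p. R $$ (i, k) * Q $$ (k, j)) \<in> borel_measurable \<nu>"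
      using ij by (intro borel_measurable_sum borel_measurable_times measurable_entry) auto
    moreover have "(R * Q) $$ (i, j) = (\<Sum>k<p. R $$ (i, k) * Q $$ (k, j))" if "Q \<in> space \<nu>" for Q
      using that ij Rc by (simp add: scalar_prod_def lessThan_atLeast0)
    ultimately show "(\<lambda>Q. (R * Q) $$ (i, j)) \<in> borel_measurable \<nu>"
      by (subst measurable_cong[where g = "\<lambda>Q. \<Sum>k<p. R $$ (i, k) * Q $$ (k, j)"]) auto
  qed (use Rc in auto)
  then have [measurable]: "(\<lambda>Q. R * Q) \<in> measurable \<nu> \<nu>"
    using measurable_cong_sets[OF refl sets_nu] by blast
  have "(\<integral>Q. f Q \<partial>\<nu>) = (\<integral>Q. f Q \<partial>(distr \<nu> \<nu> (\<lambda>Q. R * Q)))"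
    using haar R by (simp add: haar_orthogonal_def)
  also have "\<dots> = (\<integral>Q. f (R * Q) \<partial>\<nu>)" by (rule integral_distr) auto
  finally show ?thesis by simp
qed

text \<open>For \<open>w\<close> the unit vector \<open>s\<close> the reflection negates row
  \<open>s\<close>; the coordinate \<open>t\<close> has weight 0.\<close>

lemma sign_reflection:
  assumes "Q \<in> carrier_mat p p" "s < p" "s \<noteq> t" "t < p" "i < p" "j < p"
  shows "col_proj r (reflection p s t 1 0 * Q) i j
    = (if i = s then -1 else 1) * (if j = s then -1 else 1) * col_proj r Q i j"
proof -
  have "(reflection p s t 1 0 * Q) $$ (i, a) = (if i = s then -1 else 1) * Q $$ (i, a)" if "i < p" "a < r" for i a
    using assms that rp by (simp add: reflection_mult_index)
  then show ?thesis using assms by (simp add: col_proj_def sum_distrib_left mult_ac cong: if_cong)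
qed

text \<open>For \<open>w\<close> the normalised difference of two unit vectors, the reflection
  exchanges the two rows.\<close>

lemma swap_reflection:
  assumes "Q \<in> carrier_mat p p" "s < p" "s \<noteq> t" "t < p" "i < p" "j < p"
  shows "col_proj r (reflection p s t (1 / sqrt 2) (- 1 / sqrt 2) * Q) i j
    = col_proj r Q (Transposition.transpose s t i) (Transposition.transpose s t j)"
proof -
  have sq: "sqrt 2 * (sqrt 2 * z) = 2 * z" for z by (simp add: mult.assoc[symmetric])
  have "(reflection p s t (1 / sqrt 2) (- 1 / sqrt 2) * Q) $$ (i, a) = Q $$ (Transposition.transpose s t i, a)"
    if "i < p" "a < r" for i a
    using assms that rp by (simp add: reflection_mult_index Transposition.transpose_def field_simps sq)
  then show ?thesis using assms by (simp add: col_proj_def)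
qed

text \<open>A reflection that is not a signed permutation. With \<open>w\<close> proportional to (1,
  2), row \<open>s\<close> becomes (3, -4) / 5 in the rows \<open>s\<close> and \<open>t\<close>, so
  all coefficients are rational.\<close>

lemma pythagorean_reflection:
  assumes "Q \<in> carrier_mat p p" "s < p" "s \<noteq> t" "t < p"
  shows "col_proj r (reflection p s t (1 / sqrt 5) (2 / sqrt 5) * Q) s s
    = (9 * col_proj r Q s s - 24 * col_proj r Q s t + 16 * col_proj r Q t t) / 25"
proof -
  have e: "(reflection p s t (1 / sqrt 5) (2 / sqrt 5) * Q) $$ (s, a) = (3 * Q $$ (s, a) - 4 * Q $$ (t, a)) / 5"
    if "a < r" for a
    using assms that rp by (simp add: reflection_mult_index field_simps)
  then have "col_proj r (reflection p s t (1 / sqrt 5) (2 / sqrt 5) * Q) s s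
      = (\<Sum>a<r. (9 * (Q $$ (s, a) * Q $$ (s, a)) - 24 * (Q $$ (s, a) * Q $$ (t, a)) + 16 * (Q $$ (t, a) * Q $$ (t, a))) / 25)"
    unfolding col_proj_def by (intro sum.cong refl) (simp add: e, simp add: field_simps)
  then show ?thesis
    by (simp add: col_proj_def sum_distrib_left sum.distrib sum_subtractf sum_divide_distrib[symmetric])
qed

section \<open>First and second moments of a uniformly random projection\<close>

abbreviation "EE f \<equiv> integral\<^sup>L \<nu> f"

lemma ex_other: "s < p \<Longrightarrow> \<exists>t<p. s \<noteq> t"
  using p2 by (intro exI[of _ "if s = 0 then 1 else 0"]) auto

lemma first_moment_sign:
  assumes "i < p" "j < p" "i \<noteq> j"
  shows "EE (\<lambda>Q. col_proj r Q i j) = 0"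
proof -
  have "EE (\<lambda>Q. col_proj r Q i j) = EE (\<lambda>Q. col_proj r (reflection p i j 1 0 * Q) i j)"
    using assms by (intro haar_invariant[symmetric] reflection_orthogonal measurable_col_proj) auto
  also have "\<dots> = EE (\<lambda>Q. - col_proj r Q i j)"
    using assms by (intro Bochner_Integration.integral_cong) (auto simp: sign_reflection)
  finally show ?thesis by simp
qed

lemma first_moment_swap:
  assumes "i < p" "j < p" "s < p" "t < p" "s \<noteq> t"
  shows "EE (\<lambda>Q. col_proj r Q i j)
    = EE (\<lambda>Q. col_proj r Q (Transposition.transpose s t i) (Transposition.transpose s t j))"
proof -
  have "EE (\<lambda>Q. col_proj r Q i j) = EE (\<lambda>Q. col_proj r (reflection p s t (1 / sqrt 2) (- 1 / sqrt 2) * Q) i j)"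
    using assms by (intro haar_invariant[symmetric] reflection_orthogonal measurable_col_proj) (auto simp: power_divide)
  also have "\<dots> = EE (\<lambda>Q. col_proj r Q (Transposition.transpose s t i) (Transposition.transpose s t j))"
    using assms by (intro Bochner_Integration.integral_cong refl swap_reflection) auto
  finally show ?thesis .
qed

lemma AE_trace: "AE Q in \<nu>. (\<Sum>i<p. col_proj r Q i i) = real r"
  using AE_columns
proof eventually_elim
  case (elim Q)
  have "(\<Sum>i<p. col_proj r Q i i) = (\<Sum>a<r. \<Sum>i<p. Q $$ (i, a) * Q $$ (i, a))"
    unfolding col_proj_def by (rule sum.swap)
  also have "\<dots> = (\<Sum>a<r. 1)" using elim rp by (intro sum.cong) auto
  finally show ?case by simp
qed

lemma AE_idempotent: "AE Q in \<nu>. \<forall>i. (\<Sum>j<p. col_proj r Q i j * col_proj r Q i j) = col_proj r Q i i"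
  using AE_columns
proof eventually_elim
  case (elim Q)
  show ?case
  proof
    fix i
    have "(\<Sum>j<p. col_proj r Q i j * col_proj r Q i j)
        = (\<Sum>j<p. \<Sum>a<r. \<Sum>b<r. Q $$ (i, a) * Q $$ (i, b) * (Q $$ (j, a) * Q $$ (j, b)))"
      by (simp add: col_proj_def sum_product mult_ac)
    also have "\<dots> = (\<Sum>a<r. \<Sum>j<p. \<Sum>b<r. Q $$ (i, a) * Q $$ (i, b) * (Q $$ (j, a) * Q $$ (j, b)))"
      by (rule sum.swap)
    also have "\<dots> = (\<Sum>a<r. \<Sum>b<r. \<Sum>j<p. Q $$ (i, a) * Q $$ (i, b) * (Q $$ (j, a) * Q $$ (j, b)))"
      by (intro sum.cong refl sum.swap)
    also have "\<dots> = (\<Sum>a<r. \<Sum>b<r. if b = a then Q $$ (i, a) * Q $$ (i, a) else 0)"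
      using elim rp by (intro sum.cong refl) (auto simp: sum_distrib_left[symmetric])
    also have "\<dots> = col_proj r Q i i" by (simp add: col_proj_def)
    finally show "(\<Sum>j<p. col_proj r Q i j * col_proj r Q i j) = col_proj r Q i i" .
  qed
qed

lemma col_proj_commute: "col_proj r Q i j = col_proj r Q j i"
  by (simp add: col_proj_def mult.commute)

text \<open>Off the diagonal a sign change forces 0. Swaps make the diagonal means equal, and their
  sum is the trace \<open>r\<close>.\<close>

lemma first_moment:
  assumes "i < p" "j < p"
  shows "EE (\<lambda>Q. col_proj r Q i j) = real r / real p * of_bool (i = j)"
proof (cases "i = j")
  case True
  have eq: "EE (\<lambda>Q. col_proj r Q k k) = EE (\<lambda>Q. col_proj r Q i i)" if "k < p" for k
    using first_moment_swap[of k k k i] that assms by (cases "k = i") auto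
  have "real p * EE (\<lambda>Q. col_proj r Q i i) = (\<Sum>k<p. EE (\<lambda>Q. col_proj r Q k k))" by (simp add: eq)
  also have "\<dots> = EE (\<lambda>Q. \<Sum>k<p. col_proj r Q k k)"
    by (rule Bochner_Integration.integral_sum[symmetric]) (simp add: integrable_col_proj)
  also have "\<dots> = EE (\<lambda>Q. real r)"
    using AE_trace by (intro integral_cong_AE) (auto intro!: borel_measurable_sum measurable_col_proj)
  also have "\<dots> = real r" using prob_space by simp
  finally show ?thesis using True p2 by (simp add: field_simps)
qed (simp add: first_moment_sign assms)

definition proj_moment :: "nat \<Rightarrow> nat \<Rightarrow> nat \<Rightarrow> nat \<Rightarrow> real" where
  "proj_moment i j k l = EE (\<lambda>Q. col_proj r Q i j * col_proj r Q k l)"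

text \<open>The condition on the product of signs says that \<open>s\<close> occurs an odd number of
  times among the four indices; negating row \<open>s\<close> then negates the integrand.\<close>

lemma proj_moment_sign:
  assumes "i < p" "j < p" "k < p" "l < p" "s < p"
    and "(if i = s then -1 else 1) * (if j = s then -1 else 1) * (if k = s then -1 else 1) * (if l = s then -1 else (1::real)) = -1"
  shows "proj_moment i j k l = 0"
proof -
  obtain t where t: "t < p" "s \<noteq> t" using ex_other[OF assms(5)] by blast
  have "proj_moment i j k l = EE (\<lambda>Q. col_proj r (reflection p s t 1 0 * Q) i j * col_proj r (reflection p s t 1 0 * Q) k l)"
    unfolding proj_moment_def using assms t
    by (intro haar_invariant[symmetric, where f = "\<lambda>Q. col_proj r Q i j * col_proj r Q k l"]
          reflection_orthogonal borel_measurable_times measurable_col_proj) auto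
  also have "\<dots> = EE (\<lambda>Q. ((if i = s then -1 else 1) * (if j = s then -1 else 1) * (if k = s then -1 else 1)
      * (if l = s then -1 else (1::real))) * (col_proj r Q i j * col_proj r Q k l))"
    using assms(1-5) t by (intro Bochner_Integration.integral_cong refl) (simp add: sign_reflection)
  also have "\<dots> = - proj_moment i j k l" unfolding assms(6) proj_moment_def by simp
  finally show ?thesis by simp
qed

lemma proj_moment_swap:
  assumes "i < p" "j < p" "k < p" "l < p" "s < p" "t < p"
  shows "proj_moment i j k l = proj_moment (Transposition.transpose s t i) (Transposition.transpose s t j)
    (Transposition.transpose s t k) (Transposition.transpose s t l)"
proof (cases "s = t")
  case False
  let ?R = "reflection p s t (1 / sqrt 2) (- 1 / sqrt 2)"
  have "proj_moment i j k l = EE (\<lambda>Q. col_proj r (?R * Q) i j * col_proj r (?R * Q) k l)"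
    unfolding proj_moment_def using assms False
    by (intro haar_invariant[symmetric, where f = "\<lambda>Q. col_proj r Q i j * col_proj r Q k l"]
          reflection_orthogonal borel_measurable_times measurable_col_proj) (auto simp: power_divide)
  also have "\<dots> = proj_moment (Transposition.transpose s t i) (Transposition.transpose s t j)
    (Transposition.transpose s t k) (Transposition.transpose s t l)"
    unfolding proj_moment_def using assms False by (intro Bochner_Integration.integral_cong refl arg_cong2[of _ _ _ _ times] swap_reflection) auto
  finally show ?thesis .
qed simp

lemma proj_moment_comm: "proj_moment i j k l = proj_moment j i k l" "proj_moment i j k l = proj_moment i j l k" "proj_moment i j k l = proj_moment k l i j"
  unfolding proj_moment_def by (simp_all add: col_proj_commute[of _ i j] col_proj_commute[of _ k l] mult.commute)

lemma proj_moment_diag: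
  assumes "i < p"
  shows "proj_moment i i i i = proj_moment 0 0 0 0"
  using proj_moment_swap[of i i i i i 0] assms p2 by simp

lemma proj_moment_pair:
  assumes "i < p" "k < p" "i \<noteq> k"
  shows "proj_moment i i k k = proj_moment 0 0 1 1" "proj_moment i k i k = proj_moment 0 1 0 1"
proof -
  \<comment> \<open>Two transpositions carry the pair to (0, 1): the first sends \<open>i\<close> to
    0 and may displace \<open>k\<close>, whose new position \<open>k'\<close> is sent to 1 by the
    second.\<close>
  define k' where "k' = Transposition.transpose i 0 k"
  have k': "k' \<noteq> 0" "k' < p" using assms p2 by (auto simp: k'_def Transposition.transpose_def)
  have z: "Transposition.transpose k' 1 0 = 0" using k' by (simp add: Transposition.transpose_def)
  show "proj_moment i i k k = proj_moment 0 0 1 1"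
    using proj_moment_swap[of i i k k i 0] proj_moment_swap[of 0 0 k' k' k' 1] assms k' p2 z by (simp add: k'_def[symmetric])
  show "proj_moment i k i k = proj_moment 0 1 0 1"
    using proj_moment_swap[of i k i k i 0] proj_moment_swap[of 0 k' 0 k' k' 1] assms k' p2 z by (simp add: k'_def[symmetric])
qed

text \<open>After signs and swaps three moments remain: g for (0,0,0,0), a for (0,0,1,1) and b for
  (0,1,0,1). The reflection with row (3, -4) / 5 gives \<open>625 g = 337 g + 576 b + 288 a\<close>,
  that is \<open>g = a + 2 b\<close>, the condition for an isotropic tensor.\<close>

lemma proj_moment_rotation: "proj_moment 0 0 0 0 = proj_moment 0 0 1 1 + 2 * proj_moment 0 1 0 1"
proof -
  let ?R = "reflection p 0 1 (1 / sqrt 5) (2 / sqrt 5)" and ?c = "col_proj r"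
  have sq: "((9 * a - 24 * b + 16 * c) / 25) * ((9 * a - 24 * b + 16 * c) / 25)
      = 81 / 625 * (a * a) + 576 / 625 * (b * b) + 256 / 625 * (c * c) + (- 432 / 625) * (a * b)
        + (- 768 / 625) * (b * c) + 288 / 625 * (a * c)" for a b c :: real
    by (simp add: field_simps)
  have i: "integrable \<nu> (\<lambda>Q. ?c Q i j * ?c Q k l)" if "i < 2" "j < 2" "k < 2" "l < 2" for i j k l
    using that p2 by (intro integrable_col_proj2) auto
  have "proj_moment 0 0 0 0 = EE (\<lambda>Q. ?c (?R * Q) 0 0 * ?c (?R * Q) 0 0)"
    unfolding proj_moment_def using p2
    by (intro haar_invariant[symmetric, where f = "\<lambda>Q. col_proj r Q 0 0 * col_proj r Q 0 0"]
          reflection_orthogonal borel_measurable_times measurable_col_proj) (auto simp: power_divide)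
  also have "\<dots> = EE (\<lambda>Q. 81 / 625 * (?c Q 0 0 * ?c Q 0 0) + 576 / 625 * (?c Q 0 1 * ?c Q 0 1)
     + 256 / 625 * (?c Q 1 1 * ?c Q 1 1) + (- 432 / 625) * (?c Q 0 0 * ?c Q 0 1)
     + (- 768 / 625) * (?c Q 0 1 * ?c Q 1 1) + 288 / 625 * (?c Q 0 0 * ?c Q 1 1))"
  proof (intro Bochner_Integration.integral_cong refl)
    fix Q assume "Q \<in> space \<nu>"
    then have "?c (?R * Q) 0 0 = (9 * ?c Q 0 0 - 24 * ?c Q 0 1 + 16 * ?c Q 1 1) / 25"
      using p2 by (intro pythagorean_reflection) auto
    then show "?c (?R * Q) 0 0 * ?c (?R * Q) 0 0 = 81 / 625 * (?c Q 0 0 * ?c Q 0 0) + 576 / 625 * (?c Q 0 1 * ?c Q 0 1)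
     + 256 / 625 * (?c Q 1 1 * ?c Q 1 1) + (- 432 / 625) * (?c Q 0 0 * ?c Q 0 1)
     + (- 768 / 625) * (?c Q 0 1 * ?c Q 1 1) + 288 / 625 * (?c Q 0 0 * ?c Q 1 1)"
      by (simp only: sq)
  qed
  also have "\<dots> = 81 / 625 * proj_moment 0 0 0 0 + 576 / 625 * proj_moment 0 1 0 1 + 256 / 625 * proj_moment 1 1 1 1
     + (- 432 / 625) * proj_moment 0 0 0 1 + (- 768 / 625) * proj_moment 0 1 1 1 + 288 / 625 * proj_moment 0 0 1 1"
    unfolding proj_moment_def by (simp add: i del: One_nat_def)
  also have "proj_moment 0 0 0 1 = 0" using p2 by (intro proj_moment_sign[of _ _ _ _ 1]) auto
  also have "proj_moment 0 1 1 1 = 0" using p2 by (intro proj_moment_sign[of _ _ _ _ 0]) auto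
  also have "proj_moment 1 1 1 1 = proj_moment 0 0 0 0" using p2 by (intro proj_moment_diag) auto
  finally show ?thesis by simp
qed

text \<open>The mean of the (0, 0) entry of the identity \<open>S\<^sup>2 = S\<close> for a
  projection; the \<open>p - 1\<close> off-diagonal terms are equal by symmetry.\<close>

lemma proj_moment_idempotent: "proj_moment 0 0 0 0 + (real p - 1) * proj_moment 0 1 0 1 = real r / real p"
proof -
  have "real r / real p = EE (\<lambda>Q. col_proj r Q 0 0)" using first_moment[of 0 0] p2 by simp
  also have "\<dots> = EE (\<lambda>Q. \<Sum>j<p. col_proj r Q 0 j * col_proj r Q 0 j)"
    using AE_idempotent p2
    by (intro integral_cong_AE) (auto intro!: borel_measurable_sum borel_measurable_times measurable_col_proj)
  also have "\<dots> = (\<Sum>j<p. proj_moment 0 j 0 j)"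
    unfolding proj_moment_def using p2 by (intro Bochner_Integration.integral_sum integrable_col_proj2) auto
  also have "{..<p} = insert 0 {1..<p}" using p2 by auto
  also have "(\<Sum>j\<in>insert 0 {1..<p}. proj_moment 0 j 0 j) = proj_moment 0 0 0 0 + (\<Sum>j\<in>{1..<p}. proj_moment 0 1 0 1)"
  proof -
    have "(\<Sum>j\<in>{1..<p}. proj_moment 0 j 0 j) = (\<Sum>j\<in>{1..<p}. proj_moment 0 1 0 1)"
      using p2 by (intro sum.cong refl proj_moment_pair(2)) auto
    then show ?thesis by simp
  qed
  finally show ?thesis using p2 by (simp add: of_nat_diff)
qed

text \<open>The trace is almost surely \<open>r\<close>, so its square has mean \<open>r\<close>
  squared; the double sum splits into diagonal and off-diagonal pairs.\<close>

lemma proj_moment_trace: "real p * (proj_moment 0 0 0 0 + (real p - 1) * proj_moment 0 0 1 1) = (real r)\<^sup>2"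
proof -
  have "(real r)\<^sup>2 = EE (\<lambda>Q. (\<Sum>i<p. col_proj r Q i i) * (\<Sum>k<p. col_proj r Q k k))"
  proof -
    have "EE (\<lambda>Q. (\<Sum>i<p. col_proj r Q i i) * (\<Sum>k<p. col_proj r Q k k)) = EE (\<lambda>Q. (real r)\<^sup>2)"
      using AE_trace
      by (intro integral_cong_AE) (auto intro!: borel_measurable_sum borel_measurable_times measurable_col_proj simp: power2_eq_square)
    then show ?thesis using prob_space by simp
  qed
  also have "\<dots> = EE (\<lambda>Q. \<Sum>i<p. \<Sum>k<p. col_proj r Q i i * col_proj r Q k k)" by (simp add: sum_product)
  also have "\<dots> = (\<Sum>i<p. \<Sum>k<p. proj_moment i i k k)"
    unfolding proj_moment_def using p2
    by (subst Bochner_Integration.integral_sum; (intro sum.cong refl Bochner_Integration.integral_sum Bochner_Integration.integrable_sum integrable_col_proj2)?) auto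
  also have "\<dots> = (\<Sum>i<p. proj_moment 0 0 0 0 + (real p - 1) * proj_moment 0 0 1 1)"
  proof (intro sum.cong refl)
    fix i assume i: "i \<in> {..<p}"
    then have e: "{..<p} = insert i ({..<p} - {i})" by auto
    have "(\<Sum>k<p. proj_moment i i k k) = proj_moment i i i i + (\<Sum>k\<in>{..<p} - {i}. proj_moment i i k k)"
      by (subst e, subst sum.insert) auto
    also have "(\<Sum>k\<in>{..<p} - {i}. proj_moment i i k k) = (\<Sum>k\<in>{..<p} - {i}. proj_moment 0 0 1 1)"
      using i by (intro sum.cong refl proj_moment_pair) auto
    also have "\<dots> = (real p - 1) * proj_moment 0 0 1 1" using i p2 by (simp add: of_nat_diff)
    finally show "(\<Sum>k<p. proj_moment i i k k) = proj_moment 0 0 0 0 + (real p - 1) * proj_moment 0 0 1 1" using i proj_moment_diag[of i] by simp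
  qed
  finally show ?thesis by simp
qed

end

text \<open>The weight of each of the two crossed pairings in the second moment of an unscaled
  projection of rank \<open>r\<close>, an instance of the orthogonal Weingarten calculus.\<close>

definition wein_b :: "nat \<Rightarrow> nat \<Rightarrow> real" where
  "wein_b p r = real r * (real p - real r) / (real p * (real p - 1) * (real p + 2))"

text \<open>The weight of the pairing of \<open>i\<close> with \<open>j\<close> and of
  \<open>k\<close> with \<open>l\<close>, in the form in which the idempotence relation delivers it.
  The closed form \<open>r (p r + r - 2) / (p (p - 1) (p + 2))\<close> is derived in
  \<open>correction_coefficients\<close>.\<close>

definition wein_a :: "nat \<Rightarrow> nat \<Rightarrow> real" where
  "wein_a p r = real r / real p - (real p + 1) * wein_b p r"

context haar_columns begin

text \<open>Rotation, idempotence and trace are three linear equations for the three remaining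
  moments. Two of them express the other moments through \<beta>, and the third one then determines
  \<beta>.\<close>

lemma proj_moment_values: "proj_moment 0 1 0 1 = wein_b p r" "proj_moment 0 0 1 1 = wein_a p r"
proof -
  define P where "P = real p"
  define \<beta> where "\<beta> = proj_moment 0 1 0 1"
  have P: "2 \<le> P" using p2 by (simp add: P_def)
  have a: "proj_moment 0 0 1 1 = real r / P - (P + 1) * \<beta>"
    using proj_moment_rotation proj_moment_idempotent by (simp add: P_def \<beta>_def algebra_simps)
  have g: "proj_moment 0 0 0 0 = real r / P - (P - 1) * \<beta>"
    using proj_moment_idempotent by (simp add: P_def \<beta>_def algebra_simps)
  have "P * ((real r / P - (P - 1) * \<beta>) + (P - 1) * (real r / P - (P + 1) * \<beta>)) = (real r)\<^sup>2"
    using proj_moment_trace unfolding a g P_def[symmetric] .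
  moreover have "P * ((real r / P - (P - 1) * \<beta>) + (P - 1) * (real r / P - (P + 1) * \<beta>))
      = P * real r - \<beta> * (P * (P - 1) * (P + 2))" using P by (simp add: field_simps)
  ultimately have "\<beta> * (P * (P - 1) * (P + 2)) = real r * (P - real r)"
    by (simp add: power2_eq_square algebra_simps)
  then show b: "proj_moment 0 1 0 1 = wein_b p r"
    using P unfolding \<beta>_def[symmetric] wein_b_def P_def[symmetric] by (simp add: eq_divide_eq)
  show "proj_moment 0 0 1 1 = wein_a p r" using a b by (simp add: wein_a_def P_def \<beta>_def)
qed

lemma second_moment:
  assumes "i < p" "j < p" "k < p" "l < p"
  shows "EE (\<lambda>Q. col_proj r Q i j * col_proj r Q k l)
    = wein_a p r * of_bool (i = j \<and> k = l) + wein_b p r * (of_bool (i = k \<and> j = l) + of_bool (i = l \<and> j = k))"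
proof -
  have "proj_moment i j k l = wein_a p r * of_bool (i = j \<and> k = l) + wein_b p r * (of_bool (i = k \<and> j = l) + of_bool (i = l \<and> j = k))"
  proof (cases "i = j")
    case ij: True
    show ?thesis
    proof (cases "k = l")
      case True
      then show ?thesis using ij assms proj_moment_diag[of i] proj_moment_pair(1)[of i k] proj_moment_rotation proj_moment_values
        by (cases "i = k") auto
    next
      case False
      have "proj_moment i j k l = 0"
        \<comment> \<open>If \<open>k\<close> agrees with \<open>i\<close>, then \<open>l\<close>
          occurs exactly once; otherwise \<open>k\<close> does.\<close>
        using proj_moment_sign[OF assms assms(3)] proj_moment_sign[OF assms assms(4)] ij False by (cases "k = i") auto
      then show ?thesis using ij False by auto
    qed
  next
    case ij: False
    consider "i = k" "j = l" | "i = l" "j = k" | "\<not> (i = k \<and> j = l)" "\<not> (i = l \<and> j = k)" by blast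
    then show ?thesis
    proof cases
      case 1
      then show ?thesis using ij assms proj_moment_pair(2)[of i j] proj_moment_values by auto
    next
      case 2
      then show ?thesis using ij assms proj_moment_pair(2)[of i j] proj_moment_values proj_moment_comm(2)[of i j k l] by auto
    next
      case 3
      have "proj_moment i j k l = 0"
      proof (cases "i = k \<or> i = l")
        case True
        then have "j \<noteq> k" "j \<noteq> l" using 3 ij by auto
        then show ?thesis using proj_moment_sign[OF assms assms(2)] ij by simp
      next
        case False
        then show ?thesis using proj_moment_sign[OF assms assms(1)] ij by auto
      qed
      then show ?thesis using ij 3 by auto
    qed
  qed
  then show ?thesis by (simp add: proj_moment_def)
qed

end

section \<open>Conditional expectations and independence\<close>

lemma (in prob_space) sigma_finite_subalgebraI:
  "subalgebra M F \<Longrightarrow> sigma_finite_subalgebra M F"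
  by (intro finite_measure_subalgebra_is_sigma_finite)
    (simp add: finite_measure_subalgebra_def finite_measure_subalgebra_axioms_def finite_measure_axioms)

section \<open>Upper bounds for conditional expectations\<close>

context prob_space begin

text \<open>Nonnegative conditional expectations exist without any integrability, so bounds can be
  combined before anything is known to be integrable. As \<open>ennreal\<close> sends negative
  numbers to 0, the rules below carry sign conditions.\<close>

abbreviation cbound :: "'a measure \<Rightarrow> ('a \<Rightarrow> real) \<Rightarrow> ('a \<Rightarrow> real) \<Rightarrow> bool" where
  "cbound F X b \<equiv> AE \<omega> in M. nn_cond_exp M F (\<lambda>\<omega>. ennreal (X \<omega>)) \<omega> \<le> ennreal (b \<omega>)"

lemma cbound_mono:
  assumes F: "subalgebra M F" and "cbound F X b"
    and "AE \<omega> in M. Y \<omega> \<le> X \<omega>" and [measurable]: "Y \<in> borel_measurable M" "X \<in> borel_measurable M"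
    and "\<And>\<omega>. \<omega> \<in> space M \<Longrightarrow> b \<omega> \<le> c \<omega>"
  shows "cbound F Y c"
proof -
  interpret sigma_finite_subalgebra M F by (rule sigma_finite_subalgebraI[OF F])
  have "AE \<omega> in M. nn_cond_exp M F (\<lambda>\<omega>. ennreal (Y \<omega>)) \<omega> \<le> nn_cond_exp M F (\<lambda>\<omega>. ennreal (X \<omega>)) \<omega>"
    using assms(3) by (intro nn_cond_exp_mono) (auto elim!: eventually_mono intro: ennreal_leI)
  with assms(2) AE_space show ?thesis
    by eventually_elim (use assms(6) in \<open>blast intro: order_trans ennreal_leI\<close>)
qed

lemma cbound_add:
  assumes F: "subalgebra M F" and "cbound F X b" "cbound F Y c"
    and [measurable]: "X \<in> borel_measurable M" "Y \<in> borel_measurable M"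
    and nn: "\<And>\<omega>. 0 \<le> X \<omega>" "\<And>\<omega>. 0 \<le> Y \<omega>" "\<And>\<omega>. 0 \<le> b \<omega>" "\<And>\<omega>. 0 \<le> c \<omega>"
  shows "cbound F (\<lambda>\<omega>. X \<omega> + Y \<omega>) (\<lambda>\<omega>. b \<omega> + c \<omega>)"
proof -
  interpret sigma_finite_subalgebra M F by (rule sigma_finite_subalgebraI[OF F])
  have "AE \<omega> in M. nn_cond_exp M F (\<lambda>\<omega>. ennreal (X \<omega>)) \<omega> + nn_cond_exp M F (\<lambda>\<omega>. ennreal (Y \<omega>)) \<omega>
      = nn_cond_exp M F (\<lambda>\<omega>. ennreal (X \<omega>) + ennreal (Y \<omega>)) \<omega>"
    by (intro nn_cond_exp_sum) auto
  with assms(2,3) show ?thesis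
  proof eventually_elim
    case (elim \<omega>)
    have "nn_cond_exp M F (\<lambda>\<omega>. ennreal (X \<omega>)) \<omega> + nn_cond_exp M F (\<lambda>\<omega>. ennreal (Y \<omega>)) \<omega>
        \<le> ennreal (b \<omega>) + ennreal (c \<omega>)"
      using elim(1,2) by (rule add_mono)
    then show ?case using elim(3) by (simp add: nn)
  qed
qed

lemma cbound_sum:
  assumes F: "subalgebra M F" and "finite I"
    and "\<And>i. i \<in> I \<Longrightarrow> cbound F (X i) (b i)"
    and "\<And>i. i \<in> I \<Longrightarrow> X i \<in> borel_measurable M"
    and "\<And>i \<omega>. 0 \<le> X i \<omega>" "\<And>i \<omega>. 0 \<le> b i \<omega>"
  shows "cbound F (\<lambda>\<omega>. \<Sum>i\<in>I. X i \<omega>) (\<lambda>\<omega>. \<Sum>i\<in>I. b i \<omega>)"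
  using assms(2-4)
proof (induction I)
  case empty
  interpret sigma_finite_subalgebra M F by (rule sigma_finite_subalgebraI[OF F])
  have "AE \<omega> in M. 0 = nn_cond_exp M F (\<lambda>_. 0) \<omega>" by (rule nn_cond_exp_F_meas) simp
  then show ?case by (auto elim: eventually_mono)
next
  case (insert i I)
  have "cbound F (\<lambda>\<omega>. X i \<omega> + (\<Sum>i\<in>I. X i \<omega>)) (\<lambda>\<omega>. b i \<omega> + (\<Sum>i\<in>I. b i \<omega>))"
    using insert by (intro cbound_add[OF F] borel_measurable_sum sum_nonneg assms(5,6)) auto
  then show ?case using insert by simp
qed

lemma cbound_mult:
  assumes F: "subalgebra M F" and "cbound F X b"
    and [measurable]: "X \<in> borel_measurable M" "c \<in> borel_measurable F"
    and nn: "\<And>\<omega>. 0 \<le> X \<omega>" "\<And>\<omega>. 0 \<le> c \<omega>"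
  shows "cbound F (\<lambda>\<omega>. c \<omega> * X \<omega>) (\<lambda>\<omega>. c \<omega> * b \<omega>)"
proof -
  interpret sigma_finite_subalgebra M F by (rule sigma_finite_subalgebraI[OF F])
  have "AE \<omega> in M. ennreal (c \<omega>) * nn_cond_exp M F (\<lambda>\<omega>. ennreal (X \<omega>)) \<omega>
      = nn_cond_exp M F (\<lambda>\<omega>. ennreal (c \<omega>) * ennreal (X \<omega>)) \<omega>"
    by (intro nn_cond_exp_prod) auto
  with assms(2) show ?thesis
  proof eventually_elim
    case (elim \<omega>)
    have "ennreal (c \<omega>) * nn_cond_exp M F (\<lambda>\<omega>. ennreal (X \<omega>)) \<omega> \<le> ennreal (c \<omega>) * ennreal (b \<omega>)"
      using elim(1) by (intro mult_left_mono) auto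
    then show ?case using elim(2) nn by (simp add: ennreal_mult'[symmetric])
  qed
qed

lemma cbound_self:
  assumes F: "subalgebra M F" and "X \<in> borel_measurable F"
  shows "cbound F X X"
proof -
  interpret sigma_finite_subalgebra M F by (rule sigma_finite_subalgebraI[OF F])
  have "AE \<omega> in M. ennreal (X \<omega>) = nn_cond_exp M F (\<lambda>\<omega>. ennreal (X \<omega>)) \<omega>"
    using assms(2) by (intro nn_cond_exp_F_meas) measurable
  then show ?thesis by (auto elim: eventually_mono)
qed

text \<open>A bound descends to a coarser sigma-algebra if the bound itself is measurable there. In
  the applications this means that the projector must first be estimated away.\<close>

lemma cbound_tower:
  assumes G: "subalgebra M G" and FG: "subalgebra G F" and b: "cbound G X b" "b \<in> borel_measurable F"
    and [measurable]: "X \<in> borel_measurable M"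
  shows "cbound F X b"
proof -
  have F: "subalgebra M F" using G FG unfolding subalgebra_def by auto
  interpret sigma_finite_subalgebra M F by (rule sigma_finite_subalgebraI[OF F])
  have [measurable]: "b \<in> borel_measurable M" by (rule measurable_from_subalg[OF F b(2)])
  have "AE \<omega> in M. nn_cond_exp M F (nn_cond_exp M G (\<lambda>\<omega>. ennreal (X \<omega>))) \<omega> \<le> nn_cond_exp M F (\<lambda>\<omega>. ennreal (b \<omega>)) \<omega>"
    using b by (intro nn_cond_exp_mono) auto
  moreover have "AE \<omega> in M. nn_cond_exp M F (\<lambda>\<omega>. ennreal (X \<omega>)) \<omega> = nn_cond_exp M F (nn_cond_exp M G (\<lambda>\<omega>. ennreal (X \<omega>))) \<omega>"
    by (rule nn_cond_exp_nested_subalg[OF G FG]) simp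
  ultimately show ?thesis using cbound_self[OF F b(2)]
    by eventually_elim simp
qed

text \<open>The way back from conditional bounds to integrability: total expectation of the
  nonnegative conditional expectation.\<close>

lemma cbound_integrable:
  assumes F: "subalgebra M F" and b: "cbound F X b" and "integrable M b"
    and [measurable]: "X \<in> borel_measurable M" and "\<And>\<omega>. 0 \<le> X \<omega>" "\<And>\<omega>. 0 \<le> b \<omega>"
  shows "integrable M X"
proof (rule integrableI_bounded)
  interpret sigma_finite_subalgebra M F by (rule sigma_finite_subalgebraI[OF F])
  have "(\<integral>\<^sup>+ \<omega>. ennreal (X \<omega>) \<partial>M) = (\<integral>\<^sup>+ \<omega>. nn_cond_exp M F (\<lambda>\<omega>. ennreal (X \<omega>)) \<omega> \<partial>M)"
    using nn_cond_exp_intg[of "\<lambda>_. 1" "\<lambda>\<omega>. ennreal (X \<omega>)"] by simp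
  also have "\<dots> \<le> (\<integral>\<^sup>+ \<omega>. ennreal (b \<omega>) \<partial>M)" by (rule nn_integral_mono_AE[OF b])
  also have "\<dots> < \<infinity>" using assms(3,6) by (simp add: nn_integral_eq_integral)
  finally show "(\<integral>\<^sup>+ \<omega>. ennreal (norm (X \<omega>)) \<partial>M) < \<infinity>" using assms(5) by simp
qed simp

text \<open>A conditional mean used as a rule for integrals with an \<open>F\<close>-measurable
  weight. Integrability is required of the weighted coordinate, because \<open>cond_mean\<close>
  asserts only that the conditional mean of the norm is finite almost everywhere.\<close>

lemma cond_mean_weak:
  fixes X D :: "'a \<Rightarrow> 'v::euclidean_space"
  assumes cm: "cond_mean M F X D" and e: "e \<in> Basis" and c: "c \<in> borel_measurable F"
    and i: "integrable M (\<lambda>\<omega>. c \<omega> * inner (X \<omega>) e)"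
    and [measurable]: "(\<lambda>\<omega>. inner (D \<omega>) e) \<in> borel_measurable M"
  shows "integral\<^sup>L M (\<lambda>\<omega>. c \<omega> * inner (X \<omega>) e) = integral\<^sup>L M (\<lambda>\<omega>. c \<omega> * inner (D \<omega>) e)"
    and "integrable M (\<lambda>\<omega>. c \<omega> * inner (D \<omega>) e)"
proof -
  have F: "subalgebra M F" and [measurable]: "X \<in> borel_measurable M"
    and ae: "AE \<omega> in M. real_cond_exp M F (\<lambda>\<omega>. inner (X \<omega>) e) \<omega> = inner (D \<omega>) e"
    using cm e by (auto simp: cond_mean_def)
  interpret sigma_finite_subalgebra M F by (rule sigma_finite_subalgebraI[OF F])
  have [measurable]: "c \<in> borel_measurable M" by (rule measurable_from_subalg[OF F c])
  have ae': "AE \<omega> in M. c \<omega> * real_cond_exp M F (\<lambda>\<omega>. inner (X \<omega>) e) \<omega> = c \<omega> * inner (D \<omega>) e"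
    using ae by eventually_elim simp
  note r = real_cond_exp_intg[OF i c]
  show "integral\<^sup>L M (\<lambda>\<omega>. c \<omega> * inner (X \<omega>) e) = integral\<^sup>L M (\<lambda>\<omega>. c \<omega> * inner (D \<omega>) e)"
    using integral_cong_AE[OF _ _ ae'] r(2) by simp
  show "integrable M (\<lambda>\<omega>. c \<omega> * inner (D \<omega>) e)"
    using integrable_cong_AE[OF _ _ ae'] r(1) by simp
qed

text \<open>The converse direction: testing coordinates on the sets of \<open>F\<close>
  characterises the conditional mean. The three claims about means are proved through this
  rule.\<close>

lemma cond_meanI:
  fixes X D :: "'a \<Rightarrow> 'v::euclidean_space"
  assumes F: "subalgebra M F" and X: "integrable M X" and D: "integrable M D" "D \<in> borel_measurable F"
    and eq: "\<And>A e. A \<in> sets F \<Longrightarrow> e \<in> Basis \<Longrightarrow>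
      integral\<^sup>L M (\<lambda>\<omega>. indicator A \<omega> * inner (X \<omega>) e) = integral\<^sup>L M (\<lambda>\<omega>. indicator A \<omega> * inner (D \<omega>) e)"
  shows "cond_mean M F X D"
proof -
  interpret sigma_finite_subalgebra M F by (rule sigma_finite_subalgebraI[OF F])
  have [measurable]: "X \<in> borel_measurable M" using X by simp
  have "(\<integral>\<^sup>+ \<omega>. nn_cond_exp M F (\<lambda>\<omega>. ennreal (norm (X \<omega>))) \<omega> \<partial>M) = (\<integral>\<^sup>+ \<omega>. ennreal (norm (X \<omega>)) \<partial>M)"
    using nn_cond_exp_intg[of "\<lambda>_. 1" "\<lambda>\<omega>. ennreal (norm (X \<omega>))"] by simp
  also have "\<dots> \<noteq> \<infinity>" using X by (simp add: integrable_iff_bounded)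
  finally have fin: "AE \<omega> in M. nn_cond_exp M F (\<lambda>\<omega>. ennreal (norm (X \<omega>))) \<omega> \<noteq> \<infinity>"
    by (intro nn_integral_PInf_AE) auto
  have "AE \<omega> in M. real_cond_exp M F (\<lambda>\<omega>. inner (X \<omega>) e) \<omega> = inner (D \<omega>) e" if e: "e \<in> Basis" for e
  proof (rule real_cond_exp_charact)
    show "(\<lambda>\<omega>. inner (D \<omega>) e) \<in> borel_measurable F" using D(2) by measurable
    show "(\<integral>\<omega>\<in>A. inner (X \<omega>) e \<partial>M) = (\<integral>\<omega>\<in>A. inner (D \<omega>) e \<partial>M)" if "A \<in> sets F" for A
      using eq[OF that e] by (simp add: set_lebesgue_integral_def)
  qed (use X D in auto)
  then show ?thesis unfolding cond_mean_def using fin F by (auto simp: less_top)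
qed

text \<open>The conditional probability of the intersection is a constant, so integrating it over
  \<open>B\<close> gives that constant times the probability of \<open>B\<close>.\<close>

lemma prob_cond_indep:
  assumes F: "subalgebra M F" and ci: "cond_indep_sets M F G I"
    and J: "J \<subseteq> I" "finite J" and A: "\<And>j. j \<in> J \<Longrightarrow> A j \<in> G j" "\<And>j. j \<in> J \<Longrightarrow> A j \<in> sets M"
    and c: "\<And>j. j \<in> J \<Longrightarrow> AE \<omega> in M. real_cond_exp M F (indicat_real (A j)) \<omega> = c j"
    and B: "B \<in> sets F"
  shows "prob (B \<inter> (space M \<inter> (\<Inter>j\<in>J. A j))) = prob B * (\<Prod>j\<in>J. c j)"
\<comment> \<open>\<open>cond_indep_sets\<close> speaks of nonempty index sets only. The factor
  \<open>space M\<close> in the statement gives the empty intersection its proper meaning.\<close>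
proof (cases "J = {}")
  case True
  have "B \<in> sets M" using B F by (auto simp: subalgebra_def)
  then have "B \<inter> space M = B" using sets.sets_into_space by blast
  then show ?thesis using True by simp
next
  case False
  interpret sigma_finite_subalgebra M F by (rule sigma_finite_subalgebraI[OF F])
  have BM [measurable]: "B \<in> sets M" using B F by (auto simp: subalgebra_def)
  let ?I = "\<Inter>j\<in>J. A j"
  have IM [measurable]: "?I \<in> sets M" using False J A(2) by (intro sets.finite_INT) auto
  define A' where "A' j = (if j \<in> J then A j else (SOME X. X \<in> G j))" for j
  have "AE \<omega> in M. real_cond_exp M F (indicat_real ?I) \<omega> = (\<Prod>j\<in>J. real_cond_exp M F (indicat_real (A j)) \<omega>)"
    using ci J A(1) False unfolding cond_indep_sets_def by (auto simp: Pi_iff)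
  moreover have "AE \<omega> in M. \<forall>j\<in>J. real_cond_exp M F (indicat_real (A j)) \<omega> = c j"
    using c J(2) by (simp add: AE_finite_all)
  ultimately have ae: "AE \<omega> in M. real_cond_exp M F (indicat_real ?I) \<omega> = (\<Prod>j\<in>J. c j)"
    by eventually_elim simp
  have "prob (B \<inter> ?I) = (\<integral>\<omega>\<in>B. indicat_real ?I \<omega> \<partial>M)"
    by (simp add: set_lebesgue_integral_def indicator_inter_arith[symmetric])
  also have "\<dots> = (\<integral>\<omega>\<in>B. real_cond_exp M F (indicat_real ?I) \<omega> \<partial>M)"
    using B by (intro real_cond_exp_intA integrable_const_bound[where B = 1]) auto
  also have "\<dots> = (\<integral>\<omega>\<in>B. (\<Prod>j\<in>J. c j) \<partial>M)"
    unfolding set_lebesgue_integral_def using ae by (intro integral_cong_AE) auto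
  also have "\<dots> = prob B * (\<Prod>j\<in>J. c j)" by (simp add: set_lebesgue_integral_def)
  finally have "prob (B \<inter> ?I) = prob B * (\<Prod>j\<in>J. c j)" .
  moreover have "B \<inter> (space M \<inter> ?I) = B \<inter> ?I" using sets.sets_into_space[OF BM] by auto
  ultimately show ?thesis by simp
qed

text \<open>A conditional law that does not depend on the sample point makes the conditionally independent
  variables independent of \<open>F\<close> and of each other.\<close>

lemma expectation_cond_indep:
  fixes P :: "'i \<Rightarrow> 'a \<Rightarrow> 'c" and \<phi> :: "'i \<Rightarrow> 'c \<Rightarrow> real"
  assumes F: "subalgebra M F" and ci: "cond_indep_sets M F (\<lambda>i. events_of M (N i) (P i)) I"
    and P: "\<And>i. P i \<in> measurable M (N i)"
    and law: "\<And>i A. A \<in> sets (N i) \<Longrightarrow> AE \<omega> in M. real_cond_exp M F (indicat_real (P i -` A \<inter> space M)) \<omega> = c i A"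
    and J: "J \<subseteq> I" "finite J"
    and X: "X \<in> borel_measurable F" "integrable M X"
    and phi: "\<And>j. j \<in> J \<Longrightarrow> \<phi> j \<in> borel_measurable (N j)"
      "\<And>j. j \<in> J \<Longrightarrow> integrable M (\<lambda>\<omega>. \<phi> j (P j \<omega>))"
  shows "integral\<^sup>L M (\<lambda>\<omega>. X \<omega> * (\<Prod>j\<in>J. \<phi> j (P j \<omega>))) = integral\<^sup>L M X * (\<Prod>j\<in>J. integral\<^sup>L M (\<lambda>\<omega>. \<phi> j (P j \<omega>)))"
proof -
  have indep: "prob (B \<inter> (space M \<inter> (\<Inter>k\<in>K. A k))) = prob B * (\<Prod>k\<in>K. prob (A k))"
    if B: "B \<in> sets F" and K: "K \<subseteq> J" and A: "\<And>k. k \<in> K \<Longrightarrow> A k \<in> events_of M (N k) (P k)" for B K A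
  proof -
    have "\<forall>k\<in>K. \<exists>A'. A' \<in> sets (N k) \<and> A k = P k -` A' \<inter> space M" using A unfolding events_of_def by blast
    then obtain A' where A': "\<And>k. k \<in> K \<Longrightarrow> A' k \<in> sets (N k)" "\<And>k. k \<in> K \<Longrightarrow> A k = P k -` A' k \<inter> space M"
      by metis
    have fK: "finite K" "K \<subseteq> I" using K J finite_subset by auto
    have AM: "A k \<in> sets M" if "k \<in> K" for k using A'[OF that] P measurable_sets by metis
    have c: "AE \<omega> in M. real_cond_exp M F (indicat_real (A k)) \<omega> = c k (A' k)" if "k \<in> K" for k
      using law[OF A'(1)[OF that]] A'(2)[OF that] by simp
    have S: "space M \<in> sets F" using F by (metis sets.top subalgebra_def)
    have "prob (A k) = c k (A' k)" if k: "k \<in> K" for k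
    proof -
      have "prob (space M \<inter> (space M \<inter> (\<Inter>j\<in>{k}. A j))) = prob (space M) * (\<Prod>j\<in>{k}. c j (A' j))"
        by (rule prob_cond_indep[OF F ci _ _ _ _ _ S]) (use k fK A AM c in auto)
      moreover have "space M \<inter> (space M \<inter> (\<Inter>j\<in>{k}. A j)) = A k" using sets.sets_into_space[OF AM[OF k]] by auto
      ultimately show ?thesis by (simp add: prob_space)
    qed
    then show ?thesis
      using prob_cond_indep[OF F ci fK(2,1) A AM c B] by simp
  qed
  \<comment> \<open>The past variable gets index \<open>None\<close> and the factors get indices
    \<open>Some j\<close>, so that one family of independent variables covers all of them and the
    product rule for expectations applies once.\<close>
  define V where "V = case_option X (\<lambda>j \<omega>. \<phi> j (P j \<omega>))"
  let ?I = "insert None (Some ` J)"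
  have XM: "X \<in> borel_measurable M" by (rule measurable_from_subalg[OF F X(1)])
  have Vm: "V i \<in> borel_measurable M" if "i \<in> ?I" for i
    using that XM phi P by (auto simp: V_def intro!: measurable_compose[of "P _" M])
  have ev: "A \<in> events_of M (N j) (P j)" if j: "j \<in> J" and A: "A \<in> {V (Some j) -` A \<inter> space M |A. A \<in> sets borel}" for j A
  proof -
    obtain S where S: "A = (\<lambda>\<omega>. \<phi> j (P j \<omega>)) -` S \<inter> space M" "S \<in> sets borel" using A by (auto simp: V_def)
    have "A = P j -` (\<phi> j -` S \<inter> space (N j)) \<inter> space M" using S measurable_space[OF P] by auto
    moreover have "\<phi> j -` S \<inter> space (N j) \<in> sets (N j)" using phi(1)[OF j] S by (auto intro: measurable_sets)
    ultimately show ?thesis unfolding events_of_def by blast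
  qed
  have evX: "A \<in> sets F" if "A \<in> {V None -` A \<inter> space M |A. A \<in> sets borel}" for A
    using that measurable_sets[OF X(1)] F by (auto simp: V_def subalgebra_def)
  have "indep_vars (\<lambda>_. borel) V ?I"
    unfolding indep_vars_def2
  proof (intro conjI ballI indep_setsI)
    fix A K
    assume K: "K \<noteq> {}" "K \<subseteq> ?I" "finite K"
      and A: "\<forall>j\<in>K. A j \<in> {V j -` A \<inter> space M |A. A \<in> sets borel}"
    define L where "L = {j \<in> J. Some j \<in> K}"
    have L: "L \<subseteq> J" "Some ` L = K - {None}" using K(2) by (auto simp: L_def)
    have AL: "A (Some k) \<in> events_of M (N k) (P k)" if "k \<in> L" for k
      using that A L_def ev by auto
    \<comment> \<open>A subfamily without \<open>None\<close> is the case in which the event from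
      the past is the whole space.\<close>
    show "prob (\<Inter>j\<in>K. A j) = (\<Prod>j\<in>K. prob (A j))"
    proof (cases "None \<in> K")
      case True
      then have Ke: "K = insert None (Some ` L)" using L by auto
      have B: "A None \<in> sets F" using evX A True by blast
      then have "A None \<subseteq> space M" using F sets.sets_into_space by (force simp: subalgebra_def)
      then have "(\<Inter>j\<in>K. A j) = A None \<inter> (space M \<inter> (\<Inter>k\<in>L. A (Some k)))" by (auto simp: Ke)
      moreover have "(\<Prod>j\<in>K. prob (A j)) = prob (A None) * (\<Prod>k\<in>L. prob (A (Some k)))"
        unfolding Ke using finite_subset[OF L(1) J(2)] by (subst prod.insert) (auto simp: prod.reindex)
      ultimately show ?thesis using indep[OF B L(1), of "\<lambda>k. A (Some k)"] AL by simp
    next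
      case False
      then have Ke: "K = Some ` L" using L by auto
      then obtain k where k: "k \<in> L" using K(1) by auto
      have B: "space M \<in> sets F" using F by (metis sets.top subalgebra_def)
      have "A (Some k) \<subseteq> space M" using AL[OF k] by (auto simp: events_of_def)
      then have "(\<Inter>j\<in>K. A j) = space M \<inter> (space M \<inter> (\<Inter>k\<in>L. A (Some k)))" using k by (auto simp: Ke)
      moreover have "(\<Prod>j\<in>K. prob (A j)) = prob (space M) * (\<Prod>k\<in>L. prob (A (Some k)))"
        unfolding Ke by (simp add: prod.reindex prob_space)
      ultimately show ?thesis using indep[OF B L(1), of "\<lambda>k. A (Some k)"] AL by simp
    qed
  qed (use Vm in \<open>auto intro: measurable_sets\<close>)
  then have "integral\<^sup>L M (\<lambda>\<omega>. \<Prod>i\<in>?I. V i \<omega>) = (\<Prod>i\<in>?I. integral\<^sup>L M (V i))"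
    using J X phi by (intro indep_vars_lebesgue_integral) (auto simp: V_def)
  then show ?thesis using J by (simp add: V_def prod.reindex)
qed

text \<open>The conditional law is the same at every sample point, so by total expectation it is
  also the unconditional law. Moments of a projector thus become integrals against Haar
  measure.\<close>

lemma expectation_law:
  fixes \<phi> :: "'c \<Rightarrow> real"
  assumes F: "subalgebra M F" and P: "P \<in> measurable M N" and \<nu>: "prob_space \<nu>" and h: "h \<in> measurable \<nu> N"
    and law: "\<And>A. A \<in> sets N \<Longrightarrow> AE \<omega> in M. real_cond_exp M F (indicat_real (P -` A \<inter> space M)) \<omega> = measure (distr \<nu> N h) A"
  shows "distr M N P = distr \<nu> N h"
    and "\<phi> \<in> borel_measurable N \<Longrightarrow> integral\<^sup>L M (\<lambda>\<omega>. \<phi> (P \<omega>)) = integral\<^sup>L \<nu> (\<lambda>q. \<phi> (h q))"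
proof -
  interpret sigma_finite_subalgebra M F by (rule sigma_finite_subalgebraI[OF F])
  interpret D: prob_space "distr \<nu> N h" by (rule prob_space.prob_space_distr[OF \<nu> h])
  interpret E: prob_space "distr M N P" by (rule prob_space_distr[OF P])
  show 1: "distr M N P = distr \<nu> N h"
  proof (rule measure_eqI)
    fix A assume "A \<in> sets (distr M N P)"
    then have A: "A \<in> sets N" by simp
    have [measurable]: "P -` A \<inter> space M \<in> sets M" using P A by (rule measurable_sets)
    have "measure (distr M N P) A = prob (P -` A \<inter> space M)" by (rule measure_distr[OF P A])
    also have "\<dots> = integral\<^sup>L M (indicat_real (P -` A \<inter> space M))" by simp
    also have "\<dots> = integral\<^sup>L M (real_cond_exp M F (indicat_real (P -` A \<inter> space M)))"
      by (intro real_cond_exp_int(2)[symmetric] integrable_const_bound[where B = 1]) auto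
    also have "\<dots> = integral\<^sup>L M (\<lambda>\<omega>. measure (distr \<nu> N h) A)"
      using law[OF A] by (intro integral_cong_AE) auto
    also have "\<dots> = measure (distr \<nu> N h) A" by (simp add: prob_space)
    finally show "emeasure (distr M N P) A = emeasure (distr \<nu> N h) A"
      by (simp add: D.emeasure_eq_measure E.emeasure_eq_measure)
  qed simp
  show "integral\<^sup>L M (\<lambda>\<omega>. \<phi> (P \<omega>)) = integral\<^sup>L \<nu> (\<lambda>q. \<phi> (h q))" if "\<phi> \<in> borel_measurable N"
    using 1 integral_distr[OF P that] integral_distr[OF h that] by simp
qed

lemma AE_distr_transfer:
  assumes P: "P \<in> measurable M N" and h: "h \<in> measurable \<nu> N" and "distr M N P = distr \<nu> N h"
    and S: "{y \<in> space N. Q y} \<in> sets N" and "AE q in \<nu>. Q (h q)"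
  shows "AE \<omega> in M. Q (P \<omega>)"
  using AE_distr_iff[OF P S] AE_distr_iff[OF h S] assms(3,5) by metis

text \<open>The signs are independent and centred. As the product runs over a set, no sign is
  repeated; coinciding signs have to be removed beforehand, as squares equal to 1.\<close>

lemma expectation_signs:
  assumes iv: "indep_vars (\<lambda>_. borel) S I"
    and val: "\<And>i \<omega>. i \<in> I \<Longrightarrow> \<omega> \<in> space M \<Longrightarrow> S i \<omega> \<in> {-1, 1}"
    and half: "\<And>i. i \<in> I \<Longrightarrow> prob {\<omega> \<in> space M. S i \<omega> = 1} = 1 / 2"
      "\<And>i. i \<in> I \<Longrightarrow> prob {\<omega> \<in> space M. S i \<omega> = - 1} = 1 / 2"
    and J: "J \<subseteq> I" "finite J" "J \<noteq> {}"
  shows "integral\<^sup>L M (\<lambda>\<omega>. \<Prod>j\<in>J. S j \<omega> :: real) = 0"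
proof -
  have Sm [measurable]: "S i \<in> borel_measurable M" if "i \<in> I" for i using iv that by (simp add: indep_vars_def)
  have int: "integrable M (S i)" if "i \<in> I" for i
    by (rule integrable_const_bound[where B = 1]) (use val[OF that] Sm[OF that] in \<open>force intro!: AE_I2\<close>)+
  have zero: "integral\<^sup>L M (S i) = 0" if i: "i \<in> I" for i
  proof -
    have [measurable]: "{\<omega> \<in> space M. S i \<omega> = 1} \<in> sets M" "{\<omega> \<in> space M. S i \<omega> = - 1} \<in> sets M"
      using Sm[OF i] by measurable
    have "integral\<^sup>L M (S i) = integral\<^sup>L M (\<lambda>\<omega>. indicat_real {\<omega> \<in> space M. S i \<omega> = 1} \<omega> - indicat_real {\<omega> \<in> space M. S i \<omega> = - 1} \<omega>)"
      using val[OF i] by (intro Bochner_Integration.integral_cong refl) (auto simp: indicator_def)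
    also have "\<dots> = 0" using half[OF i]
      by (subst Bochner_Integration.integral_diff) (auto intro!: integrable_const_bound[where B = 1])
    finally show ?thesis .
  qed
  have "indep_vars (\<lambda>_. borel) S J" by (rule indep_vars_subset[OF iv J(1)])
  then have "integral\<^sup>L M (\<lambda>\<omega>. \<Prod>j\<in>J. S j \<omega>) = (\<Prod>j\<in>J. integral\<^sup>L M (S j))"
    using J int by (intro indep_vars_lebesgue_integral) auto
  also have "\<dots> = 0" using J zero by (auto simp: prod_zero_iff)
  finally show ?thesis .
qed

lemma expectation_indep_sigma:
  assumes ind: "indep_set A B" and X: "X \<in> borel_measurable M" "integrable M X" and Y: "Y \<in> borel_measurable M" "integrable M Y"
    and XA: "\<And>S. S \<in> sets borel \<Longrightarrow> X -` S \<inter> space M \<in> A"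
    and YB: "\<And>S. S \<in> sets borel \<Longrightarrow> Y -` S \<inter> space M \<in> B"
  shows "integral\<^sup>L M (\<lambda>\<omega>. X \<omega> * Y \<omega> :: real) = integral\<^sup>L M X * integral\<^sup>L M Y"
proof (rule indep_var_lebesgue_integral[OF _ X(2) Y(2)])
  \<comment> \<open>Preimages of the Borel sets already form a sigma-algebra, so generating changes
    nothing and membership in \<open>A\<close> or \<open>B\<close> can be checked directly.\<close>
  have s: "sigma_sets (space M) {Z -` A \<inter> space M |A. A \<in> sets borel} = {Z -` A \<inter> space M |A. A \<in> sets borel}"
    if "Z \<in> borel_measurable M" for Z :: "'a \<Rightarrow> real"
    by (rule sigma_sets_vimage_commute[of Z "space M" UNIV, of "sets borel", simplified, symmetric, unfolded sets.sigma_sets_eq[of borel, simplified]])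
  show "indep_var borel X borel Y"
    unfolding indep_var_eq s[OF X(1)] s[OF Y(1)] indep_set_def using X Y XA YB
    by (auto intro!: indep_sets_mono_sets[OF ind[unfolded indep_set_def]] split: bool.split)
qed

end

section \<open>Projectors, probes and filtrations of a run\<close>

lemma events_of_Pow: "events_of M N X \<subseteq> Pow (space M)"
  by (auto simp: events_of_def)

lemma events_of_sets: "X \<in> measurable M N \<Longrightarrow> events_of M N X \<subseteq> sets M"
  by (auto simp: events_of_def measurable_sets)

lemma measurable_sigma_events:
  assumes "events_of M N X \<subseteq> A" "A \<subseteq> Pow (space M)" "X \<in> measurable M N"
  shows "X \<in> measurable (sigma (space M) A) N"
proof (rule measurableI)
  fix S assume "S \<in> sets N"
  then have "X -` S \<inter> space M \<in> A" using assms(1) by (auto simp: events_of_def)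
  then show "X -` S \<inter> space (sigma (space M) A) \<in> sets (sigma (space M) A)"
    using assms(2) by (simp add: space_measure_of_conv)
qed (use assms(3) in \<open>auto simp: space_measure_of_conv dest: measurable_space\<close>)

lemma subalgebra_sigma:
  assumes "A \<subseteq> sets M"
  shows "subalgebra M (sigma (space M) A)"
proof -
  have "A \<subseteq> Pow (space M)" using assms sets.sets_into_space by blast
  then show ?thesis using sets.sigma_sets_subset[OF assms] by (simp add: subalgebra_def space_measure_of_conv)
qed

lemma subalgebra_trans: "subalgebra M G \<Longrightarrow> subalgebra G F \<Longrightarrow> subalgebra M F"
  by (auto simp: subalgebra_def)

context layered begin

text \<open>The sigma-algebra is a parameter since the same measurability lemmas are needed for the
  whole space, for \<open>filtP\<close> and for \<open>filtPP\<close>.\<close>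

definition rv_proj :: "'a measure \<Rightarrow> ('a \<Rightarrow> 'l \<Rightarrow> real Matrix.mat) \<Rightarrow> bool" where
  "rv_proj A P \<longleftrightarrow> (\<forall>l. (\<lambda>\<omega>. P \<omega> l) \<in> measurable A (mat_borel (m l) (r l)))"

lemma rv_proj_shaped: "rv_proj A P \<Longrightarrow> \<omega> \<in> space A \<Longrightarrow> shaped (P \<omega>)"
  unfolding rv_proj_def shaped_def using measurable_space[of "\<lambda>\<omega>. P \<omega> _" A "mat_borel _ _" \<omega>] by simp

lemma measurable_proj_entry:
  "rv_proj A P \<Longrightarrow> i < m l \<Longrightarrow> a < r l \<Longrightarrow> (\<lambda>\<omega>. P \<omega> l $$ (i, a)) \<in> borel_measurable A"
  using measurable_compose[of "\<lambda>\<omega>. P \<omega> l" A, OF _ measurable_mat_entry[of i "m l" a "r l"]]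
  unfolding rv_proj_def by simp

lemma gram_eq_col_proj: "gram P l i j = col_proj (r l) (P l) i j"
  by (simp add: gram_def col_proj_def)

lemma measurable_gram:
  "rv_proj A P \<Longrightarrow> i < m l \<Longrightarrow> j < m l \<Longrightarrow> (\<lambda>\<omega>. gram (P \<omega>) l i j) \<in> borel_measurable A"
  unfolding gram_def by (intro borel_measurable_sum borel_measurable_times measurable_proj_entry) auto

lemma measurable_Y_units:
  assumes "\<And>l i j. i < m l \<Longrightarrow> j < n l \<Longrightarrow> (\<lambda>\<omega>. inner (V \<omega>) (EY l i j)) \<in> borel_measurable A"
  shows "V \<in> borel_measurable A"
proof -
  have "(\<lambda>\<omega>. \<Sum>l\<in>UNIV. \<Sum>i<m l. \<Sum>j<n l. inner (V \<omega>) (EY l i j) *\<^sub>R EY l i j) \<in> borel_measurable A"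
    using assms by (intro borel_measurable_sum borel_measurable_scaleR) auto
  then show ?thesis using Y.representation by (metis (no_types, lifting) ext)
qed

lemma measurable_B_units:
  assumes "\<And>l a j. a < r l \<Longrightarrow> j < n l \<Longrightarrow> (\<lambda>\<omega>. inner (V \<omega>) (EB l a j)) \<in> borel_measurable A"
  shows "V \<in> borel_measurable A"
proof -
  have "(\<lambda>\<omega>. \<Sum>l\<in>UNIV. \<Sum>i<r l. \<Sum>j<n l. inner (V \<omega>) (EB l i j) *\<^sub>R EB l i j) \<in> borel_measurable A"
    using assms by (intro borel_measurable_sum borel_measurable_scaleR) auto
  then show ?thesis using B.representation by (metis (no_types, lifting) ext)
qed

lemma measurable_lift:
  assumes P: "rv_proj A P" and [measurable]: "V \<in> borel_measurable A"
  shows "(\<lambda>\<omega>. lift \<Lambda> (P \<omega>) (V \<omega>)) \<in> borel_measurable A"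
proof (rule measurable_Y_units)
  fix l i j assume ij: "i < m l" "j < n l"
  have "(\<lambda>\<omega>. \<Sum>a<r l. P \<omega> l $$ (i, a) * inner (V \<omega>) (EB l a j)) \<in> borel_measurable A"
    using ij by (intro borel_measurable_sum borel_measurable_times measurable_proj_entry[OF P]) auto
  then show "(\<lambda>\<omega>. inner (lift \<Lambda> (P \<omega>) (V \<omega>)) (EY l i j)) \<in> borel_measurable A"
    by (subst measurable_cong[OF inner_lift[OF rv_proj_shaped[OF P] ij]])
qed

lemma measurable_colift:
  assumes P: "rv_proj A P" and [measurable]: "U \<in> borel_measurable A"
  shows "(\<lambda>\<omega>. colift \<Lambda> (P \<omega>) (U \<omega>)) \<in> borel_measurable A"
proof (rule measurable_B_units)
  fix l a j assume aj: "a < r l" "j < n l"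
  have "(\<lambda>\<omega>. \<Sum>i<m l. P \<omega> l $$ (i, a) * inner (U \<omega>) (EY l i j)) \<in> borel_measurable A"
    using aj by (intro borel_measurable_sum borel_measurable_times measurable_proj_entry[OF P]) auto
  then show "(\<lambda>\<omega>. inner (colift \<Lambda> (P \<omega>) (U \<omega>)) (EB l a j)) \<in> borel_measurable A"
    by (subst measurable_cong[OF inner_colift[OF rv_proj_shaped[OF P] aj]])
qed

lemma measurable_single_block:
  assumes P: "rv_proj A P" and [measurable]: "U \<in> borel_measurable A"
  shows "(\<lambda>\<omega>. single_block \<Lambda> t ((P \<omega> t)\<^sup>T * blockY \<Lambda> (U \<omega>) t)) \<in> borel_measurable A"
proof (rule measurable_B_units)
  fix l a j assume aj: "a < r l" "j < n l"
  have "(\<lambda>\<omega>. if l = t then inner (colift \<Lambda> (P \<omega>) (U \<omega>)) (EB l a j) else 0) \<in> borel_measurable A"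
    using measurable_colift[OF assms] by simp
  then show "(\<lambda>\<omega>. inner (single_block \<Lambda> t ((P \<omega> t)\<^sup>T * blockY \<Lambda> (U \<omega>) t)) (EB l a j)) \<in> borel_measurable A"
    by (subst measurable_cong[OF inner_single_block_colift[OF rv_proj_shaped[OF P] aj]])
qed

end

section \<open>A run of the algorithm: entries of the corrected action and measurability of the
  iterates\<close>

locale bros = layered \<Lambda> + f: smooth_function f Lf1 + g: strongly_convex_family g Lg1 Lg2 \<mu>g
  for \<Lambda> :: "('l::finite, 'y::euclidean_space, 'b::euclidean_space) layout"
    and f g :: "'x::euclidean_space \<times> 'y \<Rightarrow> real" and Lf1 Lg1 Lg2 \<mu>g :: real +
  fixes \<sigma>f1 \<sigma>f2 \<sigma>g1 \<sigma>g2 :: real and R :: "('a, 'x, 'y, 'b, 'l) run"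
  assumes run: "bros_run \<Lambda> f g \<sigma>f1 \<sigma>f2 \<sigma>g1 \<sigma>g2 R"
begin

abbreviation "M \<equiv> pspace R"
abbreviation "xk \<equiv> it_x R"
abbreviation "Yk \<equiv> it_Y R"
abbreviation "Zk \<equiv> it_Z R"
abbreviation "hk \<equiv> it_h R"
abbreviation "Pk \<equiv> proj R"
abbreviation "F0 \<equiv> filt \<Lambda> R"
abbreviation "F1 \<equiv> filtP \<Lambda> R"
abbreviation "F2 \<equiv> filtPP \<Lambda> R"
abbreviation "Ho k \<omega> \<equiv> blinfun_apply (or_H R (Suc k) \<omega>)"
abbreviation "Jo k \<omega> \<equiv> blinfun_apply (or_J R (Suc k) \<omega>)"
abbreviation "hess k \<omega> \<equiv> hess22 g (xk k \<omega>) (Yk k \<omega>)"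
abbreviation "hessx k \<omega> \<equiv> hess12 g (xk k \<omega>) (Yk k \<omega>)"
abbreviation "gradf k \<omega> \<equiv> grad2 f (xk k \<omega>) (Yk k \<omega>)"
abbreviation "gradg k \<omega> \<equiv> grad2 g (xk k \<omega>) (Yk k \<omega>)"

sublocale prob_space M using run by (simp add: bros_run_def)

lemma A3: "assumption_A3 \<Lambda> R" and recursion: "bros_recursion \<Lambda> R"
  and A2: "assumption_A2 \<Lambda> R f g \<sigma>f1 \<sigma>f2 \<sigma>g1 \<sigma>g2"
  using run by (simp_all add: bros_run_def)

lemma rv_proj_M: "rv_proj M (Pk k)"
  using A3 by (simp add: assumption_A3_def Let_def rv_proj_def)

lemma shaped_P: "\<omega> \<in> space M \<Longrightarrow> shaped (Pk k \<omega>)"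
  by (rule rv_proj_shaped[OF rv_proj_M])

lemma measurable_oracles [measurable]:
  "or_Ux R (Suc k) \<in> borel_measurable M" "or_UY R (Suc k) \<in> borel_measurable M"
  "or_V R (Suc k) \<in> borel_measurable M" "or_H R (Suc k) \<in> borel_measurable M"
  "or_J R (Suc k) \<in> borel_measurable M"
  using A2 by (simp_all add: assumption_A2_def Let_def)

text \<open>Evaluating a random operator at a random direction: at a fixed vector evaluation is
  continuous in the operator, and a random direction is a measurable combination of basis
  vectors.\<close>

lemma measurable_Ho [measurable (raw)]:
  assumes [measurable]: "W \<in> borel_measurable M"
  shows "(\<lambda>\<omega>. Ho k \<omega> (W \<omega>)) \<in> borel_measurable M"
    "(\<lambda>\<omega>. Jo k \<omega> (W \<omega>)) \<in> borel_measurable M"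
proof -
  have b: "(\<lambda>\<omega>. blinfun_apply (T \<omega>) b) \<in> borel_measurable M" if "T \<in> borel_measurable M"
    for T :: "'a \<Rightarrow> 'b \<Rightarrow>\<^sub>L 'z::euclidean_space" and b
    by (rule borel_measurable_continuous_on[OF _ that]) (intro continuous_intros)
  have s: "(\<lambda>\<omega>. \<Sum>b\<in>Basis. inner (W \<omega>) b *\<^sub>R blinfun_apply (T \<omega>) b) \<in> borel_measurable M" if "T \<in> borel_measurable M"
    for T :: "'a \<Rightarrow> 'b \<Rightarrow>\<^sub>L 'z::euclidean_space"
    using b[OF that] by measurable
  have e: "(\<Sum>b\<in>Basis. inner w b *\<^sub>R blinfun_apply T b) = blinfun_apply T w" for T :: "'b \<Rightarrow>\<^sub>L 'z::euclidean_space" and w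
    by (subst (2) euclidean_representation[of w, symmetric]) (simp add: blinfun.sum_right blinfun.scaleR_right)
  show "(\<lambda>\<omega>. Ho k \<omega> (W \<omega>)) \<in> borel_measurable M"
    using s[OF measurable_oracles(4)] by (simp add: e)
  show "(\<lambda>\<omega>. Jo k \<omega> (W \<omega>)) \<in> borel_measurable M"
    using s[OF measurable_oracles(5)] by (simp add: e)
qed

abbreviation "\<xi> k \<omega> l a \<equiv> probe_xi R (Suc k) \<omega> l a"
abbreviation "\<upsilon> k \<omega> l j \<equiv> probe_u R (Suc k) \<omega> l j"

definition sgn_probe :: "nat \<Rightarrow> ('l \<times> nat) + ('l \<times> nat) \<Rightarrow> 'a \<Rightarrow> real" where
  "sgn_probe k = case_sum (\<lambda>(l, j) \<omega>. \<upsilon> k \<omega> l j) (\<lambda>(l, i) \<omega>. \<xi> k \<omega> l i)"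

definition probe_index :: "(('l \<times> nat) + ('l \<times> nat)) set" where
  "probe_index = (SIGMA l:UNIV. {..<n l}) <+> (SIGMA l:UNIV. {..<r l})"

lemma probes:
  shows "indep_vars (\<lambda>_. borel) (sgn_probe k) probe_index"
    and "\<And>i \<omega>. i \<in> probe_index \<Longrightarrow> \<omega> \<in> space M \<Longrightarrow> sgn_probe k i \<omega> \<in> {-1, 1}"
    and "\<And>i. i \<in> probe_index \<Longrightarrow> prob {\<omega> \<in> space M. sgn_probe k i \<omega> = 1} = 1 / 2"
    and "\<And>i. i \<in> probe_index \<Longrightarrow> prob {\<omega> \<in> space M. sgn_probe k i \<omega> = - 1} = 1 / 2"
proof -
  have "rademacher_probes \<Lambda> R k" using A3 by (simp add: assumption_A3_def Let_def)
  then show "indep_vars (\<lambda>_. borel) (sgn_probe k) probe_index"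
    and "\<And>i \<omega>. i \<in> probe_index \<Longrightarrow> \<omega> \<in> space M \<Longrightarrow> sgn_probe k i \<omega> \<in> {-1, 1}"
    and "\<And>i. i \<in> probe_index \<Longrightarrow> prob {\<omega> \<in> space M. sgn_probe k i \<omega> = 1} = 1 / 2"
    and "\<And>i. i \<in> probe_index \<Longrightarrow> prob {\<omega> \<in> space M. sgn_probe k i \<omega> = - 1} = 1 / 2"
    unfolding rademacher_probes_def Let_def sgn_probe_def probe_index_def by blast+
qed

lemma probe_values:
  "\<omega> \<in> space M \<Longrightarrow> j < n l \<Longrightarrow> \<upsilon> k \<omega> l j \<in> {-1, 1}"
  "\<omega> \<in> space M \<Longrightarrow> a < r l \<Longrightarrow> \<xi> k \<omega> l a \<in> {-1, 1}"
  using probes(2)[of "Inl (l, j)" \<omega> k] probes(2)[of "Inr (l, a)" \<omega> k]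
  by (auto simp: sgn_probe_def probe_index_def)

lemma measurable_probes:
  "j < n l \<Longrightarrow> (\<lambda>\<omega>. \<upsilon> k \<omega> l j) \<in> borel_measurable M"
  "a < r l \<Longrightarrow> (\<lambda>\<omega>. \<xi> k \<omega> l a) \<in> borel_measurable M"
proof -
  have "sgn_probe k i \<in> borel_measurable M" if "i \<in> probe_index" for i
    using probes(1)[of k] that by (simp add: indep_vars_def)
  from this[of "Inl (l, j)"] this[of "Inr (l, a)"]
  show "j < n l \<Longrightarrow> (\<lambda>\<omega>. \<upsilon> k \<omega> l j) \<in> borel_measurable M"
    "a < r l \<Longrightarrow> (\<lambda>\<omega>. \<xi> k \<omega> l a) \<in> borel_measurable M"
    by (auto simp: sgn_probe_def probe_index_def)
qed

text \<open>The directions in which the Hessian oracle is queried are this compressed single block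
  and the probe tuple \<open>dirW\<close>. Both are \<open>filtPP\<close>-measurable, as (A2)
  demands of random directions.\<close>

definition dirS :: "nat \<Rightarrow> 'l \<Rightarrow> 'a \<Rightarrow> 'b" where
  "dirS k t \<omega> = single_block \<Lambda> t ((Pk k \<omega> t)\<^sup>T * blockY \<Lambda> (Zk k \<omega>) t)"

definition dirW :: "nat \<Rightarrow> 'a \<Rightarrow> 'b" where
  "dirW k \<omega> = tupleB \<Lambda> (\<lambda>l. outer (xivec \<Lambda> R k \<omega> l) (uvec \<Lambda> R k \<omega> l))"

lemma inner_dirW:
  "a < r l \<Longrightarrow> j < n l \<Longrightarrow> inner (dirW k \<omega>) (EB l a j) = \<xi> k \<omega> l a * \<upsilon> k \<omega> l j"
  by (simp add: dirW_def inner_tupleB outer_def xivec_def uvec_def)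

text \<open>\<open>Aent\<close>, \<open>Cent\<close> and \<open>Bent\<close> are the entries of
  \<open>Aterm\<close>, \<open>Chat\<close> and \<open>Bsharp\<close> written as sums of real
  products, the form in which measurability, bounds and expectations are treated.\<close>

definition Aent :: "nat \<Rightarrow> 'a \<Rightarrow> 'l \<Rightarrow> 'l \<Rightarrow> nat \<Rightarrow> nat \<Rightarrow> real" where
  "Aent k \<omega> t l i j = (\<Sum>a<r l. Pk k \<omega> l $$ (i, a) * inner (Ho k \<omega> (dirS k t \<omega>)) (EB l a j))"

definition Cent :: "nat \<Rightarrow> 'a \<Rightarrow> 'l \<Rightarrow> nat \<Rightarrow> nat \<Rightarrow> real" where
  "Cent k \<omega> t i j = (\<Sum>q<n t. \<Sum>a<r t. inner (Zk k \<omega>) (EY t i q) * (\<xi> k \<omega> t a * \<upsilon> k \<omega> t j)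
     * inner (Ho k \<omega> (dirW k \<omega>)) (EB t a q))"

definition Bent :: "nat \<Rightarrow> 'a \<Rightarrow> 'l \<Rightarrow> nat \<Rightarrow> nat \<Rightarrow> real" where
  "Bent k \<omega> t i j = (\<Sum>a<r t. \<Sum>b<r t. \<Sum>q<n t. Pk k \<omega> t $$ (i, a) * inner (colift \<Lambda> (Pk k \<omega>) (Zk k \<omega>)) (EB t b q)
     * (\<xi> k \<omega> t a * \<upsilon> k \<omega> t q) * inner (Ho k \<omega> (dirW k \<omega>)) (EB t b j))"

lemma P_carrier: "\<omega> \<in> space M \<Longrightarrow> Pk k \<omega> l \<in> carrier_mat (m l) (r l)"
  using shaped_P by (simp add: shaped_def)

lemma Aterm_index:
  assumes "\<omega> \<in> space M" "i < m l" "j < n l"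
  shows "Aterm \<Lambda> R k \<omega> t l $$ (i, j) = Aent k \<omega> t l i j"
  using assms mult_mat_index[OF P_carrier[OF assms(1)] blockB_carrier, of i l j]
  by (simp add: Aterm_def Aent_def dirS_def Ztilde_def blockB_index)

lemma Mterm_index: "a < r t \<Longrightarrow> j < n t \<Longrightarrow> Mterm \<Lambda> R k \<omega> t $$ (a, j) = inner (Ho k \<omega> (dirW k \<omega>)) (EB t a j)"
  by (simp add: Mterm_def dirW_def blockB_index)

lemma Mterm_carrier: "Mterm \<Lambda> R k \<omega> t \<in> carrier_mat (r t) (n t)"
  by (simp add: Mterm_def blockB_carrier)

lemma MtermT_mult_index:
  assumes "v \<in> carrier_vec (r t)" "j < n t"
  shows "vec_index ((Mterm \<Lambda> R k \<omega> t)\<^sup>T *\<^sub>v v) j = (\<Sum>a<r t. inner (Ho k \<omega> (dirW k \<omega>)) (EB t a j) * vec_index v a)"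
proof -
  have c: "(Mterm \<Lambda> R k \<omega> t)\<^sup>T \<in> carrier_mat (n t) (r t)" using Mterm_carrier by simp
  show ?thesis using assms Mterm_carrier[of k \<omega> t] by (simp add: mult_mat_vec_index[OF c assms] Mterm_index)
qed

lemma Chat_index:
  assumes "i < m t" "j < n t"
  shows "Chat \<Lambda> R k \<omega> t $$ (i, j) = Cent k \<omega> t i j"
proof -
  let ?w = "(Mterm \<Lambda> R k \<omega> t)\<^sup>T *\<^sub>v xivec \<Lambda> R k \<omega> t"
  have x: "xivec \<Lambda> R k \<omega> t \<in> carrier_vec (r t)" by (simp add: xivec_def)
  have w: "dim_vec ?w = n t" using Mterm_carrier[of k \<omega> t] by simp
  have o: "outer ?w (uvec \<Lambda> R k \<omega> t) \<in> carrier_mat (n t) (n t)" using w by (simp add: outer_def uvec_def)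
  have "Chat \<Lambda> R k \<omega> t $$ (i, j) = (\<Sum>q<n t. inner (Zk k \<omega>) (EY t i q) * (vec_index ?w q * \<upsilon> k \<omega> t j))"
    unfolding Chat_def using assms w
    by (simp add: mult_mat_index[OF blockY_carrier o] blockY_index) (simp add: outer_def uvec_def)
  also have "\<dots> = Cent k \<omega> t i j"
    unfolding Cent_def
    by (intro sum.cong refl) (simp add: MtermT_mult_index[OF x], simp add: xivec_def sum_distrib_left sum_distrib_right mult_ac)
  finally show ?thesis .
qed

lemma Bsharp_index:
  assumes "\<omega> \<in> space M" "i < m t" "j < n t"
  shows "Bsharp \<Lambda> R k \<omega> t $$ (i, j) = Bent k \<omega> t i j"
proof -
  let ?z = "Ztilde \<Lambda> R k \<omega> t *\<^sub>v uvec \<Lambda> R k \<omega> t"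
  let ?w = "(Mterm \<Lambda> R k \<omega> t)\<^sup>T *\<^sub>v ?z"
  have Zc: "Ztilde \<Lambda> R k \<omega> t \<in> carrier_mat (r t) (n t)"
    unfolding Ztilde_def using P_carrier[OF assms(1), of k t] blockY_carrier[of "Zk k \<omega>" t] by simp
  have Ze: "Ztilde \<Lambda> R k \<omega> t $$ (b, q) = inner (colift \<Lambda> (Pk k \<omega>) (Zk k \<omega>)) (EB t b q)" if "b < r t" "q < n t" for b q
    using that by (simp add: colift_def inner_tupleB Ztilde_def)
  have uc: "uvec \<Lambda> R k \<omega> t \<in> carrier_vec (n t)" by (simp add: uvec_def)
  have zc: "?z \<in> carrier_vec (r t)" by (rule mult_mat_vec_carrier[OF Zc uc])
  have z: "vec_index ?z b = (\<Sum>q<n t. inner (colift \<Lambda> (Pk k \<omega>) (Zk k \<omega>)) (EB t b q) * \<upsilon> k \<omega> t q)" if "b < r t" for b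
    using that by (simp add: mult_mat_vec_index[OF Zc uc] Ze) (simp add: uvec_def)
  have w: "dim_vec ?w = n t" using Mterm_carrier[of k \<omega> t] by simp
  have o: "outer (xivec \<Lambda> R k \<omega> t) ?w \<in> carrier_mat (r t) (n t)" using w by (simp add: outer_def xivec_def)
  have "Bsharp \<Lambda> R k \<omega> t $$ (i, j) = (\<Sum>a<r t. Pk k \<omega> t $$ (i, a) * (\<xi> k \<omega> t a * vec_index ?w j))"
    unfolding Bsharp_def using assms w
    by (simp add: mult_mat_index[OF P_carrier[OF assms(1)] o]) (simp add: outer_def xivec_def)
  also have "\<dots> = Bent k \<omega> t i j"
    unfolding Bent_def MtermT_mult_index[OF zc assms(3)]
    by (intro sum.cong refl) (simp add: z sum_distrib_left sum_distrib_right mult_ac)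
  finally show ?thesis .
qed

definition c1 :: "'l \<Rightarrow> real" where
  "c1 t = real (r t) * (real (m t) - 1) * (real (m t) + 2) / (real (m t) * (real (m t) * real (r t) + real (m t) - 2))"
definition c2 :: "'l \<Rightarrow> real" where
  "c2 t = (real (m t) - real (r t)) / (real (m t) * real (r t) + real (m t) - 2)"
definition c3 :: "'l \<Rightarrow> real" where
  "c3 t = real (r t) * (real (m t) - 1) * (real (m t) - real (r t)) / (real (m t) * (real (r t) - 1) * (real (m t) * real (r t) + real (m t) - 2))"

lemma inner_HZhat:
  assumes "\<omega> \<in> space M" "i < m l" "j < n l"
  shows "inner (HZhat \<Lambda> R k \<omega>) (EY l i j)
    = c1 l * Aent k \<omega> l l i j - c2 l * Cent k \<omega> l i j + c3 l * (Aent k \<omega> l l i j - Bent k \<omega> l i j)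
      + (\<Sum>t\<in>UNIV - {l}. Aent k \<omega> t l i j)"
proof -
  \<comment> \<open>Entrywise evaluation of matrix sums and differences is valid within the
    dimensions only, so the dimensions of all three terms are needed.\<close>
  have A: "Aterm \<Lambda> R k \<omega> l l \<in> carrier_mat (m l) (n l)"
    unfolding Aterm_def using P_carrier[OF assms(1), of k l] blockB_carrier[of _ l] by (metis mult_carrier_mat)
  have C: "Chat \<Lambda> R k \<omega> l \<in> carrier_mat (m l) (n l)"
    using blockY_carrier[of "Zk k \<omega>" l] by (auto simp: Chat_def outer_def uvec_def)
  have Bc: "Bsharp \<Lambda> R k \<omega> l \<in> carrier_mat (m l) (n l)"
    using P_carrier[OF assms(1), of k l] Mterm_carrier[of k \<omega> l] by (auto simp: Bsharp_def outer_def)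
  show ?thesis using assms A C Bc
    by (simp add: HZhat_def inner_tupleY Hdiag_def Let_def c1_def[symmetric] c2_def[symmetric] c3_def[symmetric]
        Aterm_index Chat_index Bsharp_index)
qed

lemma measurable_dirS_gen:
  assumes "rv_proj A (Pk k)" "Zk k \<in> borel_measurable A"
  shows "dirS k t \<in> borel_measurable A"
  using measurable_single_block[OF assms] by (simp add: dirS_def[abs_def])

lemma measurable_dirW_gen:
  assumes "\<And>l j. j < n l \<Longrightarrow> (\<lambda>\<omega>. \<upsilon> k \<omega> l j) \<in> borel_measurable A"
    "\<And>l a. a < r l \<Longrightarrow> (\<lambda>\<omega>. \<xi> k \<omega> l a) \<in> borel_measurable A"
  shows "dirW k \<in> borel_measurable A"
  by (rule measurable_B_units) (simp add: inner_dirW assms borel_measurable_times)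

lemma measurable_dirW [measurable]: "dirW k \<in> borel_measurable M"
  by (rule measurable_dirW_gen) (simp_all add: measurable_probes)

lemma measurable_HZhat:
  assumes Z: "Zk k \<in> borel_measurable M"
  shows "HZhat \<Lambda> R k \<in> borel_measurable M"
proof (rule measurable_Y_units)
  fix l i j assume ij: "i < m l" "j < n l"
  note [measurable] = Z
  have [measurable]: "dirS k t \<in> borel_measurable M" for t by (rule measurable_dirS_gen[OF rv_proj_M Z])
  have A: "(\<lambda>\<omega>. Aent k \<omega> t l i j) \<in> borel_measurable M" for t
    unfolding Aent_def using ij
    by (intro borel_measurable_sum borel_measurable_times measurable_proj_entry[OF rv_proj_M]) auto
  have C: "(\<lambda>\<omega>. Cent k \<omega> l i j) \<in> borel_measurable M"
    unfolding Cent_def using ij by (intro borel_measurable_sum borel_measurable_times measurable_probes) auto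
  have Bm: "(\<lambda>\<omega>. Bent k \<omega> l i j) \<in> borel_measurable M"
    unfolding Bent_def using ij measurable_colift[OF rv_proj_M Z]
    by (intro borel_measurable_sum borel_measurable_times measurable_probes measurable_proj_entry[OF rv_proj_M]) auto
  have "(\<lambda>\<omega>. c1 l * Aent k \<omega> l l i j - c2 l * Cent k \<omega> l i j + c3 l * (Aent k \<omega> l l i j - Bent k \<omega> l i j)
      + (\<Sum>t\<in>UNIV - {l}. Aent k \<omega> t l i j)) \<in> borel_measurable M"
    using A C Bm by (intro borel_measurable_add borel_measurable_diff borel_measurable_times borel_measurable_sum) auto
  then show "(\<lambda>\<omega>. inner (HZhat \<Lambda> R k \<omega>) (EY l i j)) \<in> borel_measurable M"
    by (subst measurable_cong[OF inner_HZhat[OF _ ij]])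
qed

lemma measurable_hats:
  assumes Z: "Zk k \<in> borel_measurable M"
  shows "Vhat \<Lambda> R k \<in> borel_measurable M" "Shat \<Lambda> R k \<in> borel_measurable M" "What \<Lambda> R k \<in> borel_measurable M"
proof -
  note [measurable] = measurable_lift[OF rv_proj_M] measurable_HZhat[OF Z] measurable_colift[OF rv_proj_M Z]
  show "Vhat \<Lambda> R k \<in> borel_measurable M" unfolding Vhat_def[abs_def] by measurable
  show "Shat \<Lambda> R k \<in> borel_measurable M" unfolding Shat_def[abs_def] by measurable
  show "What \<Lambda> R k \<in> borel_measurable M" unfolding What_def[abs_def] by measurable
qed

text \<open>Measurability of the iterates is derived along the recursion, starting from
  deterministic initial values. The recursion is assumed on \<open>space M\<close> only, whence the
  congruence rules.\<close>

lemma measurable_iterates [measurable]: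
  "xk k \<in> borel_measurable M" "Yk k \<in> borel_measurable M" "Zk k \<in> borel_measurable M" "hk k \<in> borel_measurable M"
proof -
  have "xk k \<in> borel_measurable M \<and> Yk k \<in> borel_measurable M \<and> Zk k \<in> borel_measurable M \<and> hk k \<in> borel_measurable M"
  proof (induction k)
    case 0
    obtain x0 Y0 Z0 where i: "\<And>\<omega>. \<omega> \<in> space M \<Longrightarrow> xk 0 \<omega> = x0 \<and> Yk 0 \<omega> = Y0 \<and> Zk 0 \<omega> = Z0 \<and> hk 0 \<omega> = 0"
      using recursion unfolding bros_recursion_def by blast
    then show ?case
      using measurable_cong[of M "xk 0" "\<lambda>_. x0" borel] measurable_cong[of M "Yk 0" "\<lambda>_. Y0" borel]
        measurable_cong[of M "Zk 0" "\<lambda>_. Z0" borel] measurable_cong[of M "hk 0" "\<lambda>_. 0" borel] by auto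
  next
    case (Suc k)
    then have [measurable]: "xk k \<in> borel_measurable M" "Yk k \<in> borel_measurable M" "Zk k \<in> borel_measurable M" "hk k \<in> borel_measurable M"
      by auto
    note [measurable] = measurable_hats[OF \<open>Zk k \<in> borel_measurable M\<close>]
    have s: "\<And>\<omega>. \<omega> \<in> space M \<Longrightarrow> xk (Suc k) \<omega> = xk k \<omega> - step_x R k *\<^sub>R hk k \<omega>"
      "\<And>\<omega>. \<omega> \<in> space M \<Longrightarrow> Yk (Suc k) \<omega> = Yk k \<omega> - step_Y R k *\<^sub>R Vhat \<Lambda> R k \<omega>"
      "\<And>\<omega>. \<omega> \<in> space M \<Longrightarrow> Zk (Suc k) \<omega> = Zk k \<omega> - step_Z R k *\<^sub>R Shat \<Lambda> R k \<omega>"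
      "\<And>\<omega>. \<omega> \<in> space M \<Longrightarrow> hk (Suc k) \<omega> = (1 - step_h R k) *\<^sub>R hk k \<omega> + step_h R k *\<^sub>R What \<Lambda> R k \<omega>"
      using recursion unfolding bros_recursion_def by blast+
    show ?case
      by (intro conjI measurable_cong[OF s(1), THEN iffD2] measurable_cong[OF s(2), THEN iffD2]
          measurable_cong[OF s(3), THEN iffD2] measurable_cong[OF s(4), THEN iffD2]; measurable)
  qed
  then show "xk k \<in> borel_measurable M" "Yk k \<in> borel_measurable M" "Zk k \<in> borel_measurable M" "hk k \<in> borel_measurable M" by auto
qed

section \<open>The three filtrations\<close>

lemma F0_sets: "subalgebra M (F0 k)"
  unfolding filt_def using measurable_iterates rv_proj_M
  by (intro subalgebra_sigma Un_least UN_least events_of_sets) (auto simp: rv_proj_def)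

lemma F1_F0: "subalgebra (F1 k) (F0 k)" and F1_sets: "subalgebra M (F1 k)"
proof -
  let ?A = "sets (F0 k) \<union> (\<Union>l. events_of M (mat_borel (m l) (r l)) (\<lambda>\<omega>. Pk k \<omega> l))"
  have A: "?A \<subseteq> sets M" using F0_sets[of k] rv_proj_M[of k]
    by (intro Un_least UN_least events_of_sets) (auto simp: rv_proj_def subalgebra_def)
  show "subalgebra M (F1 k)" unfolding filtP_def by (rule subalgebra_sigma[OF A])
  have "?A \<subseteq> Pow (space M)" using A sets.sets_into_space by blast
  then show "subalgebra (F1 k) (F0 k)" using F0_sets[of k]
    by (auto simp: subalgebra_def filtP_def space_measure_of_conv)
qed

lemma F2_F1: "subalgebra (F2 k) (F1 k)" and F2_sets: "subalgebra M (F2 k)"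
proof -
  let ?A = "sets (F1 k) \<union> probe_events \<Lambda> R k"
  have "probe_events \<Lambda> R k \<subseteq> sets M" unfolding probe_events_def
    by (intro Un_least UN_least events_of_sets measurable_probes) auto
  then have A: "?A \<subseteq> sets M" using F1_sets[of k] by (auto simp: subalgebra_def)
  show "subalgebra M (F2 k)" unfolding filtPP_def by (rule subalgebra_sigma[OF A])
  have "?A \<subseteq> Pow (space M)" using A sets.sets_into_space by blast
  then show "subalgebra (F2 k) (F1 k)" using F1_sets[of k]
    by (auto simp: subalgebra_def filtPP_def space_measure_of_conv)
qed

lemmas F2_F0 = subalgebra_trans[OF F2_F1 F1_F0]

lemma measurable_F0: "xk k \<in> borel_measurable (F0 k)" "Yk k \<in> borel_measurable (F0 k)" "Zk k \<in> borel_measurable (F0 k)"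
proof -
  let ?A = "(\<Union>i\<le>k. events_of M borel (xk i)) \<union> (\<Union>i\<le>k. events_of M borel (Yk i)) \<union>
      (\<Union>i\<le>k. events_of M borel (Zk i)) \<union> (\<Union>i\<le>k. events_of M borel (hk i)) \<union>
      (\<Union>i<k. \<Union>l. events_of M (mat_borel (m l) (r l)) (\<lambda>\<omega>. Pk i \<omega> l))"
  have P: "?A \<subseteq> Pow (space M)" by (intro Un_least UN_least events_of_Pow)
  show "xk k \<in> borel_measurable (F0 k)" "Yk k \<in> borel_measurable (F0 k)" "Zk k \<in> borel_measurable (F0 k)"
    unfolding filt_def by (rule measurable_sigma_events[OF _ P]; auto)+
qed

lemma rv_proj_F1: "rv_proj (F1 k) (Pk k)"
  unfolding rv_proj_def
proof
  fix l
  let ?A = "sets (F0 k) \<union> (\<Union>l. events_of M (mat_borel (m l) (r l)) (\<lambda>\<omega>. Pk k \<omega> l))"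
  have P: "?A \<subseteq> Pow (space M)"
    using F0_sets[of k] sets.sets_into_space[of _ M] by (intro Un_least UN_least events_of_Pow) (auto simp: subalgebra_def)
  show "(\<lambda>\<omega>. Pk k \<omega> l) \<in> measurable (F1 k) (mat_borel (m l) (r l))"
    unfolding filtP_def by (rule measurable_sigma_events[OF _ P]) (use rv_proj_M[of k] in \<open>auto simp: rv_proj_def\<close>)
qed

lemma measurable_F1: "X \<in> measurable (F0 k) N \<Longrightarrow> X \<in> measurable (F1 k) N"
  and measurable_F2: "X \<in> measurable (F1 k) N \<Longrightarrow> X \<in> measurable (F2 k) N"
  using measurable_from_subalg[OF F1_F0] measurable_from_subalg[OF F2_F1] by auto

lemma rv_proj_F2: "rv_proj (F2 k) (Pk k)"
  using rv_proj_F1[of k] measurable_F2[of _ k] unfolding rv_proj_def by auto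

text \<open>Measurability for the sigma-algebra of the probes alone. That is the one which (A2)
  makes independent of the past and of the projectors, and \<open>filtPP\<close> would be too
  large.\<close>

lemma measurable_probes_sigma:
  "j < n l \<Longrightarrow> (\<lambda>\<omega>. \<upsilon> k \<omega> l j) \<in> borel_measurable (sigma (space M) (probe_events \<Lambda> R k))"
  "a < r l \<Longrightarrow> (\<lambda>\<omega>. \<xi> k \<omega> l a) \<in> borel_measurable (sigma (space M) (probe_events \<Lambda> R k))"
proof -
  have P: "probe_events \<Lambda> R k \<subseteq> Pow (space M)"
    unfolding probe_events_def by (intro Un_least UN_least events_of_Pow)
  show "j < n l \<Longrightarrow> (\<lambda>\<omega>. \<upsilon> k \<omega> l j) \<in> borel_measurable (sigma (space M) (probe_events \<Lambda> R k))"
    "a < r l \<Longrightarrow> (\<lambda>\<omega>. \<xi> k \<omega> l a) \<in> borel_measurable (sigma (space M) (probe_events \<Lambda> R k))"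
    by (rule measurable_sigma_events[OF _ P], force simp: probe_events_def, simp add: measurable_probes)+
qed

lemma measurable_probes_F2:
  "j < n l \<Longrightarrow> (\<lambda>\<omega>. \<upsilon> k \<omega> l j) \<in> borel_measurable (F2 k)"
  "a < r l \<Longrightarrow> (\<lambda>\<omega>. \<xi> k \<omega> l a) \<in> borel_measurable (F2 k)"
proof -
  have P: "sets (F1 k) \<union> probe_events \<Lambda> R k \<subseteq> Pow (space M)"
    using F1_sets[of k] sets.sets_into_space[of _ M] unfolding probe_events_def
    by (intro Un_least UN_least events_of_Pow) (auto simp: subalgebra_def)
  show "j < n l \<Longrightarrow> (\<lambda>\<omega>. \<upsilon> k \<omega> l j) \<in> borel_measurable (F2 k)"
    "a < r l \<Longrightarrow> (\<lambda>\<omega>. \<xi> k \<omega> l a) \<in> borel_measurable (F2 k)"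
    unfolding filtPP_def
    by (rule measurable_sigma_events[OF _ P], force simp: probe_events_def, simp add: measurable_probes)+
qed

lemma measurable_dirW_F2: "dirW k \<in> borel_measurable (F2 k)"
  by (rule measurable_dirW_gen) (simp_all add: measurable_probes_F2)

lemma measurable_dirS_F2: "dirS k t \<in> borel_measurable (F2 k)"
  by (rule measurable_dirS_gen[OF rv_proj_F2]) (intro measurable_F2 measurable_F1 measurable_F0)

lemma measurable_colift_F2: "(\<lambda>\<omega>. colift \<Lambda> (Pk k \<omega>) (Zk k \<omega>)) \<in> borel_measurable (F2 k)"
  by (rule measurable_colift[OF rv_proj_F2]) (intro measurable_F2 measurable_F1 measurable_F0)

lemma haar_law:
  obtains \<nu> where "haar_columns (m l) (r l) \<nu>"
    "\<And>A. A \<in> sets (mat_borel (m l) (r l)) \<Longrightarrow> AE \<omega> in M.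
       real_cond_exp M (F0 k) (indicat_real ((\<lambda>\<omega>. Pk k \<omega> l) -` A \<inter> space M)) \<omega>
         = measure (distr \<nu> (mat_borel (m l) (r l)) (\<lambda>Q. sqrt (real (m l) / real (r l)) \<cdot>\<^sub>m first_cols (m l) (r l) Q)) A"
proof -
  obtain \<nu> where "haar_orthogonal (m l) \<nu>" and
    2: "\<forall>A\<in>sets (mat_borel (m l) (r l)). AE \<omega> in M.
       real_cond_exp M (F0 k) (indicat_real ((\<lambda>\<omega>. Pk k \<omega> l) -` A \<inter> space M)) \<omega>
         = measure (distr \<nu> (mat_borel (m l) (r l)) (\<lambda>Q. sqrt (real (m l) / real (r l)) \<cdot>\<^sub>m first_cols (m l) (r l) Q)) A"
    using A3 unfolding assumption_A3_def Let_def by blast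
  then have "haar_columns (m l) (r l) \<nu>" by unfold_locales (auto simp: sizes)
  with 2 show ?thesis using that by blast
qed

end

context haar_columns begin

definition scaled :: "real Matrix.mat \<Rightarrow> real Matrix.mat" where
  "scaled Q = sqrt (real p / real r) \<cdot>\<^sub>m first_cols p r Q"

lemma scaled_index: "i < p \<Longrightarrow> a < r \<Longrightarrow> scaled Q $$ (i, a) = sqrt (real p / real r) * Q $$ (i, a)"
  by (simp add: scaled_def first_cols_def)

lemma measurable_scaled: "scaled \<in> measurable \<nu> (mat_borel p r)"
proof (rule measurable_into_mat_borel)
  fix i j assume ij: "i < p" "j < r"
  have "(\<lambda>Q. sqrt (real p / real r) * Q $$ (i, j)) \<in> borel_measurable \<nu>"
    using ij rp by (intro borel_measurable_times measurable_entry) auto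
  then show "(\<lambda>Q. scaled Q $$ (i, j)) \<in> borel_measurable \<nu>" using ij by (simp add: scaled_index)
qed (simp add: scaled_def first_cols_def)

text \<open>The square-root scaling of the columns multiplies the projection by
  \<open>p / r\<close>; this turns the mean \<open>r / p\<close> into 1.\<close>

lemma col_proj_scaled:
  "i < p \<Longrightarrow> j < p \<Longrightarrow> col_proj r (scaled Q) i j = real p / real r * col_proj r Q i j"
proof -
  have "sqrt (real p / real r) * (sqrt (real p / real r) * x) = real p / real r * x" for x
    by (simp add: mult.assoc[symmetric])
  then show "i < p \<Longrightarrow> j < p \<Longrightarrow> ?thesis"
    by (simp add: col_proj_def scaled_index sum_distrib_left mult_ac)
qed

end

lemma measurable_col_proj_mat:
  "i < p \<Longrightarrow> j < p \<Longrightarrow> (\<lambda>A. col_proj r A i j) \<in> borel_measurable (mat_borel p r)"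
  unfolding col_proj_def by (intro borel_measurable_sum borel_measurable_times measurable_mat_entry) auto

section \<open>Moments of the projectors and of the probes along a run\<close>

context bros begin

text \<open>Orthonormality of the columns holds almost surely for the Haar matrix and is transported
  to the projector through equality of laws. It is therefore an almost sure fact only, and so are
  the norm bounds built on it.\<close>

lemma AE_frame: "AE \<omega> in M. frame (Pk k \<omega>)"
proof -
  have "AE \<omega> in M. \<forall>l\<in>UNIV. \<forall>a\<in>{..<r l}. \<forall>b\<in>{..<r l}.
      (\<Sum>i<m l. Pk k \<omega> l $$ (i, a) * Pk k \<omega> l $$ (i, b)) = real (m l) / real (r l) * of_bool (a = b)"
  proof (rule AE_finite_allI)
    fix l
    obtain \<nu> where \<nu>: "haar_columns (m l) (r l) \<nu>" and
      law: "\<And>A. A \<in> sets (mat_borel (m l) (r l)) \<Longrightarrow> AE \<omega> in M.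
       real_cond_exp M (F0 k) (indicat_real ((\<lambda>\<omega>. Pk k \<omega> l) -` A \<inter> space M)) \<omega>
         = measure (distr \<nu> (mat_borel (m l) (r l)) (\<lambda>Q. sqrt (real (m l) / real (r l)) \<cdot>\<^sub>m first_cols (m l) (r l) Q)) A"
      using haar_law by metis
    interpret H: haar_columns "m l" "r l" \<nu> by (rule \<nu>)
    have P: "(\<lambda>\<omega>. Pk k \<omega> l) \<in> measurable M (mat_borel (m l) (r l))" using rv_proj_M by (simp add: rv_proj_def)
    have d: "distr M (mat_borel (m l) (r l)) (\<lambda>\<omega>. Pk k \<omega> l) = distr \<nu> (mat_borel (m l) (r l)) H.scaled"
      by (rule expectation_law(1)[OF F0_sets P H.prob_space_axioms H.measurable_scaled])
        (use law in \<open>simp add: H.scaled_def[abs_def]\<close>)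
    show "AE \<omega> in M. \<forall>a\<in>{..<r l}. \<forall>b\<in>{..<r l}.
      (\<Sum>i<m l. Pk k \<omega> l $$ (i, a) * Pk k \<omega> l $$ (i, b)) = real (m l) / real (r l) * of_bool (a = b)"
    proof (rule AE_distr_transfer[OF P H.measurable_scaled d])
      \<comment> \<open>The transport between laws requires that the matrices with the property form
        a measurable set.\<close>
      let ?N = "mat_borel (m l) (r l)"
      have S: "{A \<in> space ?N. (\<Sum>i<m l. A $$ (i, a) * A $$ (i, b)) = real (m l) / real (r l) * of_bool (a = b)} \<in> sets ?N"
        if "a < r l" "b < r l" for a b
      proof -
        have "(\<lambda>A. \<Sum>i<m l. A $$ (i, a) * A $$ (i, b)) \<in> borel_measurable ?N"
          using that by (intro borel_measurable_sum borel_measurable_times measurable_mat_entry) auto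
        then show ?thesis by measurable
      qed
      show "{A \<in> space ?N. \<forall>a\<in>{..<r l}. \<forall>b\<in>{..<r l}.
          (\<Sum>i<m l. A $$ (i, a) * A $$ (i, b)) = real (m l) / real (r l) * of_bool (a = b)} \<in> sets ?N"
        by (intro sets.sets_Collect_finite_All finite_lessThan S) simp_all
      show "AE Q in \<nu>. \<forall>a\<in>{..<r l}. \<forall>b\<in>{..<r l}.
          (\<Sum>i<m l. H.scaled Q $$ (i, a) * H.scaled Q $$ (i, b)) = real (m l) / real (r l) * of_bool (a = b)"
        using H.AE_columns
      proof eventually_elim
        case (elim Q)
        show ?case
        proof (intro ballI)
          fix a b assume ab: "a \<in> {..<r l}" "b \<in> {..<r l}"
          let ?s = "sqrt (real (m l) / real (r l))"
          have "(\<Sum>i<m l. H.scaled Q $$ (i, a) * H.scaled Q $$ (i, b)) = (\<Sum>i<m l. (?s * ?s) * (Q $$ (i, a) * Q $$ (i, b)))"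
            using ab by (intro sum.cong refl) (simp only: H.scaled_index lessThan_iff mult_ac)
          also have "\<dots> = (?s * ?s) * (\<Sum>i<m l. Q $$ (i, a) * Q $$ (i, b))" by (rule sum_distrib_left[symmetric])
          also have "\<dots> = real (m l) / real (r l) * of_bool (a = b)"
            using elim ab sizes(3)[of l] by (simp add: order_less_le_trans)
          finally show "(\<Sum>i<m l. H.scaled Q $$ (i, a) * H.scaled Q $$ (i, b)) = real (m l) / real (r l) * of_bool (a = b)" .
        qed
      qed
    qed
  qed simp
  then show ?thesis
    using AE_space by eventually_elim (auto simp: frame_def shaped_P)
qed

text \<open>The second-moment tensor of \<open>S\<close>, that is of \<open>m / r\<close> times a
  random projection.\<close>

definition gram2 :: "'l \<Rightarrow> nat \<Rightarrow> nat \<Rightarrow> nat \<Rightarrow> nat \<Rightarrow> real" where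
  "gram2 l i j i' j' = (real (m l) / real (r l))\<^sup>2 *
     (wein_a (m l) (r l) * of_bool (i = j \<and> i' = j') + wein_b (m l) (r l) * (of_bool (i = i' \<and> j = j') + of_bool (i = j' \<and> j = i')))"

lemma gram_expectations:
  assumes ij: "i < m l" "j < m l"
  shows "integral\<^sup>L M (\<lambda>\<omega>. gram (Pk k \<omega>) l i j) = of_bool (i = j)"
    and "i' < m l \<Longrightarrow> j' < m l \<Longrightarrow> integral\<^sup>L M (\<lambda>\<omega>. gram (Pk k \<omega>) l i j * gram (Pk k \<omega>) l i' j') = gram2 l i j i' j'"
proof -
  obtain \<nu> where \<nu>: "haar_columns (m l) (r l) \<nu>" and
    law: "\<And>A. A \<in> sets (mat_borel (m l) (r l)) \<Longrightarrow> AE \<omega> in M.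
     real_cond_exp M (F0 k) (indicat_real ((\<lambda>\<omega>. Pk k \<omega> l) -` A \<inter> space M)) \<omega>
       = measure (distr \<nu> (mat_borel (m l) (r l)) (\<lambda>Q. sqrt (real (m l) / real (r l)) \<cdot>\<^sub>m first_cols (m l) (r l) Q)) A"
    using haar_law by metis
  interpret H: haar_columns "m l" "r l" \<nu> by (rule \<nu>)
  have P: "(\<lambda>\<omega>. Pk k \<omega> l) \<in> measurable M (mat_borel (m l) (r l))" using rv_proj_M by (simp add: rv_proj_def)
  have E: "integral\<^sup>L M (\<lambda>\<omega>. \<phi> (Pk k \<omega> l)) = integral\<^sup>L \<nu> (\<lambda>Q. \<phi> (H.scaled Q))"
    if "\<phi> \<in> borel_measurable (mat_borel (m l) (r l))" for \<phi> :: "real Matrix.mat \<Rightarrow> real"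
    by (rule expectation_law(2)[OF F0_sets P H.prob_space_axioms H.measurable_scaled _ that])
      (use law in \<open>simp add: H.scaled_def[abs_def]\<close>)
  have "real (r l) \<noteq> 0" "real (m l) \<noteq> 0" using sizes[of l] by auto
  then show "integral\<^sup>L M (\<lambda>\<omega>. gram (Pk k \<omega>) l i j) = of_bool (i = j)"
    using E[OF measurable_col_proj_mat[OF ij]] ij by (simp add: gram_eq_col_proj H.col_proj_scaled H.first_moment)
  show "integral\<^sup>L M (\<lambda>\<omega>. gram (Pk k \<omega>) l i j * gram (Pk k \<omega>) l i' j') = gram2 l i j i' j'"
    if "i' < m l" "j' < m l"
  proof -
    have "integral\<^sup>L M (\<lambda>\<omega>. gram (Pk k \<omega>) l i j * gram (Pk k \<omega>) l i' j')
        = integral\<^sup>L \<nu> (\<lambda>Q. col_proj (r l) (H.scaled Q) i j * col_proj (r l) (H.scaled Q) i' j')"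
      unfolding gram_eq_col_proj using ij that
      by (intro E[of "\<lambda>A. col_proj (r l) A i j * col_proj (r l) A i' j'"] borel_measurable_times measurable_col_proj_mat)
    also have "\<dots> = integral\<^sup>L \<nu> (\<lambda>Q. (real (m l) / real (r l))\<^sup>2 * (col_proj (r l) Q i j * col_proj (r l) Q i' j'))"
      using ij that by (simp add: H.col_proj_scaled power2_eq_square mult_ac)
    also have "\<dots> = gram2 l i j i' j'" using ij that by (simp add: H.second_moment gram2_def)
    finally show ?thesis .
  qed
qed

lemma integrable_gram:
  assumes "i < m l" "j < m l"
  shows "integrable M (\<lambda>\<omega>. gram (Pk k \<omega>) l i j)"
proof (rule integrable_const_bound[where B = "real (r l) * \<kappa>\<^sup>2"])
  show "AE \<omega> in M. norm (gram (Pk k \<omega>) l i j) \<le> real (r l) * \<kappa>\<^sup>2"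
    using AE_frame[of k] by eventually_elim (simp add: frame_gram_le[OF _ assms])
qed (rule measurable_gram[OF rv_proj_M assms])

lemma integrable_gram2:
  assumes "i < m l" "j < m l" "i' < m t" "j' < m t"
  shows "integrable M (\<lambda>\<omega>. gram (Pk k \<omega>) l i j * gram (Pk k \<omega>) t i' j')"
proof (rule integrable_const_bound[where B = "(real (r l) * \<kappa>\<^sup>2) * (real (r t) * \<kappa>\<^sup>2)"])
  show "AE \<omega> in M. norm (gram (Pk k \<omega>) l i j * gram (Pk k \<omega>) t i' j') \<le> (real (r l) * \<kappa>\<^sup>2) * (real (r t) * \<kappa>\<^sup>2)"
    using AE_frame[of k]
    by eventually_elim (auto simp: abs_mult intro!: mult_mono frame_gram_le assms)
qed (intro borel_measurable_times measurable_gram[OF rv_proj_M] assms)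

text \<open>Past-measurable factors and functions of distinct layers separate. It is used for one
  \<open>gram\<close>, for two in the same layer, and for two in different layers.\<close>

lemma expectation_gram_gen:
  fixes \<phi> :: "'l \<Rightarrow> real Matrix.mat \<Rightarrow> real"
  assumes X: "X \<in> borel_measurable (F0 k)" "integrable M X" and J: "finite J"
    and phi: "\<And>j. j \<in> J \<Longrightarrow> \<phi> j \<in> borel_measurable (mat_borel (m j) (r j))"
      "\<And>j. j \<in> J \<Longrightarrow> integrable M (\<lambda>\<omega>. \<phi> j (Pk k \<omega> j))"
  shows "integral\<^sup>L M (\<lambda>\<omega>. X \<omega> * (\<Prod>j\<in>J. \<phi> j (Pk k \<omega> j)))
    = integral\<^sup>L M X * (\<Prod>j\<in>J. integral\<^sup>L M (\<lambda>\<omega>. \<phi> j (Pk k \<omega> j)))"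
proof -
  have ci: "cond_indep_sets M (F0 k) (\<lambda>l. events_of M (mat_borel (m l) (r l)) (\<lambda>\<omega>. Pk k \<omega> l)) UNIV"
    using A3 by (simp add: assumption_A3_def Let_def)
  have "\<exists>c. \<forall>A\<in>sets (mat_borel (m l) (r l)). AE \<omega> in M.
       real_cond_exp M (F0 k) (indicat_real ((\<lambda>\<omega>. Pk k \<omega> l) -` A \<inter> space M)) \<omega> = c A" for l
    using A3 unfolding assumption_A3_def Let_def by blast
  then obtain c where c: "\<And>l A. A \<in> sets (mat_borel (m l) (r l)) \<Longrightarrow> AE \<omega> in M.
       real_cond_exp M (F0 k) (indicat_real ((\<lambda>\<omega>. Pk k \<omega> l) -` A \<inter> space M)) \<omega> = c l A"
    by metis
  show ?thesis
    by (rule expectation_cond_indep[where P = "\<lambda>l \<omega>. Pk k \<omega> l" and N = "\<lambda>l. mat_borel (m l) (r l)" and \<phi> = \<phi>,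
          OF F0_sets ci _ c _ J X phi]) (use rv_proj_M[of k] in \<open>auto simp: rv_proj_def\<close>)
qed

lemma expectation_gram:
  assumes X: "X \<in> borel_measurable (F0 k)" "integrable M X" and ij: "i < m l" "j < m l"
  shows "integral\<^sup>L M (\<lambda>\<omega>. X \<omega> * gram (Pk k \<omega>) l i j) = integral\<^sup>L M X * of_bool (i = j)"
  using expectation_gram_gen[OF X, of "{l}" "\<lambda>l A. col_proj (r l) A i j"] ij
    measurable_col_proj_mat[OF ij] integrable_gram[OF ij] gram_expectations(1)[OF ij]
  by (simp add: gram_eq_col_proj[symmetric])

lemma expectation_gram2_same:
  assumes X: "X \<in> borel_measurable (F0 k)" "integrable M X" and ij: "i < m l" "j < m l" "i' < m l" "j' < m l"
  shows "integral\<^sup>L M (\<lambda>\<omega>. X \<omega> * (gram (Pk k \<omega>) l i j * gram (Pk k \<omega>) l i' j')) = integral\<^sup>L M X * gram2 l i j i' j'"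
  using expectation_gram_gen[OF X, of "{l}" "\<lambda>l A. col_proj (r l) A i j * col_proj (r l) A i' j'"] ij
    borel_measurable_times[OF measurable_col_proj_mat[OF ij(1,2)] measurable_col_proj_mat[OF ij(3,4)]]
    integrable_gram2[OF ij] gram_expectations(2)[OF ij]
  by (simp add: gram_eq_col_proj[symmetric])

lemma expectation_gram2_diff:
  assumes X: "X \<in> borel_measurable (F0 k)" "integrable M X" and ij: "i < m l" "j < m l" "i' < m t" "j' < m t"
    and lt: "l \<noteq> t"
  shows "integral\<^sup>L M (\<lambda>\<omega>. X \<omega> * (gram (Pk k \<omega>) l i j * gram (Pk k \<omega>) t i' j')) = integral\<^sup>L M X * (of_bool (i = j) * of_bool (i' = j'))"
proof -
  define \<phi> where "\<phi> s A = (if s = l then col_proj (r l) A i j else col_proj (r t) A i' j')" for s A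
  have "integral\<^sup>L M (\<lambda>\<omega>. X \<omega> * (\<Prod>s\<in>{l, t}. \<phi> s (Pk k \<omega> s))) = integral\<^sup>L M X * (\<Prod>s\<in>{l, t}. integral\<^sup>L M (\<lambda>\<omega>. \<phi> s (Pk k \<omega> s)))"
    by (rule expectation_gram_gen[OF X])
      (use ij lt measurable_col_proj_mat integrable_gram in \<open>auto simp: \<phi>_def gram_eq_col_proj[symmetric]\<close>)
  then show ?thesis using lt gram_expectations(1)[OF ij(1,2)] gram_expectations(1)[OF ij(3,4)]
    by (simp add: \<phi>_def gram_eq_col_proj[symmetric])
qed

text \<open>The rank-one probe is isotropic: different entries are uncorrelated and every entry has
  square 1. The weight \<open>X\<close> may depend on the projectors, of which the probes are
  independent.\<close>

lemma expectation_probes: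
  assumes X: "X \<in> borel_measurable (F1 k)" "integrable M X"
    and ix: "a < r t" "b < r s" "j < n t" "q < n s"
  shows "integral\<^sup>L M (\<lambda>\<omega>. X \<omega> * ((\<xi> k \<omega> t a * \<upsilon> k \<omega> t j) * (\<xi> k \<omega> s b * \<upsilon> k \<omega> s q)))
    = integral\<^sup>L M X * of_bool (s = t \<and> b = a \<and> q = j)"
    and "integrable M (\<lambda>\<omega>. X \<omega> * ((\<xi> k \<omega> t a * \<upsilon> k \<omega> t j) * (\<xi> k \<omega> s b * \<upsilon> k \<omega> s q)))"
proof -
  let ?Y = "\<lambda>\<omega>. (\<xi> k \<omega> t a * \<upsilon> k \<omega> t j) * (\<xi> k \<omega> s b * \<upsilon> k \<omega> s q)"
  let ?\<Sigma> = "sigma (space M) (probe_events \<Lambda> R k)"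
  have Ys: "?Y \<in> borel_measurable ?\<Sigma>"
    using ix by (intro borel_measurable_times measurable_probes_sigma)
  have Ym: "?Y \<in> borel_measurable M" using ix by (intro borel_measurable_times measurable_probes)
  have Xm: "X \<in> borel_measurable M" by (rule measurable_from_subalg[OF F1_sets X(1)])
  have Yb: "\<bar>?Y \<omega>\<bar> = 1" if "\<omega> \<in> space M" for \<omega>
  proof -
    have "\<bar>\<xi> k \<omega> t a\<bar> = 1" "\<bar>\<upsilon> k \<omega> t j\<bar> = 1" "\<bar>\<xi> k \<omega> s b\<bar> = 1" "\<bar>\<upsilon> k \<omega> s q\<bar> = 1"
      using probe_values(1)[OF that ix(3), of k] probe_values(1)[OF that ix(4), of k]
        probe_values(2)[OF that ix(1), of k] probe_values(2)[OF that ix(2), of k] by auto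
    then show ?thesis by (simp add: abs_mult)
  qed
  have Yi: "integrable M ?Y"
    by (rule integrable_const_bound[OF AE_I2 Ym, of 1]) (simp add: Yb)
  show "integrable M (\<lambda>\<omega>. X \<omega> * ?Y \<omega>)"
  proof (rule Bochner_Integration.integrable_bound[OF X(2) borel_measurable_times[OF Xm Ym]])
    show "AE \<omega> in M. norm (X \<omega> * ?Y \<omega>) \<le> norm (X \<omega>)"
    proof (rule AE_I2)
      fix \<omega> assume "\<omega> \<in> space M"
      then have "norm (X \<omega> * ?Y \<omega>) = norm (X \<omega>) * 1" using Yb by (metis norm_mult real_norm_def)
      then show "norm (X \<omega> * ?Y \<omega>) \<le> norm (X \<omega>)" by simp
    qed
  qed
  have ind: "indep_set (sigma_sets (space M) (probe_events \<Lambda> R k))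
      (sigma_sets (space M) (sets (F1 k) \<union> \<Union> (set (oracle_events R k))))"
    using A2 by (simp add: assumption_A2_def Let_def)
  have pe: "probe_events \<Lambda> R k \<subseteq> Pow (space M)"
    unfolding probe_events_def by (intro Un_least UN_least events_of_Pow)
  have "integral\<^sup>L M (\<lambda>\<omega>. ?Y \<omega> * X \<omega>) = integral\<^sup>L M ?Y * integral\<^sup>L M X"
  proof (rule expectation_indep_sigma[OF ind Ym Yi Xm X(2)])
    fix S :: "real set" assume S: "S \<in> sets borel"
    show "?Y -` S \<inter> space M \<in> sigma_sets (space M) (probe_events \<Lambda> R k)"
      using measurable_sets[OF Ys S] pe by (simp add: space_measure_of_conv)
    have "X -` S \<inter> space M \<in> sets (F1 k)"
      using measurable_sets[OF X(1) S] F1_sets[of k] by (simp add: subalgebra_def)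
    then show "X -` S \<inter> space M \<in> sigma_sets (space M) (sets (F1 k) \<union> \<Union> (set (oracle_events R k)))"
      by (intro sigma_sets.Basic) simp
  qed
  moreover have "integral\<^sup>L M ?Y = of_bool (s = t \<and> b = a \<and> q = j)"
  proof -
    have pi: "Inl (t, j) \<in> probe_index" "Inl (s, q) \<in> probe_index" "Inr (t, a) \<in> probe_index" "Inr (s, b) \<in> probe_index"
      using ix by (auto simp: probe_index_def)
    have E: "integral\<^sup>L M (\<lambda>\<omega>. \<Prod>i\<in>J. sgn_probe k i \<omega>) = 0" if "J \<subseteq> probe_index" "finite J" "J \<noteq> {}" for J
      using expectation_signs[OF probes that] .
    have sq: "\<xi> k \<omega> t a * \<xi> k \<omega> t a = 1" "\<upsilon> k \<omega> t j * \<upsilon> k \<omega> t j = 1" if "\<omega> \<in> space M" for \<omega>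
      using probe_values(1)[OF that ix(3), of k] probe_values(2)[OF that ix(1), of k] by auto
    \<comment> \<open>The cases record whether the two row signs coincide and whether the two column
      signs do. A coinciding pair squares to 1; the remaining signs are distinct and have mean
      0.\<close>
    consider "(s, b) = (t, a)" "(s, q) = (t, j)" | "(s, b) = (t, a)" "(s, q) \<noteq> (t, j)"
      | "(s, b) \<noteq> (t, a)" "(s, q) = (t, j)" | "(s, b) \<noteq> (t, a)" "(s, q) \<noteq> (t, j)" by blast
    then show ?thesis
    proof cases
      case 1
      have "integral\<^sup>L M ?Y = integral\<^sup>L M (\<lambda>\<omega>. (\<xi> k \<omega> t a * \<xi> k \<omega> t a) * (\<upsilon> k \<omega> t j * \<upsilon> k \<omega> t j))"
        using 1 by (simp add: mult_ac)
      also have "\<dots> = integral\<^sup>L M (\<lambda>\<omega>. 1)" by (intro Bochner_Integration.integral_cong refl) (simp only: sq)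
      finally show ?thesis using 1 by (simp add: prob_space)
    next
      case 2
      have "integral\<^sup>L M ?Y = integral\<^sup>L M (\<lambda>\<omega>. (\<xi> k \<omega> t a * \<xi> k \<omega> t a) * (\<upsilon> k \<omega> t j * \<upsilon> k \<omega> s q))"
        using 2 by (simp add: mult_ac)
      also have "\<dots> = integral\<^sup>L M (\<lambda>\<omega>. \<Prod>i\<in>{Inl (t, j), Inl (s, q)}. sgn_probe k i \<omega>)"
        using 2 by (intro Bochner_Integration.integral_cong refl) (auto simp: sq sgn_probe_def)
      also have "\<dots> = 0" using pi by (intro E) auto
      finally show ?thesis using 2 by auto
    next
      case 3
      have "integral\<^sup>L M ?Y = integral\<^sup>L M (\<lambda>\<omega>. (\<upsilon> k \<omega> t j * \<upsilon> k \<omega> t j) * (\<xi> k \<omega> t a * \<xi> k \<omega> s b))"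
        using 3 by (simp add: mult_ac)
      also have "\<dots> = integral\<^sup>L M (\<lambda>\<omega>. \<Prod>i\<in>{Inr (t, a), Inr (s, b)}. sgn_probe k i \<omega>)"
        using 3 by (intro Bochner_Integration.integral_cong refl) (auto simp: sq sgn_probe_def)
      also have "\<dots> = 0" using pi by (intro E) auto
      finally show ?thesis using 3 by auto
    next
      case 4
      have "integral\<^sup>L M ?Y = integral\<^sup>L M (\<lambda>\<omega>. \<Prod>i\<in>{Inr (t, a), Inr (s, b), Inl (t, j), Inl (s, q)}. sgn_probe k i \<omega>)"
        using 4 by (intro Bochner_Integration.integral_cong refl) (auto simp: sgn_probe_def)
      also have "\<dots> = 0" using pi by (intro E) auto
      finally show ?thesis using 4 by auto
    qed
  qed
  ultimately show "integral\<^sup>L M (\<lambda>\<omega>. X \<omega> * ?Y \<omega>) = integral\<^sup>L M X * of_bool (s = t \<and> b = a \<and> q = j)"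
    by (simp add: mult.commute)
qed

end

section \<open>Second moments\<close>

lemma norm_add_squared_le: "(norm (a + b))\<^sup>2 \<le> 2 * (norm a)\<^sup>2 + 2 * (norm (b :: 'v::real_normed_vector))\<^sup>2"
proof -
  have "(norm (a + b))\<^sup>2 \<le> (norm a + norm b)\<^sup>2" by (intro power_mono norm_triangle_ineq) simp
  also have "\<dots> \<le> 2 * (norm a)\<^sup>2 + 2 * (norm b)\<^sup>2"
    using zero_le_power2[of "norm a - norm b"] by (simp add: power2_eq_square algebra_simps)
  finally show ?thesis .
qed

lemma norm_diff_squared_le: "(norm (a - b))\<^sup>2 \<le> 2 * (norm a)\<^sup>2 + 2 * (norm (b :: 'v::real_normed_vector))\<^sup>2"
  using norm_add_squared_le[of a "- b"] by simp

lemma norm_add3_squared_le: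
  "(norm (a + b + c))\<^sup>2 \<le> 3 * (norm a)\<^sup>2 + 3 * (norm b)\<^sup>2 + 3 * (norm (c :: 'v::real_normed_vector))\<^sup>2"
proof -
  have "norm (a + b + c) \<le> norm a + norm b + norm c"
    by (meson add_right_mono norm_triangle_ineq order_trans)
  then have "(norm (a + b + c))\<^sup>2 \<le> (norm a + norm b + norm c)\<^sup>2" by (intro power_mono) auto
  also have "\<dots> \<le> 3 * (norm a)\<^sup>2 + 3 * (norm b)\<^sup>2 + 3 * (norm c)\<^sup>2"
    using zero_le_power2[of "norm a - norm b"] zero_le_power2[of "norm a - norm c"] zero_le_power2[of "norm b - norm c"]
    by (simp add: power2_eq_square algebra_simps)
  finally show ?thesis .
qed

lemma cond_mean_cong:
  assumes "cond_mean M F X D" "\<And>\<omega>. \<omega> \<in> space M \<Longrightarrow> D \<omega> = D' \<omega>"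
  shows "cond_mean M F X D'"
proof -
  have "AE \<omega> in M. real_cond_exp M F (\<lambda>\<omega>. inner (X \<omega>) e) \<omega> = inner (D' \<omega>) e" if "e \<in> Basis" for e
  proof -
    have "AE \<omega> in M. real_cond_exp M F (\<lambda>\<omega>. inner (X \<omega>) e) \<omega> = inner (D \<omega>) e"
      using assms(1) that by (simp add: cond_mean_def)
    then show ?thesis using AE_space by eventually_elim (simp add: assms(2))
  qed
  then show ?thesis using assms(1) by (simp add: cond_mean_def)
qed

lemma (in prob_space) cond_msd_cong:
  fixes X D D' :: "'a \<Rightarrow> 'v::euclidean_space"
  assumes "cond_msd_le M F X D b" "\<And>\<omega>. \<omega> \<in> space M \<Longrightarrow> D \<omega> = D' \<omega>"
    and F: "subalgebra M F" and [measurable]: "X \<in> borel_measurable M" "D' \<in> borel_measurable M"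
  shows "cbound F (\<lambda>\<omega>. (norm (X \<omega> - D' \<omega>))\<^sup>2) b"
proof -
  interpret sigma_finite_subalgebra M F by (rule sigma_finite_subalgebraI[OF F])
  have [measurable]: "D \<in> borel_measurable M"
    using measurable_cong[of M D D' borel] assms(2) by simp
  have "AE \<omega> in M. nn_cond_exp M F (\<lambda>\<omega>. ennreal ((norm (X \<omega> - D \<omega>))\<^sup>2)) \<omega> = nn_cond_exp M F (\<lambda>\<omega>. ennreal ((norm (X \<omega> - D' \<omega>))\<^sup>2)) \<omega>"
    by (intro nn_cond_exp_cong AE_I2) (auto simp: assms(2))
  then show ?thesis using assms(1)[unfolded cond_msd_le_def] by eventually_elim simp
qed

section \<open>Oracle means as compressed derivatives, and oracle second moments\<close>

context bros begin

text \<open>The conditional means of the operator oracles, identified in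
  \<open>projected_derivatives\<close>: the Hessian is compressed on both sides, the mixed
  derivative in \<open>mJ\<close> on one side.\<close>

definition mH :: "nat \<Rightarrow> 'a \<Rightarrow> 'b \<Rightarrow> 'b" where
  "mH k \<omega> W = colift \<Lambda> (Pk k \<omega>) (hess k \<omega> (lift \<Lambda> (Pk k \<omega>) W))"

definition mJ :: "nat \<Rightarrow> 'a \<Rightarrow> 'b \<Rightarrow> 'x" where
  "mJ k \<omega> W = hessx k \<omega> (lift \<Lambda> (Pk k \<omega>) W)"

lemma projected_derivatives:
  assumes "\<omega> \<in> space M"
  shows "grad1 (projected \<Lambda> f (Yk k \<omega>) (Pk k \<omega>)) (xk k \<omega>) 0 = grad1 f (xk k \<omega>) (Yk k \<omega>)"
    and "grad2 (projected \<Lambda> f (Yk k \<omega>) (Pk k \<omega>)) (xk k \<omega>) 0 = colift \<Lambda> (Pk k \<omega>) (gradf k \<omega>)"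
    and "grad2 (projected \<Lambda> g (Yk k \<omega>) (Pk k \<omega>)) (xk k \<omega>) 0 = colift \<Lambda> (Pk k \<omega>) (gradg k \<omega>)"
    and "hess22 (projected \<Lambda> g (Yk k \<omega>) (Pk k \<omega>)) (xk k \<omega>) 0 W = mH k \<omega> W"
    and "hess12 (projected \<Lambda> g (Yk k \<omega>) (Pk k \<omega>)) (xk k \<omega>) 0 W = mJ k \<omega> W"
proof -
  note l = linear_lift[OF shaped_P[OF assms]] and a = adjoint_lift[OF shaped_P[OF assms]]
  note z = linear_0[OF l]
  show "grad1 (projected \<Lambda> f (Yk k \<omega>) (Pk k \<omega>)) (xk k \<omega>) 0 = grad1 f (xk k \<omega>) (Yk k \<omega>)"
    unfolding projected_def by (subst f.grad1_projected[OF l]) (simp add: z)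
  show "grad2 (projected \<Lambda> f (Yk k \<omega>) (Pk k \<omega>)) (xk k \<omega>) 0 = colift \<Lambda> (Pk k \<omega>) (gradf k \<omega>)"
    unfolding projected_def by (subst f.grad2_projected[OF l]) (simp add: z a)
  show "grad2 (projected \<Lambda> g (Yk k \<omega>) (Pk k \<omega>)) (xk k \<omega>) 0 = colift \<Lambda> (Pk k \<omega>) (gradg k \<omega>)"
    unfolding projected_def by (subst g.grad2_projected[OF l]) (simp add: z a)
  show "hess22 (projected \<Lambda> g (Yk k \<omega>) (Pk k \<omega>)) (xk k \<omega>) 0 W = mH k \<omega> W"
    unfolding projected_def by (subst g.hess22_projected[OF l]) (simp add: z a mH_def)
  show "hess12 (projected \<Lambda> g (Yk k \<omega>) (Pk k \<omega>)) (xk k \<omega>) 0 W = mJ k \<omega> W"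
    unfolding projected_def by (subst g.hess12_projected[OF l]) (simp add: z mJ_def)
qed

lemma measurable_mH [measurable (raw)]:
  assumes [measurable]: "W \<in> borel_measurable M"
  shows "(\<lambda>\<omega>. mH k \<omega> (W \<omega>)) \<in> borel_measurable M" "(\<lambda>\<omega>. mJ k \<omega> (W \<omega>)) \<in> borel_measurable M"
proof -
  note [measurable] = measurable_lift[OF rv_proj_M] 
  have "(\<lambda>\<omega>. hess k \<omega> (lift \<Lambda> (Pk k \<omega>) (W \<omega>))) \<in> borel_measurable M" by measurable
  then show "(\<lambda>\<omega>. mH k \<omega> (W \<omega>)) \<in> borel_measurable M"
    unfolding mH_def by (rule measurable_colift[OF rv_proj_M])
  show "(\<lambda>\<omega>. mJ k \<omega> (W \<omega>)) \<in> borel_measurable M" unfolding mJ_def by measurable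
qed

lemma
  shows A2_Ux: "cond_mean M (F1 k) (or_Ux R (Suc k)) (\<lambda>\<omega>. grad1 (projected \<Lambda> f (Yk k \<omega>) (Pk k \<omega>)) (xk k \<omega>) 0)"
      "cond_msd_le M (F1 k) (or_Ux R (Suc k)) (\<lambda>\<omega>. grad1 (projected \<Lambda> f (Yk k \<omega>) (Pk k \<omega>)) (xk k \<omega>) 0) (\<lambda>_. \<sigma>f1\<^sup>2)"
    and A2_UY: "cond_mean M (F1 k) (or_UY R (Suc k)) (\<lambda>\<omega>. grad2 (projected \<Lambda> f (Yk k \<omega>) (Pk k \<omega>)) (xk k \<omega>) 0)"
      "cond_msd_le M (F1 k) (or_UY R (Suc k)) (\<lambda>\<omega>. grad2 (projected \<Lambda> f (Yk k \<omega>) (Pk k \<omega>)) (xk k \<omega>) 0) (\<lambda>_. \<sigma>f2\<^sup>2)"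
    and A2_V: "cond_mean M (F1 k) (or_V R (Suc k)) (\<lambda>\<omega>. grad2 (projected \<Lambda> g (Yk k \<omega>) (Pk k \<omega>)) (xk k \<omega>) 0)"
      "cond_msd_le M (F1 k) (or_V R (Suc k)) (\<lambda>\<omega>. grad2 (projected \<Lambda> g (Yk k \<omega>) (Pk k \<omega>)) (xk k \<omega>) 0) (\<lambda>_. \<sigma>g1\<^sup>2)"
    and A2_HJ: "\<And>W. W \<in> borel_measurable (F2 k) \<Longrightarrow> (AE \<omega> in M. nn_cond_exp M (F2 k) (\<lambda>\<omega>. ennreal ((norm (W \<omega>))\<^sup>2)) \<omega> < \<infinity>) \<Longrightarrow>
       cond_mean M (F2 k) (\<lambda>\<omega>. Ho k \<omega> (W \<omega>)) (\<lambda>\<omega>. hess22 (projected \<Lambda> g (Yk k \<omega>) (Pk k \<omega>)) (xk k \<omega>) 0 (W \<omega>)) \<and>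
       cond_msd_le M (F2 k) (\<lambda>\<omega>. Ho k \<omega> (W \<omega>)) (\<lambda>\<omega>. hess22 (projected \<Lambda> g (Yk k \<omega>) (Pk k \<omega>)) (xk k \<omega>) 0 (W \<omega>)) (\<lambda>\<omega>. \<sigma>g2\<^sup>2 * (norm (W \<omega>))\<^sup>2) \<and>
       cond_mean M (F2 k) (\<lambda>\<omega>. Jo k \<omega> (W \<omega>)) (\<lambda>\<omega>. hess12 (projected \<Lambda> g (Yk k \<omega>) (Pk k \<omega>)) (xk k \<omega>) 0 (W \<omega>)) \<and>
       cond_msd_le M (F2 k) (\<lambda>\<omega>. Jo k \<omega> (W \<omega>)) (\<lambda>\<omega>. hess12 (projected \<Lambda> g (Yk k \<omega>) (Pk k \<omega>)) (xk k \<omega>) 0 (W \<omega>)) (\<lambda>\<omega>. \<sigma>g2\<^sup>2 * (norm (W \<omega>))\<^sup>2)"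
  using A2 unfolding assumption_A2_def Let_def by blast+

lemma oracle_Ux:
  "cond_mean M (F1 k) (or_Ux R (Suc k)) (\<lambda>\<omega>. grad1 f (xk k \<omega>) (Yk k \<omega>))"
  "cbound (F1 k) (\<lambda>\<omega>. (norm (or_Ux R (Suc k) \<omega> - grad1 f (xk k \<omega>) (Yk k \<omega>)))\<^sup>2) (\<lambda>_. \<sigma>f1\<^sup>2)"
  by (rule cond_mean_cong[OF A2_Ux(1)], erule projected_derivatives,
      rule cond_msd_cong[OF A2_Ux(2) _ F1_sets], erule projected_derivatives, measurable)

lemma oracle_UY:
  "cond_mean M (F1 k) (or_UY R (Suc k)) (\<lambda>\<omega>. colift \<Lambda> (Pk k \<omega>) (gradf k \<omega>))"
  "cbound (F1 k) (\<lambda>\<omega>. (norm (or_UY R (Suc k) \<omega> - colift \<Lambda> (Pk k \<omega>) (gradf k \<omega>)))\<^sup>2) (\<lambda>_. \<sigma>f2\<^sup>2)"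
proof -
  note [measurable] = measurable_colift[OF rv_proj_M]
  show "cond_mean M (F1 k) (or_UY R (Suc k)) (\<lambda>\<omega>. colift \<Lambda> (Pk k \<omega>) (gradf k \<omega>))"
    by (rule cond_mean_cong[OF A2_UY(1)], erule projected_derivatives)
  show "cbound (F1 k) (\<lambda>\<omega>. (norm (or_UY R (Suc k) \<omega> - colift \<Lambda> (Pk k \<omega>) (gradf k \<omega>)))\<^sup>2) (\<lambda>_. \<sigma>f2\<^sup>2)"
    by (rule cond_msd_cong[OF A2_UY(2) _ F1_sets], erule projected_derivatives, measurable)
qed

lemma oracle_V:
  "cond_mean M (F1 k) (or_V R (Suc k)) (\<lambda>\<omega>. colift \<Lambda> (Pk k \<omega>) (gradg k \<omega>))"
  "cbound (F1 k) (\<lambda>\<omega>. (norm (or_V R (Suc k) \<omega> - colift \<Lambda> (Pk k \<omega>) (gradg k \<omega>)))\<^sup>2) (\<lambda>_. \<sigma>g1\<^sup>2)"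
proof -
  note [measurable] = measurable_colift[OF rv_proj_M]
  show "cond_mean M (F1 k) (or_V R (Suc k)) (\<lambda>\<omega>. colift \<Lambda> (Pk k \<omega>) (gradg k \<omega>))"
    by (rule cond_mean_cong[OF A2_V(1)], erule projected_derivatives)
  show "cbound (F1 k) (\<lambda>\<omega>. (norm (or_V R (Suc k) \<omega> - colift \<Lambda> (Pk k \<omega>) (gradg k \<omega>)))\<^sup>2) (\<lambda>_. \<sigma>g1\<^sup>2)"
    by (rule cond_msd_cong[OF A2_V(2) _ F1_sets], erule projected_derivatives, measurable)
qed

lemma oracle_HJ:
  assumes W: "W \<in> borel_measurable (F2 k)"
  shows "cond_mean M (F2 k) (\<lambda>\<omega>. Ho k \<omega> (W \<omega>)) (\<lambda>\<omega>. mH k \<omega> (W \<omega>))"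
    and "cbound (F2 k) (\<lambda>\<omega>. (norm (Ho k \<omega> (W \<omega>) - mH k \<omega> (W \<omega>)))\<^sup>2) (\<lambda>\<omega>. \<sigma>g2\<^sup>2 * (norm (W \<omega>))\<^sup>2)"
    and "cond_mean M (F2 k) (\<lambda>\<omega>. Jo k \<omega> (W \<omega>)) (\<lambda>\<omega>. mJ k \<omega> (W \<omega>))"
    and "cbound (F2 k) (\<lambda>\<omega>. (norm (Jo k \<omega> (W \<omega>) - mJ k \<omega> (W \<omega>)))\<^sup>2) (\<lambda>\<omega>. \<sigma>g2\<^sup>2 * (norm (W \<omega>))\<^sup>2)"
proof -
  have Wm [measurable]: "W \<in> borel_measurable M" by (rule measurable_from_subalg[OF F2_sets W])
  \<comment> \<open>For a direction measurable in \<open>filtPP\<close> the conditional second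
    moment is its own squared norm, so the finiteness condition in (A2) holds automatically.\<close>
  have "(\<lambda>\<omega>. (norm (W \<omega>))\<^sup>2) \<in> borel_measurable (F2 k)" using W by measurable
  from cbound_self[OF F2_sets this]
  have "AE \<omega> in M. nn_cond_exp M (F2 k) (\<lambda>\<omega>. ennreal ((norm (W \<omega>))\<^sup>2)) \<omega> < \<infinity>"
    by eventually_elim (rule le_less_trans, assumption, simp)
  note a = A2_HJ[OF W this]
  show "cond_mean M (F2 k) (\<lambda>\<omega>. Ho k \<omega> (W \<omega>)) (\<lambda>\<omega>. mH k \<omega> (W \<omega>))"
    by (rule cond_mean_cong[OF a[THEN conjunct1]], erule projected_derivatives)
  show "cbound (F2 k) (\<lambda>\<omega>. (norm (Ho k \<omega> (W \<omega>) - mH k \<omega> (W \<omega>)))\<^sup>2) (\<lambda>\<omega>. \<sigma>g2\<^sup>2 * (norm (W \<omega>))\<^sup>2)"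
    by (rule cond_msd_cong[OF a[THEN conjunct2, THEN conjunct1] _ F2_sets], erule projected_derivatives, measurable)
  show "cond_mean M (F2 k) (\<lambda>\<omega>. Jo k \<omega> (W \<omega>)) (\<lambda>\<omega>. mJ k \<omega> (W \<omega>))"
    by (rule cond_mean_cong[OF a[THEN conjunct2, THEN conjunct2, THEN conjunct1]], erule projected_derivatives)
  show "cbound (F2 k) (\<lambda>\<omega>. (norm (Jo k \<omega> (W \<omega>) - mJ k \<omega> (W \<omega>)))\<^sup>2) (\<lambda>\<omega>. \<sigma>g2\<^sup>2 * (norm (W \<omega>))\<^sup>2)"
    by (rule cond_msd_cong[OF a[THEN conjunct2, THEN conjunct2, THEN conjunct2] _ F2_sets], erule projected_derivatives, measurable)
qed

lemma norm_mH_le: "frame (Pk k \<omega>) \<Longrightarrow> norm (mH k \<omega> W) \<le> \<kappa>\<^sup>2 * Lg1 * norm W"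
  and norm_mJ_le: "frame (Pk k \<omega>) \<Longrightarrow> norm (mJ k \<omega> W) \<le> \<kappa> * Lg1 * norm W"
proof -
  assume fr: "frame (Pk k \<omega>)"
  have h: "Lg1 * norm (lift \<Lambda> (Pk k \<omega>) W) \<le> Lg1 * (\<kappa> * norm W)"
    by (intro mult_left_mono norm_lift_le fr g.L_nonneg)
  have "norm (mH k \<omega> W) \<le> \<kappa> * norm (hess k \<omega> (lift \<Lambda> (Pk k \<omega>) W))" unfolding mH_def by (rule norm_colift_le[OF fr])
  also have "\<dots> \<le> \<kappa> * (Lg1 * (\<kappa> * norm W))"
    using g.norm_hess22_le[of "xk k \<omega>" "Yk k \<omega>" "lift \<Lambda> (Pk k \<omega>) W"] h by (intro mult_left_mono kappa_ge) linarith
  finally show "norm (mH k \<omega> W) \<le> \<kappa>\<^sup>2 * Lg1 * norm W" by (simp add: power2_eq_square mult_ac)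
  show "norm (mJ k \<omega> W) \<le> \<kappa> * Lg1 * norm W"
    using g.norm_hess12_le[of "xk k \<omega>" "Yk k \<omega>" "lift \<Lambda> (Pk k \<omega>) W"] h unfolding mJ_def by (simp add: mult_ac)
qed

text \<open>Passage from the deviation to the size of the oracle. The mean \<open>D\<close> enters
  through an \<open>F\<close>-measurable bound \<open>d\<close>, which can be chosen free of the
  projector.\<close>

lemma cbound_from_deviation:
  fixes X D :: "'a \<Rightarrow> 'v::euclidean_space"
  assumes F: "subalgebra M F" and dev: "cbound F (\<lambda>\<omega>. (norm (X \<omega> - D \<omega>))\<^sup>2) s"
    and [measurable]: "X \<in> borel_measurable M" "D \<in> borel_measurable M"
    and d: "AE \<omega> in M. norm (D \<omega>) \<le> d \<omega>" "d \<in> borel_measurable F" "\<And>\<omega>. 0 \<le> d \<omega>" "\<And>\<omega>. 0 \<le> s \<omega>"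
  shows "cbound F (\<lambda>\<omega>. (norm (X \<omega>))\<^sup>2) (\<lambda>\<omega>. 2 * s \<omega> + 2 * (d \<omega>)\<^sup>2)"
proof -
  have dm: "d \<in> borel_measurable M" by (rule measurable_from_subalg[OF F d(2)])
  have 1: "cbound F (\<lambda>\<omega>. 2 * (norm (X \<omega> - D \<omega>))\<^sup>2) (\<lambda>\<omega>. 2 * s \<omega>)"
    by (rule cbound_mult[OF F dev]) auto
  have 2: "cbound F (\<lambda>\<omega>. 2 * (d \<omega>)\<^sup>2) (\<lambda>\<omega>. 2 * (d \<omega>)\<^sup>2)"
    using d(2) by (intro cbound_self[OF F] borel_measurable_times borel_measurable_power borel_measurable_const)
  have 3: "cbound F (\<lambda>\<omega>. 2 * (norm (X \<omega> - D \<omega>))\<^sup>2 + 2 * (d \<omega>)\<^sup>2) (\<lambda>\<omega>. 2 * s \<omega> + 2 * (d \<omega>)\<^sup>2)"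
    using d dm by (intro cbound_add[OF F 1 2]) auto
  show ?thesis
  proof (rule cbound_mono[OF F 3])
    show "AE \<omega> in M. (norm (X \<omega>))\<^sup>2 \<le> 2 * (norm (X \<omega> - D \<omega>))\<^sup>2 + 2 * (d \<omega>)\<^sup>2"
      using d(1)
    proof eventually_elim
      case (elim \<omega>)
      have "(norm (D \<omega>))\<^sup>2 \<le> (d \<omega>)\<^sup>2" using elim by (intro power_mono) auto
      then show ?case using norm_add_squared_le[of "X \<omega> - D \<omega>" "D \<omega>"] by simp
    qed
  qed (use dm in auto)
qed

text \<open>\<open>CH\<close> and \<open>CJ\<close> arise from \<open>cbound_from_deviation\<close>
  with the operator norms of \<open>norm_mH_le\<close> and \<open>norm_mJ_le\<close>.\<close>

definition CH :: real where "CH = 2 * \<sigma>g2\<^sup>2 + 2 * (\<kappa>\<^sup>2 * Lg1)\<^sup>2"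
definition CJ :: real where "CJ = 2 * \<sigma>g2\<^sup>2 + 2 * (\<kappa> * Lg1)\<^sup>2"

lemma CHJ_nonneg: "0 \<le> CH" "0 \<le> CJ" by (simp_all add: CH_def CJ_def)

lemma cbound_Ho:
  assumes W: "W \<in> borel_measurable (F2 k)"
  shows "cbound (F2 k) (\<lambda>\<omega>. (norm (Ho k \<omega> (W \<omega>)))\<^sup>2) (\<lambda>\<omega>. CH * (norm (W \<omega>))\<^sup>2)"
    and "cbound (F2 k) (\<lambda>\<omega>. (norm (Jo k \<omega> (W \<omega>)))\<^sup>2) (\<lambda>\<omega>. CJ * (norm (W \<omega>))\<^sup>2)"
proof -
  have Wm [measurable]: "W \<in> borel_measurable M" by (rule measurable_from_subalg[OF F2_sets W])
  have 1: "AE \<omega> in M. norm (mH k \<omega> (W \<omega>)) \<le> \<kappa>\<^sup>2 * Lg1 * norm (W \<omega>)"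
    using AE_frame[of k] by eventually_elim (rule norm_mH_le)
  have 2: "AE \<omega> in M. norm (mJ k \<omega> (W \<omega>)) \<le> \<kappa> * Lg1 * norm (W \<omega>)"
    using AE_frame[of k] by eventually_elim (rule norm_mJ_le)
  have "cbound (F2 k) (\<lambda>\<omega>. (norm (Ho k \<omega> (W \<omega>)))\<^sup>2) (\<lambda>\<omega>. 2 * (\<sigma>g2\<^sup>2 * (norm (W \<omega>))\<^sup>2) + 2 * (\<kappa>\<^sup>2 * Lg1 * norm (W \<omega>))\<^sup>2)"
    using W g.L_nonneg kappa_ge(3) by (intro cbound_from_deviation[OF F2_sets oracle_HJ(2)[OF W] _ _ 1]) auto
  then show "cbound (F2 k) (\<lambda>\<omega>. (norm (Ho k \<omega> (W \<omega>)))\<^sup>2) (\<lambda>\<omega>. CH * (norm (W \<omega>))\<^sup>2)"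
    by (simp add: CH_def power_mult_distrib algebra_simps)
  have "cbound (F2 k) (\<lambda>\<omega>. (norm (Jo k \<omega> (W \<omega>)))\<^sup>2) (\<lambda>\<omega>. 2 * (\<sigma>g2\<^sup>2 * (norm (W \<omega>))\<^sup>2) + 2 * (\<kappa> * Lg1 * norm (W \<omega>))\<^sup>2)"
    using W g.L_nonneg kappa_ge(3) by (intro cbound_from_deviation[OF F2_sets oracle_HJ(4)[OF W] _ _ 2]) auto
  then show "cbound (F2 k) (\<lambda>\<omega>. (norm (Jo k \<omega> (W \<omega>)))\<^sup>2) (\<lambda>\<omega>. CJ * (norm (W \<omega>))\<^sup>2)"
    by (simp add: CJ_def power_mult_distrib algebra_simps)
qed

lemma measurable_gradf_F0: "gradf k \<in> borel_measurable (F0 k)" "gradg k \<in> borel_measurable (F0 k)"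
  using measurable_F0[of k] by measurable

lemma cbound_V:
  "cbound (F0 k) (\<lambda>\<omega>. (norm (or_V R (Suc k) \<omega>))\<^sup>2) (\<lambda>\<omega>. 2 * \<sigma>g1\<^sup>2 + 2 * (\<kappa> * norm (gradg k \<omega>))\<^sup>2)"
  "cbound (F0 k) (\<lambda>\<omega>. (norm (or_UY R (Suc k) \<omega>))\<^sup>2) (\<lambda>\<omega>. 2 * \<sigma>f2\<^sup>2 + 2 * (\<kappa> * norm (gradf k \<omega>))\<^sup>2)"
proof -
  note [measurable] = measurable_colift[OF rv_proj_M]
  note gm = measurable_gradf_F0[of k]
  have 1: "AE \<omega> in M. norm (colift \<Lambda> (Pk k \<omega>) (U \<omega>)) \<le> \<kappa> * norm (U \<omega>)" for U
    using AE_frame[of k] by eventually_elim (rule norm_colift_le)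
  have "cbound (F1 k) (\<lambda>\<omega>. (norm (or_V R (Suc k) \<omega>))\<^sup>2) (\<lambda>\<omega>. 2 * \<sigma>g1\<^sup>2 + 2 * (\<kappa> * norm (gradg k \<omega>))\<^sup>2)"
    using measurable_F1[OF gm(2)] kappa_ge(3) by (intro cbound_from_deviation[OF F1_sets oracle_V(2) _ _ 1]) auto
  then show "cbound (F0 k) (\<lambda>\<omega>. (norm (or_V R (Suc k) \<omega>))\<^sup>2) (\<lambda>\<omega>. 2 * \<sigma>g1\<^sup>2 + 2 * (\<kappa> * norm (gradg k \<omega>))\<^sup>2)"
    using gm by (intro cbound_tower[OF F1_sets F1_F0]) auto
  have "cbound (F1 k) (\<lambda>\<omega>. (norm (or_UY R (Suc k) \<omega>))\<^sup>2) (\<lambda>\<omega>. 2 * \<sigma>f2\<^sup>2 + 2 * (\<kappa> * norm (gradf k \<omega>))\<^sup>2)"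
    using measurable_F1[OF gm(1)] kappa_ge(3) by (intro cbound_from_deviation[OF F1_sets oracle_UY(2) _ _ 1]) auto
  then show "cbound (F0 k) (\<lambda>\<omega>. (norm (or_UY R (Suc k) \<omega>))\<^sup>2) (\<lambda>\<omega>. 2 * \<sigma>f2\<^sup>2 + 2 * (\<kappa> * norm (gradf k \<omega>))\<^sup>2)"
    using gm by (intro cbound_tower[OF F1_sets F1_F0]) auto
qed

text \<open>This oracle is kept centred at its mean and not compared with 0: the gradient of
  \<open>f\<close> in \<open>x\<close> is not controlled by the distances to \<open>Ystar\<close>
  and \<open>Zstar\<close>, so its size must not enter the final bound.\<close>

lemma cbound_Ux: "cbound (F0 k) (\<lambda>\<omega>. (norm (or_Ux R (Suc k) \<omega> - grad1 f (xk k \<omega>) (Yk k \<omega>)))\<^sup>2) (\<lambda>_. \<sigma>f1\<^sup>2)"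
  by (rule cbound_tower[OF F1_sets F1_F0 oracle_Ux(2)]) measurable

lemma cbound_J:
  "cbound (F0 k) (\<lambda>\<omega>. (norm (Jo k \<omega> (colift \<Lambda> (Pk k \<omega>) (Zk k \<omega>))))\<^sup>2) (\<lambda>\<omega>. CJ * (\<kappa> * norm (Zk k \<omega>))\<^sup>2)"
proof -
  note [measurable] = measurable_colift[OF rv_proj_M measurable_iterates(3)]
  let ?W = "\<lambda>\<omega>. colift \<Lambda> (Pk k \<omega>) (Zk k \<omega>)"
  note ZF = measurable_F0(3)[of k]
  have W2: "(\<lambda>\<omega>. CJ * (norm (?W \<omega>))\<^sup>2) \<in> borel_measurable (F2 k)" using measurable_colift_F2[of k] by measurable
  have "cbound (F2 k) (\<lambda>\<omega>. (norm (Jo k \<omega> (?W \<omega>)))\<^sup>2) (\<lambda>\<omega>. CJ * (\<kappa> * norm (Zk k \<omega>))\<^sup>2)"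
    using cbound_Ho(2)[OF measurable_colift_F2[of k]] AE_frame[of k]
  proof eventually_elim
    case (elim \<omega>)
    \<comment> \<open>The compressed direction depends on the projector; replacing its norm by a
      multiple of the norm of \<open>Zk\<close> makes the bound measurable for the past.\<close>
    have "CJ * (norm (?W \<omega>))\<^sup>2 \<le> CJ * (\<kappa> * norm (Zk k \<omega>))\<^sup>2"
      using norm_colift_le[OF elim(2)] by (intro mult_left_mono power_mono CHJ_nonneg) auto
    then show ?case using elim(1) by (meson ennreal_leI order_trans)
  qed
  then show ?thesis using ZF by (intro cbound_tower[OF F2_sets F2_F0]) auto
qed

lemma norm_dirW: "\<omega> \<in> space M \<Longrightarrow> (norm (dirW k \<omega>))\<^sup>2 = real (\<Sum>l\<in>UNIV. r l * n l)"
proof -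
  assume w: "\<omega> \<in> space M"
  have "(\<xi> k \<omega> l a * \<upsilon> k \<omega> l j)\<^sup>2 = 1" if "a < r l" "j < n l" for l a j
    using probe_values(1)[OF w that(2), of k] probe_values(2)[OF w that(1), of k] by auto
  then show ?thesis by (simp add: B.norm2_units inner_dirW)
qed

lemma cbound_HoS:
  "cbound (F0 k) (\<lambda>\<omega>. (norm (Ho k \<omega> (dirS k t \<omega>)))\<^sup>2) (\<lambda>\<omega>. CH * (\<kappa> * norm (Zk k \<omega>))\<^sup>2)"
proof -
  have [measurable]: "dirS k t \<in> borel_measurable M" by (rule measurable_dirS_gen[OF rv_proj_M measurable_iterates(3)])
  note ZF = measurable_F0(3)[of k]
  have "cbound (F2 k) (\<lambda>\<omega>. (norm (Ho k \<omega> (dirS k t \<omega>)))\<^sup>2) (\<lambda>\<omega>. CH * (\<kappa> * norm (Zk k \<omega>))\<^sup>2)"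
    using cbound_Ho(1)[OF measurable_dirS_F2[of k t]] AE_frame[of k]
  proof eventually_elim
    case (elim \<omega>)
    have "CH * (norm (dirS k t \<omega>))\<^sup>2 \<le> CH * (\<kappa> * norm (Zk k \<omega>))\<^sup>2"
      using norm_single_block_colift_le[OF elim(2)] unfolding dirS_def by (intro mult_left_mono power_mono CHJ_nonneg) auto
    then show ?case using elim(1) by (meson ennreal_leI order_trans)
  qed
  then show ?thesis using ZF by (intro cbound_tower[OF F2_sets F2_F0]) auto
qed

text \<open>The probe direction has a deterministic norm, and the factor from \<open>Zk\<close>
  belongs to the past. The product is bounded as a whole because \<open>Cent\<close> and
  \<open>Bent\<close> contain both.\<close>

lemma cbound_HoW:
  "cbound (F0 k) (\<lambda>\<omega>. (norm (Zk k \<omega>))\<^sup>2 * (norm (Ho k \<omega> (dirW k \<omega>)))\<^sup>2) (\<lambda>\<omega>. (norm (Zk k \<omega>))\<^sup>2 * (CH * real (\<Sum>l\<in>UNIV. r l * n l)))"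
proof -
  have "cbound (F2 k) (\<lambda>\<omega>. (norm (Ho k \<omega> (dirW k \<omega>)))\<^sup>2) (\<lambda>\<omega>. CH * real (\<Sum>l\<in>UNIV. r l * n l))"
    using cbound_Ho(1)[OF measurable_dirW_F2[of k]] AE_space by eventually_elim (simp add: norm_dirW)
  then have "cbound (F0 k) (\<lambda>\<omega>. (norm (Ho k \<omega> (dirW k \<omega>)))\<^sup>2) (\<lambda>\<omega>. CH * real (\<Sum>l\<in>UNIV. r l * n l))"
    by (intro cbound_tower[OF F2_sets F2_F0]) auto
  then show ?thesis using measurable_F0(3)[of k] by (intro cbound_mult[OF F0_sets]) auto
qed

section \<open>Size of the corrected Hessian action\<close>

definition HoS :: "nat \<Rightarrow> 'a \<Rightarrow> real" where
  "HoS k \<omega> = (\<Sum>t\<in>UNIV. norm (Ho k \<omega> (dirS k t \<omega>))) + norm (Zk k \<omega>) * norm (Ho k \<omega> (dirW k \<omega>))"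

text \<open>A common factor for the entry bounds: \<open>Aent\<close> needs \<kappa> squared,
  \<open>Cent\<close> needs \<kappa> times \<open>n\<close>, and \<open>Bent\<close>, with two sums
  over the rank and two projector factors, needs the fourth power of \<kappa> times
  \<open>n\<close>.\<close>

definition Kent :: real where "Kent = \<kappa> ^ 4 * real (\<Sum>l\<in>UNIV. n l)"

lemma Kent_ge: "\<kappa> * \<kappa> \<le> Kent" "\<kappa> * real (n t) \<le> Kent" "\<kappa> ^ 4 * real (n t) \<le> Kent" "0 \<le> Kent"
proof -
  have N: "real (n t) \<le> real (\<Sum>l\<in>UNIV. n l)" unfolding of_nat_sum by (rule member_le_sum) auto
  have N1: "1 \<le> real (\<Sum>l\<in>UNIV. n l)" using N sizes(1)[of t] by linarith
  have k4: "\<kappa> * \<kappa> \<le> \<kappa> ^ 4" "\<kappa> \<le> \<kappa> ^ 4" "0 \<le> \<kappa> ^ 4"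
    using power_increasing[of 2 4 \<kappa>] power_increasing[of 1 4 \<kappa>] kappa_ge(2) by (auto simp: power2_eq_square)
  show "\<kappa> ^ 4 * real (n t) \<le> Kent" "0 \<le> Kent" unfolding Kent_def using N k4 by (auto intro: mult_left_mono)
  show "\<kappa> * real (n t) \<le> Kent" unfolding Kent_def using N k4 by (intro mult_mono) auto
  have "\<kappa> * \<kappa> * 1 \<le> \<kappa> ^ 4 * real (\<Sum>l\<in>UNIV. n l)" using N1 k4 by (intro mult_mono) auto
  then show "\<kappa> * \<kappa> \<le> Kent" by (simp add: Kent_def)
qed

lemma r_le_kappa: "real (r l) \<le> \<kappa>"
  using kappa_ge(1)[of l] sizes(3)[of l] by linarith

lemma entry_bounds:
  assumes w: "\<omega> \<in> space M" and fr: "frame (Pk k \<omega>)" and ij: "i < m l" "j < n l"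
  shows "\<bar>Aent k \<omega> t l i j\<bar> \<le> Kent * norm (Ho k \<omega> (dirS k t \<omega>))"
    and "\<bar>Cent k \<omega> l i j\<bar> \<le> Kent * (norm (Zk k \<omega>) * norm (Ho k \<omega> (dirW k \<omega>)))"
    and "\<bar>Bent k \<omega> l i j\<bar> \<le> Kent * (norm (Zk k \<omega>) * norm (Ho k \<omega> (dirW k \<omega>)))"
proof -
  have p: "\<bar>\<xi> k \<omega> l a * \<upsilon> k \<omega> l q\<bar> = 1" if "a < r l" "q < n l" for a q
    using probe_values(1)[OF w that(2), of k] probe_values(2)[OF w that(1), of k] by (auto simp: abs_mult)
  let ?S = "norm (Ho k \<omega> (dirS k t \<omega>))" and ?Z = "norm (Zk k \<omega>)" and ?W = "norm (Ho k \<omega> (dirW k \<omega>))"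
  have "\<bar>Aent k \<omega> t l i j\<bar> \<le> (\<Sum>a<r l. \<kappa> * ?S)"
    unfolding Aent_def using ij kappa_ge(3)
    by (intro order_trans[OF sum_abs] sum_mono) (auto simp: abs_mult intro!: mult_mono frame_entry_le[OF fr] B.abs_inner_unit_le)
  also have "\<dots> = real (r l) * (\<kappa> * ?S)" by simp
  also have "\<dots> \<le> \<kappa> * (\<kappa> * ?S)" using kappa_ge(3) by (intro mult_right_mono r_le_kappa) auto
  also have "\<dots> = (\<kappa> * \<kappa>) * ?S" by simp
  also have "\<dots> \<le> Kent * ?S" by (intro mult_right_mono Kent_ge) simp
  finally show "\<bar>Aent k \<omega> t l i j\<bar> \<le> Kent * ?S" .
  have "\<bar>Cent k \<omega> l i j\<bar> \<le> (\<Sum>q<n l. \<Sum>a<r l. ?Z * 1 * ?W)"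
    unfolding Cent_def using ij
    by (intro order_trans[OF sum_abs] sum_mono)
      (auto simp: abs_mult[of _ "inner _ _"] abs_mult[of "inner _ _"] p intro!: mult_mono B.abs_inner_unit_le Y.abs_inner_unit_le
        order_trans[OF sum_abs] sum_mono)
  also have "\<dots> = (real (r l) * real (n l)) * (?Z * ?W)" by simp
  also have "\<dots> \<le> (\<kappa> * real (n l)) * (?Z * ?W)" by (intro mult_right_mono r_le_kappa) auto
  also have "\<dots> \<le> Kent * (?Z * ?W)" by (intro mult_right_mono Kent_ge) simp
  finally show "\<bar>Cent k \<omega> l i j\<bar> \<le> Kent * (?Z * ?W)" .
  have c: "\<bar>inner (colift \<Lambda> (Pk k \<omega>) (Zk k \<omega>)) (EB l b q)\<bar> \<le> \<kappa> * ?Z" if "b < r l" "q < n l" for b q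
    using B.abs_inner_unit_le[OF that, of "colift \<Lambda> (Pk k \<omega>) (Zk k \<omega>)"] norm_colift_le[OF fr, of "Zk k \<omega>"] by linarith
  have "\<bar>Bent k \<omega> l i j\<bar> \<le> (\<Sum>a<r l. \<Sum>b<r l. \<Sum>q<n l. \<kappa> * (\<kappa> * ?Z) * 1 * ?W)"
    unfolding Bent_def
  proof (intro order_trans[OF sum_abs] sum_mono)
    fix a b q assume abq: "a \<in> {..<r l}" "b \<in> {..<r l}" "q \<in> {..<n l}"
    then have "\<bar>Pk k \<omega> l $$ (i, a)\<bar> * \<bar>inner (colift \<Lambda> (Pk k \<omega>) (Zk k \<omega>)) (EB l b q)\<bar> * \<bar>\<xi> k \<omega> l a * \<upsilon> k \<omega> l q\<bar> * \<bar>inner (Ho k \<omega> (dirW k \<omega>)) (EB l b j)\<bar>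
        \<le> \<kappa> * (\<kappa> * ?Z) * 1 * ?W"
      using ij kappa_ge(3) by (intro mult_mono frame_entry_le[OF fr] c B.abs_inner_unit_le) (auto simp: p)
    then show "\<bar>Pk k \<omega> l $$ (i, a) * inner (colift \<Lambda> (Pk k \<omega>) (Zk k \<omega>)) (EB l b q) * (\<xi> k \<omega> l a * \<upsilon> k \<omega> l q) * inner (Ho k \<omega> (dirW k \<omega>)) (EB l b j)\<bar>
        \<le> \<kappa> * (\<kappa> * ?Z) * 1 * ?W" by (simp only: abs_mult)
  qed
  also have "\<dots> = (real (r l) * real (r l)) * (real (n l) * (\<kappa> * \<kappa>)) * (?Z * ?W)" by simp
  also have "\<dots> \<le> (\<kappa> * \<kappa>) * (real (n l) * (\<kappa> * \<kappa>)) * (?Z * ?W)"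
    using kappa_ge(3) by (intro mult_right_mono mult_mono r_le_kappa) auto
  also have "\<dots> = (\<kappa> ^ 4 * real (n l)) * (?Z * ?W)" by (simp add: power4_eq_xxxx mult_ac)
  also have "\<dots> \<le> Kent * (?Z * ?W)" by (intro mult_right_mono Kent_ge) simp
  finally show "\<bar>Bent k \<omega> l i j\<bar> \<le> Kent * (?Z * ?W)" .
qed

text \<open>The norm is estimated by the sum of the absolute coordinates, whence the dimension. The
  sum over layers dominates the coefficients of any one layer.\<close>

definition KHZ :: real where
  "KHZ = real DIM('y) * (Kent * (\<Sum>l\<in>UNIV. \<bar>c1 l\<bar> + \<bar>c2 l\<bar> + 2 * \<bar>c3 l\<bar> + 1))"

lemma norm_HZhat_le:
  assumes w: "\<omega> \<in> space M" and fr: "frame (Pk k \<omega>)"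
  shows "norm (HZhat \<Lambda> R k \<omega>) \<le> KHZ * HoS k \<omega>"
proof -
  let ?C = "\<Sum>l\<in>UNIV. \<bar>c1 l\<bar> + \<bar>c2 l\<bar> + 2 * \<bar>c3 l\<bar> + 1"
  have S0: "0 \<le> HoS k \<omega>" by (auto simp: HoS_def intro!: add_nonneg_nonneg sum_nonneg)
  have "\<bar>inner (HZhat \<Lambda> R k \<omega>) b\<bar> \<le> Kent * ?C * HoS k \<omega>" if b: "b \<in> Basis" for b
  proof -
    obtain l i j where ij: "i < m l" "j < n l" "b = EY l i j" using Y.Basis_unitE[OF b] .
    note e = entry_bounds[OF w fr ij(1,2)]
    let ?K = "Kent * HoS k \<omega>"
    have SS: "norm (Ho k \<omega> (dirS k t \<omega>)) \<le> HoS k \<omega>" for t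
      using member_le_sum[of t UNIV "\<lambda>t. norm (Ho k \<omega> (dirS k t \<omega>))"] unfolding HoS_def by (simp add: add_increasing2)
    have SW: "norm (Zk k \<omega>) * norm (Ho k \<omega> (dirW k \<omega>)) \<le> HoS k \<omega>" unfolding HoS_def by (simp add: sum_nonneg)
    have A: "\<bar>Aent k \<omega> t l i j\<bar> \<le> ?K" for t
      using e(1)[of t] mult_left_mono[OF SS[of t] Kent_ge(4)] by linarith
    have C: "\<bar>Cent k \<omega> l i j\<bar> \<le> ?K" "\<bar>Bent k \<omega> l i j\<bar> \<le> ?K"
      using e(2,3) mult_left_mono[OF SW Kent_ge(4)] by linarith+
    have "\<bar>\<Sum>t\<in>UNIV - {l}. Aent k \<omega> t l i j\<bar> \<le> (\<Sum>t\<in>UNIV - {l}. Kent * norm (Ho k \<omega> (dirS k t \<omega>)))"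
      by (intro order_trans[OF sum_abs] sum_mono e)
    also have "\<dots> \<le> (\<Sum>t\<in>UNIV. Kent * norm (Ho k \<omega> (dirS k t \<omega>)))"
      using Kent_ge(4) by (intro sum_mono2) auto
    also have "\<dots> \<le> ?K" unfolding HoS_def sum_distrib_left[symmetric] using Kent_ge(4) by (intro mult_left_mono) auto
    finally have T: "\<bar>\<Sum>t\<in>UNIV - {l}. Aent k \<omega> t l i j\<bar> \<le> ?K" .
    have "\<bar>inner (HZhat \<Lambda> R k \<omega>) b\<bar> \<le> \<bar>c1 l\<bar> * \<bar>Aent k \<omega> l l i j\<bar> + \<bar>c2 l\<bar> * \<bar>Cent k \<omega> l i j\<bar>
        + \<bar>c3 l\<bar> * (\<bar>Aent k \<omega> l l i j\<bar> + \<bar>Bent k \<omega> l i j\<bar>) + \<bar>\<Sum>t\<in>UNIV - {l}. Aent k \<omega> t l i j\<bar>"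
    proof -
      have "\<bar>c3 l * (Aent k \<omega> l l i j - Bent k \<omega> l i j)\<bar> \<le> \<bar>c3 l\<bar> * (\<bar>Aent k \<omega> l l i j\<bar> + \<bar>Bent k \<omega> l i j\<bar>)"
        unfolding abs_mult by (intro mult_left_mono) auto
      then show ?thesis unfolding ij(3) inner_HZhat[OF w ij(1,2)] abs_mult[symmetric] by linarith
    qed
    also have "\<dots> \<le> \<bar>c1 l\<bar> * ?K + \<bar>c2 l\<bar> * ?K + \<bar>c3 l\<bar> * (?K + ?K) + ?K"
      using A C T by (intro add_mono mult_left_mono) auto
    also have "\<dots> = (\<bar>c1 l\<bar> + \<bar>c2 l\<bar> + 2 * \<bar>c3 l\<bar> + 1) * ?K" by (simp add: algebra_simps)
    also have "\<dots> \<le> ?C * ?K"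
      using S0 Kent_ge(4) by (intro mult_right_mono member_le_sum) auto
    finally show ?thesis by (simp add: mult_ac)
  qed
  then have "(\<Sum>b\<in>Basis. \<bar>inner (HZhat \<Lambda> R k \<omega>) b\<bar>) \<le> (\<Sum>b\<in>(Basis :: 'y set). Kent * ?C * HoS k \<omega>)"
    by (rule sum_mono)
  also have "\<dots> = KHZ * HoS k \<omega>" by (simp add: KHZ_def)
  finally show ?thesis using norm_le_l1[of "HZhat \<Lambda> R k \<omega>"] by linarith
qed

text \<open>The number of layers comes from the Cauchy-Schwarz inequality for the sum over the
  queried blocks, and the 2 from separating the probe term.\<close>

definition QH :: real where "QH = KHZ\<^sup>2 * (2 * real CARD('l))"

lemma norm2_HZhat_le:
  assumes w: "\<omega> \<in> space M" and fr: "frame (Pk k \<omega>)"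
  shows "(norm (HZhat \<Lambda> R k \<omega>))\<^sup>2
    \<le> QH * ((\<Sum>t\<in>UNIV. (norm (Ho k \<omega> (dirS k t \<omega>)))\<^sup>2) + (norm (Zk k \<omega>))\<^sup>2 * (norm (Ho k \<omega> (dirW k \<omega>)))\<^sup>2)"
proof -
  let ?S = "\<Sum>t\<in>UNIV. norm (Ho k \<omega> (dirS k t \<omega>))" and ?S2 = "\<Sum>t\<in>UNIV. (norm (Ho k \<omega> (dirS k t \<omega>)))\<^sup>2"
  let ?W = "norm (Zk k \<omega>) * norm (Ho k \<omega> (dirW k \<omega>))"
  have c: "1 \<le> real CARD('l)" by (simp add: Suc_leI)
  have "(HoS k \<omega>)\<^sup>2 \<le> 2 * ?S\<^sup>2 + 2 * ?W\<^sup>2"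
    using norm_add_squared_le[of ?S ?W] by (simp add: HoS_def)
  also have "\<dots> \<le> 2 * (real CARD('l) * ?S2) + 2 * (real CARD('l) * ?W\<^sup>2)"
    using sum_squared_le_sum_of_squares[of "\<lambda>t. norm (Ho k \<omega> (dirS k t \<omega>))" "UNIV :: 'l set"] mult_right_mono[OF c, of "?W\<^sup>2"]
    by (simp add: mult.commute)
  finally have S: "(HoS k \<omega>)\<^sup>2 \<le> (2 * real CARD('l)) * (?S2 + ?W\<^sup>2)" by (simp add: algebra_simps)
  have "(norm (HZhat \<Lambda> R k \<omega>))\<^sup>2 \<le> (KHZ * HoS k \<omega>)\<^sup>2"
    by (intro power_mono norm_HZhat_le w fr) simp
  also have "\<dots> = KHZ\<^sup>2 * (HoS k \<omega>)\<^sup>2" by (rule power_mult_distrib)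
  also have "\<dots> \<le> KHZ\<^sup>2 * ((2 * real CARD('l)) * (?S2 + ?W\<^sup>2))" by (intro mult_left_mono S) simp
  finally show ?thesis by (simp only: QH_def power_mult_distrib mult.assoc)
qed

definition QZ :: real where
  "QZ = QH * (real CARD('l) * (CH * \<kappa>\<^sup>2) + CH * real (\<Sum>l\<in>UNIV. r l * n l))"

lemma measurable_HZhat_M [measurable]: "HZhat \<Lambda> R k \<in> borel_measurable M"
  "Vhat \<Lambda> R k \<in> borel_measurable M" "Shat \<Lambda> R k \<in> borel_measurable M" "What \<Lambda> R k \<in> borel_measurable M"
  using measurable_HZhat measurable_hats measurable_iterates(3) by auto

lemma cbound_HZhat: "cbound (F0 k) (\<lambda>\<omega>. (norm (HZhat \<Lambda> R k \<omega>))\<^sup>2) (\<lambda>\<omega>. QZ * (norm (Zk k \<omega>))\<^sup>2)"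
proof -
  have Sm [measurable]: "dirS k t \<in> borel_measurable M" for t by (rule measurable_dirS_gen[OF rv_proj_M measurable_iterates(3)])
  have Q0: "0 \<le> QH" by (simp add: QH_def)
  let ?X = "\<lambda>\<omega>. (\<Sum>t\<in>UNIV. (norm (Ho k \<omega> (dirS k t \<omega>)))\<^sup>2) + (norm (Zk k \<omega>))\<^sup>2 * (norm (Ho k \<omega> (dirW k \<omega>)))\<^sup>2"
  let ?B = "\<lambda>\<omega>. (\<Sum>t\<in>(UNIV :: 'l set). CH * (\<kappa> * norm (Zk k \<omega>))\<^sup>2) + (norm (Zk k \<omega>))\<^sup>2 * (CH * real (\<Sum>l\<in>UNIV. r l * n l))"
  have "cbound (F0 k) (\<lambda>\<omega>. \<Sum>t\<in>UNIV. (norm (Ho k \<omega> (dirS k t \<omega>)))\<^sup>2) (\<lambda>\<omega>. \<Sum>t\<in>(UNIV :: 'l set). CH * (\<kappa> * norm (Zk k \<omega>))\<^sup>2)"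
    using CHJ_nonneg by (intro cbound_sum[OF F0_sets] cbound_HoS) auto
  then have "cbound (F0 k) ?X ?B"
    using CHJ_nonneg by (intro cbound_add[OF F0_sets] cbound_HoW) (auto intro!: sum_nonneg mult_nonneg_nonneg simp del: of_nat_sum)
  then have "cbound (F0 k) (\<lambda>\<omega>. QH * ?X \<omega>) (\<lambda>\<omega>. QH * ?B \<omega>)"
    using Q0 by (intro cbound_mult[OF F0_sets]) (auto intro!: add_nonneg_nonneg sum_nonneg)
  then show ?thesis
  proof (rule cbound_mono[OF F0_sets])
    show "AE \<omega> in M. (norm (HZhat \<Lambda> R k \<omega>))\<^sup>2 \<le> QH * ?X \<omega>"
      using AE_frame[of k] AE_space by eventually_elim (rule norm2_HZhat_le)
    show "QH * ?B \<omega> \<le> QZ * (norm (Zk k \<omega>))\<^sup>2" for \<omega>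
      by (simp add: QZ_def power_mult_distrib algebra_simps)
  qed measurable
qed

text \<open>The variance is first bounded by quantities at the iterate. This form serves twice: for
  square integrability along the run and, through \<open>growth_le\<close>, for the bound in
  distances to \<open>Ystar\<close> and \<open>Zstar\<close>.\<close>

definition growth :: "nat \<Rightarrow> 'a \<Rightarrow> real" where
  "growth k \<omega> = 1 + (norm (gradg k \<omega>))\<^sup>2 + (norm (gradf k \<omega>))\<^sup>2 + (norm (Zk k \<omega>))\<^sup>2"

definition total_deviation :: "nat \<Rightarrow> 'a \<Rightarrow> real" where
  "total_deviation k \<omega> = (norm (Vhat \<Lambda> R k \<omega> - dirY R g k \<omega>))\<^sup>2 + (norm (Shat \<Lambda> R k \<omega> - dirZ R f g k \<omega>))\<^sup>2
     + (norm (What \<Lambda> R k \<omega> - dirx R f g k \<omega>))\<^sup>2"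

text \<open>Built from the layout, \<open>Lg1\<close> and the noise levels only, so it depends
  neither on the run nor on \<open>k\<close>.\<close>

definition variance_const :: real where
  "variance_const = 2 * \<kappa>\<^sup>2 * (2 * \<sigma>g1\<^sup>2 + 2 * \<kappa>\<^sup>2) + 2 + 3 * QZ + 3 * \<kappa>\<^sup>2 * (2 * \<sigma>f2\<^sup>2 + 2 * \<kappa>\<^sup>2) + 6 * Lg1\<^sup>2 + 6
     + 3 * \<sigma>f1\<^sup>2 + 3 * (CJ * \<kappa>\<^sup>2) + 3 * Lg1\<^sup>2"

lemma growth_nonneg: "0 \<le> growth k \<omega>" by (simp add: growth_def)

lemma QZ_nonneg: "0 \<le> QZ"
  using CHJ_nonneg by (auto simp: QZ_def QH_def intro!: mult_nonneg_nonneg add_nonneg_nonneg simp del: of_nat_sum)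

lemma variance_const_nonneg: "0 \<le> variance_const"
  using CHJ_nonneg QZ_nonneg by (simp add: variance_const_def)

lemma measurable_dirs:
  "dirY R g k \<in> borel_measurable (F0 k)" "dirZ R f g k \<in> borel_measurable (F0 k)" "dirx R f g k \<in> borel_measurable (F0 k)"
proof -
  note [measurable] = measurable_F0[of k]
  show "dirY R g k \<in> borel_measurable (F0 k)" unfolding dirY_def[abs_def] by measurable
  show "dirZ R f g k \<in> borel_measurable (F0 k)" unfolding dirZ_def[abs_def] by measurable
  show "dirx R f g k \<in> borel_measurable (F0 k)" unfolding dirx_def[abs_def] by measurable
qed

lemma measurable_dirs_M [measurable]:
  "dirY R g k \<in> borel_measurable M" "dirZ R f g k \<in> borel_measurable M" "dirx R f g k \<in> borel_measurable M"
  using measurable_dirs measurable_from_subalg[OF F0_sets] by blast+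

lemma norm2_dirZ_le: "(norm (dirZ R f g k \<omega>))\<^sup>2 \<le> 2 * Lg1\<^sup>2 * (norm (Zk k \<omega>))\<^sup>2 + 2 * (norm (gradf k \<omega>))\<^sup>2"
proof -
  have "(norm (hess k \<omega> (Zk k \<omega>)))\<^sup>2 \<le> (Lg1 * norm (Zk k \<omega>))\<^sup>2" by (intro power_mono g.norm_hess22_le) simp
  then show ?thesis using norm_diff_squared_le[of "hess k \<omega> (Zk k \<omega>)" "gradf k \<omega>"]
    by (simp add: dirZ_def power_mult_distrib)
qed

lemma norm2_hessx_le: "(norm (hessx k \<omega> (Zk k \<omega>)))\<^sup>2 \<le> Lg1\<^sup>2 * (norm (Zk k \<omega>))\<^sup>2"
proof -
  have "(norm (hessx k \<omega> (Zk k \<omega>)))\<^sup>2 \<le> (Lg1 * norm (Zk k \<omega>))\<^sup>2" by (intro power_mono g.norm_hess12_le) simp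
  then show ?thesis by (simp add: power_mult_distrib)
qed

lemma total_deviation_le:
  assumes fr: "frame (Pk k \<omega>)"
  shows "total_deviation k \<omega> \<le> 2 * \<kappa>\<^sup>2 * (norm (or_V R (Suc k) \<omega>))\<^sup>2 + 3 * (norm (HZhat \<Lambda> R k \<omega>))\<^sup>2
    + 3 * \<kappa>\<^sup>2 * (norm (or_UY R (Suc k) \<omega>))\<^sup>2 + 3 * (norm (or_Ux R (Suc k) \<omega> - grad1 f (xk k \<omega>) (Yk k \<omega>)))\<^sup>2
    + 3 * (norm (Jo k \<omega> (colift \<Lambda> (Pk k \<omega>) (Zk k \<omega>))))\<^sup>2
    + (2 * (norm (gradg k \<omega>))\<^sup>2 + 6 * Lg1\<^sup>2 * (norm (Zk k \<omega>))\<^sup>2 + 6 * (norm (gradf k \<omega>))\<^sup>2 + 3 * Lg1\<^sup>2 * (norm (Zk k \<omega>))\<^sup>2)"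
proof -
  have l: "(norm (lift \<Lambda> (Pk k \<omega>) V))\<^sup>2 \<le> \<kappa>\<^sup>2 * (norm V)\<^sup>2" for V
    unfolding power_mult_distrib[symmetric] by (intro power_mono norm_lift_le fr) simp
  have ar: "a \<le> 3 * h + 3 * c * u + 3 * d" if "a \<le> 3 * h + 3 * x + 3 * z" "x \<le> c * u" "z \<le> d"
    for a h x z c u d :: real
    using that by (simp add: mult.assoc)
  have 1: "(norm (Vhat \<Lambda> R k \<omega> - dirY R g k \<omega>))\<^sup>2 \<le> 2 * \<kappa>\<^sup>2 * (norm (or_V R (Suc k) \<omega>))\<^sup>2 + 2 * (norm (gradg k \<omega>))\<^sup>2"
    using norm_diff_squared_le[of "Vhat \<Lambda> R k \<omega>" "dirY R g k \<omega>"] l[of "or_V R (Suc k) \<omega>"]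
    unfolding Vhat_def dirY_def by linarith
  have e2: "Shat \<Lambda> R k \<omega> - dirZ R f g k \<omega> = HZhat \<Lambda> R k \<omega> + (- lift \<Lambda> (Pk k \<omega>) (or_UY R (Suc k) \<omega>)) + (- dirZ R f g k \<omega>)"
    by (simp add: Shat_def)
  have 2: "(norm (Shat \<Lambda> R k \<omega> - dirZ R f g k \<omega>))\<^sup>2 \<le> 3 * (norm (HZhat \<Lambda> R k \<omega>))\<^sup>2
      + 3 * \<kappa>\<^sup>2 * (norm (or_UY R (Suc k) \<omega>))\<^sup>2 + 3 * (2 * Lg1\<^sup>2 * (norm (Zk k \<omega>))\<^sup>2 + 2 * (norm (gradf k \<omega>))\<^sup>2)"
    unfolding e2
    by (rule ar[OF norm_add3_squared_le[of "HZhat \<Lambda> R k \<omega>" "- lift \<Lambda> (Pk k \<omega>) (or_UY R (Suc k) \<omega>)" "- dirZ R f g k \<omega>",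
          unfolded norm_minus_cancel] l[of "or_UY R (Suc k) \<omega>"] norm2_dirZ_le[of k \<omega>]])
  let ?J = "Jo k \<omega> (colift \<Lambda> (Pk k \<omega>) (Zk k \<omega>))"
  have e3: "What \<Lambda> R k \<omega> - dirx R f g k \<omega>
      = (or_Ux R (Suc k) \<omega> - grad1 f (xk k \<omega>) (Yk k \<omega>)) + (- ?J) + hessx k \<omega> (Zk k \<omega>)"
    by (simp add: What_def dirx_def)
  have 3: "(norm (What \<Lambda> R k \<omega> - dirx R f g k \<omega>))\<^sup>2
      \<le> 3 * (norm (or_Ux R (Suc k) \<omega> - grad1 f (xk k \<omega>) (Yk k \<omega>)))\<^sup>2 + 3 * (norm ?J)\<^sup>2 + 3 * (Lg1\<^sup>2 * (norm (Zk k \<omega>))\<^sup>2)"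
    unfolding e3 using norm_add3_squared_le[of "or_Ux R (Suc k) \<omega> - grad1 f (xk k \<omega>) (Yk k \<omega>)" "- ?J" "hessx k \<omega> (Zk k \<omega>)"]
      norm2_hessx_le[of k \<omega>] unfolding norm_minus_cancel by linarith
  show ?thesis unfolding total_deviation_def using 1 2 3 by (simp add: algebra_simps)
qed

lemma cbound_cmult:
  assumes "cbound F X b" "subalgebra M F" "X \<in> borel_measurable M" "\<And>\<omega>. 0 \<le> X \<omega>" "0 \<le> (c :: real)"
  shows "cbound F (\<lambda>\<omega>. c * X \<omega>) (\<lambda>\<omega>. c * b \<omega>)"
  using assms by (intro cbound_mult) auto

lemma cbound_total_deviation: "cbound (F0 k) (total_deviation k) (\<lambda>\<omega>. variance_const * growth k \<omega>)"
proof -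
  note F = F0_sets[of k]
  note [measurable] = measurable_colift[OF rv_proj_M measurable_iterates(3)]
  let ?g = "\<lambda>\<omega>. norm (gradg k \<omega>)" and ?f = "\<lambda>\<omega>. norm (gradf k \<omega>)" and ?Z = "\<lambda>\<omega>. norm (Zk k \<omega>)"
  let ?X = "\<lambda>\<omega>. 2 * \<kappa>\<^sup>2 * (norm (or_V R (Suc k) \<omega>))\<^sup>2 + 3 * (norm (HZhat \<Lambda> R k \<omega>))\<^sup>2
    + 3 * \<kappa>\<^sup>2 * (norm (or_UY R (Suc k) \<omega>))\<^sup>2 + 3 * (norm (or_Ux R (Suc k) \<omega> - grad1 f (xk k \<omega>) (Yk k \<omega>)))\<^sup>2
    + 3 * (norm (Jo k \<omega> (colift \<Lambda> (Pk k \<omega>) (Zk k \<omega>))))\<^sup>2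
    + (2 * (?g \<omega>)\<^sup>2 + 6 * Lg1\<^sup>2 * (?Z \<omega>)\<^sup>2 + 6 * (?f \<omega>)\<^sup>2 + 3 * Lg1\<^sup>2 * (?Z \<omega>)\<^sup>2)"
  let ?B = "\<lambda>\<omega>. 2 * \<kappa>\<^sup>2 * (2 * \<sigma>g1\<^sup>2 + 2 * (\<kappa> * ?g \<omega>)\<^sup>2) + 3 * (QZ * (?Z \<omega>)\<^sup>2)
    + 3 * \<kappa>\<^sup>2 * (2 * \<sigma>f2\<^sup>2 + 2 * (\<kappa> * ?f \<omega>)\<^sup>2) + 3 * \<sigma>f1\<^sup>2 + 3 * (CJ * (\<kappa> * ?Z \<omega>)\<^sup>2)
    + (2 * (?g \<omega>)\<^sup>2 + 6 * Lg1\<^sup>2 * (?Z \<omega>)\<^sup>2 + 6 * (?f \<omega>)\<^sup>2 + 3 * Lg1\<^sup>2 * (?Z \<omega>)\<^sup>2)"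
  have self: "cbound (F0 k) (\<lambda>\<omega>. 2 * (?g \<omega>)\<^sup>2 + 6 * Lg1\<^sup>2 * (?Z \<omega>)\<^sup>2 + 6 * (?f \<omega>)\<^sup>2 + 3 * Lg1\<^sup>2 * (?Z \<omega>)\<^sup>2)
    (\<lambda>\<omega>. 2 * (?g \<omega>)\<^sup>2 + 6 * Lg1\<^sup>2 * (?Z \<omega>)\<^sup>2 + 6 * (?f \<omega>)\<^sup>2 + 3 * Lg1\<^sup>2 * (?Z \<omega>)\<^sup>2)"
  proof (rule cbound_self[OF F])
    note [measurable] = measurable_F0[of k]
    show "(\<lambda>\<omega>. 2 * (?g \<omega>)\<^sup>2 + 6 * Lg1\<^sup>2 * (?Z \<omega>)\<^sup>2 + 6 * (?f \<omega>)\<^sup>2 + 3 * Lg1\<^sup>2 * (?Z \<omega>)\<^sup>2) \<in> borel_measurable (F0 k)"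
      by measurable
  qed
  have nn: "\<And>\<omega>. 0 \<le> CJ * (\<kappa> * ?Z \<omega>)\<^sup>2" "\<And>\<omega>. 0 \<le> QZ * (?Z \<omega>)\<^sup>2" using CHJ_nonneg QZ_nonneg by auto
  have "cbound (F0 k) ?X ?B"
    using nn by (intro cbound_add[OF F] cbound_cmult[OF _ F] cbound_V cbound_HZhat cbound_Ux cbound_J self)
      (auto intro!: add_nonneg_nonneg mult_nonneg_nonneg)
  then show ?thesis
  proof (rule cbound_mono[OF F])
    show "AE \<omega> in M. total_deviation k \<omega> \<le> ?X \<omega>" using AE_frame[of k] by eventually_elim (rule total_deviation_le)
    show "total_deviation k \<in> borel_measurable M" unfolding total_deviation_def[abs_def] by measurable
    show "?B \<omega> \<le> variance_const * growth k \<omega>" for \<omega>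
    proof -
      \<comment> \<open>Each of 1, \<open>G\<close>, \<open>H\<close> and \<open>Z\<close> is at
        most \<open>growth\<close>, so every term of the bound can be replaced by its coefficient
        times \<open>growth\<close>.\<close>
      define G where "G = (?g \<omega>)\<^sup>2"
      define H where "H = (?f \<omega>)\<^sup>2"
      define Z where "Z = (?Z \<omega>)\<^sup>2"
      have p: "0 \<le> G" "0 \<le> H" "0 \<le> Z" by (simp_all add: G_def H_def Z_def)
      define b where "b = growth k \<omega>"
      have b: "1 \<le> b" "G \<le> b" "H \<le> b" "Z \<le> b" using p by (simp_all add: b_def growth_def G_def H_def Z_def)
      have "?B \<omega> = 2 * \<kappa>\<^sup>2 * (2 * \<sigma>g1\<^sup>2 * 1 + 2 * \<kappa>\<^sup>2 * G) + 3 * QZ * Z + 3 * \<kappa>\<^sup>2 * (2 * \<sigma>f2\<^sup>2 * 1 + 2 * \<kappa>\<^sup>2 * H)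
          + 3 * \<sigma>f1\<^sup>2 * 1 + 3 * (CJ * \<kappa>\<^sup>2) * Z + (2 * G + 6 * Lg1\<^sup>2 * Z + 6 * H + 3 * Lg1\<^sup>2 * Z)"
        by (simp add: G_def H_def Z_def power_mult_distrib mult.assoc)
      also have "\<dots> \<le> 2 * \<kappa>\<^sup>2 * (2 * \<sigma>g1\<^sup>2 * b + 2 * \<kappa>\<^sup>2 * b) + 3 * QZ * b + 3 * \<kappa>\<^sup>2 * (2 * \<sigma>f2\<^sup>2 * b + 2 * \<kappa>\<^sup>2 * b)
          + 3 * \<sigma>f1\<^sup>2 * b + 3 * (CJ * \<kappa>\<^sup>2) * b + (2 * b + 6 * Lg1\<^sup>2 * b + 6 * b + 3 * Lg1\<^sup>2 * b)"
        using b CHJ_nonneg QZ_nonneg by (intro add_mono mult_left_mono) auto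
      also have "\<dots> = variance_const * b" by (simp add: variance_const_def algebra_simps)
      finally show ?thesis by (simp add: b_def)
    qed
  qed measurable
qed

section \<open>Square integrability along the run\<close>

definition sq_int :: "('a \<Rightarrow> 'v::euclidean_space) \<Rightarrow> bool" where
  "sq_int X \<longleftrightarrow> X \<in> borel_measurable M \<and> integrable M (\<lambda>\<omega>. (norm (X \<omega>))\<^sup>2)"

lemma sq_intI:
  assumes "X \<in> borel_measurable M" "integrable M b" "\<And>\<omega>. \<omega> \<in> space M \<Longrightarrow> (norm (X \<omega>))\<^sup>2 \<le> b \<omega>"
  shows "sq_int X"
  unfolding sq_int_def
proof
  show "integrable M (\<lambda>\<omega>. (norm (X \<omega>))\<^sup>2)"
    by (rule Bochner_Integration.integrable_bound[OF assms(2)]) (use assms in \<open>auto intro!: AE_I2 order_trans[OF assms(3)]\<close>)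
qed (rule assms)

lemma sq_int_add:
  assumes "sq_int X" "sq_int Y" shows "sq_int (\<lambda>\<omega>. X \<omega> + Y \<omega>)"
  using assms by (intro sq_intI[where b = "\<lambda>\<omega>. 2 * (norm (X \<omega>))\<^sup>2 + 2 * (norm (Y \<omega>))\<^sup>2"] norm_add_squared_le)
    (auto simp: sq_int_def)

lemma sq_int_scaleR: "sq_int X \<Longrightarrow> sq_int (\<lambda>\<omega>. c *\<^sub>R X \<omega>)"
  by (auto simp: sq_int_def power_mult_distrib)

lemma sq_int_diff:
  assumes "sq_int X" "sq_int Y" shows "sq_int (\<lambda>\<omega>. X \<omega> - Y \<omega>)"
  using sq_int_add[OF assms(1) sq_int_scaleR[OF assms(2), of "-1"]] by simp

lemma sq_int_integrable:
  assumes "sq_int X" shows "integrable M X"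
proof (rule Bochner_Integration.integrable_bound)
  show "integrable M (\<lambda>\<omega>. 1 + (norm (X \<omega>))\<^sup>2)" using assms by (auto simp: sq_int_def)
  have "norm (X \<omega>) \<le> 1 + (norm (X \<omega>))\<^sup>2" for \<omega>
  proof -
    have "0 \<le> (norm (X \<omega>) - 1)\<^sup>2" by simp
    then have "2 * norm (X \<omega>) \<le> 1 + (norm (X \<omega>))\<^sup>2" by (simp add: power2_eq_square algebra_simps)
    then show ?thesis using norm_ge_zero[of "X \<omega>"] by linarith
  qed
  then show "AE \<omega> in M. norm (X \<omega>) \<le> norm (1 + (norm (X \<omega>))\<^sup>2)" by simp
qed (use assms in \<open>simp add: sq_int_def\<close>)

lemma sq_int_cong:
  assumes "sq_int X" "\<And>\<omega>. \<omega> \<in> space M \<Longrightarrow> Y \<omega> = X \<omega>" shows "sq_int Y"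
  using assms(1) measurable_cong[of M Y X borel] assms(2)
  by (intro sq_intI[where b = "\<lambda>\<omega>. (norm (X \<omega>))\<^sup>2"]) (auto simp: sq_int_def)

text \<open>For gradients: being Lipschitz, they grow at most linearly in the iterates.\<close>

lemma sq_int_affine_bound:
  fixes X :: "'a \<Rightarrow> 'u::euclidean_space" and Y :: "'a \<Rightarrow> 'v::euclidean_space" and V :: "'a \<Rightarrow> 'w::euclidean_space"
  assumes "V \<in> borel_measurable M" "sq_int X" "sq_int Y"
    and "\<And>\<omega>. norm (V \<omega>) \<le> c + L * (norm (X \<omega>) + norm (Y \<omega>))"
  shows "sq_int V"
proof (rule sq_intI[where b = "\<lambda>\<omega>. 3 * c\<^sup>2 + 3 * (L\<^sup>2 * (norm (X \<omega>))\<^sup>2) + 3 * (L\<^sup>2 * (norm (Y \<omega>))\<^sup>2)"])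
  fix \<omega>
  have "(norm (V \<omega>))\<^sup>2 \<le> (c + L * norm (X \<omega>) + L * norm (Y \<omega>))\<^sup>2"
    using assms(4)[of \<omega>] by (intro power_mono) (auto simp: algebra_simps)
  also have "\<dots> \<le> 3 * c\<^sup>2 + 3 * (L * norm (X \<omega>))\<^sup>2 + 3 * (L * norm (Y \<omega>))\<^sup>2"
    using norm_add3_squared_le[of c "L * norm (X \<omega>)" "L * norm (Y \<omega>)"] by simp
  finally show "(norm (V \<omega>))\<^sup>2 \<le> 3 * c\<^sup>2 + 3 * (L\<^sup>2 * (norm (X \<omega>))\<^sup>2) + 3 * (L\<^sup>2 * (norm (Y \<omega>))\<^sup>2)"
    by (simp add: power_mult_distrib)
qed (use assms in \<open>auto simp: sq_int_def\<close>)

definition sq_int_state :: "nat \<Rightarrow> bool" where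
  "sq_int_state k \<longleftrightarrow> sq_int (xk k) \<and> sq_int (Yk k) \<and> sq_int (Zk k) \<and> sq_int (hk k)"

text \<open>The induction step for \<open>sq_int_states\<close>. Square integrable iterates make
  \<open>growth\<close> integrable, hence the total deviation, and each stochastic direction is its
  deviation plus a square integrable full-space direction.\<close>

lemma sq_int_hats:
  assumes "sq_int_state k"
  shows "sq_int (Vhat \<Lambda> R k)" "sq_int (Shat \<Lambda> R k)" "sq_int (What \<Lambda> R k)"
    "sq_int (dirY R g k)" "sq_int (dirZ R f g k)" "sq_int (dirx R f g k)" "sq_int (gradf k)"
proof -
  have s: "sq_int (xk k)" "sq_int (Yk k)" "sq_int (Zk k)" using assms by (auto simp: sq_int_state_def)
  have gg: "sq_int (gradg k)"
    by (rule sq_int_affine_bound[OF _ s(1,2) g.norm_grad2_le]) measurable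
  show gf: "sq_int (gradf k)"
    by (rule sq_int_affine_bound[OF _ s(1,2) f.norm_grad2_le]) measurable
  have g1: "sq_int (\<lambda>\<omega>. grad1 f (xk k \<omega>) (Yk k \<omega>))"
    by (rule sq_int_affine_bound[OF _ s(1,2) f.norm_grad1_le]) measurable
  have "integrable M (growth k)" using gg gf s(3) unfolding growth_def[abs_def] sq_int_def by auto
  then have "integrable M (\<lambda>\<omega>. variance_const * growth k \<omega>)" by simp
  then have dev: "integrable M (total_deviation k)"
    using growth_nonneg variance_const_nonneg by (intro cbound_integrable[OF F0_sets cbound_total_deviation]) (auto simp: total_deviation_def[abs_def])
  show dY: "sq_int (dirY R g k)" using gg by (simp add: dirY_def[abs_def])
  show dZ: "sq_int (dirZ R f g k)"
    by (rule sq_intI[OF _ _ norm2_dirZ_le]) (use s(3) gf in \<open>auto simp: sq_int_def\<close>)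
  have "sq_int (\<lambda>\<omega>. hessx k \<omega> (Zk k \<omega>))"
    by (rule sq_intI[OF _ _ norm2_hessx_le]) (use s(3) in \<open>auto simp: sq_int_def\<close>)
  then show dx: "sq_int (dirx R f g k)" using sq_int_diff[OF g1] by (simp add: dirx_def[abs_def])
  have d: "sq_int (\<lambda>\<omega>. Vhat \<Lambda> R k \<omega> - dirY R g k \<omega>)" "sq_int (\<lambda>\<omega>. Shat \<Lambda> R k \<omega> - dirZ R f g k \<omega>)"
    "sq_int (\<lambda>\<omega>. What \<Lambda> R k \<omega> - dirx R f g k \<omega>)"
    by (rule sq_intI[OF _ dev], measurable, simp add: total_deviation_def)+
  show "sq_int (Vhat \<Lambda> R k)" "sq_int (Shat \<Lambda> R k)" "sq_int (What \<Lambda> R k)"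
    using sq_int_add[OF d(1) dY] sq_int_add[OF d(2) dZ] sq_int_add[OF d(3) dx] by simp_all
qed

lemma sq_int_states: "sq_int_state k"
proof (induction k)
  case 0
  obtain x0 Y0 Z0 where i: "\<And>\<omega>. \<omega> \<in> space M \<Longrightarrow> xk 0 \<omega> = x0 \<and> Yk 0 \<omega> = Y0 \<and> Zk 0 \<omega> = Z0 \<and> hk 0 \<omega> = 0"
    using recursion unfolding bros_recursion_def by blast
  have c: "sq_int (\<lambda>_. c)" for c :: "'v::euclidean_space" by (simp add: sq_int_def)
  have "sq_int (xk 0)" by (rule sq_int_cong[OF c[of x0]]) (simp add: i)
  moreover have "sq_int (Yk 0)" by (rule sq_int_cong[OF c[of Y0]]) (simp add: i)
  moreover have "sq_int (Zk 0)" by (rule sq_int_cong[OF c[of Z0]]) (simp add: i)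
  moreover have "sq_int (hk 0)" by (rule sq_int_cong[OF c[of 0]]) (simp add: i)
  ultimately show ?case by (simp add: sq_int_state_def)
next
  case (Suc k)
  note h = sq_int_hats[OF Suc]
  have s: "sq_int (xk k)" "sq_int (Yk k)" "sq_int (Zk k)" "sq_int (hk k)" using Suc by (auto simp: sq_int_state_def)
  have e: "\<And>\<omega>. \<omega> \<in> space M \<Longrightarrow> xk (Suc k) \<omega> = xk k \<omega> - step_x R k *\<^sub>R hk k \<omega>"
    "\<And>\<omega>. \<omega> \<in> space M \<Longrightarrow> Yk (Suc k) \<omega> = Yk k \<omega> - step_Y R k *\<^sub>R Vhat \<Lambda> R k \<omega>"
    "\<And>\<omega>. \<omega> \<in> space M \<Longrightarrow> Zk (Suc k) \<omega> = Zk k \<omega> - step_Z R k *\<^sub>R Shat \<Lambda> R k \<omega>"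
    "\<And>\<omega>. \<omega> \<in> space M \<Longrightarrow> hk (Suc k) \<omega> = (1 - step_h R k) *\<^sub>R hk k \<omega> + step_h R k *\<^sub>R What \<Lambda> R k \<omega>"
    using recursion unfolding bros_recursion_def by blast+
  have "sq_int (xk (Suc k))" by (rule sq_int_cong[OF sq_int_diff[OF s(1) sq_int_scaleR[OF s(4)]] e(1)])
  moreover have "sq_int (Yk (Suc k))" by (rule sq_int_cong[OF sq_int_diff[OF s(2) sq_int_scaleR[OF h(1)]] e(2)])
  moreover have "sq_int (Zk (Suc k))" by (rule sq_int_cong[OF sq_int_diff[OF s(3) sq_int_scaleR[OF h(2)]] e(3)])
  moreover have "sq_int (hk (Suc k))"
    by (rule sq_int_cong[OF sq_int_add[OF sq_int_scaleR[OF s(4)] sq_int_scaleR[OF h(3)]] e(4)])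
  ultimately show ?case by (simp add: sq_int_state_def)
qed

end

section \<open>Conditional means\<close>

context bros begin

lemma sq_int_AE_bound:
  fixes X :: "'a \<Rightarrow> 'u::euclidean_space" and Y :: "'a \<Rightarrow> 'v::euclidean_space"
  assumes "X \<in> borel_measurable M" "sq_int Y" "AE \<omega> in M. norm (X \<omega>) \<le> C * norm (Y \<omega>)"
  shows "sq_int X"
  unfolding sq_int_def
proof
  show "integrable M (\<lambda>\<omega>. (norm (X \<omega>))\<^sup>2)"
  proof (rule Bochner_Integration.integrable_bound)
    show "integrable M (\<lambda>\<omega>. C\<^sup>2 * (norm (Y \<omega>))\<^sup>2)" using assms(2) by (simp add: sq_int_def)
    show "AE \<omega> in M. norm ((norm (X \<omega>))\<^sup>2) \<le> norm (C\<^sup>2 * (norm (Y \<omega>))\<^sup>2)"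
      using assms(3)
    proof eventually_elim
      case (elim \<omega>)
      have "(norm (X \<omega>))\<^sup>2 \<le> (C * norm (Y \<omega>))\<^sup>2" using elim by (intro power_mono) auto
      then show ?case by (simp add: power_mult_distrib)
    qed
  qed (use assms(1) in measurable)
qed (rule assms(1))

lemma sq_int_bounded:
  fixes X :: "'a \<Rightarrow> real"
  assumes "X \<in> borel_measurable M" "AE \<omega> in M. \<bar>X \<omega>\<bar> \<le> B"
  shows "sq_int X"
  by (rule sq_int_AE_bound[where Y = "\<lambda>_. 1 :: real" and C = B]) (use assms in \<open>auto simp: sq_int_def\<close>)

lemma sq_int_bounded_mult:
  fixes b X :: "'a \<Rightarrow> real"
  assumes "b \<in> borel_measurable M" "AE \<omega> in M. \<bar>b \<omega>\<bar> \<le> B" "sq_int X"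
  shows "sq_int (\<lambda>\<omega>. b \<omega> * X \<omega>)"
proof (rule sq_int_AE_bound[OF _ assms(3)])
  show "(\<lambda>\<omega>. b \<omega> * X \<omega>) \<in> borel_measurable M" using assms by (auto simp: sq_int_def)
  show "AE \<omega> in M. norm (b \<omega> * X \<omega>) \<le> B * norm (X \<omega>)"
    using assms(2) by eventually_elim (simp add: abs_mult mult_right_mono)
qed

lemma sq_int_mult_integrable:
  fixes X Y :: "'a \<Rightarrow> real"
  assumes "sq_int X" "sq_int Y"
  shows "integrable M (\<lambda>\<omega>. X \<omega> * Y \<omega>)"
proof (rule Bochner_Integration.integrable_bound)
  show "integrable M (\<lambda>\<omega>. (X \<omega>)\<^sup>2 + (Y \<omega>)\<^sup>2)" using assms by (simp add: sq_int_def)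
  show "AE \<omega> in M. norm (X \<omega> * Y \<omega>) \<le> norm ((X \<omega>)\<^sup>2 + (Y \<omega>)\<^sup>2)"
  proof (rule AE_I2)
    fix \<omega>
    have "0 \<le> (\<bar>X \<omega>\<bar> - \<bar>Y \<omega>\<bar>)\<^sup>2" by simp
    then have "2 * (\<bar>X \<omega>\<bar> * \<bar>Y \<omega>\<bar>) \<le> (X \<omega>)\<^sup>2 + (Y \<omega>)\<^sup>2" by (simp add: power2_diff)
    moreover have "0 \<le> \<bar>X \<omega>\<bar> * \<bar>Y \<omega>\<bar>" by simp
    ultimately have "\<bar>X \<omega>\<bar> * \<bar>Y \<omega>\<bar> \<le> (X \<omega>)\<^sup>2 + (Y \<omega>)\<^sup>2" by linarith
    then show "norm (X \<omega> * Y \<omega>) \<le> norm ((X \<omega>)\<^sup>2 + (Y \<omega>)\<^sup>2)" by (simp add: abs_mult)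
  qed
qed (use assms in \<open>auto simp: sq_int_def\<close>)

lemma sq_int_inner:
  assumes "sq_int X" shows "sq_int (\<lambda>\<omega>. inner (X \<omega>) e)"
proof (rule sq_int_AE_bound[OF _ assms])
  show "AE \<omega> in M. norm (inner (X \<omega>) e) \<le> norm e * norm (X \<omega>)"
    by (rule AE_I2) (metis Cauchy_Schwarz_ineq2 mult.commute real_norm_def)
qed (use assms in \<open>auto simp: sq_int_def\<close>)

lemma integrable_times_bounded:
  fixes X b :: "'a \<Rightarrow> real"
  assumes "integrable M X" "b \<in> borel_measurable M" "AE \<omega> in M. \<bar>b \<omega>\<bar> \<le> B"
  shows "integrable M (\<lambda>\<omega>. X \<omega> * b \<omega>)"
proof (rule Bochner_Integration.integrable_bound)
  show "integrable M (\<lambda>\<omega>. B * X \<omega>)" using assms by simp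
  show "AE \<omega> in M. norm (X \<omega> * b \<omega>) \<le> norm (B * X \<omega>)"
    using assms(3)
  proof eventually_elim
    case (elim \<omega>)
    have "\<bar>X \<omega>\<bar> * \<bar>b \<omega>\<bar> \<le> \<bar>X \<omega>\<bar> * \<bar>B\<bar>" using elim by (intro mult_left_mono) auto
    then show ?case by (simp add: abs_mult mult.commute)
  qed
qed (use assms in auto)

lemma sq_int_Z: "sq_int (Zk k)" "sq_int (gradf k)" "sq_int (gradg k)"
  using sq_int_states[of k] sq_int_hats[OF sq_int_states, of k] by (auto simp: sq_int_state_def dirY_def[abs_def])

lemma sq_int_oracles:
  "sq_int (or_V R (Suc k))" "sq_int (or_UY R (Suc k))" "sq_int (or_Ux R (Suc k))" "sq_int (\<lambda>\<omega>. grad1 f (xk k \<omega>) (Yk k \<omega>))"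
proof -
  have s: "sq_int (xk k)" "sq_int (Yk k)" using sq_int_states[of k] by (auto simp: sq_int_state_def)
  show g1: "sq_int (\<lambda>\<omega>. grad1 f (xk k \<omega>) (Yk k \<omega>))"
    by (rule sq_int_affine_bound[OF _ s f.norm_grad1_le]) measurable
  have gi: "integrable M (\<lambda>\<omega>. (norm (gradg k \<omega>))\<^sup>2)" "integrable M (\<lambda>\<omega>. (norm (gradf k \<omega>))\<^sup>2)"
    using sq_int_Z by (auto simp: sq_int_def)
  have "integrable M (\<lambda>\<omega>. (norm (or_V R (Suc k) \<omega>))\<^sup>2)"
    using gi by (intro cbound_integrable[OF F0_sets cbound_V(1)]) (auto simp: power_mult_distrib)
  then show "sq_int (or_V R (Suc k))" by (simp add: sq_int_def)
  have "integrable M (\<lambda>\<omega>. (norm (or_UY R (Suc k) \<omega>))\<^sup>2)"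
    using gi by (intro cbound_integrable[OF F0_sets cbound_V(2)]) (auto simp: power_mult_distrib)
  then show "sq_int (or_UY R (Suc k))" by (simp add: sq_int_def)
  have "integrable M (\<lambda>\<omega>. (norm (or_Ux R (Suc k) \<omega> - grad1 f (xk k \<omega>) (Yk k \<omega>)))\<^sup>2)"
    by (intro cbound_integrable[OF F0_sets cbound_Ux]) auto
  then have "sq_int (\<lambda>\<omega>. or_Ux R (Suc k) \<omega> - grad1 f (xk k \<omega>) (Yk k \<omega>))" by (simp add: sq_int_def)
  from sq_int_add[OF this g1] show "sq_int (or_Ux R (Suc k))" by simp
qed

lemma sq_int_colift:
  assumes "sq_int U" shows "sq_int (\<lambda>\<omega>. colift \<Lambda> (Pk k \<omega>) (U \<omega>))"
proof (rule sq_int_AE_bound[OF _ assms])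
  show "(\<lambda>\<omega>. colift \<Lambda> (Pk k \<omega>) (U \<omega>)) \<in> borel_measurable M"
    using measurable_colift[OF rv_proj_M] assms by (auto simp: sq_int_def)
  show "AE \<omega> in M. norm (colift \<Lambda> (Pk k \<omega>) (U \<omega>)) \<le> \<kappa> * norm (U \<omega>)"
    using AE_frame[of k] by eventually_elim (rule norm_colift_le)
qed

lemma sq_int_dirS: "sq_int (dirS k t)"
proof (rule sq_int_AE_bound[OF measurable_dirS_gen[OF rv_proj_M measurable_iterates(3)] sq_int_Z(1)])
  show "AE \<omega> in M. norm (dirS k t \<omega>) \<le> \<kappa> * norm (Zk k \<omega>)"
    using AE_frame[of k] unfolding dirS_def by eventually_elim (rule norm_single_block_colift_le)
qed

lemma sq_int_dirW: "sq_int (dirW k)"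
  by (rule sq_intI[where b = "\<lambda>_. real (\<Sum>l\<in>UNIV. r l * n l)"]) (auto simp: norm_dirW)

lemma sq_int_HoJ:
  assumes W: "W \<in> borel_measurable (F2 k)" "sq_int W"
  shows "sq_int (\<lambda>\<omega>. Ho k \<omega> (W \<omega>))" "sq_int (\<lambda>\<omega>. Jo k \<omega> (W \<omega>))"
proof -
  have Wm [measurable]: "W \<in> borel_measurable M" using W by (simp add: sq_int_def)
  have Wi: "integrable M (\<lambda>\<omega>. (norm (W \<omega>))\<^sup>2)" using W by (simp add: sq_int_def)
  have "integrable M (\<lambda>\<omega>. (norm (Ho k \<omega> (W \<omega>)))\<^sup>2)"
    using Wi CHJ_nonneg by (intro cbound_integrable[OF F2_sets cbound_Ho(1)[OF W(1)]]) auto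
  then show "sq_int (\<lambda>\<omega>. Ho k \<omega> (W \<omega>))" by (simp add: sq_int_def)
  have "integrable M (\<lambda>\<omega>. (norm (Jo k \<omega> (W \<omega>)))\<^sup>2)"
    using Wi CHJ_nonneg by (intro cbound_integrable[OF F2_sets cbound_Ho(2)[OF W(1)]]) auto
  then show "sq_int (\<lambda>\<omega>. Jo k \<omega> (W \<omega>))" by (simp add: sq_int_def)
qed

text \<open>The weight \<open>c\<close> may contain projector and probe entries, since everything in
  \<open>filtPP\<close> counts as known here. Square integrability of weight and response makes the
  product integrable.\<close>

lemma pull_H:
  assumes W: "W \<in> borel_measurable (F2 k)" "sq_int W" and c: "c \<in> borel_measurable (F2 k)" "sq_int c" and e: "e \<in> Basis"
  shows "integrable M (\<lambda>\<omega>. c \<omega> * inner (Ho k \<omega> (W \<omega>)) e)"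
    and "expectation (\<lambda>\<omega>. c \<omega> * inner (Ho k \<omega> (W \<omega>)) e) = expectation (\<lambda>\<omega>. c \<omega> * inner (mH k \<omega> (W \<omega>)) e)"
    and "integrable M (\<lambda>\<omega>. c \<omega> * inner (mH k \<omega> (W \<omega>)) e)"
proof -
  have [measurable]: "W \<in> borel_measurable M" using W by (simp add: sq_int_def)
  show 1: "integrable M (\<lambda>\<omega>. c \<omega> * inner (Ho k \<omega> (W \<omega>)) e)"
    by (intro sq_int_mult_integrable c sq_int_inner sq_int_HoJ W)
  show "expectation (\<lambda>\<omega>. c \<omega> * inner (Ho k \<omega> (W \<omega>)) e) = expectation (\<lambda>\<omega>. c \<omega> * inner (mH k \<omega> (W \<omega>)) e)"
    "integrable M (\<lambda>\<omega>. c \<omega> * inner (mH k \<omega> (W \<omega>)) e)"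
    using cond_mean_weak[OF oracle_HJ(1)[OF W(1)] e c(1) 1] by auto
qed

lemma pull_J:
  assumes W: "W \<in> borel_measurable (F2 k)" "sq_int W" and c: "c \<in> borel_measurable (F2 k)" "sq_int c" and e: "e \<in> Basis"
  shows "integrable M (\<lambda>\<omega>. c \<omega> * inner (Jo k \<omega> (W \<omega>)) e)"
    and "expectation (\<lambda>\<omega>. c \<omega> * inner (Jo k \<omega> (W \<omega>)) e) = expectation (\<lambda>\<omega>. c \<omega> * inner (mJ k \<omega> (W \<omega>)) e)"
proof -
  have [measurable]: "W \<in> borel_measurable M" using W by (simp add: sq_int_def)
  show 1: "integrable M (\<lambda>\<omega>. c \<omega> * inner (Jo k \<omega> (W \<omega>)) e)"
    by (intro sq_int_mult_integrable c sq_int_inner sq_int_HoJ W)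
  show "expectation (\<lambda>\<omega>. c \<omega> * inner (Jo k \<omega> (W \<omega>)) e) = expectation (\<lambda>\<omega>. c \<omega> * inner (mJ k \<omega> (W \<omega>)) e)"
    using cond_mean_weak[OF oracle_HJ(3)[OF W(1)] e c(1) 1] by auto
qed

lemma measurable_F0_M: "X \<in> borel_measurable (F0 k) \<Longrightarrow> X \<in> borel_measurable M"
  by (rule measurable_from_subalg[OF F0_sets])

lemma sq_int_times_entry:
  assumes c: "c \<in> borel_measurable M" "\<And>\<omega>. \<bar>c \<omega>\<bar> \<le> 1" and ia: "i < m l" "a < r l"
  shows "sq_int (\<lambda>\<omega>. c \<omega> * Pk k \<omega> l $$ (i, a))"
proof (rule sq_int_bounded[where B = \<kappa>])
  show "AE \<omega> in M. \<bar>c \<omega> * Pk k \<omega> l $$ (i, a)\<bar> \<le> \<kappa>"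
    using AE_frame[of k]
  proof eventually_elim
    case (elim \<omega>)
    have "\<bar>c \<omega>\<bar> * \<bar>Pk k \<omega> l $$ (i, a)\<bar> \<le> 1 * \<kappa>"
      using c(2) frame_entry_le[OF elim ia] by (intro mult_mono) auto
    then show ?case by (simp add: abs_mult)
  qed
qed (intro borel_measurable_times c measurable_proj_entry[OF rv_proj_M] ia)

lemma integrable_times_gram:
  assumes "integrable M X" "i < m l" "j < m l"
  shows "integrable M (\<lambda>\<omega>. X \<omega> * gram (Pk k \<omega>) l i j)"
  using AE_frame[of k] assms
  by (intro integrable_times_bounded measurable_gram[OF rv_proj_M]) (auto elim!: eventually_mono intro: frame_gram_le)

lemma integrable_times_gram2:
  assumes "integrable M X" "i < m l" "j < m l" "i' < m t" "j' < m t"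
  shows "integrable M (\<lambda>\<omega>. X \<omega> * (gram (Pk k \<omega>) l i j * gram (Pk k \<omega>) t i' j'))"
  using integrable_times_gram[OF integrable_times_gram[OF assms(1-3)] assms(4,5)] by (simp add: mult.assoc)

text \<open>Serves both the direction for \<open>Y\<close> and the gradient part of the direction
  for \<open>Z\<close>. The outer projector entry joins the weight, the oracle becomes
  \<open>P\<^sup>T D\<close>, and the two projectors combine to a \<open>gram\<close> whose mean is
  the identity.\<close>

lemma expectation_lift:
  assumes c: "c \<in> borel_measurable (F0 k)" "\<And>\<omega>. \<bar>c \<omega>\<bar> \<le> 1"
    and U: "sq_int U" "cond_mean M (F1 k) U (\<lambda>\<omega>. colift \<Lambda> (Pk k \<omega>) (D \<omega>))"
    and D: "D \<in> borel_measurable (F0 k)" "sq_int D"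
    and ij: "i < m l" "j < n l"
  shows "expectation (\<lambda>\<omega>. c \<omega> * inner (lift \<Lambda> (Pk k \<omega>) (U \<omega>)) (EY l i j)) = expectation (\<lambda>\<omega>. c \<omega> * inner (D \<omega>) (EY l i j))"
proof -
  have cM: "c \<in> borel_measurable M" by (rule measurable_F0_M[OF c(1)])
  have DM [measurable]: "D \<in> borel_measurable M" by (rule measurable_F0_M[OF D(1)])
  have cP: "sq_int (\<lambda>\<omega>. c \<omega> * Pk k \<omega> l $$ (i, a))" if "a < r l" for a
    using sq_int_times_entry[OF cM c(2) ij(1) that] .
  have cP1: "(\<lambda>\<omega>. c \<omega> * Pk k \<omega> l $$ (i, a)) \<in> borel_measurable (F1 k)" if "a < r l" for a
    using that ij by (intro borel_measurable_times measurable_F1[OF c(1)] measurable_proj_entry[OF rv_proj_F1])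
  have i1: "integrable M (\<lambda>\<omega>. c \<omega> * Pk k \<omega> l $$ (i, a) * inner (U \<omega>) (EB l a j))" if "a < r l" for a
    by (intro sq_int_mult_integrable cP that sq_int_inner U)
  have w: "expectation (\<lambda>\<omega>. c \<omega> * Pk k \<omega> l $$ (i, a) * inner (U \<omega>) (EB l a j))
      = expectation (\<lambda>\<omega>. c \<omega> * Pk k \<omega> l $$ (i, a) * inner (colift \<Lambda> (Pk k \<omega>) (D \<omega>)) (EB l a j))"
    "integrable M (\<lambda>\<omega>. c \<omega> * Pk k \<omega> l $$ (i, a) * inner (colift \<Lambda> (Pk k \<omega>) (D \<omega>)) (EB l a j))" if a: "a < r l" for a
    using cond_mean_weak[OF U(2) B.unit_Basis[OF a ij(2)] cP1[OF a] i1[OF a]] measurable_colift[OF rv_proj_M DM, of k] by auto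
  have Xi: "integrable M (\<lambda>\<omega>. c \<omega> * inner (D \<omega>) (EY l p j))" for p
    by (intro sq_int_mult_integrable sq_int_inner D sq_int_bounded[OF cM, of 1] AE_I2 c)
  have Xm: "(\<lambda>\<omega>. c \<omega> * inner (D \<omega>) (EY l p j)) \<in> borel_measurable (F0 k)" for p using c(1) D(1) by measurable
  have "expectation (\<lambda>\<omega>. c \<omega> * inner (lift \<Lambda> (Pk k \<omega>) (U \<omega>)) (EY l i j))
      = expectation (\<lambda>\<omega>. \<Sum>a<r l. c \<omega> * Pk k \<omega> l $$ (i, a) * inner (U \<omega>) (EB l a j))"
    by (intro Bochner_Integration.integral_cong refl) (simp add: inner_lift[OF shaped_P ij] sum_distrib_left mult.assoc)
  also have "\<dots> = (\<Sum>a<r l. expectation (\<lambda>\<omega>. c \<omega> * Pk k \<omega> l $$ (i, a) * inner (U \<omega>) (EB l a j)))"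
    by (intro Bochner_Integration.integral_sum i1) simp
  also have "\<dots> = (\<Sum>a<r l. expectation (\<lambda>\<omega>. c \<omega> * Pk k \<omega> l $$ (i, a) * inner (colift \<Lambda> (Pk k \<omega>) (D \<omega>)) (EB l a j)))"
    by (intro sum.cong refl w) simp
  also have "\<dots> = expectation (\<lambda>\<omega>. \<Sum>a<r l. c \<omega> * Pk k \<omega> l $$ (i, a) * inner (colift \<Lambda> (Pk k \<omega>) (D \<omega>)) (EB l a j))"
    by (intro Bochner_Integration.integral_sum[symmetric] w) simp
  also have "\<dots> = expectation (\<lambda>\<omega>. \<Sum>p<m l. c \<omega> * inner (D \<omega>) (EY l p j) * gram (Pk k \<omega>) l i p)"
  proof (intro Bochner_Integration.integral_cong refl)
    fix \<omega> assume "\<omega> \<in> space M"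
    then have "(\<Sum>a<r l. Pk k \<omega> l $$ (i, a) * inner (colift \<Lambda> (Pk k \<omega>) (D \<omega>)) (EB l a j))
        = (\<Sum>p<m l. gram (Pk k \<omega>) l i p * inner (D \<omega>) (EY l p j))"
      by (intro lift_colift_unit shaped_P ij)
    then show "(\<Sum>a<r l. c \<omega> * Pk k \<omega> l $$ (i, a) * inner (colift \<Lambda> (Pk k \<omega>) (D \<omega>)) (EB l a j))
        = (\<Sum>p<m l. c \<omega> * inner (D \<omega>) (EY l p j) * gram (Pk k \<omega>) l i p)"
      by (simp add: mult.assoc sum_distrib_left[symmetric]) (simp add: mult.commute)
  qed
  also have "\<dots> = (\<Sum>p<m l. expectation (\<lambda>\<omega>. c \<omega> * inner (D \<omega>) (EY l p j) * gram (Pk k \<omega>) l i p))"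
    using ij by (intro Bochner_Integration.integral_sum integrable_times_gram Xi) auto
  also have "\<dots> = (\<Sum>p<m l. expectation (\<lambda>\<omega>. c \<omega> * inner (D \<omega>) (EY l p j)) * of_bool (i = p))"
    using ij by (intro sum.cong refl expectation_gram Xm Xi) auto
  also have "\<dots> = (\<Sum>p<m l. if p = i then expectation (\<lambda>\<omega>. c \<omega> * inner (D \<omega>) (EY l i j)) else 0)"
    by (intro sum.cong) auto
  finally show ?thesis using ij by simp
qed

text \<open>Coordinates of the Hessian, and below of \<open>Zk\<close>. They are measurable for the
  past and so separate from the projector moments.\<close>

definition hc :: "nat \<Rightarrow> 'a \<Rightarrow> 'l \<Rightarrow> nat \<Rightarrow> nat \<Rightarrow> 'l \<Rightarrow> nat \<Rightarrow> nat \<Rightarrow> real" where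
  "hc k \<omega> s p q l i j = inner (hess k \<omega> (EY s p q)) (EY l i j)"

definition Zc :: "nat \<Rightarrow> 'a \<Rightarrow> 'l \<Rightarrow> nat \<Rightarrow> nat \<Rightarrow> real" where
  "Zc k \<omega> l i j = inner (Zk k \<omega>) (EY l i j)"

text \<open>The Hessian entry is bounded by \<open>Lg1\<close>, so integrability only needs the
  square integrability of \<open>Zk\<close>.\<close>

lemma hc_Zc:
  assumes c: "c \<in> borel_measurable (F0 k)" "\<And>\<omega>. \<bar>c \<omega>\<bar> \<le> 1" and ix: "p < m s" "q < n s" "i < m l" "j < n l"
  shows "(\<lambda>\<omega>. c \<omega> * (hc k \<omega> s p q l i j * Zc k \<omega> t p' q')) \<in> borel_measurable (F0 k)"
    and "integrable M (\<lambda>\<omega>. c \<omega> * (hc k \<omega> s p q l i j * Zc k \<omega> t p' q'))"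
proof -
  note [measurable] = measurable_F0[of k] c(1)
  have h: "(\<lambda>\<omega>. hc k \<omega> s p q l i j) \<in> borel_measurable (F0 k)" unfolding hc_def by measurable
  have "(\<lambda>\<omega>. Zc k \<omega> t p' q') \<in> borel_measurable (F0 k)" unfolding Zc_def by measurable
  with h show "(\<lambda>\<omega>. c \<omega> * (hc k \<omega> s p q l i j * Zc k \<omega> t p' q')) \<in> borel_measurable (F0 k)" by measurable
  have hb: "\<bar>hc k \<omega> s p q l i j\<bar> \<le> Lg1" for \<omega>
  proof -
    have "\<bar>hc k \<omega> s p q l i j\<bar> \<le> norm (hess k \<omega> (EY s p q))"
      unfolding hc_def by (rule Y.abs_inner_unit_le[OF ix(3,4)])
    also have "\<dots> \<le> Lg1 * norm (EY s p q)" by (rule g.norm_hess22_le)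
    finally show ?thesis using norm_Basis[OF Y.unit_Basis[OF ix(1,2)]] by simp
  qed
  have z: "sq_int (\<lambda>\<omega>. Zc k \<omega> t p' q')" unfolding Zc_def by (rule sq_int_inner[OF sq_int_Z(1)])
  have "sq_int (\<lambda>\<omega>. hc k \<omega> s p q l i j * Zc k \<omega> t p' q')"
    by (rule sq_int_bounded_mult[OF measurable_F0_M[OF h] AE_I2[OF hb] z])
  then show "integrable M (\<lambda>\<omega>. c \<omega> * (hc k \<omega> s p q l i j * Zc k \<omega> t p' q'))"
    by (intro sq_int_mult_integrable sq_int_bounded[OF measurable_F0_M[OF c(1)], of 1] AE_I2 c)
qed

lemma expectation_sum2:
  fixes h :: "'i \<Rightarrow> 'j \<Rightarrow> 'a \<Rightarrow> real"
  assumes "\<And>i j. i \<in> I \<Longrightarrow> j \<in> J \<Longrightarrow> integrable M (h i j)"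
  shows "expectation (\<lambda>\<omega>. \<Sum>i\<in>I. \<Sum>j\<in>J. h i j \<omega>) = (\<Sum>i\<in>I. \<Sum>j\<in>J. expectation (h i j))"
  using assms by (subst Bochner_Integration.integral_sum)
    (auto intro!: Bochner_Integration.integral_sum sum.cong Bochner_Integration.integrable_sum)

lemma expectation_sum4:
  fixes h :: "'i \<Rightarrow> 'j \<Rightarrow> 'k \<Rightarrow> 'm \<Rightarrow> 'a \<Rightarrow> real"
  assumes "\<And>i j k l. i \<in> I \<Longrightarrow> j \<in> J \<Longrightarrow> k \<in> K \<Longrightarrow> l \<in> L \<Longrightarrow> integrable M (h i j k l)"
  shows "expectation (\<lambda>\<omega>. \<Sum>i\<in>I. \<Sum>j\<in>J. \<Sum>k\<in>K. \<Sum>l\<in>L. h i j k l \<omega>)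
    = (\<Sum>i\<in>I. \<Sum>j\<in>J. \<Sum>k\<in>K. \<Sum>l\<in>L. expectation (h i j k l))"
  using assms by (subst expectation_sum2)
    (auto intro!: expectation_sum2 sum.cong Bochner_Integration.integrable_sum)

section \<open>Contractions with the second-moment tensor\<close>

lemma sum_of_bool_mult:
  fixes G :: "nat \<Rightarrow> real"
  shows "i < N \<Longrightarrow> (\<Sum>x<N. G x * of_bool (i = x)) = G i" "i < N \<Longrightarrow> (\<Sum>x<N. G x * of_bool (x = i)) = G i"
proof -
  have "(\<Sum>x<N. G x * of_bool (i = x)) = (\<Sum>x<N. if x = i then G i else 0)"
    "(\<Sum>x<N. G x * of_bool (x = i)) = (\<Sum>x<N. if x = i then G i else 0)"
    by (intro sum.cong; auto)+
  then show "i < N \<Longrightarrow> (\<Sum>x<N. G x * of_bool (i = x)) = G i" "i < N \<Longrightarrow> (\<Sum>x<N. G x * of_bool (x = i)) = G i"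
    by simp_all
qed

lemma sum_delta_ends:
  fixes X :: "nat \<Rightarrow> nat \<Rightarrow> nat \<Rightarrow> real"
  assumes "i < N"
  shows "(\<Sum>x<N. \<Sum>y<N'. \<Sum>z<N'. X x y z * of_bool (i = x \<and> y = z)) = (\<Sum>y<N'. X i y y)"
proof -
  have "(\<Sum>y<N'. \<Sum>z<N'. X x y z * of_bool (i = x \<and> y = z)) = (\<Sum>y<N'. X x y y) * of_bool (i = x)" for x
  proof (cases "i = x")
    case True
    then show ?thesis by (auto simp: sum_of_bool_mult intro!: sum.cong)
  qed simp
  then show ?thesis using sum_of_bool_mult(1)[OF assms, of "\<lambda>x. \<Sum>y<N'. X x y y"] by simp
qed

text \<open>The fixed index \<open>i\<close> can be paired with \<open>x\<close>, \<open>y\<close>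
  or \<open>z\<close>, which leaves three single sums; the first pairing has weight
  \<open>wein_a\<close>, the other two have weight \<open>wein_b\<close>.\<close>

lemma sum_gram2:
  fixes X :: "nat \<Rightarrow> nat \<Rightarrow> nat \<Rightarrow> real"
  assumes i: "i < m l"
  shows "(\<Sum>x<m l. \<Sum>y<m l. \<Sum>z<m l. X x y z * gram2 l i x y z) = (real (m l) / real (r l))\<^sup>2 *
    (wein_a (m l) (r l) * (\<Sum>y<m l. X i y y) + wein_b (m l) (r l) * ((\<Sum>x<m l. X x i x) + (\<Sum>x<m l. X x x i)))"
proof -
  have D2: "(\<Sum>x<m l. \<Sum>y<m l. \<Sum>z<m l. X x y z * of_bool (i = y \<and> x = z)) = (\<Sum>x<m l. X x i x)"
    by (subst sum.swap) (rule sum_delta_ends[OF i, of "\<lambda>y x z. X x y z"])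
  have D3: "(\<Sum>x<m l. \<Sum>y<m l. \<Sum>z<m l. X x y z * of_bool (i = z \<and> x = y)) = (\<Sum>x<m l. X x x i)"
  proof -
    have "(\<Sum>x<m l. \<Sum>y<m l. \<Sum>z<m l. X x y z * of_bool (i = z \<and> x = y))
        = (\<Sum>x<m l. \<Sum>z<m l. \<Sum>y<m l. X x y z * of_bool (i = z \<and> x = y))"
      by (intro sum.cong refl sum.swap)
    also have "\<dots> = (\<Sum>z<m l. \<Sum>x<m l. \<Sum>y<m l. X x y z * of_bool (i = z \<and> x = y))" by (rule sum.swap)
    also have "\<dots> = (\<Sum>x<m l. X x x i)" by (rule sum_delta_ends[OF i, of "\<lambda>z x y. X x y z"])
    finally show ?thesis .
  qed
  have e: "X x y z * gram2 l i x y z = (real (m l) / real (r l))\<^sup>2 * (wein_a (m l) (r l) * (X x y z * of_bool (i = x \<and> y = z))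
     + wein_b (m l) (r l) * (X x y z * of_bool (i = y \<and> x = z) + X x y z * of_bool (i = z \<and> x = y)))" for x y z
    by (simp add: gram2_def algebra_simps)
  show ?thesis
    unfolding e sum_distrib_left[symmetric] sum.distrib sum_delta_ends[OF i] D2 D3 ..
qed

text \<open>The three contractions of the Hessian block with \<open>Z\<close> that occur in the means of the
  corrected Hessian action: the target and the two parasitic terms.\<close>

definition target_term :: "nat \<Rightarrow> ('a \<Rightarrow> real) \<Rightarrow> 'l \<Rightarrow> 'l \<Rightarrow> nat \<Rightarrow> nat \<Rightarrow> real" where
  "target_term k c t l i j = (\<Sum>q<n t. \<Sum>p<m t. expectation (\<lambda>\<omega>. c \<omega> * (hc k \<omega> t p q l i j * Zc k \<omega> t p q)))"

definition sharp_term :: "nat \<Rightarrow> ('a \<Rightarrow> real) \<Rightarrow> 'l \<Rightarrow> nat \<Rightarrow> nat \<Rightarrow> real" where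
  "sharp_term k c l i j = (\<Sum>q<n l. \<Sum>p<m l. expectation (\<lambda>\<omega>. c \<omega> * (hc k \<omega> l i q l p j * Zc k \<omega> l p q)))"

definition trace_term :: "nat \<Rightarrow> ('a \<Rightarrow> real) \<Rightarrow> 'l \<Rightarrow> nat \<Rightarrow> nat \<Rightarrow> real" where
  "trace_term k c l i j = (\<Sum>q<n l. \<Sum>p<m l. expectation (\<lambda>\<omega>. c \<omega> * (hc k \<omega> l p q l p j * Zc k \<omega> l i q)))"

lemma c_entry_F2:
  assumes "c \<in> borel_measurable (F0 k)" "i < m l" "a < r l"
  shows "(\<lambda>\<omega>. c \<omega> * Pk k \<omega> l $$ (i, a)) \<in> borel_measurable (F2 k)"
  using assms by (intro borel_measurable_times measurable_F2 measurable_F1[OF assms(1)] measurable_proj_entry[OF rv_proj_F2])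
    (auto intro: measurable_F1 measurable_F2)

text \<open>Two compressions meet here: lifting the output gives a \<open>gram\<close> of layer
  \<open>l\<close>, and the compressed direction gives a \<open>gram\<close> of layer
  \<open>t\<close>.\<close>

lemma expectation_Aent_gram:
  assumes c: "c \<in> borel_measurable (F0 k)" "\<And>\<omega>. \<bar>c \<omega>\<bar> \<le> 1" and ij: "i < m l" "j < n l"
  shows "integrable M (\<lambda>\<omega>. c \<omega> * Aent k \<omega> t l i j)"
    and "expectation (\<lambda>\<omega>. c \<omega> * Aent k \<omega> t l i j) = (\<Sum>q<n t. \<Sum>x<m l. \<Sum>p<m t. \<Sum>p'<m t.
      expectation (\<lambda>\<omega>. c \<omega> * (hc k \<omega> t p q l x j * Zc k \<omega> t p' q) * (gram (Pk k \<omega>) l i x * gram (Pk k \<omega>) t p p')))"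
proof -
  have cM: "c \<in> borel_measurable M" by (rule measurable_F0_M[OF c(1)])
  note pull = pull_H[OF measurable_dirS_F2 sq_int_dirS c_entry_F2[OF c(1) ij(1)] sq_int_times_entry[OF cM c(2) ij(1)] B.unit_Basis[OF _ ij(2)]]
  have e: "c \<omega> * Aent k \<omega> t l i j = (\<Sum>a<r l. c \<omega> * Pk k \<omega> l $$ (i, a) * inner (Ho k \<omega> (dirS k t \<omega>)) (EB l a j))" for \<omega>
    by (simp add: Aent_def sum_distrib_left mult.assoc)
  show "integrable M (\<lambda>\<omega>. c \<omega> * Aent k \<omega> t l i j)"
    unfolding e by (intro Bochner_Integration.integrable_sum pull) auto
  have "expectation (\<lambda>\<omega>. c \<omega> * Aent k \<omega> t l i j)
      = (\<Sum>a<r l. expectation (\<lambda>\<omega>. c \<omega> * Pk k \<omega> l $$ (i, a) * inner (Ho k \<omega> (dirS k t \<omega>)) (EB l a j)))"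
    unfolding e by (intro Bochner_Integration.integral_sum pull) auto
  also have "\<dots> = (\<Sum>a<r l. expectation (\<lambda>\<omega>. c \<omega> * Pk k \<omega> l $$ (i, a) * inner (mH k \<omega> (dirS k t \<omega>)) (EB l a j)))"
    by (intro sum.cong refl pull) auto
  also have "\<dots> = expectation (\<lambda>\<omega>. \<Sum>a<r l. c \<omega> * Pk k \<omega> l $$ (i, a) * inner (mH k \<omega> (dirS k t \<omega>)) (EB l a j))"
    by (intro Bochner_Integration.integral_sum[symmetric] pull) auto
  also have "\<dots> = expectation (\<lambda>\<omega>. \<Sum>q<n t. \<Sum>x<m l. \<Sum>p<m t. \<Sum>p'<m t.
      c \<omega> * (hc k \<omega> t p q l x j * Zc k \<omega> t p' q) * (gram (Pk k \<omega>) l i x * gram (Pk k \<omega>) t p p'))"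
  proof (intro Bochner_Integration.integral_cong refl)
    fix \<omega> assume w: "\<omega> \<in> space M"
    note sh = shaped_P[OF w, of k]
    have "(\<Sum>a<r l. c \<omega> * Pk k \<omega> l $$ (i, a) * inner (mH k \<omega> (dirS k t \<omega>)) (EB l a j))
        = c \<omega> * (\<Sum>a<r l. Pk k \<omega> l $$ (i, a) * inner (mH k \<omega> (dirS k t \<omega>)) (EB l a j))"
      by (simp add: sum_distrib_left mult.assoc)
    also have "\<dots> = c \<omega> * (\<Sum>x<m l. gram (Pk k \<omega>) l i x * inner (hess k \<omega> (lift \<Lambda> (Pk k \<omega>) (dirS k t \<omega>))) (EY l x j))"
      unfolding mH_def by (simp add: lift_colift_unit[OF sh ij])
    also have "\<dots> = c \<omega> * (\<Sum>x<m l. gram (Pk k \<omega>) l i x * (\<Sum>p<m t. \<Sum>q<n t. \<Sum>p'<m t. gram (Pk k \<omega>) t p p' * (hc k \<omega> t p q l x j * Zc k \<omega> t p' q)))"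
      unfolding dirS_def linear_lift_single_block[OF g.linear_hess22 sh] hc_def Zc_def ..
    also have "\<dots> = (\<Sum>x<m l. \<Sum>p<m t. \<Sum>q<n t. \<Sum>p'<m t.
        c \<omega> * (hc k \<omega> t p q l x j * Zc k \<omega> t p' q) * (gram (Pk k \<omega>) l i x * gram (Pk k \<omega>) t p p'))"
      by (simp add: sum_distrib_left mult_ac)
    also have "\<dots> = (\<Sum>x<m l. \<Sum>q<n t. \<Sum>p<m t. \<Sum>p'<m t.
        c \<omega> * (hc k \<omega> t p q l x j * Zc k \<omega> t p' q) * (gram (Pk k \<omega>) l i x * gram (Pk k \<omega>) t p p'))"
      by (intro sum.cong refl sum.swap)
    also have "\<dots> = (\<Sum>q<n t. \<Sum>x<m l. \<Sum>p<m t. \<Sum>p'<m t.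
        c \<omega> * (hc k \<omega> t p q l x j * Zc k \<omega> t p' q) * (gram (Pk k \<omega>) l i x * gram (Pk k \<omega>) t p p'))"
      by (rule sum.swap)
    finally show "(\<Sum>a<r l. c \<omega> * Pk k \<omega> l $$ (i, a) * inner (mH k \<omega> (dirS k t \<omega>)) (EB l a j)) = \<dots>" .
  qed
  also have "\<dots> = (\<Sum>q<n t. \<Sum>x<m l. \<Sum>p<m t. \<Sum>p'<m t.
      expectation (\<lambda>\<omega>. c \<omega> * (hc k \<omega> t p q l x j * Zc k \<omega> t p' q) * (gram (Pk k \<omega>) l i x * gram (Pk k \<omega>) t p p')))"
  proof -
    have int: "integrable M (\<lambda>\<omega>. c \<omega> * (hc k \<omega> t p q l x j * Zc k \<omega> t p' q) * (gram (Pk k \<omega>) l i x * gram (Pk k \<omega>) t p p'))"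
      if "q < n t" "x < m l" "p < m t" "p' < m t" for q x p p'
      using that ij by (intro integrable_times_gram2 hc_Zc(2)[OF c]) auto
    show ?thesis by (rule expectation_sum4) (simp add: int)
  qed
  finally show "expectation (\<lambda>\<omega>. c \<omega> * Aent k \<omega> t l i j) = \<dots>" .
qed

text \<open>Different layers have independent projectors, so both \<open>gram\<close> factors
  average to the identity. This is why the off-diagonal blocks need no correction.\<close>

lemma expectation_Aent_diff:
  assumes c: "c \<in> borel_measurable (F0 k)" "\<And>\<omega>. \<bar>c \<omega>\<bar> \<le> 1" and ij: "i < m l" "j < n l" and tl: "t \<noteq> l"
  shows "expectation (\<lambda>\<omega>. c \<omega> * Aent k \<omega> t l i j) = target_term k c t l i j"
proof -
  let ?X = "\<lambda>p q x p'. expectation (\<lambda>\<omega>. c \<omega> * (hc k \<omega> t p q l x j * Zc k \<omega> t p' q))"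
  have "expectation (\<lambda>\<omega>. c \<omega> * Aent k \<omega> t l i j)
    = (\<Sum>q<n t. \<Sum>x<m l. \<Sum>p<m t. \<Sum>p'<m t. ?X p q x p' * (of_bool (i = x) * of_bool (p = p')))"
    unfolding expectation_Aent_gram(2)[OF c ij] using ij tl
    by (intro sum.cong refl expectation_gram2_diff hc_Zc[OF c]) auto
  also have "\<dots> = target_term k c t l i j"
    unfolding target_term_def of_bool_conj[symmetric] by (intro sum.cong refl sum_delta_ends ij)
  finally show ?thesis .
qed

abbreviation "sc l \<equiv> (real (m l) / real (r l))\<^sup>2"
abbreviation "wa l \<equiv> wein_a (m l) (r l)"
abbreviation "wb l \<equiv> wein_b (m l) (r l)"

lemma expectation_Aent_same:
  assumes c: "c \<in> borel_measurable (F0 k)" "\<And>\<omega>. \<bar>c \<omega>\<bar> \<le> 1" and ij: "i < m l" "j < n l"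
  shows "expectation (\<lambda>\<omega>. c \<omega> * Aent k \<omega> l l i j) = sc l * (wa l * target_term k c l l i j + wb l * (sharp_term k c l i j + trace_term k c l i j))"
proof -
  let ?X = "\<lambda>q x p p'. expectation (\<lambda>\<omega>. c \<omega> * (hc k \<omega> l p q l x j * Zc k \<omega> l p' q))"
  have "expectation (\<lambda>\<omega>. c \<omega> * Aent k \<omega> l l i j)
    = (\<Sum>q<n l. \<Sum>x<m l. \<Sum>p<m l. \<Sum>p'<m l. ?X q x p p' * gram2 l i x p p')"
    unfolding expectation_Aent_gram(2)[OF c ij] using ij
    by (intro sum.cong refl expectation_gram2_same hc_Zc[OF c]) auto
  \<comment> \<open>Pairing \<open>i\<close> with the output row gives the target, with the row of
    the Hessian direction \<open>sharp_term\<close>, and with the row of \<open>Zk\<close>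
    \<open>trace_term\<close>.\<close>
  also have "\<dots> = (\<Sum>q<n l. sc l * (wa l * (\<Sum>p<m l. ?X q i p p) + wb l * ((\<Sum>p<m l. ?X q p i p) + (\<Sum>p<m l. ?X q p p i))))"
    by (intro sum.cong refl sum_gram2 ij)
  also have "\<dots> = sc l * (wa l * target_term k c l l i j + wb l * (sharp_term k c l i j + trace_term k c l i j))"
    by (simp add: target_term_def sharp_term_def trace_term_def sum_distrib_left[symmetric] sum.distrib)
  finally show ?thesis .
qed

lemma mH_entry:
  assumes w: "\<omega> \<in> space M" and a: "a < r l" "a' < r l" and j: "j < n l" "q < n l"
  shows "inner (mH k \<omega> (EB l a j)) (EB l a' q)
    = (\<Sum>y<m l. \<Sum>x<m l. Pk k \<omega> l $$ (y, a') * Pk k \<omega> l $$ (x, a) * hc k \<omega> l x j l y q)"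
proof -
  note sh = shaped_P[OF w, of k]
  have "hess k \<omega> (lift \<Lambda> (Pk k \<omega>) (EB l a j)) = (\<Sum>x<m l. Pk k \<omega> l $$ (x, a) *\<^sub>R hess k \<omega> (EY l x j))"
    unfolding lift_unitB[OF sh a(1) j(1)] by (simp add: linear_sum[OF g.linear_hess22] linear_scale[OF g.linear_hess22])
  then show ?thesis
    unfolding mH_def inner_colift[OF sh a(2) j(2)] by (simp add: hc_def inner_sum_left sum_distrib_left mult_ac)
qed

lemma mH_entry_measurable: "(\<lambda>\<omega>. inner (mH k \<omega> W) e) \<in> borel_measurable (F1 k)"
proof -
  note [measurable] = measurable_lift[OF rv_proj_F1] measurable_F1[OF measurable_F0(1)] measurable_F1[OF measurable_F0(2)]
  have "(\<lambda>\<omega>. hess k \<omega> (lift \<Lambda> (Pk k \<omega>) W)) \<in> borel_measurable (F1 k)" by measurable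
  from measurable_colift[OF rv_proj_F1 this] show ?thesis unfolding mH_def by measurable
qed

lemma mH_entry_bound:
  assumes "a < r l" "j < n l" "a' < r t" "q < n t"
  shows "AE \<omega> in M. \<bar>inner (mH k \<omega> (EB l a j)) (EB t a' q)\<bar> \<le> \<kappa>\<^sup>2 * Lg1"
  using AE_frame[of k]
proof eventually_elim
  case (elim \<omega>)
  have "\<bar>inner (mH k \<omega> (EB l a j)) (EB t a' q)\<bar> \<le> norm (mH k \<omega> (EB l a j))"
    by (rule B.abs_inner_unit_le[OF assms(3,4)])
  also have "\<dots> \<le> \<kappa>\<^sup>2 * Lg1 * norm (EB l a j)" by (rule norm_mH_le[OF elim])
  finally show ?case using norm_Basis[OF B.unit_Basis[OF assms(1,2)]] by simp
qed

lemma linear_mH: "\<omega> \<in> space M \<Longrightarrow> linear (mH k \<omega>)"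
proof -
  assume w: "\<omega> \<in> space M"
  have "linear (colift \<Lambda> (Pk k \<omega>) \<circ> (hess k \<omega> \<circ> lift \<Lambda> (Pk k \<omega>)))"
    using adjoint_linear[OF linear_lift[OF shaped_P[OF w]]] unfolding adjoint_lift[OF shaped_P[OF w]]
    by (intro linear_compose linear_lift shaped_P w g.linear_hess22)
  then show ?thesis by (simp add: comp_def mH_def[abs_def])
qed

lemma sq_int_probe_mult:
  assumes "sq_int G" "a < r l" "j < n l"
  shows "sq_int (\<lambda>\<omega>. G \<omega> * (\<xi> k \<omega> l a * \<upsilon> k \<omega> l j))"
proof -
  have "sq_int (\<lambda>\<omega>. (\<xi> k \<omega> l a * \<upsilon> k \<omega> l j) * G \<omega>)"
  proof (rule sq_int_bounded_mult[OF _ AE_I2 assms(1)])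
    show "\<bar>\<xi> k \<omega> l a * \<upsilon> k \<omega> l j\<bar> \<le> 1" if "\<omega> \<in> space M" for \<omega>
      using probe_values(1)[OF that assms(3), of k] probe_values(2)[OF that assms(2), of k] by (auto simp: abs_mult)
  qed (intro borel_measurable_times measurable_probes assms)
  then show ?thesis by (simp add: mult.commute)
qed

text \<open>A Hutchinson-type identity: by isotropy, weighting the response to the random probe with
  one probe entry recovers on average the response to the matrix unit of that entry. The weight
  \<open>G\<close> must not involve the probes.\<close>

lemma expectation_probe_H:
  assumes G: "G \<in> borel_measurable (F1 k)" "sq_int G" and ix: "a < r l" "j < n l" "a' < r l" "q < n l"
  shows "integrable M (\<lambda>\<omega>. G \<omega> * (\<xi> k \<omega> l a * \<upsilon> k \<omega> l j) * inner (Ho k \<omega> (dirW k \<omega>)) (EB l a' q))"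
    and "expectation (\<lambda>\<omega>. G \<omega> * (\<xi> k \<omega> l a * \<upsilon> k \<omega> l j) * inner (Ho k \<omega> (dirW k \<omega>)) (EB l a' q))
      = expectation (\<lambda>\<omega>. G \<omega> * inner (mH k \<omega> (EB l a j)) (EB l a' q))"
    and "integrable M (\<lambda>\<omega>. G \<omega> * inner (mH k \<omega> (EB l a j)) (EB l a' q))"
proof -
  have c: "(\<lambda>\<omega>. G \<omega> * (\<xi> k \<omega> l a * \<upsilon> k \<omega> l j)) \<in> borel_measurable (F2 k)"
    using ix by (intro borel_measurable_times measurable_F2[OF G(1)] measurable_probes_F2)
  note pull = pull_H[OF measurable_dirW_F2 sq_int_dirW c sq_int_probe_mult[OF G(2) ix(1,2)] B.unit_Basis[OF ix(3,4)]]
  show "integrable M (\<lambda>\<omega>. G \<omega> * (\<xi> k \<omega> l a * \<upsilon> k \<omega> l j) * inner (Ho k \<omega> (dirW k \<omega>)) (EB l a' q))" by (rule pull)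
  let ?h = "\<lambda>\<omega> s b x. inner (mH k \<omega> (EB s b x)) (EB l a' q)"
  have Gi: "integrable M (\<lambda>\<omega>. G \<omega> * ?h \<omega> s b x)" if "b < r s" "x < n s" for s b x
    by (rule integrable_times_bounded[OF sq_int_integrable[OF G(2)] measurable_from_subalg[OF F1_sets mH_entry_measurable] mH_entry_bound])
      (use that ix in auto)
  then show "integrable M (\<lambda>\<omega>. G \<omega> * inner (mH k \<omega> (EB l a j)) (EB l a' q))" using ix by blast
  have Gm: "(\<lambda>\<omega>. G \<omega> * ?h \<omega> s b x) \<in> borel_measurable (F1 k)" for s b x
    by (intro borel_measurable_times G mH_entry_measurable)
  have "expectation (\<lambda>\<omega>. G \<omega> * (\<xi> k \<omega> l a * \<upsilon> k \<omega> l j) * inner (mH k \<omega> (dirW k \<omega>)) (EB l a' q))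
      = expectation (\<lambda>\<omega>. \<Sum>s\<in>UNIV. \<Sum>b<r s. \<Sum>x<n s. (G \<omega> * ?h \<omega> s b x) * ((\<xi> k \<omega> l a * \<upsilon> k \<omega> l j) * (\<xi> k \<omega> s b * \<upsilon> k \<omega> s x)))"
  proof (intro Bochner_Integration.integral_cong refl)
    fix \<omega> assume w: "\<omega> \<in> space M"
    have "dirW k \<omega> = (\<Sum>s\<in>UNIV. \<Sum>b<r s. \<Sum>x<n s. (\<xi> k \<omega> s b * \<upsilon> k \<omega> s x) *\<^sub>R EB s b x)"
      by (subst B.representation[of "dirW k \<omega>"]) (simp add: inner_dirW)
    then have "inner (mH k \<omega> (dirW k \<omega>)) (EB l a' q) = (\<Sum>s\<in>UNIV. \<Sum>b<r s. \<Sum>x<n s. (\<xi> k \<omega> s b * \<upsilon> k \<omega> s x) * ?h \<omega> s b x)"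
      by (simp add: linear_sum[OF linear_mH[OF w]] linear_scale[OF linear_mH[OF w]] inner_sum_left)
    then show "G \<omega> * (\<xi> k \<omega> l a * \<upsilon> k \<omega> l j) * inner (mH k \<omega> (dirW k \<omega>)) (EB l a' q)
        = (\<Sum>s\<in>UNIV. \<Sum>b<r s. \<Sum>x<n s. (G \<omega> * ?h \<omega> s b x) * ((\<xi> k \<omega> l a * \<upsilon> k \<omega> l j) * (\<xi> k \<omega> s b * \<upsilon> k \<omega> s x)))"
      by (simp add: sum_distrib_left mult_ac)
  qed
  also have "\<dots> = (\<Sum>s\<in>UNIV. \<Sum>b<r s. \<Sum>x<n s. expectation (\<lambda>\<omega>. (G \<omega> * ?h \<omega> s b x) * ((\<xi> k \<omega> l a * \<upsilon> k \<omega> l j) * (\<xi> k \<omega> s b * \<upsilon> k \<omega> s x))))"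
    (is "_ = ?R")
  proof -
    have int: "integrable M (\<lambda>\<omega>. (G \<omega> * ?h \<omega> s b x) * ((\<xi> k \<omega> l a * \<upsilon> k \<omega> l j) * (\<xi> k \<omega> s b * \<upsilon> k \<omega> s x)))"
      if "b < r s" "x < n s" for s b x
      using that ix by (intro expectation_probes(2) Gm Gi) auto
    show ?thesis
      by (subst Bochner_Integration.integral_sum)
        (auto intro!: expectation_sum2 sum.cong Bochner_Integration.integrable_sum int)
  qed
  also have "?R = (\<Sum>s\<in>UNIV. \<Sum>b<r s. \<Sum>x<n s. expectation (\<lambda>\<omega>. G \<omega> * ?h \<omega> s b x) * of_bool (s = l \<and> b = a \<and> x = j))"
    using ix by (intro sum.cong refl expectation_probes(1) Gm Gi) auto
  also have "\<dots> = expectation (\<lambda>\<omega>. G \<omega> * inner (mH k \<omega> (EB l a j)) (EB l a' q))"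
    by (rule B.sum_delta_units[OF ix(1,2)])
  finally show "expectation (\<lambda>\<omega>. G \<omega> * (\<xi> k \<omega> l a * \<upsilon> k \<omega> l j) * inner (Ho k \<omega> (dirW k \<omega>)) (EB l a' q))
      = expectation (\<lambda>\<omega>. G \<omega> * inner (mH k \<omega> (EB l a j)) (EB l a' q))"
    using pull(2) by simp
qed

lemma hc_symmetric: "hc k \<omega> s p q l i j = hc k \<omega> l i j s p q"
  unfolding hc_def by (rule g.hess22_symmetric)

text \<open>The symmetry of the Hessian is needed here: it identifies the contraction in the mean of \<open>Chat\<close>
  with the one in the mean of \<open>Aterm\<close>.\<close>

lemma expectation_Cent:
  assumes c: "c \<in> borel_measurable (F0 k)" "\<And>\<omega>. \<bar>c \<omega>\<bar> \<le> 1" and ij: "i < m l" "j < n l"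
  shows "integrable M (\<lambda>\<omega>. c \<omega> * Cent k \<omega> l i j)"
    and "expectation (\<lambda>\<omega>. c \<omega> * Cent k \<omega> l i j) = trace_term k c l i j"
proof -
  have cM: "c \<in> borel_measurable M" by (rule measurable_F0_M[OF c(1)])
  have Zm: "(\<lambda>\<omega>. Zc k \<omega> l i q) \<in> borel_measurable (F0 k)" for q
    unfolding Zc_def using measurable_F0(3)[of k] by measurable
  have G: "(\<lambda>\<omega>. c \<omega> * Zc k \<omega> l i q) \<in> borel_measurable (F1 k)" "sq_int (\<lambda>\<omega>. c \<omega> * Zc k \<omega> l i q)" for q
  proof -
    show "(\<lambda>\<omega>. c \<omega> * Zc k \<omega> l i q) \<in> borel_measurable (F1 k)" by (intro measurable_F1 borel_measurable_times c Zm)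
    show "sq_int (\<lambda>\<omega>. c \<omega> * Zc k \<omega> l i q)"
      unfolding Zc_def by (intro sq_int_bounded_mult[OF cM AE_I2 sq_int_inner[OF sq_int_Z(1)], of 1] c)
  qed
  note pr = expectation_probe_H[OF G]
  have e: "c \<omega> * Cent k \<omega> l i j = (\<Sum>q<n l. \<Sum>a<r l. c \<omega> * Zc k \<omega> l i q * (\<xi> k \<omega> l a * \<upsilon> k \<omega> l j) * inner (Ho k \<omega> (dirW k \<omega>)) (EB l a q))" for \<omega>
    by (simp add: Cent_def Zc_def sum_distrib_left mult.assoc)
  show "integrable M (\<lambda>\<omega>. c \<omega> * Cent k \<omega> l i j)"
    unfolding e using ij by (intro Bochner_Integration.integrable_sum pr) auto
  have "expectation (\<lambda>\<omega>. c \<omega> * Cent k \<omega> l i j)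
      = (\<Sum>q<n l. \<Sum>a<r l. expectation (\<lambda>\<omega>. c \<omega> * Zc k \<omega> l i q * (\<xi> k \<omega> l a * \<upsilon> k \<omega> l j) * inner (Ho k \<omega> (dirW k \<omega>)) (EB l a q)))"
    unfolding e using ij by (intro expectation_sum2 pr) auto
  also have "\<dots> = (\<Sum>q<n l. \<Sum>a<r l. expectation (\<lambda>\<omega>. c \<omega> * Zc k \<omega> l i q * inner (mH k \<omega> (EB l a j)) (EB l a q)))"
    using ij by (intro sum.cong refl pr) auto
  also have "\<dots> = (\<Sum>q<n l. expectation (\<lambda>\<omega>. \<Sum>a<r l. c \<omega> * Zc k \<omega> l i q * inner (mH k \<omega> (EB l a j)) (EB l a q)))"
    using ij by (intro sum.cong refl Bochner_Integration.integral_sum[symmetric] pr) auto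
  \<comment> \<open>\<open>Zk\<close> enters \<open>Chat\<close> uncompressed, so a single
    \<open>gram\<close> remains and its first moment suffices: \<open>Chat\<close> is an unbiased
    estimate of \<open>trace_term\<close>.\<close>
  also have "\<dots> = (\<Sum>q<n l. expectation (\<lambda>\<omega>. \<Sum>y<m l. \<Sum>x<m l. c \<omega> * (hc k \<omega> l y q l x j * Zc k \<omega> l i q) * gram (Pk k \<omega>) l y x))"
  proof (rule sum.cong[OF refl], rule Bochner_Integration.integral_cong[OF refl])
    fix q \<omega> assume q: "q \<in> {..<n l}" and w: "\<omega> \<in> space M"
    have "(\<Sum>a<r l. c \<omega> * Zc k \<omega> l i q * inner (mH k \<omega> (EB l a j)) (EB l a q))
        = (\<Sum>a<r l. \<Sum>y<m l. \<Sum>x<m l. c \<omega> * (hc k \<omega> l y q l x j * Zc k \<omega> l i q) * (Pk k \<omega> l $$ (y, a) * Pk k \<omega> l $$ (x, a)))"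
      using q ij by (intro sum.cong refl) (simp add: mH_entry[OF w] sum_distrib_left hc_symmetric[of k \<omega> l _ j] mult_ac)
    also have "\<dots> = (\<Sum>y<m l. \<Sum>a<r l. \<Sum>x<m l. c \<omega> * (hc k \<omega> l y q l x j * Zc k \<omega> l i q) * (Pk k \<omega> l $$ (y, a) * Pk k \<omega> l $$ (x, a)))"
      by (rule sum.swap)
    also have "\<dots> = (\<Sum>y<m l. \<Sum>x<m l. \<Sum>a<r l. c \<omega> * (hc k \<omega> l y q l x j * Zc k \<omega> l i q) * (Pk k \<omega> l $$ (y, a) * Pk k \<omega> l $$ (x, a)))"
      by (intro sum.cong refl sum.swap)
    also have "\<dots> = (\<Sum>y<m l. \<Sum>x<m l. c \<omega> * (hc k \<omega> l y q l x j * Zc k \<omega> l i q) * gram (Pk k \<omega>) l y x)"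
      by (simp add: gram_def sum_distrib_left)
    finally show "(\<Sum>a<r l. c \<omega> * Zc k \<omega> l i q * inner (mH k \<omega> (EB l a j)) (EB l a q)) = \<dots>" .
  qed
  also have "\<dots> = (\<Sum>q<n l. \<Sum>y<m l. \<Sum>x<m l. expectation (\<lambda>\<omega>. c \<omega> * (hc k \<omega> l y q l x j * Zc k \<omega> l i q)) * of_bool (y = x))"
  proof (rule sum.cong[OF refl])
    fix q assume q: "q \<in> {..<n l}"
    have "expectation (\<lambda>\<omega>. \<Sum>y<m l. \<Sum>x<m l. c \<omega> * (hc k \<omega> l y q l x j * Zc k \<omega> l i q) * gram (Pk k \<omega>) l y x)
        = (\<Sum>y<m l. \<Sum>x<m l. expectation (\<lambda>\<omega>. c \<omega> * (hc k \<omega> l y q l x j * Zc k \<omega> l i q) * gram (Pk k \<omega>) l y x))"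
      using q ij by (intro expectation_sum2 integrable_times_gram hc_Zc(2)[OF c]) auto
    also have "\<dots> = (\<Sum>y<m l. \<Sum>x<m l. expectation (\<lambda>\<omega>. c \<omega> * (hc k \<omega> l y q l x j * Zc k \<omega> l i q)) * of_bool (y = x))"
      using q ij by (intro sum.cong refl expectation_gram hc_Zc[OF c]) auto
    finally show "expectation (\<lambda>\<omega>. \<Sum>y<m l. \<Sum>x<m l. c \<omega> * (hc k \<omega> l y q l x j * Zc k \<omega> l i q) * gram (Pk k \<omega>) l y x)
        = (\<Sum>y<m l. \<Sum>x<m l. expectation (\<lambda>\<omega>. c \<omega> * (hc k \<omega> l y q l x j * Zc k \<omega> l i q)) * of_bool (y = x))" .
  qed
  also have "\<dots> = trace_term k c l i j"
    unfolding trace_term_def by (intro sum.cong refl sum_of_bool_mult) auto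
  finally show "expectation (\<lambda>\<omega>. c \<omega> * Cent k \<omega> l i j) = trace_term k c l i j" .
qed

text \<open>Collects the sums over the columns \<open>a\<close> and \<open>b\<close> into two
  factors, which become the two \<open>gram\<close> entries. The abbreviation \<open>T\<close> keeps
  the summand opaque while the sums are exchanged.\<close>

lemma sum_rearrange:
  fixes u v :: "nat \<Rightarrow> real" and s h :: "nat \<Rightarrow> nat \<Rightarrow> real"
  shows "(\<Sum>a\<in>A. \<Sum>b\<in>B. u a * (\<Sum>p\<in>C. s p b * v p) * (\<Sum>y\<in>C. \<Sum>x\<in>C. s y b * s x a * h x y))
    = (\<Sum>x\<in>C. \<Sum>p\<in>C. \<Sum>y\<in>C. (h x y * v p) * ((\<Sum>a\<in>A. u a * s x a) * (\<Sum>b\<in>B. s p b * s y b)))"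
proof -
  define T where "T a b p y x = (h x y * v p) * ((u a * s x a) * (s p b * s y b))" for a b p y x
  have "(\<Sum>a\<in>A. \<Sum>b\<in>B. u a * (\<Sum>p\<in>C. s p b * v p) * (\<Sum>y\<in>C. \<Sum>x\<in>C. s y b * s x a * h x y))
      = (\<Sum>a\<in>A. \<Sum>b\<in>B. \<Sum>p\<in>C. \<Sum>y\<in>C. \<Sum>x\<in>C. T a b p y x)"
  proof (rule sum.cong[OF refl], rule sum.cong[OF refl])
    fix a b
    have "u a * (\<Sum>p\<in>C. s p b * v p) * (\<Sum>y\<in>C. \<Sum>x\<in>C. s y b * s x a * h x y)
        = u a * (\<Sum>p\<in>C. \<Sum>y\<in>C. (s p b * v p) * (\<Sum>x\<in>C. s y b * s x a * h x y))"
      by (simp only: mult.assoc sum_product)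
    then show "u a * (\<Sum>p\<in>C. s p b * v p) * (\<Sum>y\<in>C. \<Sum>x\<in>C. s y b * s x a * h x y) = (\<Sum>p\<in>C. \<Sum>y\<in>C. \<Sum>x\<in>C. T a b p y x)"
      by (simp add: T_def sum_distrib_left mult_ac)
  qed
  also have "\<dots> = (\<Sum>a\<in>A. \<Sum>p\<in>C. \<Sum>b\<in>B. \<Sum>y\<in>C. \<Sum>x\<in>C. T a b p y x)"
    by (rule sum.cong[OF refl], rule sum.swap)
  also have "\<dots> = (\<Sum>p\<in>C. \<Sum>a\<in>A. \<Sum>b\<in>B. \<Sum>y\<in>C. \<Sum>x\<in>C. T a b p y x)" by (rule sum.swap)
  also have "\<dots> = (\<Sum>p\<in>C. \<Sum>a\<in>A. \<Sum>y\<in>C. \<Sum>b\<in>B. \<Sum>x\<in>C. T a b p y x)"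
    by (rule sum.cong[OF refl], rule sum.cong[OF refl], rule sum.swap)
  also have "\<dots> = (\<Sum>p\<in>C. \<Sum>y\<in>C. \<Sum>a\<in>A. \<Sum>b\<in>B. \<Sum>x\<in>C. T a b p y x)"
    by (rule sum.cong[OF refl], rule sum.swap)
  also have "\<dots> = (\<Sum>p\<in>C. \<Sum>y\<in>C. \<Sum>a\<in>A. \<Sum>x\<in>C. \<Sum>b\<in>B. T a b p y x)"
    by (rule sum.cong[OF refl], rule sum.cong[OF refl], rule sum.cong[OF refl], rule sum.swap)
  also have "\<dots> = (\<Sum>p\<in>C. \<Sum>y\<in>C. \<Sum>x\<in>C. \<Sum>a\<in>A. \<Sum>b\<in>B. T a b p y x)"
    by (rule sum.cong[OF refl], rule sum.cong[OF refl], rule sum.swap)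
  also have "\<dots> = (\<Sum>p\<in>C. \<Sum>x\<in>C. \<Sum>y\<in>C. \<Sum>a\<in>A. \<Sum>b\<in>B. T a b p y x)"
    by (rule sum.cong[OF refl], rule sum.swap)
  also have "\<dots> = (\<Sum>x\<in>C. \<Sum>p\<in>C. \<Sum>y\<in>C. \<Sum>a\<in>A. \<Sum>b\<in>B. T a b p y x)" by (rule sum.swap)
  also have "\<dots> = (\<Sum>x\<in>C. \<Sum>p\<in>C. \<Sum>y\<in>C. (h x y * v p) * ((\<Sum>a\<in>A. u a * s x a) * (\<Sum>b\<in>B. s p b * s y b)))"
    unfolding T_def by (intro sum.cong refl) (subst sum_product, simp only: sum_distrib_left)
  finally show ?thesis .
qed

text \<open>Compared with \<open>expectation_Aent_same\<close> the target and
  \<open>sharp_term\<close> change places, whereas \<open>trace_term\<close> keeps its weight. Hence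
  the mean of \<open>A - Bsharp\<close> is a multiple of the target minus
  \<open>sharp_term\<close>.\<close>

lemma expectation_Bent:
  assumes c: "c \<in> borel_measurable (F0 k)" "\<And>\<omega>. \<bar>c \<omega>\<bar> \<le> 1" and ij: "i < m l" "j < n l"
  shows "integrable M (\<lambda>\<omega>. c \<omega> * Bent k \<omega> l i j)"
    and "expectation (\<lambda>\<omega>. c \<omega> * Bent k \<omega> l i j) = sc l * (wa l * sharp_term k c l i j + wb l * (trace_term k c l i j + target_term k c l l i j))"
proof -
  have cM: "c \<in> borel_measurable M" by (rule measurable_F0_M[OF c(1)])
  let ?z = "\<lambda>\<omega> b q. inner (colift \<Lambda> (Pk k \<omega>) (Zk k \<omega>)) (EB l b q)"
  let ?P = "\<lambda>\<omega> i a. Pk k \<omega> l $$ (i, a)"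
  have G: "(\<lambda>\<omega>. c \<omega> * ?P \<omega> i a * ?z \<omega> b q) \<in> borel_measurable (F1 k)" "sq_int (\<lambda>\<omega>. c \<omega> * ?P \<omega> i a * ?z \<omega> b q)"
    if a: "a < r l" for a b q
  proof -
    have z: "(\<lambda>\<omega>. ?z \<omega> b q) \<in> borel_measurable (F1 k)"
      using measurable_colift[OF rv_proj_F1 measurable_F1[OF measurable_F0(3)]] by measurable
    have cp: "(\<lambda>\<omega>. c \<omega> * ?P \<omega> i a) \<in> borel_measurable (F1 k)"
      using a ij by (intro borel_measurable_times measurable_F1[OF c(1)] measurable_proj_entry[OF rv_proj_F1])
    show "(\<lambda>\<omega>. c \<omega> * ?P \<omega> i a * ?z \<omega> b q) \<in> borel_measurable (F1 k)"
      by (intro borel_measurable_times[OF cp z])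
    show "sq_int (\<lambda>\<omega>. c \<omega> * ?P \<omega> i a * ?z \<omega> b q)"
    proof (rule sq_int_bounded_mult[OF measurable_from_subalg[OF F1_sets cp] _ sq_int_inner[OF sq_int_colift[OF sq_int_Z(1)]]])
      show "AE \<omega> in M. \<bar>c \<omega> * ?P \<omega> i a\<bar> \<le> 1 * \<kappa>"
        using AE_frame[of k]
        by eventually_elim (unfold abs_mult, intro mult_mono c frame_entry_le ij a, auto)
    qed
  qed
  note pr = expectation_probe_H[OF G]
  have e: "c \<omega> * Bent k \<omega> l i j = (\<Sum>q<n l. \<Sum>a<r l. \<Sum>b<r l. c \<omega> * ?P \<omega> i a * ?z \<omega> b q * (\<xi> k \<omega> l a * \<upsilon> k \<omega> l q) * inner (Ho k \<omega> (dirW k \<omega>)) (EB l b j))" for \<omega>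
  proof -
    let ?t = "\<lambda>a b q. ?P \<omega> i a * ?z \<omega> b q * (\<xi> k \<omega> l a * \<upsilon> k \<omega> l q) * inner (Ho k \<omega> (dirW k \<omega>)) (EB l b j)"
    have "Bent k \<omega> l i j = (\<Sum>a<r l. \<Sum>q<n l. \<Sum>b<r l. ?t a b q)"
      unfolding Bent_def by (rule sum.cong[OF refl], rule sum.swap)
    also have "\<dots> = (\<Sum>q<n l. \<Sum>a<r l. \<Sum>b<r l. ?t a b q)" by (rule sum.swap)
    finally show ?thesis by (simp add: sum_distrib_left mult.assoc)
  qed
  have int: "integrable M (\<lambda>\<omega>. \<Sum>a<r l. \<Sum>b<r l. c \<omega> * ?P \<omega> i a * ?z \<omega> b q * (\<xi> k \<omega> l a * \<upsilon> k \<omega> l q) * inner (Ho k \<omega> (dirW k \<omega>)) (EB l b j))"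
    if "q < n l" for q using that ij by (intro Bochner_Integration.integrable_sum pr) auto
  show "integrable M (\<lambda>\<omega>. c \<omega> * Bent k \<omega> l i j)"
    unfolding e by (rule Bochner_Integration.integrable_sum) (simp add: int)
  have "expectation (\<lambda>\<omega>. c \<omega> * Bent k \<omega> l i j)
      = (\<Sum>q<n l. expectation (\<lambda>\<omega>. \<Sum>a<r l. \<Sum>b<r l. c \<omega> * ?P \<omega> i a * ?z \<omega> b q * (\<xi> k \<omega> l a * \<upsilon> k \<omega> l q) * inner (Ho k \<omega> (dirW k \<omega>)) (EB l b j)))"
    unfolding e by (rule Bochner_Integration.integral_sum) (simp add: int)
  also have "\<dots> = (\<Sum>q<n l. \<Sum>x<m l. \<Sum>p<m l. \<Sum>y<m l.
      expectation (\<lambda>\<omega>. c \<omega> * (hc k \<omega> l x q l y j * Zc k \<omega> l p q)) * gram2 l i x p y)"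
  proof (rule sum.cong[OF refl])
    fix q assume "q \<in> {..<n l}"
    then have q: "q < n l" by simp
    have "expectation (\<lambda>\<omega>. \<Sum>a<r l. \<Sum>b<r l. c \<omega> * ?P \<omega> i a * ?z \<omega> b q * (\<xi> k \<omega> l a * \<upsilon> k \<omega> l q) * inner (Ho k \<omega> (dirW k \<omega>)) (EB l b j))
        = (\<Sum>a<r l. \<Sum>b<r l. expectation (\<lambda>\<omega>. c \<omega> * ?P \<omega> i a * ?z \<omega> b q * (\<xi> k \<omega> l a * \<upsilon> k \<omega> l q) * inner (Ho k \<omega> (dirW k \<omega>)) (EB l b j)))"
      using q ij by (intro expectation_sum2 pr) auto
    also have "\<dots> = (\<Sum>a<r l. \<Sum>b<r l. expectation (\<lambda>\<omega>. c \<omega> * ?P \<omega> i a * ?z \<omega> b q * inner (mH k \<omega> (EB l a q)) (EB l b j)))"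
      using q ij by (intro sum.cong refl pr) auto
    also have "\<dots> = expectation (\<lambda>\<omega>. \<Sum>a<r l. \<Sum>b<r l. c \<omega> * ?P \<omega> i a * ?z \<omega> b q * inner (mH k \<omega> (EB l a q)) (EB l b j))"
      using q ij by (intro expectation_sum2[symmetric] pr) auto
    also have "\<dots> = expectation (\<lambda>\<omega>. \<Sum>x<m l. \<Sum>p<m l. \<Sum>y<m l.
        c \<omega> * (hc k \<omega> l x q l y j * Zc k \<omega> l p q) * (gram (Pk k \<omega>) l i x * gram (Pk k \<omega>) l p y))"
    \<comment> \<open>Three projector factors and the one in the compressed \<open>Zk\<close> pair
      up: the sums over \<open>a\<close> and \<open>b\<close> each close to a
      \<open>gram\<close>.\<close>
    proof (intro Bochner_Integration.integral_cong refl)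
      fix \<omega> assume w: "\<omega> \<in> space M"
      have "(\<Sum>a<r l. \<Sum>b<r l. c \<omega> * ?P \<omega> i a * ?z \<omega> b q * inner (mH k \<omega> (EB l a q)) (EB l b j))
          = c \<omega> * (\<Sum>a<r l. \<Sum>b<r l. ?P \<omega> i a * (\<Sum>p<m l. ?P \<omega> p b * Zc k \<omega> l p q)
              * (\<Sum>y<m l. \<Sum>x<m l. ?P \<omega> y b * ?P \<omega> x a * hc k \<omega> l x q l y j))"
        unfolding sum_distrib_left[of "c \<omega>"] using q ij
        by (intro sum.cong refl) (simp add: mH_entry[OF w] inner_colift[OF shaped_P[OF w]] Zc_def mult.assoc)
      also have "\<dots> = c \<omega> * (\<Sum>x<m l. \<Sum>p<m l. \<Sum>y<m l. (hc k \<omega> l x q l y j * Zc k \<omega> l p q) * (gram (Pk k \<omega>) l i x * gram (Pk k \<omega>) l p y))"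
        unfolding sum_rearrange gram_def ..
      finally show "(\<Sum>a<r l. \<Sum>b<r l. c \<omega> * ?P \<omega> i a * ?z \<omega> b q * inner (mH k \<omega> (EB l a q)) (EB l b j))
          = (\<Sum>x<m l. \<Sum>p<m l. \<Sum>y<m l. c \<omega> * (hc k \<omega> l x q l y j * Zc k \<omega> l p q) * (gram (Pk k \<omega>) l i x * gram (Pk k \<omega>) l p y))"
        by (simp add: sum_distrib_left mult.assoc)
    qed
    also have "\<dots> = (\<Sum>x<m l. \<Sum>p<m l. \<Sum>y<m l.
        expectation (\<lambda>\<omega>. c \<omega> * (hc k \<omega> l x q l y j * Zc k \<omega> l p q) * (gram (Pk k \<omega>) l i x * gram (Pk k \<omega>) l p y)))"
    proof -
      have "integrable M (\<lambda>\<omega>. c \<omega> * (hc k \<omega> l x q l y j * Zc k \<omega> l p q) * (gram (Pk k \<omega>) l i x * gram (Pk k \<omega>) l p y))"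
        if "x < m l" "p < m l" "y < m l" for x p y
        using that q ij by (intro integrable_times_gram2 hc_Zc(2)[OF c]) auto
      then show ?thesis
        by (subst expectation_sum2) (auto intro!: Bochner_Integration.integral_sum sum.cong Bochner_Integration.integrable_sum)
    qed
    also have "\<dots> = (\<Sum>x<m l. \<Sum>p<m l. \<Sum>y<m l. expectation (\<lambda>\<omega>. c \<omega> * (hc k \<omega> l x q l y j * Zc k \<omega> l p q)) * gram2 l i x p y)"
      using q ij by (intro sum.cong refl expectation_gram2_same hc_Zc[OF c]) auto
    finally show "expectation (\<lambda>\<omega>. \<Sum>a<r l. \<Sum>b<r l. c \<omega> * ?P \<omega> i a * ?z \<omega> b q * (\<xi> k \<omega> l a * \<upsilon> k \<omega> l q) * inner (Ho k \<omega> (dirW k \<omega>)) (EB l b j)) = \<dots>" .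
  qed
  also have "\<dots> = (\<Sum>q<n l. sc l * (wa l * (\<Sum>p<m l. expectation (\<lambda>\<omega>. c \<omega> * (hc k \<omega> l i q l p j * Zc k \<omega> l p q)))
      + wb l * ((\<Sum>p<m l. expectation (\<lambda>\<omega>. c \<omega> * (hc k \<omega> l p q l p j * Zc k \<omega> l i q)))
              + (\<Sum>p<m l. expectation (\<lambda>\<omega>. c \<omega> * (hc k \<omega> l p q l i j * Zc k \<omega> l p q))))))"
    by (intro sum.cong refl sum_gram2 ij)
  also have "\<dots> = sc l * (wa l * sharp_term k c l i j + wb l * (trace_term k c l i j + target_term k c l l i j))"
    by (simp add: target_term_def sharp_term_def trace_term_def sum_distrib_left[symmetric] sum.distrib)
  finally show "expectation (\<lambda>\<omega>. c \<omega> * Bent k \<omega> l i j) = \<dots>" .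
qed

text \<open>The equations that determine the coefficients. In the mean of the corrected block the
  first cancels \<open>trace_term\<close>, the first two together cancel \<open>sharp_term\<close>,
  and the third then gives the target weight 1. The second is solvable because
  \<open>wein_a - wein_b = r (r - 1) / (m (m - 1))\<close> does not vanish for \<open>r\<close> at
  least 2.\<close>

lemma correction_coefficients:
  shows "c1 l * (sc l * wb l) = c2 l" "c3 l * (sc l * (wa l - wb l)) = c2 l"
    "c1 l * (sc l * wa l) + c2 l = 1"
proof -
  define x where "x = real (m l)"
  define y where "y = real (r l)"
  have xy: "2 \<le> y" "y \<le> x" using sizes[of l] by (simp_all add: x_def y_def)
  then have nz: "x \<noteq> 0" "y \<noteq> 0" "x - 1 \<noteq> 0" "x + 2 \<noteq> 0" "y - 1 \<noteq> 0" by auto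
  define D where "D = x * y + x - 2"
  have "0 \<le> x * y" using xy by simp
  then have D: "D \<noteq> 0" using xy mult_mono[of 2 x 2 y] by (simp add: D_def)
  have b: "wb l = y * (x - y) / (x * (x - 1) * (x + 2))" by (simp add: wein_b_def x_def y_def)
  have "wa l = y / x - (x + 1) * (y * (x - y) / (x * (x - 1) * (x + 2)))" by (simp add: wein_a_def b x_def y_def[symmetric])
  also have "\<dots> = (y * ((x - 1) * (x + 2))) / (x * (x - 1) * (x + 2)) - (x + 1) * (y * (x - y)) / (x * (x - 1) * (x + 2))"
    using nz by simp
  also have "\<dots> = y * (x * y + y - 2) / (x * (x - 1) * (x + 2))"
    unfolding diff_divide_distrib[symmetric] by (simp add: algebra_simps)
  finally have a: "wa l = y * (x * y + y - 2) / (x * (x - 1) * (x + 2))" .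
  have "wa l - wb l = (y * (y - 1) * (x + 2)) / (x * (x - 1) * (x + 2))"
    unfolding a b diff_divide_distrib[symmetric] by (simp add: algebra_simps)
  then have ab: "wa l - wb l = y * (y - 1) / (x * (x - 1))" using nz by simp
  have s: "sc l = x * x / (y * y)" by (simp add: x_def y_def power2_eq_square)
  have c1: "c1 l = y * (x - 1) * (x + 2) / (x * D)" by (simp add: c1_def x_def y_def D_def)
  have c2: "c2 l = (x - y) / D" by (simp add: c2_def x_def y_def D_def)
  have c3: "c3 l = y * (x - 1) * (x - y) / (x * (y - 1) * D)" by (simp add: c3_def x_def y_def D_def)
  show "c1 l * (sc l * wb l) = c2 l" unfolding c1 s b c2 using nz D by simp
  show "c3 l * (sc l * (wa l - wb l)) = c2 l" unfolding c3 s ab c2 using nz D by simp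
  have "c1 l * (sc l * wa l) = (x * y + y - 2) / D" unfolding c1 s a using nz D by simp
  then have "c1 l * (sc l * wa l) + c2 l = (x * y + y - 2 + (x - y)) / D"
    unfolding c2 add_divide_distrib[of "x * y + y - 2"] by (rule arg_cong)
  also have "x * y + y - 2 + (x - y) = D" by (simp add: D_def)
  finally show "c1 l * (sc l * wa l) + c2 l = 1" using D by simp
qed

lemma expectation_HZhat:
  assumes c: "c \<in> borel_measurable (F0 k)" "\<And>\<omega>. \<bar>c \<omega>\<bar> \<le> 1" and ij: "i < m l" "j < n l"
  shows "integrable M (\<lambda>\<omega>. c \<omega> * inner (HZhat \<Lambda> R k \<omega>) (EY l i j))"
    and "expectation (\<lambda>\<omega>. c \<omega> * inner (HZhat \<Lambda> R k \<omega>) (EY l i j)) = (\<Sum>t\<in>UNIV. target_term k c t l i j)"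
proof -
  let ?A = "\<lambda>\<omega> t. c \<omega> * Aent k \<omega> t l i j" and ?C = "\<lambda>\<omega>. c \<omega> * Cent k \<omega> l i j" and ?B = "\<lambda>\<omega>. c \<omega> * Bent k \<omega> l i j"
  have e: "c \<omega> * inner (HZhat \<Lambda> R k \<omega>) (EY l i j)
      = c1 l * ?A \<omega> l - c2 l * ?C \<omega> + c3 l * (?A \<omega> l - ?B \<omega>) + (\<Sum>t\<in>UNIV - {l}. ?A \<omega> t)" if "\<omega> \<in> space M" for \<omega>
    unfolding inner_HZhat[OF that ij] by (simp add: sum_distrib_left algebra_simps)
  note ints = expectation_Aent_gram(1)[OF c ij] expectation_Cent(1)[OF c ij] expectation_Bent(1)[OF c ij]
  have i: "integrable M (\<lambda>\<omega>. c1 l * ?A \<omega> l - c2 l * ?C \<omega> + c3 l * (?A \<omega> l - ?B \<omega>) + (\<Sum>t\<in>UNIV - {l}. ?A \<omega> t))"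
    using ints by auto
  show "integrable M (\<lambda>\<omega>. c \<omega> * inner (HZhat \<Lambda> R k \<omega>) (EY l i j))"
    by (rule Bochner_Integration.integrable_cong[THEN iffD2, OF refl _ i]) (rule e)
  have "expectation (\<lambda>\<omega>. c \<omega> * inner (HZhat \<Lambda> R k \<omega>) (EY l i j))
      = expectation (\<lambda>\<omega>. c1 l * ?A \<omega> l - c2 l * ?C \<omega> + c3 l * (?A \<omega> l - ?B \<omega>) + (\<Sum>t\<in>UNIV - {l}. ?A \<omega> t))"
    by (intro Bochner_Integration.integral_cong refl e)
  also have "\<dots> = c1 l * expectation (\<lambda>\<omega>. ?A \<omega> l) - c2 l * expectation ?C + c3 l * (expectation (\<lambda>\<omega>. ?A \<omega> l) - expectation ?B)
      + (\<Sum>t\<in>UNIV - {l}. expectation (\<lambda>\<omega>. ?A \<omega> t))"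
    using ints by simp
  also have "(\<Sum>t\<in>UNIV - {l}. expectation (\<lambda>\<omega>. ?A \<omega> t)) = (\<Sum>t\<in>UNIV - {l}. target_term k c t l i j)"
    by (intro sum.cong refl expectation_Aent_diff c ij) auto
  also have "c1 l * expectation (\<lambda>\<omega>. ?A \<omega> l) - c2 l * expectation ?C + c3 l * (expectation (\<lambda>\<omega>. ?A \<omega> l) - expectation ?B) = target_term k c l l i j"
  proof -
    define h where "h = target_term k c l l i j"
    define p where "p = sharp_term k c l i j"
    define q where "q = trace_term k c l i j"
    have "c1 l * (sc l * (wa l * h + wb l * (p + q))) - c2 l * q + c3 l * (sc l * (wa l * h + wb l * (p + q)) - sc l * (wa l * p + wb l * (q + h)))
        = (c1 l * (sc l * wa l)) * h + (c1 l * (sc l * wb l)) * (p + q) - c2 l * q + (c3 l * (sc l * (wa l - wb l))) * (h - p)"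
      by (simp add: algebra_simps)
    also have "\<dots> = (c1 l * (sc l * wa l) + c2 l) * h" unfolding correction_coefficients(1,2) by (simp add: algebra_simps)
    also have "\<dots> = h" unfolding correction_coefficients(3) by simp
    finally show ?thesis
      unfolding expectation_Aent_same[OF c ij] expectation_Cent(2)[OF c ij] expectation_Bent(2)[OF c ij] h_def p_def q_def .
  qed
  finally show "expectation (\<lambda>\<omega>. c \<omega> * inner (HZhat \<Lambda> R k \<omega>) (EY l i j)) = (\<Sum>t\<in>UNIV. target_term k c t l i j)"
    by (simp add: sum.remove[of UNIV l "\<lambda>t. target_term k c t l i j"])
qed

text \<open>The exact Hessian action expanded into the same \<open>target_term\<close>s, so that it
  can be compared with \<open>expectation_HZhat\<close> term by term.\<close>

lemma expectation_hess:
  assumes c: "c \<in> borel_measurable (F0 k)" "\<And>\<omega>. \<bar>c \<omega>\<bar> \<le> 1" and ij: "i < m l" "j < n l"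
  shows "integrable M (\<lambda>\<omega>. c \<omega> * inner (hess k \<omega> (Zk k \<omega>)) (EY l i j))"
    and "expectation (\<lambda>\<omega>. c \<omega> * inner (hess k \<omega> (Zk k \<omega>)) (EY l i j)) = (\<Sum>t\<in>UNIV. target_term k c t l i j)"
proof -
  have e: "c \<omega> * inner (hess k \<omega> (Zk k \<omega>)) (EY l i j) = (\<Sum>t\<in>UNIV. \<Sum>q<n t. \<Sum>p<m t. c \<omega> * (hc k \<omega> t p q l i j * Zc k \<omega> t p q))" for \<omega>
  proof -
    have "hess k \<omega> (Zk k \<omega>) = hess k \<omega> (\<Sum>t\<in>UNIV. \<Sum>p<m t. \<Sum>q<n t. Zc k \<omega> t p q *\<^sub>R EY t p q)"
      unfolding Zc_def by (subst Y.representation[symmetric]) (rule refl)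
    also have "\<dots> = (\<Sum>t\<in>UNIV. \<Sum>p<m t. \<Sum>q<n t. Zc k \<omega> t p q *\<^sub>R hess k \<omega> (EY t p q))"
      by (simp add: linear_sum[OF g.linear_hess22] linear_scale[OF g.linear_hess22])
    finally have "inner (hess k \<omega> (Zk k \<omega>)) (EY l i j) = (\<Sum>t\<in>UNIV. \<Sum>p<m t. \<Sum>q<n t. hc k \<omega> t p q l i j * Zc k \<omega> t p q)"
      by (simp add: inner_sum_left hc_def mult.commute)
    also have "\<dots> = (\<Sum>t\<in>UNIV. \<Sum>q<n t. \<Sum>p<m t. hc k \<omega> t p q l i j * Zc k \<omega> t p q)"
      by (rule sum.cong[OF refl], rule sum.swap)
    finally show ?thesis by (simp add: sum_distrib_left)
  qed
  have int: "integrable M (\<lambda>\<omega>. \<Sum>q<n t. \<Sum>p<m t. c \<omega> * (hc k \<omega> t p q l i j * Zc k \<omega> t p q))" for t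
    using ij by (intro Bochner_Integration.integrable_sum hc_Zc(2)[OF c]) auto
  show "integrable M (\<lambda>\<omega>. c \<omega> * inner (hess k \<omega> (Zk k \<omega>)) (EY l i j))"
    unfolding e by (intro Bochner_Integration.integrable_sum int)
  have "expectation (\<lambda>\<omega>. c \<omega> * inner (hess k \<omega> (Zk k \<omega>)) (EY l i j))
      = (\<Sum>t\<in>UNIV. expectation (\<lambda>\<omega>. \<Sum>q<n t. \<Sum>p<m t. c \<omega> * (hc k \<omega> t p q l i j * Zc k \<omega> t p q)))"
    unfolding e by (intro Bochner_Integration.integral_sum int)
  also have "\<dots> = (\<Sum>t\<in>UNIV. target_term k c t l i j)"
    unfolding target_term_def using ij by (intro sum.cong refl expectation_sum2 hc_Zc(2)[OF c]) auto
  finally show "expectation (\<lambda>\<omega>. c \<omega> * inner (hess k \<omega> (Zk k \<omega>)) (EY l i j)) = (\<Sum>t\<in>UNIV. target_term k c t l i j)" .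
qed

section \<open>Unbiasedness of the three stochastic directions\<close>

lemma cond_mean_V: "cond_mean M (F0 k) (Vhat \<Lambda> R k) (dirY R g k)"
proof (rule cond_meanI[OF F0_sets])
  note h = sq_int_hats[OF sq_int_states[of k]]
  show "integrable M (Vhat \<Lambda> R k)" "integrable M (dirY R g k)" using h by (auto intro: sq_int_integrable)
  show "dirY R g k \<in> borel_measurable (F0 k)" by (rule measurable_dirs)
  fix A and e :: 'y assume A: "A \<in> sets (F0 k)" and e: "e \<in> Basis"
  obtain l i j where ij: "i < m l" "j < n l" "e = EY l i j" using Y.Basis_unitE[OF e] .
  show "expectation (\<lambda>\<omega>. indicator A \<omega> * inner (Vhat \<Lambda> R k \<omega>) e) = expectation (\<lambda>\<omega>. indicator A \<omega> * inner (dirY R g k \<omega>) e)"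
    unfolding Vhat_def dirY_def ij(3) using A
    by (intro expectation_lift[OF _ _ sq_int_oracles(1) oracle_V(1) measurable_gradf_F0(2) sq_int_Z(3)] ij)
      (auto simp: indicator_def)
qed

lemma cond_mean_S: "cond_mean M (F0 k) (Shat \<Lambda> R k) (dirZ R f g k)"
proof (rule cond_meanI[OF F0_sets])
  note h = sq_int_hats[OF sq_int_states[of k]]
  show "integrable M (Shat \<Lambda> R k)" "integrable M (dirZ R f g k)" using h by (auto intro: sq_int_integrable)
  show "dirZ R f g k \<in> borel_measurable (F0 k)" by (rule measurable_dirs)
  fix A and e :: 'y assume A: "A \<in> sets (F0 k)" and e: "e \<in> Basis"
  obtain l i j where ij: "i < m l" "j < n l" "e = EY l i j" using Y.Basis_unitE[OF e] .
  define c :: "'a \<Rightarrow> real" where "c = indicator A"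
  have c: "c \<in> borel_measurable (F0 k)" "\<And>\<omega>. \<bar>c \<omega>\<bar> \<le> 1" using A by (auto simp: c_def indicator_def)
  have cM: "c \<in> borel_measurable M" by (rule measurable_F0_M[OF c(1)])
  have cs: "sq_int c" by (rule sq_int_bounded[OF cM AE_I2[OF c(2)]])
  let ?U = "\<lambda>\<omega>. lift \<Lambda> (Pk k \<omega>) (or_UY R (Suc k) \<omega>)"
  have U: "sq_int ?U"
  proof (rule sq_int_AE_bound[OF _ sq_int_oracles(2)])
    show "?U \<in> borel_measurable M" by (rule measurable_lift[OF rv_proj_M]) measurable
    show "AE \<omega> in M. norm (?U \<omega>) \<le> \<kappa> * norm (or_UY R (Suc k) \<omega>)"
      using AE_frame[of k] by eventually_elim (rule norm_lift_le)
  qed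
  have i: "integrable M (\<lambda>\<omega>. c \<omega> * inner (?U \<omega>) e)" "integrable M (\<lambda>\<omega>. c \<omega> * inner (gradf k \<omega>) e)"
    by (intro sq_int_mult_integrable cs sq_int_inner U sq_int_Z)+
  have "expectation (\<lambda>\<omega>. c \<omega> * inner (Shat \<Lambda> R k \<omega>) e)
      = expectation (\<lambda>\<omega>. c \<omega> * inner (HZhat \<Lambda> R k \<omega>) e) - expectation (\<lambda>\<omega>. c \<omega> * inner (?U \<omega>) e)"
    using expectation_HZhat(1)[OF c ij(1,2)] i unfolding ij(3)
    by (simp add: Shat_def inner_diff_left right_diff_distrib)
  also have "\<dots> = expectation (\<lambda>\<omega>. c \<omega> * inner (hess k \<omega> (Zk k \<omega>)) e) - expectation (\<lambda>\<omega>. c \<omega> * inner (gradf k \<omega>) e)"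
    unfolding ij(3) expectation_HZhat(2)[OF c ij(1,2)] expectation_hess(2)[OF c ij(1,2)]
      expectation_lift[OF c sq_int_oracles(2) oracle_UY(1) measurable_gradf_F0(1) sq_int_Z(2) ij(1,2)] ..
  also have "\<dots> = expectation (\<lambda>\<omega>. c \<omega> * inner (dirZ R f g k \<omega>) e)"
    using expectation_hess(1)[OF c ij(1,2)] i unfolding ij(3)
    by (simp add: dirZ_def inner_diff_left right_diff_distrib)
  finally show "expectation (\<lambda>\<omega>. indicator A \<omega> * inner (Shat \<Lambda> R k \<omega>) e) = expectation (\<lambda>\<omega>. indicator A \<omega> * inner (dirZ R f g k \<omega>) e)"
    by (simp add: c_def)
qed

text \<open>The direction handed to the oracle is compressed once and its mean lifts it once, so
  \<open>hessx\<close> is applied to \<open>P P\<^sup>T Zk\<close> and the first moment of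
  \<open>gram\<close> is enough.\<close>

lemma expectation_J:
  assumes c: "c \<in> borel_measurable (F0 k)" "\<And>\<omega>. \<bar>c \<omega>\<bar> \<le> 1" and e: "e \<in> Basis"
  shows "integrable M (\<lambda>\<omega>. c \<omega> * inner (Jo k \<omega> (colift \<Lambda> (Pk k \<omega>) (Zk k \<omega>))) e)"
    and "expectation (\<lambda>\<omega>. c \<omega> * inner (Jo k \<omega> (colift \<Lambda> (Pk k \<omega>) (Zk k \<omega>))) e)
      = expectation (\<lambda>\<omega>. c \<omega> * inner (hessx k \<omega> (Zk k \<omega>)) e)"
proof -
  have cM: "c \<in> borel_measurable M" by (rule measurable_F0_M[OF c(1)])
  have cs: "sq_int c" by (rule sq_int_bounded[OF cM AE_I2[OF c(2)]])
  note pull = pull_J[OF measurable_colift_F2 sq_int_colift[OF sq_int_Z(1)] measurable_F2[OF measurable_F1[OF c(1)]] cs e]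
  show "integrable M (\<lambda>\<omega>. c \<omega> * inner (Jo k \<omega> (colift \<Lambda> (Pk k \<omega>) (Zk k \<omega>))) e)" by (rule pull)
  let ?h = "\<lambda>\<omega> l i j. inner (hessx k \<omega> (EY l i j)) e"
  let ?X = "\<lambda>l i j p \<omega>. c \<omega> * (?h \<omega> l i j * Zc k \<omega> l p j)"
  have hm: "(\<lambda>\<omega>. ?h \<omega> l i j) \<in> borel_measurable (F0 k)" for l i j
  proof -
    note [measurable] = measurable_F0[of k]
    show ?thesis by measurable
  qed
  have zm: "(\<lambda>\<omega>. Zc k \<omega> l p j) \<in> borel_measurable (F0 k)" for l p j
    unfolding Zc_def using measurable_F0(3)[of k] by measurable
  have Xm: "?X l i j p \<in> borel_measurable (F0 k)" for l i j p
    by (intro borel_measurable_times c hm zm)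
  have Xi: "integrable M (?X l i j p)" if "i < m l" "j < n l" for l i j p
  proof (intro sq_int_mult_integrable cs sq_int_bounded_mult[OF measurable_F0_M[OF hm] AE_I2])
    show "sq_int (\<lambda>\<omega>. Zc k \<omega> l p j)" unfolding Zc_def by (rule sq_int_inner[OF sq_int_Z(1)])
    fix \<omega>
    have "\<bar>?h \<omega> l i j\<bar> \<le> norm (hessx k \<omega> (EY l i j))" by (rule Basis_le_norm[OF e])
    also have "\<dots> \<le> Lg1 * norm (EY l i j)" by (rule g.norm_hess12_le)
    finally show "\<bar>?h \<omega> l i j\<bar> \<le> Lg1" using norm_Basis[OF Y.unit_Basis[OF that]] by simp
  qed
  have lin: "inner (hessx k \<omega> V) e = (\<Sum>l\<in>UNIV. \<Sum>i<m l. \<Sum>j<n l. inner V (EY l i j) * ?h \<omega> l i j)" for \<omega> V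
    by (subst Y.representation[of V]) (simp add: linear_sum[OF g.linear_hess12] linear_scale[OF g.linear_hess12] inner_sum_left)
  have linZ: "inner (hessx k \<omega> (Zk k \<omega>)) e = (\<Sum>l\<in>UNIV. \<Sum>i<m l. \<Sum>j<n l. inner (Zk k \<omega>) (EY l i j) * ?h \<omega> l i j)" for \<omega>
    by (rule lin)
  have split: "expectation (\<lambda>\<omega>. \<Sum>l\<in>UNIV. \<Sum>i<m l. \<Sum>j<n l. H l i j \<omega>) = (\<Sum>l\<in>UNIV. \<Sum>i<m l. \<Sum>j<n l. expectation (H l i j))"
    if "\<And>l i j. i < m l \<Longrightarrow> j < n l \<Longrightarrow> integrable M (H l i j)" for H :: "'l \<Rightarrow> nat \<Rightarrow> nat \<Rightarrow> 'a \<Rightarrow> real"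
    using that by (subst Bochner_Integration.integral_sum)
      (auto intro!: expectation_sum2 sum.cong Bochner_Integration.integrable_sum)
  have "expectation (\<lambda>\<omega>. c \<omega> * inner (Jo k \<omega> (colift \<Lambda> (Pk k \<omega>) (Zk k \<omega>))) e)
      = expectation (\<lambda>\<omega>. c \<omega> * inner (mJ k \<omega> (colift \<Lambda> (Pk k \<omega>) (Zk k \<omega>))) e)" by (rule pull)
  also have "\<dots> = expectation (\<lambda>\<omega>. \<Sum>l\<in>UNIV. \<Sum>i<m l. \<Sum>j<n l. \<Sum>p<m l. ?X l i j p \<omega> * gram (Pk k \<omega>) l i p)"
  proof (intro Bochner_Integration.integral_cong refl)
    fix \<omega> assume w: "\<omega> \<in> space M"
    note sh = shaped_P[OF w, of k]
    have "c \<omega> * inner (mJ k \<omega> (colift \<Lambda> (Pk k \<omega>) (Zk k \<omega>))) e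
        = c \<omega> * (\<Sum>l\<in>UNIV. \<Sum>i<m l. \<Sum>j<n l. (\<Sum>p<m l. gram (Pk k \<omega>) l i p * Zc k \<omega> l p j) * ?h \<omega> l i j)"
      unfolding mJ_def by (subst lin) (simp add: Zc_def inner_lift[OF sh] lift_colift_unit[OF sh])
    then show "c \<omega> * inner (mJ k \<omega> (colift \<Lambda> (Pk k \<omega>) (Zk k \<omega>))) e
        = (\<Sum>l\<in>UNIV. \<Sum>i<m l. \<Sum>j<n l. \<Sum>p<m l. ?X l i j p \<omega> * gram (Pk k \<omega>) l i p)"
      by (simp add: sum_distrib_left sum_distrib_right mult_ac)
  qed
  also have "\<dots> = (\<Sum>l\<in>UNIV. \<Sum>i<m l. \<Sum>j<n l. expectation (\<lambda>\<omega>. \<Sum>p<m l. ?X l i j p \<omega> * gram (Pk k \<omega>) l i p))"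
    by (rule split) (auto intro!: Bochner_Integration.integrable_sum integrable_times_gram Xi)
  also have "\<dots> = (\<Sum>l\<in>UNIV. \<Sum>i<m l. \<Sum>j<n l. expectation (?X l i j i))"
  proof (intro sum.cong refl)
    fix l i j assume ij: "i \<in> {..<m l}" "j \<in> {..<n l}"
    have "expectation (\<lambda>\<omega>. \<Sum>p<m l. ?X l i j p \<omega> * gram (Pk k \<omega>) l i p)
        = (\<Sum>p<m l. expectation (\<lambda>\<omega>. ?X l i j p \<omega> * gram (Pk k \<omega>) l i p))"
      using ij by (intro Bochner_Integration.integral_sum integrable_times_gram Xi) auto
    also have "\<dots> = (\<Sum>p<m l. expectation (?X l i j p) * of_bool (i = p))"
      using ij by (intro sum.cong refl expectation_gram Xm Xi) auto
    also have "\<dots> = expectation (?X l i j i)" using ij by (intro sum_of_bool_mult) auto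
    finally show "expectation (\<lambda>\<omega>. \<Sum>p<m l. ?X l i j p \<omega> * gram (Pk k \<omega>) l i p) = expectation (?X l i j i)" .
  qed
  also have "\<dots> = expectation (\<lambda>\<omega>. \<Sum>l\<in>UNIV. \<Sum>i<m l. \<Sum>j<n l. ?X l i j i \<omega>)"
    by (rule split[symmetric]) (rule Xi)
  also have "\<dots> = expectation (\<lambda>\<omega>. c \<omega> * inner (hessx k \<omega> (Zk k \<omega>)) e)"
    unfolding linZ by (simp add: sum_distrib_left Zc_def mult_ac)
  finally show "expectation (\<lambda>\<omega>. c \<omega> * inner (Jo k \<omega> (colift \<Lambda> (Pk k \<omega>) (Zk k \<omega>))) e)
      = expectation (\<lambda>\<omega>. c \<omega> * inner (hessx k \<omega> (Zk k \<omega>)) e)" .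
qed

lemma cond_mean_W: "cond_mean M (F0 k) (What \<Lambda> R k) (dirx R f g k)"
proof (rule cond_meanI[OF F0_sets])
  note h = sq_int_hats[OF sq_int_states[of k]]
  show "integrable M (What \<Lambda> R k)" "integrable M (dirx R f g k)" using h by (auto intro: sq_int_integrable)
  show "dirx R f g k \<in> borel_measurable (F0 k)" by (rule measurable_dirs)
  fix A and e :: 'x assume A: "A \<in> sets (F0 k)" and e: "e \<in> Basis"
  define c :: "'a \<Rightarrow> real" where "c = indicator A"
  have c: "c \<in> borel_measurable (F0 k)" "\<And>\<omega>. \<bar>c \<omega>\<bar> \<le> 1" using A by (auto simp: c_def indicator_def)
  have cM: "c \<in> borel_measurable M" by (rule measurable_F0_M[OF c(1)])
  have cs: "sq_int c" by (rule sq_int_bounded[OF cM AE_I2[OF c(2)]])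
  let ?J = "\<lambda>\<omega>. Jo k \<omega> (colift \<Lambda> (Pk k \<omega>) (Zk k \<omega>))"
  have hx: "sq_int (\<lambda>\<omega>. hessx k \<omega> (Zk k \<omega>))"
    using sq_int_diff[OF sq_int_oracles(4)[of k] h(6)] by (simp add: dirx_def)
  have i: "integrable M (\<lambda>\<omega>. c \<omega> * inner (or_Ux R (Suc k) \<omega>) e)" "integrable M (\<lambda>\<omega>. c \<omega> * inner (grad1 f (xk k \<omega>) (Yk k \<omega>)) e)"
    "integrable M (\<lambda>\<omega>. c \<omega> * inner (hessx k \<omega> (Zk k \<omega>)) e)"
    by (intro sq_int_mult_integrable cs sq_int_inner sq_int_oracles hx)+
  have U: "expectation (\<lambda>\<omega>. c \<omega> * inner (or_Ux R (Suc k) \<omega>) e) = expectation (\<lambda>\<omega>. c \<omega> * inner (grad1 f (xk k \<omega>) (Yk k \<omega>)) e)"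
    by (rule cond_mean_weak[OF oracle_Ux(1) e measurable_F1[OF c(1)] i(1)]) measurable
  have "expectation (\<lambda>\<omega>. c \<omega> * inner (What \<Lambda> R k \<omega>) e)
      = expectation (\<lambda>\<omega>. c \<omega> * inner (or_Ux R (Suc k) \<omega>) e) - expectation (\<lambda>\<omega>. c \<omega> * inner (?J \<omega>) e)"
    using expectation_J(1)[OF c e] i by (simp add: What_def inner_diff_left right_diff_distrib)
  also have "\<dots> = expectation (\<lambda>\<omega>. c \<omega> * inner (dirx R f g k \<omega>) e)"
    unfolding U expectation_J(2)[OF c e] using i by (simp add: dirx_def inner_diff_left right_diff_distrib)
  finally show "expectation (\<lambda>\<omega>. indicator A \<omega> * inner (What \<Lambda> R k \<omega>) e) = expectation (\<lambda>\<omega>. indicator A \<omega> * inner (dirx R f g k \<omega>) e)"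
    by (simp add: c_def)
qed

text \<open>The gradient of \<open>g\<close> vanishes at \<open>Ystar\<close>, that of
  \<open>f\<close> is at most \<open>Lf0\<close> there, and \<open>Zstar\<close> is at most
  \<open>Lf0 / \<mu>g\<close>; Lipschitz continuity does the rest. In the constant, 1 and the two
  squared distances have each been replaced by their sum.\<close>

lemma growth_le:
  assumes f0: "norm (grad2 f (xk k \<omega>) (Ystar g (xk k \<omega>))) \<le> Lf0"
  shows "growth k \<omega> \<le> (1 + Lg1\<^sup>2 + 2 * Lf0\<^sup>2 + 2 * Lf1\<^sup>2 + 2 + 2 * (Lf0 / \<mu>g)\<^sup>2)
    * (1 + (norm (Yk k \<omega> - Ystar g (xk k \<omega>)))\<^sup>2 + (norm (Zk k \<omega> - Zstar f g (xk k \<omega>)))\<^sup>2)"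
proof -
  let ?x = "xk k \<omega>"
  define u where "u = (norm (Yk k \<omega> - Ystar g ?x))\<^sup>2"
  define v where "v = (norm (Zk k \<omega> - Zstar f g ?x))\<^sup>2"
  define d where "d = 1 + u + v"
  have uv: "0 \<le> u" "0 \<le> v" by (simp_all add: u_def v_def)
  then have d: "1 \<le> d" "u \<le> d" "v \<le> d" by (simp_all add: d_def)
  have "(norm (gradg k \<omega>))\<^sup>2 \<le> (Lg1 * norm (Yk k \<omega> - Ystar g ?x))\<^sup>2"
    by (intro power_mono g.norm_grad2_le_Ystar) simp
  then have 1: "(norm (gradg k \<omega>))\<^sup>2 \<le> Lg1\<^sup>2 * u" by (simp add: u_def power_mult_distrib)
  have "(norm (gradf k \<omega> - grad2 f ?x (Ystar g ?x)))\<^sup>2 \<le> (Lf1 * norm (Yk k \<omega> - Ystar g ?x))\<^sup>2"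
    by (intro power_mono f.norm_grad2_diff) simp
  moreover have "(norm (grad2 f ?x (Ystar g ?x)))\<^sup>2 \<le> Lf0\<^sup>2" by (intro power_mono f0) simp
  ultimately have 2: "(norm (gradf k \<omega>))\<^sup>2 \<le> 2 * (Lf1\<^sup>2 * u) + 2 * Lf0\<^sup>2"
    using norm_add_squared_le[of "gradf k \<omega> - grad2 f ?x (Ystar g ?x)" "grad2 f ?x (Ystar g ?x)"]
    by (simp add: u_def power_mult_distrib)
  have "\<mu>g * norm (Zstar f g ?x) \<le> Lf0" using g.norm_Zstar_le[of f ?x] f0 by simp
  then have "norm (Zstar f g ?x) \<le> Lf0 / \<mu>g" using g.mu_pos by (simp add: pos_le_divide_eq mult.commute)
  then have "(norm (Zstar f g ?x))\<^sup>2 \<le> (Lf0 / \<mu>g)\<^sup>2" by (intro power_mono) auto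
  then have 3: "(norm (Zk k \<omega>))\<^sup>2 \<le> 2 * v + 2 * (Lf0 / \<mu>g)\<^sup>2"
    using norm_add_squared_le[of "Zk k \<omega> - Zstar f g ?x" "Zstar f g ?x"] by (simp add: v_def)
  have "growth k \<omega> \<le> 1 * 1 + Lg1\<^sup>2 * u + (2 * Lf1\<^sup>2 * u + 2 * Lf0\<^sup>2 * 1) + (2 * v + 2 * (Lf0 / \<mu>g)\<^sup>2 * 1)"
    unfolding growth_def using 1 2 3 by simp
  also have "\<dots> \<le> 1 * d + Lg1\<^sup>2 * d + (2 * Lf1\<^sup>2 * d + 2 * Lf0\<^sup>2 * d) + (2 * d + 2 * (Lf0 / \<mu>g)\<^sup>2 * d)"
    using d by (intro add_mono mult_left_mono) auto
  also have "\<dots> = (1 + Lg1\<^sup>2 + 2 * Lf0\<^sup>2 + 2 * Lf1\<^sup>2 + 2 + 2 * (Lf0 / \<mu>g)\<^sup>2) * d" by (simp add: algebra_simps)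
  finally show ?thesis by (simp add: d_def u_def v_def)
qed

end

theorem lemma1:
  fixes \<Lambda> :: "('l::finite, 'y::euclidean_space, 'b::euclidean_space) layout"
    and f g :: "(real ^ 'd) \<times> 'y \<Rightarrow> real"
    and \<mu>g Lf0 Lf1 Lg1 Lg2 \<sigma>f1 \<sigma>f2 \<sigma>g1 \<sigma>g2 :: real
  assumes "valid_layout \<Lambda>"
    and "assumption_A1 f g \<mu>g Lf0 Lf1 Lg1 Lg2"
    and "0 \<le> \<sigma>f1" "0 \<le> \<sigma>f2" "0 \<le> \<sigma>g1" "0 \<le> \<sigma>g2"
  shows "(\<forall>R :: ('a, real ^ 'd, 'y, 'b, 'l) run. bros_run \<Lambda> f g \<sigma>f1 \<sigma>f2 \<sigma>g1 \<sigma>g2 R \<longrightarrow> (\<forall>k.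
            integrable (pspace R) (Vhat \<Lambda> R k) \<and> cond_mean (pspace R) (filt \<Lambda> R k) (Vhat \<Lambda> R k) (dirY R g k) \<and>
            integrable (pspace R) (Shat \<Lambda> R k) \<and> cond_mean (pspace R) (filt \<Lambda> R k) (Shat \<Lambda> R k) (dirZ R f g k) \<and>
            integrable (pspace R) (What \<Lambda> R k) \<and> cond_mean (pspace R) (filt \<Lambda> R k) (What \<Lambda> R k) (dirx R f g k)))
       \<and> (\<exists>Cm>0. \<forall>R :: ('a, real ^ 'd, 'y, 'b, 'l) run. bros_run \<Lambda> f g \<sigma>f1 \<sigma>f2 \<sigma>g1 \<sigma>g2 R \<longrightarrow> (\<forall>k.
            AE \<omega> in pspace R.
              nn_cond_exp (pspace R) (filt \<Lambda> R k)
                (\<lambda>\<omega>. ennreal ((norm (Vhat \<Lambda> R k \<omega> - dirY R g k \<omega>))\<^sup>2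
                            + (norm (Shat \<Lambda> R k \<omega> - dirZ R f g k \<omega>))\<^sup>2
                            + (norm (What \<Lambda> R k \<omega> - dirx R f g k \<omega>))\<^sup>2)) \<omega>
              \<le> ennreal (Cm * (1 + (norm (it_Y R k \<omega> - Ystar g (it_x R k \<omega>)))\<^sup>2
                                 + (norm (it_Z R k \<omega> - Zstar f g (it_x R k \<omega>)))\<^sup>2))))"
proof -
  have f0: "\<And>x. norm (grad2 f x (Ystar g x)) \<le> Lf0"
    using assms(2) by (simp add: assumption_A1_def)
  have loc: "bros \<Lambda> f g Lf1 Lg1 Lg2 \<mu>g \<sigma>f1 \<sigma>f2 \<sigma>g1 \<sigma>g2 R"
    if "bros_run \<Lambda> f g \<sigma>f1 \<sigma>f2 \<sigma>g1 \<sigma>g2 R" for R :: "('a, real ^ 'd, 'y, 'b, 'l) run"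
    using assms(1,2) that by unfold_locales (auto simp: assumption_A1_def)
  define K where "K = 1 + Lg1\<^sup>2 + 2 * Lf0\<^sup>2 + 2 * Lf1\<^sup>2 + 2 + 2 * (Lf0 / \<mu>g)\<^sup>2"
  have K: "1 \<le> K" by (simp add: K_def)
  \<comment> \<open>Exported from the locale, the constant has no run among its arguments. This
    allows it to be chosen before \<open>R\<close> and \<open>k\<close>.\<close>
  define C where "C = bros.variance_const \<Lambda> Lg1 \<sigma>f1 \<sigma>f2 \<sigma>g1 \<sigma>g2"
  show ?thesis
  \<comment> \<open>The absolute value and the summand 1 make the witness positive without reference
    to a run; nonnegativity of \<open>C\<close> itself is available only inside the locale.\<close>
  proof (intro conjI exI[of _ "\<bar>C\<bar> * K + 1"] allI impI)
    fix R :: "('a, real ^ 'd, 'y, 'b, 'l) run" and k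
    assume "bros_run \<Lambda> f g \<sigma>f1 \<sigma>f2 \<sigma>g1 \<sigma>g2 R"
    then interpret bros \<Lambda> f g Lf1 Lg1 Lg2 \<mu>g \<sigma>f1 \<sigma>f2 \<sigma>g1 \<sigma>g2 R by (rule loc)
    note h = sq_int_hats[OF sq_int_states[of k]]
    show "integrable (pspace R) (Vhat \<Lambda> R k)" "integrable (pspace R) (Shat \<Lambda> R k)" "integrable (pspace R) (What \<Lambda> R k)"
      using h by (auto intro: sq_int_integrable)
    show "cond_mean (pspace R) (filt \<Lambda> R k) (Vhat \<Lambda> R k) (dirY R g k)"
      "cond_mean (pspace R) (filt \<Lambda> R k) (Shat \<Lambda> R k) (dirZ R f g k)"
      "cond_mean (pspace R) (filt \<Lambda> R k) (What \<Lambda> R k) (dirx R f g k)"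
      by (rule cond_mean_V cond_mean_S cond_mean_W)+
  next
    show "0 < \<bar>C\<bar> * K + 1" using K by (simp add: add_nonneg_pos)
  next
    fix R :: "('a, real ^ 'd, 'y, 'b, 'l) run" and k
    assume "bros_run \<Lambda> f g \<sigma>f1 \<sigma>f2 \<sigma>g1 \<sigma>g2 R"
    then interpret bros \<Lambda> f g Lf1 Lg1 Lg2 \<mu>g \<sigma>f1 \<sigma>f2 \<sigma>g1 \<sigma>g2 R by (rule loc)
    let ?d = "\<lambda>\<omega>. 1 + (norm (it_Y R k \<omega> - Ystar g (it_x R k \<omega>)))\<^sup>2 + (norm (it_Z R k \<omega> - Zstar f g (it_x R k \<omega>)))\<^sup>2"
    have "variance_const * growth k \<omega> \<le> (\<bar>C\<bar> * K + 1) * ?d \<omega>" for \<omega>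
    proof -
      have "variance_const * growth k \<omega> \<le> variance_const * (K * ?d \<omega>)"
        unfolding K_def by (intro mult_left_mono growth_le f0 variance_const_nonneg)
      also have "\<dots> = (\<bar>C\<bar> * K) * ?d \<omega>" using variance_const_nonneg by (simp add: C_def)
      also have "\<dots> \<le> (\<bar>C\<bar> * K + 1) * ?d \<omega>" by (intro mult_right_mono) auto
      finally show ?thesis .
    qed
    then show "AE \<omega> in pspace R.
        nn_cond_exp (pspace R) (filt \<Lambda> R k)
          (\<lambda>\<omega>. ennreal ((norm (Vhat \<Lambda> R k \<omega> - dirY R g k \<omega>))\<^sup>2
                      + (norm (Shat \<Lambda> R k \<omega> - dirZ R f g k \<omega>))\<^sup>2
                      + (norm (What \<Lambda> R k \<omega> - dirx R f g k \<omega>))\<^sup>2)) \<omega>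
        \<le> ennreal ((\<bar>C\<bar> * K + 1) * ?d \<omega>)"
      using cbound_total_deviation[of k] unfolding total_deviation_def
      by (auto elim!: eventually_mono intro: order_trans ennreal_leI)
  qed
qed

end
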